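(* Let $n\ge1$ be an integer, $\alpha\in(-1,1)$, $2-\alpha\le b<n+1$, and let $U\subset\mathbb R^{n+1}$ be a bounded domain containing the origin. Put $D:=\sup_{z\in U^+}\Phi_0(z)$, $P_i=P_i(\Phi_0(z)/D)$, $X_i=X_i(\Phi_0(z)/D)$, and $$K(n,\alpha,b)=(1-\alpha)\,\frac{\Gamma\left(\frac{n-2\alpha-b+3}{4}\right)\Gamma\left(\frac{n+b-1}{4}\right)\Gamma\left(\frac{\alpha+1}{2}\right)}{\Gamma\left(\frac{3-\alpha}{2}\right)\Gamma\left(\frac{n+1-b}{4}\right)\Gamma\left(\frac{n+2\alpha+b-3}{4}\right)}.$$ (i) For all $u\in C_0^\infty(U)$, $$K(n,\alpha,b)\int_{U_0}\frac{u^2(x,0)}{H_0^{1-\alpha}(x)}\,dx+\frac{(\alpha+b-2)^2}{4}\int_{U^+}\frac{y^\alpha u^2(z)}{\Phi_0^2(z)}\,dz+\frac14\sum_{i=1}^\infty\int_{U^+}\frac{y^\alpha P_i^2}{\Phi_0^2(z)}\,u^2(z)\,dz\le\int_{U^+}y^\alpha\,\Phi^2(\nabla u)\,dz .$$ (ii) For $k=1,2,3,\dots$ and $u\in C_0^\infty(U)$ set $$I_k[u]=\int_{U^+}y^\alpha\Phi^2(\nabla u)\,dz-K(n,\alpha,b)\int_{U_0}\frac{u^2(x,0)}{H_0^{1-\alpha}(x)}\,dx-\frac{(\alpha+b-2)^2}{4}\int_{U^+}\frac{y^\alpha u^2(z)}{\Phi_0^2(z)}\,dz-\frac14\sum_{i=1}^{k-1}\int_{U^+}\frac{y^\alpha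 P_i^2}{\Phi_0^2(z)}\,u^2(z)\,dz .$$ Then for every $k=1,2,3,\dots$ the constant $\frac14$ of the $k$-th remainder term is optimal: $$\frac14=\inf_{u}\ \frac{I_k[u]}{\int_{U^+}\frac{y^\alpha P_k^2}{\Phi_0^2(z)}\,u^2(z)\,dz},$$ the infimum being over all $u\in C_0^\infty(U)$ for which the denominator is nonzero. (iii) The power of the logarithmic weights is optimal: for every $k=1,2,3,\dots$, every $0<\epsilon<2$ and every $C>0$, the inequality $$C\int_{U^+}\frac{y^\alpha P_{k-1}^2X_k^{2-\epsilon}}{\Phi_0^2(z)}\,u^2(z)\,dz\le I_k[u]$$ fails for some $u\in C_0^\infty(U)$.
   Context: Points of $\mathbb R^{n+1}$ are written $z=(x,y)$, $x\in\mathbb R^n$, $y\in\mathbb R$, and $\mathbb R^{n+1}_+=\{(x,y)\in\mathbb R^{n+1}: y>0\}$. For $U\subset\mathbb R^{n+1}$: $U^+=U\cap\mathbb R^{n+1}_+$ and $U_0=\{x\in\mathbb R^n:(x,0)\in U\}$. $\nabla u$ is the full gradient in $z=(x,y)$. $\Gamma$ is the Gamma function. $C_0^\infty(U)$ denotes real-valued smooth functions with compact support in $U$. $H:\mathbb R^n\to[0,\infty)$ is a norm (in particular $H(\lambda\xi)=|\lambda|H(\xi)$) of class $C^2(\mathbb R^n\setminus\{0\})$ such that $H^2$ is strictly convex. Its dual norm is $H_0(x)=\sup_{\xi\in\mathbb R^n\setminus\{0\}}\frac{\langle x,\xi\rangle}{H(\xi)}$, with $\langle\cdot,\cdot\rangle$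 the Euclidean inner product. On $\mathbb R^{n+1}$ one sets $\Phi(\xi,\mathrm y)=\sqrt{H^2(\xi)+\mathrm y^2}$ for $\xi\in\mathbb R^n,\ \mathrm y\in\mathbb R$, and $\Phi_0(x,y)=\sqrt{H_0^2(x)+y^2}$. For $0<\rho<1$ define recursively $X_1(\rho)=\frac{1}{1-\ln\rho}$, $X_k(\rho)=X_1(X_{k-1}(\rho))$ for $k=2,3,\dots$, and $P_k(\rho)=X_1(\rho)X_2(\rho)\cdots X_k(\rho)$, with $P_0\equiv1$. For $k=1$ the sum $\sum_{i=1}^{k-1}$ is zero. *)

theory Defs
  imports "HOL-Analysis.Analysis"
begin

text \<open>
  Points of the space of dimension \<open>n + 1\<close> are pairs \<open>(x, y)\<close> of type \<open>(real ^ 'n) \<times> real\<close>, where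
  \<open>n = CARD('n) \<ge> 1\<close>; the inner product and the measure \<open>lborel\<close> on this product type are the
  Euclidean inner product and Lebesgue measure.
\<close>

text \<open>Class \<open>C\<^sup>k\<close>; only meant for open \<open>S\<close>, since derivatives are taken in the full space.\<close>

primrec Ck_on :: "nat \<Rightarrow> ('a::euclidean_space \<Rightarrow> real) \<Rightarrow> 'a set \<Rightarrow> bool" where
  "Ck_on 0 f S \<longleftrightarrow> continuous_on S f"
| "Ck_on (Suc k) f S \<longleftrightarrow>
     (\<forall>x\<in>S. f differentiable (at x)) \<and> (\<forall>v. Ck_on k (\<lambda>x. frechet_derivative f (at x) v) S)"

text \<open>For open \<open>U\<close>, elements of \<open>C\<^sub>0\<^sup>\<infinity>(U)\<close> are represented by their extensions by zero.\<close>

definition test_functions :: "('a::euclidean_space) set \<Rightarrow> ('a \<Rightarrow> real) set" where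
  "test_functions U = {u. (\<forall>k. Ck_on k u UNIV) \<and>
     compact (closure {z. u z \<noteq> 0}) \<and> closure {z. u z \<noteq> 0} \<subseteq> U}"

definition grad :: "('a::euclidean_space \<Rightarrow> real) \<Rightarrow> 'a \<Rightarrow> 'a" where
  "grad u z = (THE D. GDERIV u z :> D)"

definition is_norm :: "('a::real_vector \<Rightarrow> real) \<Rightarrow> bool" where
  "is_norm H \<longleftrightarrow>
     (\<forall>x. 0 \<le> H x) \<and> (\<forall>x. H x = 0 \<longleftrightarrow> x = 0) \<and>
     (\<forall>c x. H (c *\<^sub>R x) = \<bar>c\<bar> * H x) \<and> (\<forall>x y. H (x + y) \<le> H x + H y)"

definition strictly_convex :: "('a::real_vector \<Rightarrow> real) \<Rightarrow> bool" where
  "strictly_convex f \<longleftrightarrow>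
     (\<forall>x y t. x \<noteq> y \<longrightarrow> 0 < t \<longrightarrow> t < 1 \<longrightarrow>
        f ((1 - t) *\<^sub>R x + t *\<^sub>R y) < (1 - t) * f x + t * f y)"

definition dual_norm :: "('a::real_inner \<Rightarrow> real) \<Rightarrow> 'a \<Rightarrow> real" where
  "dual_norm H x = (SUP \<xi>\<in>UNIV - {0}. inner x \<xi> / H \<xi>)"

definition Phi :: "('a::real_inner \<Rightarrow> real) \<Rightarrow> 'a \<times> real \<Rightarrow> real" where
  "Phi H = (\<lambda>(\<xi>, \<eta>). sqrt ((H \<xi>)\<^sup>2 + \<eta>\<^sup>2))"

definition Phi0 :: "('a::real_inner \<Rightarrow> real) \<Rightarrow> 'a \<times> real \<Rightarrow> real" where
  "Phi0 H = (\<lambda>(x, y). sqrt ((dual_norm H x)\<^sup>2 + y\<^sup>2))"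

definition upper :: "('a \<times> real) set \<Rightarrow> ('a \<times> real) set" where
  "upper U = {z\<in>U. 0 < snd z}"

definition base :: "('a \<times> real) set \<Rightarrow> 'a set" where
  "base U = {x. (x, 0) \<in> U}"

definition sup_Phi0 :: "('a::real_inner \<Rightarrow> real) \<Rightarrow> ('a \<times> real) set \<Rightarrow> real" where
  "sup_Phi0 H U = (SUP z\<in>upper U. Phi0 H z)"

text \<open>
  The index \<open>0\<close> is only an auxiliary start of the iteration: \<open>X 1 \<rho> = 1 / (1 - ln \<rho>)\<close> and
  \<open>X (k + 1) \<rho> = X 1 (X k \<rho>)\<close> for \<open>k \<ge> 1\<close>.
\<close>

primrec X :: "nat \<Rightarrow> real \<Rightarrow> real" where
  "X 0 \<rho> = \<rho>"
| "X (Suc k) \<rho> = 1 / (1 - ln (X k \<rho>))"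

definition P :: "nat \<Rightarrow> real \<Rightarrow> real" where
  "P k \<rho> = (\<Prod>i\<in>{1..k}. X i \<rho>)"

definition K :: "real \<Rightarrow> real \<Rightarrow> real \<Rightarrow> real" where
  "K n \<alpha> b = (1 - \<alpha>) *
     (Gamma ((n - 2 * \<alpha> - b + 3) / 4) * Gamma ((n + b - 1) / 4) * Gamma ((\<alpha> + 1) / 2)) /
     (Gamma ((3 - \<alpha>) / 2) * Gamma ((n + 1 - b) / 4) * Gamma ((n + 2 * \<alpha> + b - 3) / 4))"

definition energy_density ::
    "('a::euclidean_space \<Rightarrow> real) \<Rightarrow> real \<Rightarrow> ('a \<times> real \<Rightarrow> real) \<Rightarrow> 'a \<times> real \<Rightarrow> real" where
  "energy_density H \<alpha> u z = snd z powr \<alpha> * (Phi H (grad u z))\<^sup>2"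

definition trace_density ::
    "('a::euclidean_space \<Rightarrow> real) \<Rightarrow> real \<Rightarrow> ('a \<times> real \<Rightarrow> real) \<Rightarrow> 'a \<Rightarrow> real" where
  "trace_density H \<alpha> u x = (u (x, 0))\<^sup>2 / dual_norm H x powr (1 - \<alpha>)"

text \<open>
  Here \<open>w\<close> is the logarithmic weight as a function of \<open>\<rho> = Phi0 H z / sup_Phi0 H U\<close>; the Hardy
  term without logarithms is the case \<open>w = 1\<close>.
\<close>

definition hardy_density ::
    "('a::euclidean_space \<Rightarrow> real) \<Rightarrow> real \<Rightarrow> ('a \<times> real) set \<Rightarrow> (real \<Rightarrow> real) \<Rightarrow>
     ('a \<times> real \<Rightarrow> real) \<Rightarrow> 'a \<times> real \<Rightarrow> real" where
  "hardy_density H \<alpha> U w u z =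
     snd z powr \<alpha> * w (Phi0 H z / sup_Phi0 H U) / (Phi0 H z)\<^sup>2 * (u z)\<^sup>2"

definition energy ::
    "('a::euclidean_space \<Rightarrow> real) \<Rightarrow> real \<Rightarrow> ('a \<times> real) set \<Rightarrow> ('a \<times> real \<Rightarrow> real) \<Rightarrow> real" where
  "energy H \<alpha> U u = (LINT z:upper U|lborel. energy_density H \<alpha> u z)"

definition trace_term ::
    "('a::euclidean_space \<Rightarrow> real) \<Rightarrow> real \<Rightarrow> ('a \<times> real) set \<Rightarrow> ('a \<times> real \<Rightarrow> real) \<Rightarrow> real" where
  "trace_term H \<alpha> U u = (LINT x:base U|lborel. trace_density H \<alpha> u x)"

definition hardy_term ::
    "('a::euclidean_space \<Rightarrow> real) \<Rightarrow> real \<Rightarrow> ('a \<times> real) set \<Rightarrow> (real \<Rightarrow> real) \<Rightarrow>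
     ('a \<times> real \<Rightarrow> real) \<Rightarrow> real" where
  "hardy_term H \<alpha> U w u = (LINT z:upper U|lborel. hardy_density H \<alpha> U w u z)"

definition I ::
    "(real ^ 'n \<Rightarrow> real) \<Rightarrow> real \<Rightarrow> real \<Rightarrow> ((real ^ 'n) \<times> real) set \<Rightarrow> nat \<Rightarrow>
     ((real ^ 'n) \<times> real \<Rightarrow> real) \<Rightarrow> real" where
  "I H \<alpha> b U k u =
     energy H \<alpha> U u
     - K (real CARD('n)) \<alpha> b * trace_term H \<alpha> U u
     - (\<alpha> + b - 2)\<^sup>2 / 4 * hardy_term H \<alpha> U (\<lambda>\<rho>. 1) u
     - 1 / 4 * (\<Sum>i\<in>{1..<k}. hardy_term H \<alpha> U (\<lambda>\<rho>. (P i \<rho>)\<^sup>2) u)"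

end

theory Submission
  imports Defs
begin

text \<open>
  Write \<open>H\<^sub>0\<close> for the dual norm, \<open>\<rho> = \<Phi>\<^sub>0(z)\<close> and \<open>w = y / H\<^sub>0(x)\<close>. In the polar coordinates given by the
  direction \<open>x / H\<^sub>0(x)\<close>, the radius \<open>\<rho>\<close> and the slope \<open>w\<close> the measure \<open>y\<^sup>\<alpha> dz\<close> is a product
  (\<open>nn_integral_weighted_half_space\<close>), with radial density \<open>\<rho>\<^sup>2\<^sup>\<sigma>\<^sup>+\<^sup>1\<close>, \<open>2 \<sigma> = n + \<alpha> - 1\<close>. The
  duality \<open>\<langle>z, \<zeta>\<rangle> \<le> \<Phi>\<^sub>0(z) \<Phi>(\<zeta>)\<close> alone shows that \<open>\<Phi>\<^sup>2(\<nabla>u)\<close> is at least the sum of the squares of the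
  radial and of the normalised angular derivative of \<open>u\<close> (\<open>Phi_ge_radial_angular\<close>). So the inequality
  follows from two inequalities in one variable.

  On rays, completing the square with the function \<open>\<rho>\<^sup>-\<^sup>\<sigma> P\<^sub>k\<^sup>-\<^sup>1\<^sup>/\<^sup>2\<close> gives the Hardy inequality with constant
  \<open>\<sigma>\<^sup>2\<close> and the \<open>k\<close> logarithmic remainders with constant 1/4 (\<open>radial_inequality\<close>). On arcs, from the base
  \<open>w = 0\<close> to the pole \<open>w = \<infinity>\<close>, the ground state is the hypergeometric function \<open>F(A, B; n/2; t)\<close> of
  \<open>t = 1 / (1 + w\<^sup>2)\<close>, where \<open>A + B = \<sigma>\<close> and \<open>4 A B = \<sigma>\<^sup>2 - (\<alpha> + b - 2)\<^sup>2 / 4\<close>. Completing the square with it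
  gives a trace inequality (\<open>angular_inequality\<close>) whose constant is the flux of the ground state through
  the base over its value there. The value is given by Gauss's theorem (\<open>hyp_Gauss\<close>), the flux by the
  blow-up rate of the derivative (\<open>hyp_blowup\<close>), and their ratio is \<open>K\<close>. The angular part costs \<open>4 A B\<close>
  times the Hardy integral, which leaves \<open>\<sigma>\<^sup>2 - 4 A B = (\<alpha> + b - 2)\<^sup>2 / 4\<close>. Letting \<open>k\<close> tend to infinity
  gives the series of part (i), and the partial sum up to \<open>k\<close> gives the lower bound of part (ii).

  For the optimality one needs test functions for which both squares nearly vanish
  (\<open>near_optimal\<close>). The radial factor is \<open>\<rho>\<^sup>-\<^sup>\<sigma> P\<^sub>k\<^sup>-\<^sup>1\<^sup>/\<^sup>2\<close> times a bump in the variable \<open>- ln X\<^sub>k\<close>. In this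
  variable the completed square is the Dirichlet integral of the bump and the \<open>k\<close>-th remainder its \<open>L\<^sup>2\<close>
  norm, and near the origin there is room to stretch the bump (\<open>radial_trial\<close>). The angular factor is a
  Taylor polynomial of the ground state (\<open>angular_equality_taylor\<close>). To be smooth, the trial functions are
  formed with smooth functions \<open>N\<^sub>j\<close> in place of \<open>H\<^sub>0\<close>, logarithms of sums of exponentials of linear
  functions, for which \<open>H(\<nabla>N\<^sub>j) \<le> 1\<close> and \<open>N\<^sub>j \<rightarrow> H\<^sub>0\<close> (\<open>smooth_dual_norm\<close>). Dominated convergence for an
  upper bound of the energy and Fatou's lemma for the terms on the other side suffice to pass to the limit
  (\<open>trial_test_function_exists\<close>).

  The trial functions can be supported arbitrarily near the origin, where \<open>X\<^sub>k\<close> is small. There \<open>P\<^sub>k\<^sup>2\<close> is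
  small compared with \<open>P\<^sub>k\<^sub>-\<^sub>1\<^sup>2 X\<^sub>k\<^sup>2\<^sup>-\<^sup>\<epsilon>\<close>, which gives part (iii).
\<close>

section \<open>Norms and their duals\<close>

context
  fixes H :: "'a::euclidean_space \<Rightarrow> real"
  assumes H: "is_norm H"
begin

lemma norm_nonneg: "0 \<le> H x"
  and norm_eq_0_iff: "H x = 0 \<longleftrightarrow> x = 0"
  and norm_scale: "H (c *\<^sub>R x) = \<bar>c\<bar> * H x"
  and norm_triangle: "H (x + y) \<le> H x + H y"
  using H by (auto simp: is_norm_def)

lemma norm_zero: "H 0 = 0"
  by (simp add: norm_eq_0_iff)

lemma norm_pos: "x \<noteq> 0 \<Longrightarrow> 0 < H x"
  using norm_nonneg[of x] norm_eq_0_iff[of x] by linarith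

lemma norm_minus_self: "H (- x) = H x"
  using norm_scale[of "-1" x] by simp

lemma norm_sum_le: "H (\<Sum>i\<in>A. f i) \<le> (\<Sum>i\<in>A. H (f i))"
proof (induction A rule: infinite_finite_induct)
  case (insert i A)
  then show ?case using norm_triangle[of "f i" "sum f A"] by simp
qed (auto simp: norm_zero)

lemma norm_upper: "\<exists>C>0. \<forall>x. H x \<le> C * norm x"
proof (intro exI conjI allI)
  let ?C = "(\<Sum>b\<in>Basis. H b) + 1"
  show "0 < ?C" using sum_nonneg[of Basis H] norm_nonneg by (simp add: add_nonneg_pos)
  fix x :: 'a
  have "H x = H (\<Sum>b\<in>Basis. (x \<bullet> b) *\<^sub>R b)" by (simp add: euclidean_representation)
  also have "\<dots> \<le> (\<Sum>b\<in>Basis. H ((x \<bullet> b) *\<^sub>R b))" by (rule norm_sum_le)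
  also have "\<dots> \<le> (\<Sum>b\<in>Basis. norm x * H b)"
    by (rule sum_mono) (auto simp: norm_scale norm_nonneg Basis_le_norm intro: mult_right_mono)
  also have "\<dots> \<le> ?C * norm x" by (simp add: sum_distrib_left algebra_simps)
  finally show "H x \<le> ?C * norm x" .
qed

lemma norm_diff_le: "\<bar>H x - H y\<bar> \<le> H (x - y)"
  using norm_triangle[of "x - y" y] norm_triangle[of "y - x" x] norm_minus_self[of "x - y"]
  by simp

lemma norm_continuous: "continuous_on S H"
proof -
  obtain C where C: "C > 0" "\<And>x. H x \<le> C * norm x" using norm_upper by blast
  have "C-lipschitz_on UNIV H"
  proof (rule lipschitz_onI)
    show "dist (H x) (H y) \<le> C * dist x y" for x y
      using norm_diff_le[of x y] C(2)[of "x - y"] by (simp add: dist_norm)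
  qed (use C in simp)
  then have "continuous_on UNIV H" by (rule lipschitz_on_continuous_on)
  then show ?thesis by (rule continuous_on_subset) simp
qed

lemma norm_borel: "H \<in> borel_measurable borel"
  by (rule borel_measurable_continuous_onI) (rule norm_continuous)

text \<open>
  The unit sphere is compact, and a norm has a positive minimum on it.
\<close>

lemma norm_lower: "\<exists>c>0. \<forall>x. c * norm x \<le> H x"
proof -
  have "\<exists>x\<in>sphere 0 1. \<forall>y\<in>sphere (0::'a) 1. H x \<le> H y"
    by (rule continuous_attains_inf) (auto intro: norm_continuous)
  then obtain x0 :: 'a where x0: "norm x0 = 1" "\<And>y. norm y = 1 \<Longrightarrow> H x0 \<le> H y"
    by (auto simp: sphere_def)
  show ?thesis
  proof (intro exI conjI allI)
    show "0 < H x0" using x0 by (intro norm_pos) auto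
    fix x :: 'a
    show "H x0 * norm x \<le> H x"
    proof (cases "x = 0")
      case False
      then have "H x0 \<le> H ((1 / norm x) *\<^sub>R x)" by (intro x0) simp
      then show ?thesis using False by (simp add: norm_scale field_simps)
    qed (simp add: norm_zero)
  qed
qed

lemma dual_norm_bdd: "bdd_above ((\<lambda>\<xi>. inner x \<xi> / H \<xi>) ` (UNIV - {0}))"
proof -
  obtain c where c: "c > 0" "\<And>x. c * norm x \<le> H x" using norm_lower by blast
  show ?thesis
  proof (rule bdd_aboveI2)
    fix \<xi> :: 'a assume "\<xi> \<in> UNIV - {0}"
    then have xi: "\<xi> \<noteq> 0" by simp
    have "inner x \<xi> \<le> norm x * norm \<xi>" by (rule norm_cauchy_schwarz)
    also have "\<dots> \<le> norm x / c * H \<xi>"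
      using mult_left_mono[OF c(2)[of \<xi>], of "norm x / c"] c(1) by simp
    finally show "inner x \<xi> / H \<xi> \<le> norm x / c"
      using norm_pos[OF xi] by (simp add: field_simps)
  qed
qed

lemma inner_le_dual: "inner x \<xi> \<le> dual_norm H x * H \<xi>"
proof (cases "\<xi> = 0")
  case False
  then have "inner x \<xi> / H \<xi> \<le> dual_norm H x"
    unfolding dual_norm_def by (intro cSUP_upper dual_norm_bdd) auto
  then show ?thesis using norm_pos[OF False] by (simp add: field_simps)
qed (simp add: norm_zero)

lemma dual_norm_le:
  assumes "\<And>\<xi>. inner x \<xi> \<le> M * H \<xi>"
  shows "dual_norm H x \<le> M"
proof -
  obtain b :: 'a where "b \<in> Basis" using nonempty_Basis by blast
  then have "b \<in> UNIV - {0}" by auto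
  then have "UNIV - {0::'a} \<noteq> {}" by blast
  then show ?thesis unfolding dual_norm_def
    using assms norm_pos by (intro cSUP_least) (auto simp: field_simps)
qed

lemma dual_norm_nonneg: "0 \<le> dual_norm H x"
proof -
  obtain b :: 'a where b: "b \<in> Basis" using nonempty_Basis by blast
  have "0 < H b" using b by (intro norm_pos) auto
  moreover have "\<bar>inner x b\<bar> \<le> dual_norm H x * H b"
    using inner_le_dual[of x b] inner_le_dual[of x "- b"] norm_minus_self[of b] by simp
  ultimately show ?thesis by (smt (verit) zero_le_mult_iff)
qed

lemma is_norm_dual: "is_norm (dual_norm H)"
  unfolding is_norm_def
proof (intro conjI allI)
  show "0 \<le> dual_norm H x" for x by (rule dual_norm_nonneg)
  show tri: "dual_norm H (x + y) \<le> dual_norm H x + dual_norm H y" for x y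
    using add_mono[OF inner_le_dual[of x] inner_le_dual[of y]]
    by (intro dual_norm_le) (simp add: inner_add_left algebra_simps)
  have zero: "dual_norm H 0 = 0"
    using dual_norm_le[of 0 0] dual_norm_nonneg[of 0] by simp
  show "dual_norm H x = 0 \<longleftrightarrow> x = 0" for x
  proof
    assume "dual_norm H x = 0"
    then show "x = 0" using inner_le_dual[of x x] by (metis inner_gt_zero_iff mult_zero_left not_le)
  qed (simp add: zero)
  have le: "dual_norm H (c *\<^sub>R x) \<le> \<bar>c\<bar> * dual_norm H x" for c x
  proof (rule dual_norm_le)
    fix \<xi>
    have "c * inner x \<xi> \<le> \<bar>c\<bar> * (dual_norm H x * H \<xi>)"
    proof (cases "c \<ge> 0")
      case True
      then show ?thesis using inner_le_dual[of x \<xi>] by (simp add: mult_left_mono)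
    next
      case False
      then show ?thesis using mult_left_mono[OF inner_le_dual[of x "- \<xi>"], of "- c"]
        by (simp add: norm_minus_self)
    qed
    then show "inner (c *\<^sub>R x) \<xi> \<le> \<bar>c\<bar> * dual_norm H x * H \<xi>" by simp
  qed
  show "dual_norm H (c *\<^sub>R x) = \<bar>c\<bar> * dual_norm H x" for c x
  proof (cases "c = 0")
    case False
    have "dual_norm H x \<le> \<bar>1 / c\<bar> * dual_norm H (c *\<^sub>R x)"
      using le[of "1 / c" "c *\<^sub>R x"] False by simp
    then show ?thesis using le[of c x] False by (simp add: field_simps)
  qed (simp add: zero)
qed

text \<open>
  Near-maximisers may be taken in the unit ball of \<open>H\<close>, so that the dual norm is recovered from linear
  functions of a bounded set of slopes.
\<close>

lemma dual_norm_approx: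
  assumes "a < dual_norm H x"
  shows "\<exists>\<xi>. H \<xi> \<le> 1 \<and> a < inner x \<xi>"
proof -
  obtain b :: 'a where "b \<in> Basis" using nonempty_Basis by blast
  then have "b \<in> UNIV - {0}" by auto
  then have ne: "UNIV - {0::'a} \<noteq> {}" by blast
  obtain \<xi> where xi: "\<xi> \<noteq> 0" "a < inner x \<xi> / H \<xi>"
    using assms unfolding dual_norm_def less_cSUP_iff[OF ne dual_norm_bdd] by blast
  have "H ((1 / H \<xi>) *\<^sub>R \<xi>) \<le> 1" "a < inner x ((1 / H \<xi>) *\<^sub>R \<xi>)"
    using xi norm_pos[of \<xi>] by (auto simp: norm_scale)
  then show ?thesis by blast
qed

lemma Phi_nonneg: "0 \<le> Phi H z"
  by (simp add: Phi_def case_prod_beta)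

lemma Phi0_nonneg: "0 \<le> Phi0 H z"
  by (simp add: Phi0_def case_prod_beta)

lemma Phi_sq: "(Phi H z)\<^sup>2 = (H (fst z))\<^sup>2 + (snd z)\<^sup>2"
  and Phi0_sq: "(Phi0 H z)\<^sup>2 = (dual_norm H (fst z))\<^sup>2 + (snd z)\<^sup>2"
  by (simp_all add: Phi_def Phi0_def case_prod_beta)

text \<open>Duality of \<open>\<Phi>\<close> and \<open>\<Phi>\<^sub>0\<close>: the duality of \<open>H\<close> and \<open>H\<^sub>0\<close>, then Cauchy-Schwarz in the plane.\<close>

lemma inner_le_Phi: "inner z \<zeta> \<le> Phi0 H z * Phi H \<zeta>"
proof -
  let ?a = "(dual_norm H (fst z), snd z)" and ?b = "(H (fst \<zeta>), snd \<zeta>)"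
  have "inner z \<zeta> \<le> inner ?a ?b"
    using inner_le_dual[of "fst z" "fst \<zeta>"] by (simp add: inner_prod_def)
  also have "\<dots> \<le> norm ?a * norm ?b" by (rule norm_cauchy_schwarz)
  finally show ?thesis
    by (simp add: norm_Pair Phi_def Phi0_def case_prod_beta)
qed

lemma is_norm_Phi0: "is_norm (Phi0 H)"
  unfolding is_norm_def
proof (intro conjI allI)
  note N = is_norm_dual[unfolded is_norm_def]
  have eq: "Phi0 H z = norm (dual_norm H (fst z), snd z)" for z
    using N by (simp add: norm_Pair Phi0_def case_prod_beta)
  fix x y :: "'a \<times> real" and c :: real
  show "0 \<le> Phi0 H x" by (rule Phi0_nonneg)
  show "Phi0 H x = 0 \<longleftrightarrow> x = 0"
    using N by (simp add: eq prod_eq_iff)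
  have "(dual_norm H (fst (c *\<^sub>R x)), snd (c *\<^sub>R x)) = (\<bar>c\<bar> * dual_norm H (fst x), c * snd x)"
    using N by simp
  then show "Phi0 H (c *\<^sub>R x) = \<bar>c\<bar> * Phi0 H x"
    by (simp add: Phi0_def case_prod_beta power_mult_distrib real_sqrt_mult flip: distrib_left)
  have "Phi0 H (x + y) \<le> sqrt ((dual_norm H (fst x) + dual_norm H (fst y))\<^sup>2 + (snd x + snd y)\<^sup>2)"
    unfolding Phi0_def case_prod_beta using N by (auto intro!: power_mono)
  also have "\<dots> = norm ((dual_norm H (fst x), snd x) + (dual_norm H (fst y), snd y))"
    by (simp add: norm_Pair)
  also have "\<dots> \<le> Phi0 H x + Phi0 H y"
    unfolding eq by (rule norm_triangle_ineq)
  finally show "Phi0 H (x + y) \<le> Phi0 H x + Phi0 H y" .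
qed

end

section \<open>Polar coordinates for a norm\<close>

text \<open>
  Linear substitution; with Tonelli's theorem it replaces the change of variables formula.
\<close>

lemma nn_integral_lborel_scale:
  fixes f :: "'a::euclidean_space \<Rightarrow> ennreal"
  assumes [measurable]: "f \<in> borel_measurable borel" and c: "c > 0"
  shows "(\<integral>\<^sup>+x. f x \<partial>lborel) = ennreal (c ^ DIM('a)) * (\<integral>\<^sup>+x. f (c *\<^sub>R x) \<partial>lborel)"
proof -
  have "(lborel::'a measure) = density (distr lborel borel (\<lambda>x. 0 + c *\<^sub>R x)) (\<lambda>_. \<bar>c\<bar>^DIM('a))"
    using c by (intro lborel_affine) simp
  then have "(\<integral>\<^sup>+x. f x \<partial>lborel) =
      (\<integral>\<^sup>+x. f x \<partial>density (distr lborel borel (\<lambda>x. c *\<^sub>R x)) (\<lambda>_. c^DIM('a)))"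
    using c by simp
  also have "\<dots> = ennreal (c ^ DIM('a)) * (\<integral>\<^sup>+x. f (c *\<^sub>R x) \<partial>lborel)"
    by (simp add: nn_integral_density nn_integral_distr nn_integral_cmult)
  finally show ?thesis .
qed

text \<open>
  In place of a surface measure on the unit sphere of a norm \<open>N\<close>, directions are sampled from the
  shell \<open>1 \<le> N \<le> e\<close> with density \<open>N\<^sup>-\<^sup>n\<close>. The shell meets every ray in a set of
  measure 1 for \<open>ds / s\<close>, so that integration in polar coordinates needs nothing but Tonelli and
  the scaling of Lebesgue measure.
\<close>

definition cone_measure :: "('a::euclidean_space \<Rightarrow> real) \<Rightarrow> 'a measure" where
  "cone_measure N = density lborel
     (\<lambda>x. ennreal (indicator {x. 1 \<le> N x \<and> N x \<le> exp 1} x / N x ^ DIM('a)))"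

lemma sets_cone_measure [measurable_cong, simp]: "sets (cone_measure N) = sets borel"
  by (simp add: cone_measure_def)

lemma nn_integral_cone_measure:
  fixes N :: "'a::euclidean_space \<Rightarrow> real"
  assumes N: "is_norm N" and [measurable]: "g \<in> borel_measurable borel"
  shows "(\<integral>\<^sup>+x. g x \<partial>cone_measure N) =
    (\<integral>\<^sup>+x. ennreal (indicator {x. 1 \<le> N x \<and> N x \<le> exp 1} x / N x ^ DIM('a)) * g x \<partial>lborel)"
proof -
  have [measurable]: "N \<in> borel_measurable borel" by (rule norm_borel[OF N])
  show ?thesis unfolding cone_measure_def by (rule nn_integral_density) measurable
qed

text \<open>
  The total mass plays the part of the area of the unit sphere: all functionals of a function that is
  constant in the direction are multiples of it.
\<close>

lemma emeasure_cone_measure: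
  fixes N :: "'a::euclidean_space \<Rightarrow> real"
  assumes N: "is_norm N"
  shows "emeasure (cone_measure N) UNIV < \<infinity>" "emeasure (cone_measure N) UNIV > 0"
proof -
  have [measurable]: "N \<in> borel_measurable borel" by (rule norm_borel[OF N])
  let ?A = "{x. 1 \<le> N x \<and> N x \<le> exp 1}"
  have A: "?A \<in> sets borel" by measurable
  have em: "emeasure (cone_measure N) UNIV = (\<integral>\<^sup>+x. ennreal (indicator ?A x / N x ^ DIM('a)) \<partial>lborel)"
    unfolding cone_measure_def by (subst emeasure_density) auto
  obtain c where c: "c > 0" "\<And>x. c * norm x \<le> N x" using norm_lower[OF N] by blast
  have "?A \<subseteq> cball 0 (exp 1 / c)"
  proof
    fix x assume "x \<in> ?A"
    then show "x \<in> cball 0 (exp 1 / c)" using c(1) c(2)[of x] by (simp add: field_simps)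
  qed
  then have fin: "emeasure lborel ?A < \<infinity>"
    by (metis bounded_cball bounded_subset emeasure_bounded_finite)
  have "emeasure (cone_measure N) UNIV \<le> (\<integral>\<^sup>+x. indicator ?A x \<partial>lborel)"
    unfolding em
    by (rule nn_integral_mono) (auto simp: indicator_def divide_le_eq_1 one_le_power simp flip: ennreal_1)
  also have "\<dots> = emeasure lborel ?A" using A by simp
  finally show "emeasure (cone_measure N) UNIV < \<infinity>" using fin by simp
  let ?V = "{x. 1 < N x \<and> N x < exp 1}"
  have V: "open ?V"
    using norm_continuous[OF N, of UNIV]
    by (auto intro!: open_Collect_conj open_Collect_less continuous_intros)
  obtain b :: 'a where "b \<in> Basis" using nonempty_Basis by blast
  then have b: "b \<noteq> 0" by auto
  have "(exp (1/2) / N b) *\<^sub>R b \<in> ?V"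
    using norm_pos[OF N b] by (simp add: norm_scale[OF N])
  then have "?V \<noteq> {}" by blast
  then have Vpos: "emeasure lborel ?V > 0"
    using open_not_negligible[OF V] V
    by (metis (no_types, lifting) borel_open emeasure_lborel_countable negligible_iff_null_sets
        null_setsI not_gr_zero null_sets_completionI sets_lborel)
  have "(\<integral>\<^sup>+x. ennreal (1 / exp 1 ^ DIM('a)) * indicator ?V x \<partial>lborel) \<le> emeasure (cone_measure N) UNIV"
    unfolding em
  proof (rule nn_integral_mono)
    fix x
    show "ennreal (1 / exp 1 ^ DIM('a)) * indicator ?V x \<le> ennreal (indicator ?A x / N x ^ DIM('a))"
    proof (cases "x \<in> ?V")
      case True
      then have "N x ^ DIM('a) \<le> exp 1 ^ DIM('a)" by (intro power_mono) auto
      then show ?thesis using True by (auto intro!: ennreal_leI divide_left_mono)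
    qed simp
  qed
  moreover have "(\<integral>\<^sup>+x. ennreal (1 / exp 1 ^ DIM('a)) * indicator ?V x \<partial>lborel)
      = ennreal (1 / exp 1 ^ DIM('a)) * emeasure lborel ?V"
    using V by (subst nn_integral_cmult_indicator) auto
  moreover have "ennreal (1 / exp 1 ^ DIM('a)) * emeasure lborel ?V > 0"
    using Vpos by (auto simp: ennreal_zero_less_mult_iff)
  ultimately show "emeasure (cone_measure N) UNIV > 0" by simp
qed

lemma nn_integral_polar:
  fixes N :: "'a::euclidean_space \<Rightarrow> real"
  assumes N: "is_norm N" and f [measurable]: "f \<in> borel_measurable borel"
  shows "(\<integral>\<^sup>+x. f x \<partial>lborel) =
    (\<integral>\<^sup>+x. (\<integral>\<^sup>+s. indicator {0<..} s * ennreal (s ^ (DIM('a) - 1)) * f (s *\<^sub>R (x /\<^sub>R N x)) \<partial>lborel)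
       \<partial>cone_measure N)"
proof -
  have N_m [measurable]: "N \<in> borel_measurable borel" by (rule norm_borel[OF N])
  define A where "A = {x. 1 \<le> N x \<and> N x \<le> exp 1}"
  have A [measurable]: "A \<in> sets borel" unfolding A_def by measurable
  let ?n = "DIM('a)"
  have n: "?n = Suc (?n - 1)" using DIM_positive[where 'a='a] by simp
  have inner: "ennreal (indicator A x / N x ^ ?n) *
        (\<integral>\<^sup>+s. indicator {0<..} s * ennreal (s ^ (?n - 1)) * f (s *\<^sub>R (x /\<^sub>R N x)) \<partial>lborel)
      = (\<integral>\<^sup>+\<tau>. indicator A x * (indicator {0<..} \<tau> * ennreal (\<tau> ^ (?n - 1)) * f (\<tau> *\<^sub>R x)) \<partial>lborel)"
    (is "?l = ?r") for x
  proof (cases "x \<in> A")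
    case True
    then have p: "N x > 0" by (auto simp: A_def)
    have "(\<integral>\<^sup>+s. indicator {0<..} s * ennreal (s ^ (?n - 1)) * f (s *\<^sub>R (x /\<^sub>R N x)) \<partial>lborel)
      = ennreal (N x) * (\<integral>\<^sup>+\<tau>. indicator {0<..} (0 + N x * \<tau>) * ennreal ((0 + N x * \<tau>) ^ (?n - 1))
          * f ((0 + N x * \<tau>) *\<^sub>R (x /\<^sub>R N x)) \<partial>lborel)"
      using p by (subst nn_integral_real_affine[where c = "N x" and t = 0]) auto
    also have "\<dots> = ennreal (N x) * (\<integral>\<^sup>+\<tau>. ennreal (N x ^ (?n - 1)) *
          (indicator {0<..} \<tau> * ennreal (\<tau> ^ (?n - 1)) * f (\<tau> *\<^sub>R x)) \<partial>lborel)"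
    proof (rule arg_cong[where f = "\<lambda>t. ennreal (N x) * t"], rule nn_integral_cong)
      fix \<tau> :: real
      show "indicator {0<..} (0 + N x * \<tau>) * ennreal ((0 + N x * \<tau>) ^ (?n - 1))
          * f ((0 + N x * \<tau>) *\<^sub>R (x /\<^sub>R N x)) = ennreal (N x ^ (?n - 1)) *
          (indicator {0<..} \<tau> * ennreal (\<tau> ^ (?n - 1)) * f (\<tau> *\<^sub>R x))"
        using p by (cases "\<tau> > 0")
          (auto simp: power_mult_distrib ennreal_mult mult_ac zero_less_mult_iff)
    qed
    also have "\<dots> = ennreal (N x ^ ?n) * (\<integral>\<^sup>+\<tau>. indicator {0<..} \<tau> * ennreal (\<tau> ^ (?n - 1)) * f (\<tau> *\<^sub>R x) \<partial>lborel)"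
      using p by (subst nn_integral_cmult) (auto simp: mult.assoc[symmetric] ennreal_mult[symmetric] n[symmetric] simp flip: power_Suc)
    finally have "?l = ennreal (indicator A x / N x ^ ?n) * (ennreal (N x ^ ?n) *
        (\<integral>\<^sup>+\<tau>. indicator {0<..} \<tau> * ennreal (\<tau> ^ (?n - 1)) * f (\<tau> *\<^sub>R x) \<partial>lborel))"
      by simp
    also have "\<dots> = ?r"
      using True p by (simp add: mult.assoc[symmetric] ennreal_mult[symmetric])
    finally show ?thesis .
  qed simp
  have shell: "(\<integral>\<^sup>+\<tau>. indicator {0<..} \<tau> * ennreal (1 / \<tau>) * indicator A ((1 / \<tau>) *\<^sub>R x) \<partial>lborel) = 1"
    if x: "x \<noteq> 0" for x
  proof -
    have p: "N x > 0" by (rule norm_pos[OF N x])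
    have e: "N x / exp 1 \<le> N x" using p by (simp add: divide_le_eq)
    have "(\<integral>\<^sup>+\<tau>. indicator {0<..} \<tau> * ennreal (1 / \<tau>) * indicator A ((1 / \<tau>) *\<^sub>R x) \<partial>lborel)
      = (\<integral>\<^sup>+\<tau>. ennreal (1 / \<tau>) * indicator {N x / exp 1..N x} \<tau> \<partial>lborel)"
    proof (rule nn_integral_cong)
      fix \<tau> :: real
      show "indicator {0<..} \<tau> * ennreal (1 / \<tau>) * indicator A ((1 / \<tau>) *\<^sub>R x)
          = ennreal (1 / \<tau>) * indicator {N x / exp 1..N x} \<tau>"
      proof (cases "\<tau> > 0")
        case True
        then have "N ((1 / \<tau>) *\<^sub>R x) = N x / \<tau>" by (simp add: norm_scale[OF N])
        moreover have "1 \<le> N x / \<tau> \<and> N x / \<tau> \<le> exp 1 \<longleftrightarrow> \<tau> \<in> {N x / exp 1..N x}"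
          using True by (auto simp: field_simps)
        ultimately have "(1 / \<tau>) *\<^sub>R x \<in> A \<longleftrightarrow> \<tau> \<in> {N x / exp 1..N x}"
          unfolding A_def mem_Collect_eq by simp
        then show ?thesis using True by (auto simp: indicator_def)
      next
        case False
        then have "\<not> (N x / exp 1 \<le> \<tau>)"
          using p by (smt (verit) divide_pos_pos exp_gt_zero)
        then show ?thesis using False by auto
      qed
    qed
    also have "\<dots> = ennreal (ln (N x) - ln (N x / exp 1))"
    proof (rule nn_integral_FTC_Icc)
      show "(ln has_real_derivative 1 / t) (at t)" "0 \<le> 1 / t" if "t \<in> {N x / exp 1..N x}" for t
      proof -
        have "t > 0" using that p by (smt (verit) atLeastAtMost_iff divide_pos_pos exp_gt_zero)
        then show "(ln has_real_derivative 1 / t) (at t)" "0 \<le> 1 / t"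
          by (auto intro!: derivative_eq_intros)
      qed
    qed (use e in auto)
    also have "\<dots> = 1" using p by (simp add: ln_div)
    finally show ?thesis .
  qed
  have "(\<integral>\<^sup>+x. (\<integral>\<^sup>+s. indicator {0<..} s * ennreal (s ^ (?n - 1)) * f (s *\<^sub>R (x /\<^sub>R N x)) \<partial>lborel)
       \<partial>cone_measure N)
     = (\<integral>\<^sup>+x. (\<integral>\<^sup>+\<tau>. indicator A x * (indicator {0<..} \<tau> * ennreal (\<tau> ^ (?n - 1)) * f (\<tau> *\<^sub>R x)) \<partial>lborel) \<partial>lborel)"
    by (subst nn_integral_cone_measure[OF N], measurable, unfold A_def[symmetric] inner, rule refl)
  also have "\<dots> = (\<integral>\<^sup>+\<tau>. (\<integral>\<^sup>+x. indicator A x * (indicator {0<..} \<tau> * ennreal (\<tau> ^ (?n - 1)) * f (\<tau> *\<^sub>R x)) \<partial>lborel) \<partial>lborel)"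
    by (rule lborel_pair.Fubini') measurable
  also have "\<dots> = (\<integral>\<^sup>+\<tau>. (\<integral>\<^sup>+x. f x * (indicator {0<..} \<tau> * ennreal (1 / \<tau>) * indicator A ((1 / \<tau>) *\<^sub>R x)) \<partial>lborel) \<partial>lborel)"
  proof (rule nn_integral_cong)
    fix \<tau> :: real
    show "(\<integral>\<^sup>+x. indicator A x * (indicator {0<..} \<tau> * ennreal (\<tau> ^ (?n - 1)) * f (\<tau> *\<^sub>R x)) \<partial>lborel)
      = (\<integral>\<^sup>+x. f x * (indicator {0<..} \<tau> * ennreal (1 / \<tau>) * indicator A ((1 / \<tau>) *\<^sub>R x)) \<partial>lborel)"
    proof (cases "\<tau> > 0")
      case True
      have "(\<integral>\<^sup>+x. f x * (indicator {0<..} \<tau> * ennreal (1 / \<tau>) * indicator A ((1 / \<tau>) *\<^sub>R x)) \<partial>lborel)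
        = ennreal (\<tau> ^ ?n) * (\<integral>\<^sup>+x. ennreal (1 / \<tau>) * (indicator A x * f (\<tau> *\<^sub>R x)) \<partial>lborel)"
        using True by (subst nn_integral_lborel_scale[of _ \<tau>]) (auto simp: mult_ac)
      also have "\<dots> = (\<integral>\<^sup>+x. ennreal (\<tau> ^ ?n) * (ennreal (1 / \<tau>) * (indicator A x * f (\<tau> *\<^sub>R x))) \<partial>lborel)"
        by (rule nn_integral_cmult[symmetric]) measurable
      also have "\<dots> = (\<integral>\<^sup>+x. indicator A x * (indicator {0<..} \<tau> * ennreal (\<tau> ^ (?n - 1)) * f (\<tau> *\<^sub>R x)) \<partial>lborel)"
      proof (rule nn_integral_cong)
        fix x
        have "ennreal (\<tau> ^ ?n) * ennreal (1 / \<tau>) = ennreal (\<tau> ^ (?n - 1))"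
          using True n by (metis (no_types, lifting) ennreal_mult[symmetric] less_imp_le zero_le_power zero_le_divide_1_iff nonzero_mult_div_cancel_left power_Suc less_irrefl times_divide_eq_right mult.right_neutral)
        then show "ennreal (\<tau> ^ ?n) * (ennreal (1 / \<tau>) * (indicator A x * f (\<tau> *\<^sub>R x)))
            = indicator A x * (indicator {0<..} \<tau> * ennreal (\<tau> ^ (?n - 1)) * f (\<tau> *\<^sub>R x))"
          using True by (simp add: mult.assoc[symmetric]) (simp add: mult_ac)
      qed
      finally show ?thesis by simp
    qed simp
  qed
  also have "\<dots> = (\<integral>\<^sup>+x. (\<integral>\<^sup>+\<tau>. f x * (indicator {0<..} \<tau> * ennreal (1 / \<tau>) * indicator A ((1 / \<tau>) *\<^sub>R x)) \<partial>lborel) \<partial>lborel)"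
    by (rule lborel_pair.Fubini'[symmetric]) measurable
  also have "\<dots> = (\<integral>\<^sup>+x. f x \<partial>lborel)"
  proof (rule nn_integral_cong_AE)
    show "AE x in lborel. (\<integral>\<^sup>+\<tau>. f x * (indicator {0<..} \<tau> * ennreal (1 / \<tau>) * indicator A ((1 / \<tau>) *\<^sub>R x)) \<partial>lborel) = f x"
      using AE_lborel_singleton[of 0]
    proof eventually_elim
      case (elim x)
      have "(\<integral>\<^sup>+\<tau>. f x * (indicator {0<..} \<tau> * ennreal (1 / \<tau>) * indicator A ((1 / \<tau>) *\<^sub>R x)) \<partial>lborel)
        = f x * (\<integral>\<^sup>+\<tau>. indicator {0<..} \<tau> * ennreal (1 / \<tau>) * indicator A ((1 / \<tau>) *\<^sub>R x) \<partial>lborel)"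
        by (rule nn_integral_cmult) measurable
      then show ?case by (simp add: shell[OF elim])
    qed
  qed
  finally show ?thesis by simp
qed

text \<open>
  The half-space is parametrised by a direction \<open>x\<close> of the base, the value \<open>\<rho>\<close> of \<open>\<Phi>\<^sub>0\<close> and
  the slope \<open>w = y / H\<^sub>0\<close>; \<open>arc \<omega>\<close> runs through the quarter of the unit sphere of \<open>\<Phi>\<^sub>0\<close>
  above the ray through \<open>\<omega>\<close>, from the base (\<open>w = 0\<close>) to the pole (\<open>w \<rightarrow> \<infinity>\<close>).
\<close>

definition arc :: "'a::real_normed_vector \<Rightarrow> real \<Rightarrow> 'a \<times> real" where
  "arc \<omega> w = (1 / sqrt (1 + w\<^sup>2)) *\<^sub>R (\<omega>, w)"

lemma one_plus_sq_pos: "(0::real) < 1 + w\<^sup>2" "(1::real) + w\<^sup>2 \<noteq> 0"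
  by (smt (verit) zero_le_power2)+

lemma arc_measurable [measurable (raw)]:
  fixes f :: "'b \<Rightarrow> 'a::euclidean_space"
  assumes [measurable]: "f \<in> borel_measurable M" "g \<in> borel_measurable M"
  shows "(\<lambda>x. arc (f x) (g x)) \<in> borel_measurable M"
  unfolding arc_def by measurable

text \<open>
  On the ray of slope \<open>w\<close> one has \<open>H\<^sub>0 = \<rho> / sqrt (1 + w\<^sup>2)\<close>. The factor \<open>H\<^sub>0\<^sup>n\<^sup>-\<^sup>1\<close> of the polar
  coordinates in the base and the two Jacobians combine to the density below, a product of a function
  of \<open>\<rho>\<close> and one of \<open>w\<close>.
\<close>

theorem nn_integral_half_space:
  fixes N :: "'a::euclidean_space \<Rightarrow> real" and f :: "'a \<times> real \<Rightarrow> ennreal"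
  assumes N: "is_norm N" and f [measurable]: "f \<in> borel_measurable borel"
  shows "(\<integral>\<^sup>+z. indicator {z. 0 < snd z} z * f z \<partial>lborel) =
    (\<integral>\<^sup>+x. (\<integral>\<^sup>+w. (\<integral>\<^sup>+\<rho>. indicator {0<..} w * indicator {0<..} \<rho> *
        ennreal (\<rho> ^ DIM('a) * (1 + w\<^sup>2) powr (- (real DIM('a) + 1) / 2)) *
        f (\<rho> *\<^sub>R arc (x /\<^sub>R N x) w) \<partial>lborel) \<partial>lborel) \<partial>cone_measure N)"
proof -
  let ?n = "DIM('a)"
  have n: "?n = Suc (?n - 1)" using DIM_positive[where 'a='a] by simp
  have N_m [measurable]: "N \<in> borel_measurable borel" by (rule norm_borel[OF N])
  have fp [measurable]: "f \<in> borel_measurable (borel \<Otimes>\<^sub>M borel)"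
    using f by (simp add: borel_prod)
  have sf: "sigma_finite_measure (cone_measure N)"
    using emeasure_cone_measure[OF N]
    by (intro finite_measure.axioms(1) finite_measureI) (auto simp: cone_measure_def)
  interpret CM: sigma_finite_measure "cone_measure N" by fact
  interpret PCM: pair_sigma_finite "cone_measure N" "lborel :: real measure" ..
  let ?g = "\<lambda>x s y. indicator {0<..} s * ennreal (s ^ (?n - 1)) * (indicator {0<..} y * f (s *\<^sub>R (x /\<^sub>R N x), y))"
  have "(\<integral>\<^sup>+z. indicator {z. 0 < snd z} z * f z \<partial>lborel)
     = (\<integral>\<^sup>+z. indicator {z. 0 < snd z} z * f z \<partial>(lborel \<Otimes>\<^sub>M lborel))"
    by (simp add: lborel_prod)
  also have "\<dots> = (\<integral>\<^sup>+y. (\<integral>\<^sup>+x. indicator {0<..} y * f (x, y) \<partial>lborel) \<partial>lborel)"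
    by (subst lborel_pair.nn_integral_snd[symmetric]) (auto simp: indicator_def intro!: nn_integral_cong)
  also have "\<dots> = (\<integral>\<^sup>+y. (\<integral>\<^sup>+x. (\<integral>\<^sup>+s. ?g x s y \<partial>lborel) \<partial>cone_measure N) \<partial>lborel)"
    by (intro nn_integral_cong nn_integral_polar[OF N]) measurable
  also have "\<dots> = (\<integral>\<^sup>+x. (\<integral>\<^sup>+y. (\<integral>\<^sup>+s. ?g x s y \<partial>lborel) \<partial>lborel) \<partial>cone_measure N)"
    by (rule PCM.Fubini') measurable
  also have "\<dots> = (\<integral>\<^sup>+x. (\<integral>\<^sup>+w. (\<integral>\<^sup>+\<rho>. indicator {0<..} w * indicator {0<..} \<rho> *
        ennreal (\<rho> ^ ?n * (1 + w\<^sup>2) powr (- (real ?n + 1) / 2)) *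
        f (\<rho> *\<^sub>R arc (x /\<^sub>R N x) w) \<partial>lborel) \<partial>lborel) \<partial>cone_measure N)"
  proof (rule nn_integral_cong)
    fix x :: 'a
    define \<omega> where "\<omega> = x /\<^sub>R N x"
    have "(\<integral>\<^sup>+y. (\<integral>\<^sup>+s. ?g x s y \<partial>lborel) \<partial>lborel) = (\<integral>\<^sup>+s. (\<integral>\<^sup>+y. ?g x s y \<partial>lborel) \<partial>lborel)"
      by (rule lborel_pair.Fubini') measurable
    \<comment> \<open>first \<open>y = s w\<close> at fixed \<open>s\<close>, then \<open>s = \<rho> / sqrt (1 + w\<^sup>2)\<close> at fixed \<open>w\<close>\<close>
    also have "\<dots> = (\<integral>\<^sup>+s. (\<integral>\<^sup>+w. indicator {0<..} s * indicator {0<..} w * ennreal (s ^ ?n) *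
        f (s *\<^sub>R (\<omega>, w)) \<partial>lborel) \<partial>lborel)"
    proof (rule nn_integral_cong)
      fix s :: real
      show "(\<integral>\<^sup>+y. ?g x s y \<partial>lborel) = (\<integral>\<^sup>+w. indicator {0<..} s * indicator {0<..} w * ennreal (s ^ ?n) *
        f (s *\<^sub>R (\<omega>, w)) \<partial>lborel)"
      proof (cases "s > 0")
        case True
        have m: "?g x s \<in> borel_measurable borel" by measurable
        have "(\<integral>\<^sup>+y. ?g x s y \<partial>lborel) = ennreal s * (\<integral>\<^sup>+w. ?g x s (0 + s * w) \<partial>lborel)"
          using nn_integral_real_affine[OF m, of s 0] True by (simp only: abs_of_pos) 
        also have "\<dots> = (\<integral>\<^sup>+w. ennreal s * ?g x s (0 + s * w) \<partial>lborel)"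
          by (rule nn_integral_cmult[symmetric]) measurable
        also have "\<dots> = (\<integral>\<^sup>+w. indicator {0<..} s * indicator {0<..} w * ennreal (s ^ ?n) *
            f (s *\<^sub>R (\<omega>, w)) \<partial>lborel)"
        proof (rule nn_integral_cong)
          fix w :: real
          have "ennreal s * ennreal (s ^ (?n - 1)) = ennreal (s ^ ?n)"
            using True n by (metis ennreal_mult less_imp_le power_Suc zero_le_power)
          then show "ennreal s * ?g x s (0 + s * w) = indicator {0<..} s * indicator {0<..} w *
              ennreal (s ^ ?n) * f (s *\<^sub>R (\<omega>, w))"
            using True by (cases "w > 0") (simp_all add: \<omega>_def zero_less_mult_iff mult.assoc[symmetric])
        qed
        finally show ?thesis .
      qed simp
    qed
    also have "\<dots> = (\<integral>\<^sup>+w. (\<integral>\<^sup>+s. indicator {0<..} s * indicator {0<..} w * ennreal (s ^ ?n) *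
        f (s *\<^sub>R (\<omega>, w)) \<partial>lborel) \<partial>lborel)"
      by (rule lborel_pair.Fubini') measurable
    also have "\<dots> = (\<integral>\<^sup>+w. (\<integral>\<^sup>+\<rho>. indicator {0<..} w * indicator {0<..} \<rho> *
        ennreal (\<rho> ^ ?n * (1 + w\<^sup>2) powr (- (real ?n + 1) / 2)) *
        f (\<rho> *\<^sub>R arc \<omega> w) \<partial>lborel) \<partial>lborel)"
    proof (rule nn_integral_cong)
      fix w :: real
      define c where "c = 1 / sqrt (1 + w\<^sup>2)"
      have c: "c > 0" unfolding c_def using one_plus_sq_pos[of w] by simp
      have "c = (1 + w\<^sup>2) powr (- 1 / 2)"
        unfolding c_def using one_plus_sq_pos[of w] by (simp add: powr_minus_divide powr_half_sqrt)
      then have "c powr real (Suc ?n) = (1 + w\<^sup>2) powr (- 1 / 2 * real (Suc ?n))"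
        by (simp only: powr_powr)
      also have "- 1 / 2 * real (Suc ?n) = - (real ?n + 1) / 2" by (simp add: field_simps)
      finally have "c ^ Suc ?n = (1 + w\<^sup>2) powr (- (real ?n + 1) / 2)"
        using c by (simp only: powr_realpow)
      then have cn: "ennreal c * ennreal ((c * \<rho>) ^ ?n) = ennreal (\<rho> ^ ?n * (1 + w\<^sup>2) powr (- (real ?n + 1) / 2))"
        if "\<rho> > 0" for \<rho>
        using that c by (simp add: power_mult_distrib mult_ac flip: ennreal_mult)
      have "(\<integral>\<^sup>+s. indicator {0<..} s * indicator {0<..} w * ennreal (s ^ ?n) * f (s *\<^sub>R (\<omega>, w)) \<partial>lborel)
        = ennreal c * (\<integral>\<^sup>+\<rho>. indicator {0<..} (0 + c * \<rho>) * indicator {0<..} w *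
           ennreal ((0 + c * \<rho>) ^ ?n) * f ((0 + c * \<rho>) *\<^sub>R (\<omega>, w)) \<partial>lborel)"
        using c by (subst nn_integral_real_affine[where c = c and t = 0]) auto
      also have "\<dots> = (\<integral>\<^sup>+\<rho>. ennreal c * (indicator {0<..} (0 + c * \<rho>) * indicator {0<..} w *
           ennreal ((0 + c * \<rho>) ^ ?n) * f ((0 + c * \<rho>) *\<^sub>R (\<omega>, w))) \<partial>lborel)"
        by (rule nn_integral_cmult[symmetric]) measurable
      also have "\<dots> = (\<integral>\<^sup>+\<rho>. indicator {0<..} w * indicator {0<..} \<rho> *
        ennreal (\<rho> ^ ?n * (1 + w\<^sup>2) powr (- (real ?n + 1) / 2)) * f (\<rho> *\<^sub>R arc \<omega> w) \<partial>lborel)"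
      proof (rule nn_integral_cong)
        fix \<rho> :: real
        have a: "(c * \<rho>) *\<^sub>R (\<omega>, w) = \<rho> *\<^sub>R arc \<omega> w"
          by (simp add: arc_def c_def)
        show "ennreal c * (indicator {0<..} (0 + c * \<rho>) * indicator {0<..} w *
           ennreal ((0 + c * \<rho>) ^ ?n) * f ((0 + c * \<rho>) *\<^sub>R (\<omega>, w))) = indicator {0<..} w * indicator {0<..} \<rho> *
        ennreal (\<rho> ^ ?n * (1 + w\<^sup>2) powr (- (real ?n + 1) / 2)) * f (\<rho> *\<^sub>R arc \<omega> w)"
        proof (cases "\<rho> > 0")
          case True
          show ?thesis unfolding cn[OF True, symmetric] add_0_left a
            using True c by (simp add: zero_less_mult_iff mult_ac indicator_def)
        qed (use c in \<open>simp add: zero_less_mult_iff\<close>)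
      qed
      finally show "(\<integral>\<^sup>+s. indicator {0<..} s * indicator {0<..} w * ennreal (s ^ ?n) * f (s *\<^sub>R (\<omega>, w)) \<partial>lborel)
        = (\<integral>\<^sup>+\<rho>. indicator {0<..} w * indicator {0<..} \<rho> *
        ennreal (\<rho> ^ ?n * (1 + w\<^sup>2) powr (- (real ?n + 1) / 2)) * f (\<rho> *\<^sub>R arc \<omega> w) \<partial>lborel)" .
    qed
    finally show "(\<integral>\<^sup>+y. (\<integral>\<^sup>+s. ?g x s y \<partial>lborel) \<partial>lborel) = (\<integral>\<^sup>+w. (\<integral>\<^sup>+\<rho>. indicator {0<..} w * indicator {0<..} \<rho> *
        ennreal (\<rho> ^ ?n * (1 + w\<^sup>2) powr (- (real ?n + 1) / 2)) *
        f (\<rho> *\<^sub>R arc (x /\<^sub>R N x) w) \<partial>lborel) \<partial>lborel)"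
      unfolding \<omega>_def .
  qed
  finally show ?thesis .
qed

section \<open>The hypergeometric function on the unit interval\<close>

text \<open>
  Coefficients of Gauss's hypergeometric function \<open>F(a, b; c; t)\<close>.
\<close>

definition hyp_coeff :: "real \<Rightarrow> real \<Rightarrow> real \<Rightarrow> nat \<Rightarrow> real" where
  "hyp_coeff a b c n = pochhammer a n * pochhammer b n / (pochhammer c n * fact n)"

definition hyp :: "real \<Rightarrow> real \<Rightarrow> real \<Rightarrow> real \<Rightarrow> real" where
  "hyp a b c t = (\<Sum>n. hyp_coeff a b c n * t ^ n)"

lemma hyp_coeff_0: "hyp_coeff a b c 0 = 1"
  by (simp add: hyp_coeff_def)

lemma hyp_coeff_Suc:
  "hyp_coeff a b c (Suc n) = hyp_coeff a b c n * ((a + n) * (b + n) / ((c + n) * (1 + n)))"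
  by (simp add: hyp_coeff_def pochhammer_Suc mult_ac add_ac)

lemma diffs_hyp_coeff:
  "diffs (hyp_coeff a b c) n = a * b / c * hyp_coeff (a + 1) (b + 1) (c + 1) n"
proof -
  have "fact (Suc n) = (1 + real n) * (fact n :: real)" by (simp add: algebra_simps)
  then show ?thesis
    unfolding diffs_def hyp_coeff_def pochhammer_rec by (simp add: mult_ac)
qed

context
  fixes a b c :: real
  assumes abc: "0 < a" "0 < b" "0 < c"
begin

lemma hyp_coeff_pos: "0 < hyp_coeff a b c n"
  using abc by (auto simp: hyp_coeff_def intro!: divide_pos_pos mult_pos_pos pochhammer_pos)

lemma hyp_ratio_tendsto:
  "(\<lambda>n. (a + real n) * (b + real n) / ((c + real n) * (1 + real n))) \<longlonglongrightarrow> 1"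
proof -
  have "(\<lambda>n. (a * inverse (real n) + 1) * (b * inverse (real n) + 1) /
      ((c * inverse (real n) + 1) * (1 * inverse (real n) + 1))) \<longlonglongrightarrow>
      (a * 0 + 1) * (b * 0 + 1) / ((c * 0 + 1) * (1 * 0 + 1))"
    by (intro tendsto_intros lim_inverse_n) simp_all
  moreover have "\<forall>\<^sub>F n in sequentially. (a * inverse (real n) + 1) * (b * inverse (real n) + 1) /
      ((c * inverse (real n) + 1) * (1 * inverse (real n) + 1)) =
      (a + real n) * (b + real n) / ((c + real n) * (1 + real n))"
    using eventually_gt_at_top[of 0]
  proof eventually_elim
    case (elim n)
    then have n: "real n > 0" by simp
    have "x * inverse (real n) + 1 = (x + real n) / real n" for x using n by (simp add: field_simps)
    moreover have "(u / real n * (v / real n)) / (u' / real n * (v' / real n)) = u * v / (u' * v')" for u v u' v'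
      using n by (auto simp: divide_simps)
    ultimately show ?case by (simp only:)
  qed
  ultimately show ?thesis by (simp add: filterlim_cong)
qed

lemma hyp_sums:
  assumes "\<bar>t\<bar> < 1"
  shows "(\<lambda>n. hyp_coeff a b c n * t ^ n) sums hyp a b c t"
proof -
  define r where "r = (1 + \<bar>t\<bar>) / 2"
  have r: "\<bar>t\<bar> < r" "r < 1" "0 < r" using assms by (auto simp: r_def)
  have lim: "(\<lambda>n. (a + real n) * (b + real n) / ((c + real n) * (1 + real n)) * \<bar>t\<bar>) \<longlonglongrightarrow> 1 * \<bar>t\<bar>"
    by (intro tendsto_intros hyp_ratio_tendsto)
  then have "\<forall>\<^sub>F n in sequentially. (a + real n) * (b + real n) / ((c + real n) * (1 + real n)) * \<bar>t\<bar> < r"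
    using r by (intro order_tendstoD(2)[OF lim]) simp
  then obtain N where N: "\<And>n. n \<ge> N \<Longrightarrow> (a + real n) * (b + real n) / ((c + real n) * (1 + real n)) * \<bar>t\<bar> < r"
    by (auto simp: eventually_sequentially)
  have "summable (\<lambda>n. hyp_coeff a b c n * t ^ n)"
  proof (rule summable_ratio_test[where c = r and N = N])
    fix n assume n: "N \<le> n"
    have "norm (hyp_coeff a b c (Suc n) * t ^ Suc n) =
        hyp_coeff a b c n * \<bar>t\<bar> ^ n * ((a + real n) * (b + real n) / ((c + real n) * (1 + real n)) * \<bar>t\<bar>)"
      using abc hyp_coeff_pos[of n] by (simp add: hyp_coeff_Suc abs_mult power_abs)
    also have "\<dots> \<le> hyp_coeff a b c n * \<bar>t\<bar> ^ n * r"
      using N[OF n] hyp_coeff_pos[of n] by (intro mult_left_mono) auto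
    also have "\<dots> = r * norm (hyp_coeff a b c n * t ^ n)"
      using hyp_coeff_pos[of n] by (simp add: abs_mult power_abs)
    finally show "norm (hyp_coeff a b c (Suc n) * t ^ Suc n) \<le> r * norm (hyp_coeff a b c n * t ^ n)" .
  qed (use r in simp)
  then show ?thesis by (simp add: hyp_def summable_sums)
qed

lemma hyp_ge_1:
  assumes "0 \<le> t" "t < 1"
  shows "1 \<le> hyp a b c t"
proof -
  have "(\<Sum>n\<in>{0}. hyp_coeff a b c n * t ^ n) \<le> (\<Sum>n. hyp_coeff a b c n * t ^ n)"
    using hyp_sums[of t] assms less_imp_le[OF hyp_coeff_pos]
    by (intro sum_le_suminf) (auto simp: sums_iff)
  then show ?thesis by (simp add: hyp_def hyp_coeff_0)
qed

lemma partial_sum_le_hyp: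
  assumes "0 \<le> t" "t < 1"
  shows "(\<Sum>i<n. hyp_coeff a b c i * t ^ i) \<le> hyp a b c t"
  unfolding hyp_def using hyp_sums[of t] assms less_imp_le[OF hyp_coeff_pos]
  by (intro sum_le_suminf) (auto simp: sums_iff)

end

lemma hyp_deriv:
  assumes abc: "0 < a" "0 < b" "0 < c" and t: "\<bar>t\<bar> < 1"
  shows "(hyp a b c has_real_derivative a * b / c * hyp (a + 1) (b + 1) (c + 1) t) (at t)"
proof -
  have s: "summable (\<lambda>n. hyp_coeff a b c n * x ^ n)" if "norm x < 1" for x
    using hyp_sums[OF abc, of x] that by (auto simp: sums_iff)
  have "(hyp a b c has_real_derivative (\<Sum>n. diffs (hyp_coeff a b c) n * t ^ n)) (at t)"
    unfolding hyp_def[abs_def] using t by (intro termdiffs_strong'[OF s]) auto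
  moreover have "(\<lambda>n. diffs (hyp_coeff a b c) n * t ^ n) sums (a * b / c * hyp (a + 1) (b + 1) (c + 1) t)"
    unfolding diffs_hyp_coeff mult.assoc[of "a * b / c"]
    using abc t by (intro sums_mult hyp_sums) auto
  ultimately show ?thesis by (simp add: sums_iff)
qed

text \<open>The hypergeometric equation, read off from the recursion of the coefficients.\<close>

lemma hyp_ode:
  assumes abc: "0 < a" "0 < b" "0 < c" and t: "0 < t" "t < 1"
  defines "h1 \<equiv> a * b / c * hyp (a + 1) (b + 1) (c + 1) t"
    and "h2 \<equiv> a * b / c * ((a + 1) * (b + 1) / (c + 1) * hyp (a + 2) (b + 2) (c + 2) t)"
  shows "t * (1 - t) * h2 + (c - (a + b + 1) * t) * h1 = a * b * hyp a b c t"
proof -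
  let ?c = "hyp_coeff a b c"
  have S0: "(\<lambda>n. ?c n * t ^ n) sums hyp a b c t"
    using abc t by (intro hyp_sums) auto
  have c1: "real (Suc n) * ?c (Suc n) = a * b / c * hyp_coeff (a + 1) (b + 1) (c + 1) n" for n
    using diffs_hyp_coeff[of a b c n] by (simp add: diffs_def)
  have c2: "real (Suc n) * hyp_coeff (a + 1) (b + 1) (c + 1) (Suc n) =
      (a + 1) * (b + 1) / (c + 1) * hyp_coeff (a + 2) (b + 2) (c + 2) n" for n
    using diffs_hyp_coeff[of "a + 1" "b + 1" "c + 1" n] by (simp add: diffs_def add.assoc)
  have "(\<lambda>n. a * b / c * (hyp_coeff (a + 1) (b + 1) (c + 1) n * t ^ n) * t) sums (h1 * t)"
    unfolding h1_def using abc t by (intro sums_mult sums_mult2 hyp_sums) auto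
  moreover have "a * b / c * (hyp_coeff (a + 1) (b + 1) (c + 1) n * t ^ n) * t
      = real (Suc n) * ?c (Suc n) * t ^ Suc n" for n
    by (simp only: c1) simp
  ultimately have "(\<lambda>n. real (Suc n) * ?c (Suc n) * t ^ Suc n) sums (h1 * t)" by simp
  from sums_Suc[OF this] have S1: "(\<lambda>n. real n * ?c n * t ^ n) sums (h1 * t)" by simp
  have "(\<lambda>n. a * b / c * ((a + 1) * (b + 1) / (c + 1) * (hyp_coeff (a + 2) (b + 2) (c + 2) n * t ^ n)) * t\<^sup>2)
      sums (h2 * t\<^sup>2)"
    unfolding h2_def using abc t by (intro sums_mult sums_mult2 hyp_sums) auto
  moreover have "a * b / c * ((a + 1) * (b + 1) / (c + 1) * (hyp_coeff (a + 2) (b + 2) (c + 2) n * t ^ n)) * t\<^sup>2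
      = real (Suc (Suc n)) * real (Suc n) * ?c (Suc (Suc n)) * t ^ Suc (Suc n)" for n
  proof -
    have "real (Suc (Suc n)) * real (Suc n) * ?c (Suc (Suc n)) =
        real (Suc n) * (a * b / c * hyp_coeff (a + 1) (b + 1) (c + 1) (Suc n))"
      by (simp only: c1[symmetric]) (simp only: mult_ac)
    also have "\<dots> = a * b / c * ((a + 1) * (b + 1) / (c + 1) * hyp_coeff (a + 2) (b + 2) (c + 2) n)"
      by (simp only: c2[symmetric]) (simp only: mult_ac)
    finally show ?thesis by (simp only: power_Suc power2_eq_square) (simp only: mult_ac)
  qed
  ultimately have "(\<lambda>n. real (Suc (Suc n)) * real (Suc n) * ?c (Suc (Suc n)) * t ^ Suc (Suc n)) sums (h2 * t\<^sup>2)"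
    by (simp only:)
  from sums_Suc[OF this] have "(\<lambda>n. real (Suc n) * real n * ?c (Suc n) * t ^ Suc n) sums (h2 * t\<^sup>2)"
    by simp
  from sums_Suc[where f = "\<lambda>n. real n * (real n - 1) * ?c n * t ^ n", simplified, OF this[simplified]]
  have S2: "(\<lambda>n. real n * (real n - 1) * ?c n * t ^ n) sums (h2 * t\<^sup>2)" by simp
  have L: "(\<lambda>n. real n * (real n - 1 + c) * ?c n * t ^ n) sums (h2 * t\<^sup>2 + c * (h1 * t))"
    using sums_add[OF S2 sums_mult[OF S1, of c]] by (simp add: algebra_simps)
  have R: "(\<lambda>n. (a + n) * (b + n) * ?c n * t ^ n) sums (h2 * t\<^sup>2 + (a + b + 1) * (h1 * t) + a * b * hyp a b c t)"
    using sums_add[OF sums_add[OF S2 sums_mult[OF S1, of "a + b + 1"]] sums_mult[OF S0, of "a * b"]]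
    by (simp add: algebra_simps)
  have "(\<lambda>n. real (Suc n) * (real (Suc n) - 1 + c) * ?c (Suc n) * t ^ Suc n) sums
      (t * (h2 * t\<^sup>2 + (a + b + 1) * (h1 * t) + a * b * hyp a b c t))"
  proof -
    have "real (Suc n) * (real (Suc n) - 1 + c) * ?c (Suc n) * t ^ Suc n
        = t * ((a + n) * (b + n) * ?c n * t ^ n)" for n
    proof -
      have "real (Suc n) * (real (Suc n) - 1 + c) = (c + n) * (1 + n)" by (simp add: algebra_simps)
      moreover have "(c + n) * (1 + n) \<noteq> 0" using abc by simp
      ultimately have "real (Suc n) * (real (Suc n) - 1 + c) * ((a + n) * (b + n) / ((c + n) * (1 + n))) = (a + n) * (b + n)"
        by (metis nonzero_mult_div_cancel_left times_divide_eq_right)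
      moreover have "real (Suc n) * (real (Suc n) - 1 + c) * ?c (Suc n) * t ^ Suc n =
          real (Suc n) * (real (Suc n) - 1 + c) * ((a + n) * (b + n) / ((c + n) * (1 + n))) * (?c n * (t * t ^ n))"
        by (simp only: hyp_coeff_Suc power_Suc mult_ac)
      ultimately show ?thesis by (simp only: mult_ac)
    qed
    then show ?thesis by (simp only:) (rule sums_mult[OF R])
  qed
  from sums_Suc[OF this] have "(\<lambda>n. real n * (real n - 1 + c) * ?c n * t ^ n) sums
      (t * (h2 * t\<^sup>2 + (a + b + 1) * (h1 * t) + a * b * hyp a b c t))"
    by simp
  then have "h2 * t\<^sup>2 + c * (h1 * t) = t * (h2 * t\<^sup>2 + (a + b + 1) * (h1 * t) + a * b * hyp a b c t)"
    using L sums_unique2 by blast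
  then have "t * (h2 * t + c * h1) = t * (h2 * t\<^sup>2 + (a + b + 1) * (h1 * t) + a * b * hyp a b c t)"
    by (simp add: power2_eq_square algebra_simps)
  then have "h2 * t + c * h1 = h2 * t\<^sup>2 + (a + b + 1) * (h1 * t) + a * b * hyp a b c t"
    using t by simp
  then show ?thesis by (simp add: algebra_simps power2_eq_square)
qed

text \<open>
  The case \<open>b = c\<close> of the series, in which the function is an elementary power.
\<close>

lemma binomial_series_neg_powr:
  fixes \<mu> t :: real
  assumes "\<bar>t\<bar> < 1"
  shows "(\<lambda>n. pochhammer \<mu> n / fact n * t ^ n) sums (1 - t) powr (- \<mu>)"
proof -
  have "(\<lambda>n. (- \<mu> gchoose n) * (- t) ^ n) sums (1 + (- t)) powr (- \<mu>)"
    using assms by (intro gen_binomial_real) simp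
  moreover have "(- \<mu> gchoose n) * (- t) ^ n = pochhammer \<mu> n / fact n * t ^ n" for n
  proof -
    have "(- 1) ^ n * (- t) ^ n = t ^ n" by (simp flip: power_mult_distrib)
    then show ?thesis unfolding gbinomial_pochhammer by (metis (no_types) add.inverse_inverse mult.assoc mult.commute times_divide_eq_left)
  qed
  ultimately show ?thesis by simp
qed

lemma nn_integral_Beta:
  assumes "p > 0" "q > (0::real)"
  shows "(\<integral>\<^sup>+s. ennreal (indicator {0..1} s * (s powr (p - 1) * (1 - s) powr (q - 1))) \<partial>lborel) = ennreal (Beta p q)"
  by (rule nn_integral_has_integral_lebesgue[OF _ has_integral_Beta_real[OF assms]]) simp

text \<open>
  Gauss's summation theorem: expand \<open>(1 - s)\<^sup>-\<^sup>a\<close> in the Beta integral for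
  \<open>B(b, c - a - b)\<close>; all terms are nonnegative, so that monotone convergence gives both
  the convergence of the series and its value.
\<close>

theorem hyp_Gauss:
  assumes ab: "0 < a" "0 < b" and c: "a + b < c"
  shows "hyp_coeff a b c sums (Gamma c * Gamma (c - a - b) / (Gamma (c - a) * Gamma (c - b)))"
proof -
  let ?f = "\<lambda>n s. ennreal (indicator {0..1} s * (s powr (b + n - 1) * (1 - s) powr (c - b - 1)))"
  have Beta_pos: "Beta p q > 0" if "p > 0" "q > 0" for p q :: real
    using that by (simp add: Beta_def)
  have B: "pochhammer a n / fact n * Beta (b + n) (c - b) = Beta b (c - b) * hyp_coeff a b c n" for n
  proof -
    have "b \<notin> \<int>\<^sub>\<le>\<^sub>0" "c \<notin> \<int>\<^sub>\<le>\<^sub>0" using ab c by (auto simp: nonpos_Ints_def)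
    then have "pochhammer b n = Gamma (b + n) / Gamma b" "pochhammer c n = Gamma (c + n) / Gamma c"
      by (simp_all add: pochhammer_Gamma)
    moreover have "Gamma b > 0" "Gamma c > 0" "Gamma (c + n) > 0" using ab c by simp_all
    moreover have "b + n + (c - b) = c + n" "b + (c - b) = c" by simp_all
    ultimately show ?thesis
      by (simp add: Beta_def hyp_coeff_def field_simps)
  qed
  have "(\<Sum>n. ennreal (Beta b (c - b) * hyp_coeff a b c n)) =
      (\<Sum>n. (\<integral>\<^sup>+s. ennreal (pochhammer a n / fact n) * ?f n s \<partial>lborel))"
  proof (rule arg_cong[where f = suminf], rule ext)
    fix n
    have "(\<integral>\<^sup>+s. ennreal (pochhammer a n / fact n) * ?f n s \<partial>lborel) =
        ennreal (pochhammer a n / fact n) * ennreal (Beta (b + n) (c - b))"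
      using ab c by (subst nn_integral_cmult) (auto simp: nn_integral_Beta)
    also have "\<dots> = ennreal (Beta b (c - b) * hyp_coeff a b c n)"
      using ab c Beta_pos[of "b + n" "c - b"]
      by (subst ennreal_mult[symmetric]) (auto intro!: divide_nonneg_nonneg pochhammer_nonneg fact_ge_zero simp only: B less_imp_le)
    finally show "ennreal (Beta b (c - b) * hyp_coeff a b c n) =
       (\<integral>\<^sup>+s. ennreal (pochhammer a n / fact n) * ?f n s \<partial>lborel)" by simp
  qed
  also have "\<dots> = (\<integral>\<^sup>+s. (\<Sum>n. ennreal (pochhammer a n / fact n) * ?f n s) \<partial>lborel)"
    by (rule nn_integral_suminf[symmetric]) measurable
  also have "\<dots> = (\<integral>\<^sup>+s. ennreal (indicator {0..1} s * (s powr (b - 1) * (1 - s) powr (c - a - b - 1))) \<partial>lborel)"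
  proof (rule nn_integral_cong_AE)
    show "AE s in lborel. (\<Sum>n. ennreal (pochhammer a n / fact n) * ?f n s) =
        ennreal (indicator {0..1} s * (s powr (b - 1) * (1 - s) powr (c - a - b - 1)))"
      using AE_lborel_singleton[of 0] AE_lborel_singleton[of 1]
    proof eventually_elim
      case (elim s)
      show ?case
      proof (cases "s \<in> {0..1}")
        case True
        then have s: "0 < s" "s < 1" using elim by auto
        have sm: "(\<lambda>n. pochhammer a n / fact n * s ^ n) sums (1 - s) powr (- a)"
          using s by (intro binomial_series_neg_powr) auto
        have "(\<lambda>n. pochhammer a n / fact n * s ^ n * (s powr (b - 1) * (1 - s) powr (c - b - 1))) sums
            ((1 - s) powr (- a) * (s powr (b - 1) * (1 - s) powr (c - b - 1)))"
          by (intro sums_mult2 sm)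
        moreover have "(1 - s) powr (- a) * (s powr (b - 1) * (1 - s) powr (c - b - 1))
            = s powr (b - 1) * (1 - s) powr (c - a - b - 1)"
          using s by (simp add: mult_ac powr_add[symmetric] algebra_simps)
        moreover have "pochhammer a n / fact n * s ^ n * (s powr (b - 1) * (1 - s) powr (c - b - 1))
            = pochhammer a n / fact n * (s powr (b + n - 1) * (1 - s) powr (c - b - 1))" for n
          using s by (simp add: powr_realpow[symmetric] powr_add[symmetric] algebra_simps powr_diff)
        ultimately have "(\<lambda>n. pochhammer a n / fact n * (s powr (b + n - 1) * (1 - s) powr (c - b - 1))) sums
            (s powr (b - 1) * (1 - s) powr (c - a - b - 1))" by (simp only:)
        then have "(\<Sum>n. ennreal (pochhammer a n / fact n * (s powr (b + n - 1) * (1 - s) powr (c - b - 1))))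
            = ennreal (s powr (b - 1) * (1 - s) powr (c - a - b - 1))"
          using ab by (intro suminf_ennreal_eq) (auto intro!: mult_nonneg_nonneg divide_nonneg_nonneg pochhammer_nonneg)
        then show ?thesis using True ab
          by (simp add: ennreal_mult[symmetric] pochhammer_nonneg)
      qed simp
    qed
  qed
  also have "\<dots> = ennreal (Beta b (c - a - b))"
    using ab c nn_integral_Beta[of b "c - a - b"] by simp
  finally have "(\<lambda>n. ennreal (Beta b (c - b) * hyp_coeff a b c n)) sums ennreal (Beta b (c - a - b))"
    by (simp add: sums_iff)
  then have "(\<lambda>n. Beta b (c - b) * hyp_coeff a b c n) sums Beta b (c - a - b)"
    using ab c Beta_pos[of b "c - a - b"] Beta_pos[of b "c - b"] hyp_coeff_pos[of a b c]
    by (subst (asm) sums_ennreal) (auto intro!: mult_nonneg_nonneg less_imp_le)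
  then have "(\<lambda>n. Beta b (c - b) * hyp_coeff a b c n / Beta b (c - b)) sums (Beta b (c - a - b) / Beta b (c - b))"
    by (rule sums_divide)
  moreover have "Beta b (c - b) > 0" using ab c by (intro Beta_pos) auto
  moreover have "Beta b (c - a - b) / Beta b (c - b)
      = Gamma c * Gamma (c - a - b) / (Gamma (c - a) * Gamma (c - b))"
  proof -
    have "b + (c - a - b) = c - a" "b + (c - b) = c" by simp_all
    moreover have "Gamma b > 0" "Gamma c > 0" "Gamma (c - a) > 0" "Gamma (c - b) > 0" using ab c by simp_all
    ultimately show ?thesis by (simp add: Beta_def field_simps)
  qed
  ultimately show ?thesis by simp
qed

text \<open>
  For \<open>a + b < c\<close> the coefficients are summable, and the series converges uniformly up to the end point.
\<close>

lemma hyp_continuous_at_1: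
  assumes ab: "0 < a" "0 < b" and c: "a + b < c"
  shows "continuous_on {0..1} (hyp a b c)"
proof -
  have pos: "0 \<le> hyp_coeff a b c n" for n using hyp_coeff_pos[of a b c n] ab c by simp
  have "uniform_limit {0..1} (\<lambda>n t. \<Sum>i<n. hyp_coeff a b c i * t ^ i) (\<lambda>t. \<Sum>i. hyp_coeff a b c i * t ^ i) sequentially"
  proof (rule Weierstrass_m_test)
    show "norm (hyp_coeff a b c n * t ^ n) \<le> hyp_coeff a b c n" if "t \<in> {0..1}" for n t
      using that pos[of n] by (auto simp: abs_mult power_le_one mult_left_le)
    show "summable (hyp_coeff a b c)" using hyp_Gauss[OF assms] by (rule sums_summable)
  qed
  then show ?thesis
    unfolding hyp_def[abs_def]
    by (rule uniform_limit_theorem[rotated]) (auto intro!: always_eventually continuous_intros)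
qed

text \<open>
  The Pochhammer symbols are, up to powers of \<open>n\<close>, the products that converge to \<open>1 / \<Gamma>\<close>, and the
  powers cancel if \<open>a + b = c + \<mu>\<close>.
\<close>

lemma hyp_coeff_asymp:
  assumes "0 < a" "0 < b" "0 < c" "0 < \<mu>" "a + b = c + \<mu>"
  shows "(\<lambda>n. hyp_coeff a b c n / (pochhammer \<mu> n / fact n)) \<longlonglongrightarrow>
     Gamma c * Gamma \<mu> / (Gamma a * Gamma b)"
proof -
  have nz: "rGamma x \<noteq> 0" if "x > 0" for x :: real
    using that by (auto simp: rGamma_eq_zero_iff nonpos_Ints_def)
  have "(\<lambda>n. rGamma_series a n * rGamma_series b n / (rGamma_series c n * rGamma_series \<mu> n)) \<longlonglongrightarrow>
      rGamma a * rGamma b / (rGamma c * rGamma \<mu>)"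
    using assms nz by (intro tendsto_intros) auto
  moreover have "rGamma a * rGamma b / (rGamma c * rGamma \<mu>) = Gamma c * Gamma \<mu> / (Gamma a * Gamma b)"
    by (simp add: rGamma_inverse_Gamma field_simps)
  moreover have "rGamma_series a n * rGamma_series b n / (rGamma_series c n * rGamma_series \<mu> n)
      = hyp_coeff a b c (Suc n) / (pochhammer \<mu> (Suc n) / fact (Suc n))" for n
  proof -
    define E where "E x = exp (x * ln (real n))" for x
    have E: "E a * E b = E c * E \<mu>" unfolding E_def
      by (simp add: exp_add[symmetric] distrib_right[symmetric] assms)
    have Epos: "E x > 0" for x by (simp add: E_def)
    have rg: "rGamma_series x n = pochhammer x (Suc n) / (fact n * E x)" for x
      by (simp add: rGamma_series_def E_def)
    have p: "pochhammer x (Suc n) > 0" if "x > 0" for x :: real using that by (rule pochhammer_pos)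
    have "rGamma_series a n * rGamma_series b n / (rGamma_series c n * rGamma_series \<mu> n)
        = pochhammer a (Suc n) * pochhammer b (Suc n) * (E c * E \<mu>) /
          (pochhammer c (Suc n) * pochhammer \<mu> (Suc n) * (E a * E b))"
      unfolding rg by (simp add: field_simps)
    also have "\<dots> = pochhammer a (Suc n) * pochhammer b (Suc n) / (pochhammer c (Suc n) * pochhammer \<mu> (Suc n))"
      unfolding E using Epos[of c] Epos[of \<mu>] by (simp add: less_imp_neq[THEN not_sym])
    also have "\<dots> = hyp_coeff a b c (Suc n) / (pochhammer \<mu> (Suc n) / fact (Suc n))"
      unfolding hyp_coeff_def by (simp del: pochhammer_Suc fact_Suc)
    finally show ?thesis .
  qed
  ultimately have "(\<lambda>n. hyp_coeff a b c (Suc n) / (pochhammer \<mu> (Suc n) / fact (Suc n))) \<longlonglongrightarrow>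
     Gamma c * Gamma \<mu> / (Gamma a * Gamma b)" by simp
  then show ?thesis by (rule LIMSEQ_imp_Suc)
qed

text \<open>
  When \<open>\<mu> = a + b - c\<close> is positive the function blows up like \<open>(1 - t)\<^sup>-\<^sup>\<mu>\<close>: its
  coefficients are asymptotically proportional to those of the binomial series, and the constant of
  proportionality passes to the functions by Abel's argument, since finitely many coefficients do not
  matter against a divergent series.
\<close>

theorem hyp_blowup:
  assumes abc: "0 < a" "0 < b" "0 < c" "0 < \<mu>" "a + b = c + \<mu>"
  shows "((\<lambda>t. (1 - t) powr \<mu> * hyp a b c t) \<longlongrightarrow> Gamma c * Gamma \<mu> / (Gamma a * Gamma b)) (at_left 1)"
proof (rule tendstoI)
  define L where "L = Gamma c * Gamma \<mu> / (Gamma a * Gamma b)"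
  define d where "d n = pochhammer \<mu> n / fact n" for n
  have d: "d n > 0" for n using abc by (simp add: d_def pochhammer_pos)
  fix e :: real assume e: "0 < e"
  have "\<forall>\<^sub>F n in sequentially. dist (hyp_coeff a b c n / d n) L < e / 2"
    using tendstoD[OF hyp_coeff_asymp[OF abc], of "e / 2"] e by (simp add: d_def L_def)
  then obtain N where N: "\<And>n. n \<ge> N \<Longrightarrow> \<bar>hyp_coeff a b c n / d n - L\<bar> < e / 2"
    by (auto simp: eventually_sequentially dist_real_def)
  define C where "C = (\<Sum>n<N. \<bar>hyp_coeff a b c n - L * d n\<bar>)"
  have est: "\<bar>hyp_coeff a b c n - L * d n\<bar> \<le> (if n < N then \<bar>hyp_coeff a b c n - L * d n\<bar> else 0) + e / 2 * d n" for n
  proof (cases "n < N")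
    case True
    then show ?thesis using d[of n] e by simp
  next
    case False
    have "hyp_coeff a b c n - L * d n = (hyp_coeff a b c n / d n - L) * d n"
      using d[of n] by (simp add: field_simps)
    then have "\<bar>hyp_coeff a b c n - L * d n\<bar> = \<bar>hyp_coeff a b c n / d n - L\<bar> * d n"
      using d[of n] by (simp add: abs_mult)
    also have "\<dots> \<le> e / 2 * d n" using N[of n] False d[of n] by (intro mult_right_mono) auto
    finally show ?thesis using False by simp
  qed
  have "((\<lambda>t. (1 - t) powr \<mu> * C) \<longlongrightarrow> (1 - 1) powr \<mu> * C) (at_left (1::real))"
    using abc by (intro tendsto_intros) (auto intro: eventually_at_leftI[of 0])
  then have "\<forall>\<^sub>F t in at_left (1::real). dist ((1 - t) powr \<mu> * C) 0 < e / 2"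
    using e by (auto dest!: tendstoD[where e = "e / 2"])
  moreover have "\<forall>\<^sub>F t in at_left (1::real). t \<in> {0<..<1}"
    by (rule eventually_at_leftI[of 0]) auto
  ultimately show "\<forall>\<^sub>F t in at_left 1. dist ((1 - t) powr \<mu> * hyp a b c t) (Gamma c * Gamma \<mu> / (Gamma a * Gamma b)) < e"
  proof eventually_elim
    case (elim t)
    then have t: "0 < t" "t < 1" by auto
    have s1: "(\<lambda>n. hyp_coeff a b c n * t ^ n) sums hyp a b c t"
      using abc t by (intro hyp_sums) auto
    have s2: "(\<lambda>n. d n * t ^ n) sums (1 - t) powr (- \<mu>)"
      unfolding d_def using t by (intro binomial_series_neg_powr) auto
    have s3: "(\<lambda>n. (hyp_coeff a b c n - L * d n) * t ^ n) sums (hyp a b c t - L * (1 - t) powr (- \<mu>))"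
      using sums_diff[OF s1 sums_mult[OF s2, of L]] by (simp add: algebra_simps)
    have s4: "(\<lambda>n. (if n < N then \<bar>hyp_coeff a b c n - L * d n\<bar> else 0) + e / 2 * (d n * t ^ n)) sums
        (C + e / 2 * (1 - t) powr (- \<mu>))"
      unfolding C_def
      by (intro sums_add sums_mult s2)
        (use sums_If_finite[of "\<lambda>n. n < N" "\<lambda>n. \<bar>hyp_coeff a b c n - L * d n\<bar>"] in \<open>simp add: lessThan_def\<close>)
    have le: "\<bar>(hyp_coeff a b c n - L * d n) * t ^ n\<bar> \<le>
        (if n < N then \<bar>hyp_coeff a b c n - L * d n\<bar> else 0) + e / 2 * (d n * t ^ n)" for n
    proof -
      have "\<bar>(hyp_coeff a b c n - L * d n) * t ^ n\<bar> = \<bar>hyp_coeff a b c n - L * d n\<bar> * t ^ n"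
        using t by (simp add: abs_mult)
      also have "\<dots> \<le> ((if n < N then \<bar>hyp_coeff a b c n - L * d n\<bar> else 0) + e / 2 * d n) * t ^ n"
        using t by (intro mult_right_mono est) auto
      also have "\<dots> \<le> (if n < N then \<bar>hyp_coeff a b c n - L * d n\<bar> else 0) + e / 2 * (d n * t ^ n)"
        using t by (auto simp: distrib_right mult.assoc intro!: mult_left_le power_le_one)
      finally show ?thesis .
    qed
    have "\<bar>hyp a b c t - L * (1 - t) powr (- \<mu>)\<bar> \<le> C + e / 2 * (1 - t) powr (- \<mu>)"
      using norm_suminf_le[of "\<lambda>n. (hyp_coeff a b c n - L * d n) * t ^ n", OF _ sums_summable[OF s4]] le
        sums_unique[OF s3] sums_unique[OF s4] by simp
    then have "(1 - t) powr \<mu> * \<bar>hyp a b c t - L * (1 - t) powr (- \<mu>)\<bar> \<le> (1 - t) powr \<mu> * (C + e / 2 * (1 - t) powr (- \<mu>))"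
      by (rule mult_left_mono) simp
    moreover have "(1 - t) powr \<mu> * (1 - t) powr (- \<mu>) = 1"
      using t by (simp add: powr_minus)
    ultimately have "(1 - t) powr \<mu> * \<bar>hyp a b c t - L * (1 - t) powr (- \<mu>)\<bar> \<le> (1 - t) powr \<mu> * C + e / 2"
      by (simp add: algebra_simps)
    moreover have "(1 - t) powr \<mu> * C < e / 2" using elim by (auto simp: dist_real_def)
    moreover have "(1 - t) powr \<mu> * \<bar>hyp a b c t - L * (1 - t) powr (- \<mu>)\<bar> = \<bar>(1 - t) powr \<mu> * hyp a b c t - L\<bar>"
    proof -
      have "(1 - t) powr \<mu> * \<bar>hyp a b c t - L * (1 - t) powr (- \<mu>)\<bar>
          = \<bar>(1 - t) powr \<mu> * (hyp a b c t - L * (1 - t) powr (- \<mu>))\<bar>"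
        by (simp add: abs_mult)
      also have "(1 - t) powr \<mu> * (hyp a b c t - L * (1 - t) powr (- \<mu>)) = (1 - t) powr \<mu> * hyp a b c t - L"
        using \<open>(1 - t) powr \<mu> * (1 - t) powr (- \<mu>) = 1\<close> by (simp add: algebra_simps)
      finally show ?thesis .
    qed
    ultimately show ?case by (simp add: dist_real_def L_def)
  qed
qed

section \<open>The angular inequality\<close>

lemma pos_not_nonpos_Int: "0 < x \<Longrightarrow> x \<notin> \<int>\<^sub>\<le>\<^sub>0" for x :: real
  by (auto simp: nonpos_Ints_def)

lemma nn_integral_Icc_eq_integral:
  fixes f :: "real \<Rightarrow> real"
  assumes "continuous_on {a..b} f" "\<And>x. x \<in> {a..b} \<Longrightarrow> 0 \<le> f x"
  shows "(\<integral>\<^sup>+x. indicator {a..b} x * ennreal (f x) \<partial>lborel) = ennreal (integral {a..b} f)"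
proof -
  have "(f has_integral integral {a..b} f) {a..b}"
    by (rule integrable_integral) (rule integrable_continuous_real[OF assms(1)])
  then have "(\<integral>\<^sup>+x. ennreal (indicator {a..b} x * f x) \<partial>lborel) = ennreal (integral {a..b} f)"
    using assms(2) by (rule nn_integral_has_integral_lebesgue[rotated])
  moreover have "ennreal (indicator {a..b} x * f x) = indicator {a..b} x * ennreal (f x)" for x
    by (auto simp: indicator_def)
  ultimately show ?thesis by simp
qed

lemma nn_integral_ge_FTC_Icc:
  fixes Q :: "real \<Rightarrow> real"
  assumes "a \<le> b"
    and "\<And>x. a \<le> x \<Longrightarrow> x \<le> b \<Longrightarrow> (Q has_real_derivative D x) (at x)"
    and "\<And>x. a \<le> x \<Longrightarrow> x \<le> b \<Longrightarrow> D x \<le> E x" "\<And>x. a \<le> x \<Longrightarrow> x \<le> b \<Longrightarrow> 0 \<le> E x"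
    and "continuous_on {a..b} E"
  shows "ennreal (Q b - Q a) \<le> (\<integral>\<^sup>+x. indicator {a..b} x * ennreal (E x) \<partial>lborel)"
proof -
  have "(D has_integral (Q b - Q a)) {a..b}"
  proof (rule fundamental_theorem_of_calculus[OF assms(1)])
    fix x assume "x \<in> {a..b}"
    then have "(Q has_real_derivative D x) (at x within {a..b})"
      using assms(2)[of x] by (auto intro: has_field_derivative_at_within)
    then show "(Q has_vector_derivative D x) (at x within {a..b})"
      by (simp only: has_real_derivative_iff_has_vector_derivative)
  qed
  moreover have "(E has_integral integral {a..b} E) {a..b}"
    by (rule integrable_integral) (rule integrable_continuous_real[OF assms(5)])
  ultimately have "Q b - Q a \<le> integral {a..b} E"
    by (rule has_integral_le) (use assms(3) in auto)
  then show ?thesis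
    using assms(4,5) by (subst nn_integral_Icc_eq_integral) (auto intro: ennreal_leI)
qed

lemma nn_integral_ge_FTC_Ioi:
  fixes Q :: "real \<Rightarrow> real"
  assumes Q: "\<And>x. 0 < x \<Longrightarrow> (Q has_real_derivative D x) (at x)"
    and D: "\<And>x. 0 < x \<Longrightarrow> D x \<le> E x" and E: "\<And>x. 0 < x \<Longrightarrow> 0 \<le> E x"
    and cont: "continuous_on {0<..} E"
    and q0: "(Q \<longlongrightarrow> q0) (at_right 0)" and q1: "(Q \<longlongrightarrow> q1) at_top"
  shows "ennreal (q1 - q0) \<le> (\<integral>\<^sup>+x. indicator {0<..} x * ennreal (E x) \<partial>lborel)"
proof (rule tendsto_upperbound)
  have "filterlim (\<lambda>j. inverse (real (Suc j))) (at_right 0) sequentially"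
    using LIMSEQ_inverse_real_of_nat
    by (auto simp: filterlim_at intro!: always_eventually)
  moreover have "filterlim (\<lambda>j. real (Suc j)) at_top sequentially"
    using filterlim_compose[OF filterlim_real_sequentially filterlim_Suc] by simp
  ultimately show "(\<lambda>j. ennreal (Q (real (Suc j)) - Q (inverse (real (Suc j))))) \<longlonglongrightarrow> ennreal (q1 - q0)"
    by (intro tendsto_ennrealI tendsto_diff) (auto intro: filterlim_compose[OF q1] filterlim_compose[OF q0])
  show "\<forall>\<^sub>F j in sequentially. ennreal (Q (real (Suc j)) - Q (inverse (real (Suc j))))
      \<le> (\<integral>\<^sup>+x. indicator {0<..} x * ennreal (E x) \<partial>lborel)"
  proof (rule always_eventually, rule allI)
    fix j
    let ?a = "inverse (real (Suc j))" and ?b = "real (Suc j)"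
    have a: "0 < ?a" by simp
    have "?a \<le> 1" "1 \<le> ?b" by (simp_all add: inverse_le_1_iff)
    then have "?a \<le> ?b" by linarith
    have pos: "0 < x" if "?a \<le> x" for x using a that by linarith
    have "ennreal (Q ?b - Q ?a) \<le> (\<integral>\<^sup>+x. indicator {?a..?b} x * ennreal (E x) \<partial>lborel)"
    proof (rule nn_integral_ge_FTC_Icc[where D = D])
      show "continuous_on {?a..?b} E"
        by (rule continuous_on_subset[OF cont]) (use pos in auto)
    qed (use \<open>?a \<le> ?b\<close> pos Q D E in blast)+
    also have "\<dots> \<le> (\<integral>\<^sup>+x. indicator {0<..} x * ennreal (E x) \<partial>lborel)"
      by (intro nn_integral_mono mult_right_mono) (use pos in \<open>auto simp: indicator_def simp del: of_nat_Suc\<close>)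
    finally show "ennreal (Q ?b - Q ?a) \<le> (\<integral>\<^sup>+x. indicator {0<..} x * ennreal (E x) \<partial>lborel)" .
  qed
qed simp

lemma nn_integral_FTC_Ioi:
  fixes Q :: "real \<Rightarrow> real"
  assumes Q: "\<And>x. 0 < x \<Longrightarrow> (Q has_real_derivative E x) (at x)"
    and E: "\<And>x. 0 < x \<Longrightarrow> 0 \<le> E x"
    and cont: "continuous_on {0<..} E"
    and q0: "(Q \<longlongrightarrow> q0) (at_right 0)" and q1: "(Q \<longlongrightarrow> q1) at_top"
  shows "(\<integral>\<^sup>+x. indicator {0<..} x * ennreal (E x) \<partial>lborel) = ennreal (q1 - q0)"
proof -
  have ei: "einterval (ereal 0) \<infinity> = {0::real<..}"
    by (auto simp: einterval_def)
  have isC: "isCont E x" if "0 < x" for x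
    using cont that by (simp add: continuous_on_eq_continuous_at)
  have "set_integrable lborel (einterval (ereal 0) \<infinity>) E" "(LBINT x=ereal 0..\<infinity>. E x) = q1 - q0"
    using Q E isC q0 q1
    by (intro interval_integral_FTC_nonneg[where F = Q]; simp add: ereal_tendsto_simps)+
  then have i: "set_integrable lborel {0<..} E" and eq: "(LINT x:{0<..}|lborel. E x) = q1 - q0"
    unfolding ei by (simp_all add: interval_lebesgue_integral_def ei zero_ereal_def)
  have "(\<integral>\<^sup>+x. indicator {0<..} x * ennreal (E x) \<partial>lborel) = (\<integral>\<^sup>+x. ennreal (indicator {0<..} x *\<^sub>R E x) \<partial>lborel)"
    by (intro nn_integral_cong) (auto simp: indicator_def)
  also have "\<dots> = ennreal (q1 - q0)"
    using i eq E unfolding set_integrable_def set_lebesgue_integral_def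
    by (subst nn_integral_eq_integral) (auto simp: indicator_def)
  finally show ?thesis .
qed

text \<open>
  In the slope variable \<open>w\<close> the derivative along the arcs enters the energy with the weight
  \<open>angular_weight\<close>, the function itself the Hardy terms with the weight \<open>angular_mass\<close>. The Euler-Lagrange
  equation of the resulting one-dimensional problem is hypergeometric in
  \<open>t = H\<^sub>0\<^sup>2 / \<Phi>\<^sub>0\<^sup>2 = 1 / (1 + w\<^sup>2)\<close>, with \<open>c = n / 2\<close> and with parameters \<open>A, B\<close> such that \<open>A + B = \<sigma>\<close> and
  \<open>4 A B = \<sigma>\<^sup>2 - (\<alpha> + b - 2)\<^sup>2 / 4\<close>; \<open>t = 1\<close> is the base of the half-space and \<open>t = 0\<close> the axis \<open>x = 0\<close>.
\<close>

locale hardy_parameters =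
  fixes n \<alpha> b :: real
  assumes n: "1 \<le> n" and \<alpha>: "-1 < \<alpha>" "\<alpha> < 1" and b: "2 - \<alpha> \<le> b" "b < n + 1"
begin

definition A where "A = (n + 2 * \<alpha> + b - 3) / 4"
definition B where "B = (n + 1 - b) / 4"
definition \<sigma> where "\<sigma> = (n + \<alpha> - 1) / 2"

lemma parameters_pos: "0 < A" "0 < B" "0 < n / 2" "0 < \<sigma>" "A + B < n / 2"
proof -
  show "0 < A" "0 < B" "0 < n / 2" "0 < \<sigma>"
    using n \<alpha> b by (simp_all add: A_def B_def \<sigma>_def)
  show "A + B < n / 2"
    unfolding A_def B_def add_divide_distrib diff_divide_distrib using \<alpha> by linarith
qed

lemma four_AB: "4 * (A * B) = \<sigma>\<^sup>2 - (\<alpha> + b - 2)\<^sup>2 / 4"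
  by (simp add: A_def B_def \<sigma>_def power2_eq_square field_simps)

definition profile where "profile = hyp A B (n / 2)"
definition profile1 where
  "profile1 t = A * B / (n / 2) * hyp (A + 1) (B + 1) (n / 2 + 1) t"
definition profile2 where
  "profile2 t = A * B / (n / 2) * ((A + 1) * (B + 1) / (n / 2 + 1) * hyp (A + 2) (B + 2) (n / 2 + 2) t)"

lemma profile_deriv:
  assumes "\<bar>t\<bar> < 1"
  shows "(profile has_real_derivative profile1 t) (at t)"
    and "(profile1 has_real_derivative profile2 t) (at t)"
proof -
  show "(profile has_real_derivative profile1 t) (at t)"
    unfolding profile_def profile1_def using parameters_pos assms by (intro hyp_deriv) auto
  have "(hyp (A + 1) (B + 1) (n / 2 + 1) has_real_derivative
      (A + 1) * (B + 1) / (n / 2 + 1) * hyp (A + 1 + 1) (B + 1 + 1) (n / 2 + 1 + 1) t) (at t)"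
    using parameters_pos assms by (intro hyp_deriv) auto
  then show "(profile1 has_real_derivative profile2 t) (at t)"
    unfolding profile1_def[abs_def] profile2_def by (intro DERIV_cmult) (simp add: add.assoc)
qed

lemma profile_ode:
  assumes "0 < t" "t < 1"
  shows "t * (1 - t) * profile2 t + (n / 2 - (A + B + 1) * t) * profile1 t = A * B * profile t"
  unfolding profile_def profile1_def profile2_def using parameters_pos assms by (intro hyp_ode) auto

lemma profile_ge_1: "0 \<le> t \<Longrightarrow> t < 1 \<Longrightarrow> 1 \<le> profile t"
  unfolding profile_def using parameters_pos by (intro hyp_ge_1) auto

lemma profile_continuous: "continuous_on {0..1} profile"
  unfolding profile_def using parameters_pos by (intro hyp_continuous_at_1) auto

text \<open>
  The constant of the trace term is the ratio of the flux of the ground state through the base to its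
  value there: Gauss's theorem gives the value, the blow-up of the derivative gives the flux. The
  functional equation of \<open>\<Gamma>\<close> turns the ratio into the quotient of Gamma functions in \<open>K\<close>.
\<close>

lemma profile_flux_ratio:
  obtains \<Lambda> where
    "((\<lambda>t. (1 - t) powr ((1 + \<alpha>) / 2) * profile1 t) \<longlongrightarrow> \<Lambda>) (at_left 1)"
    "2 * \<Lambda> = K n \<alpha> b * profile 1" "0 < profile 1" "0 < K n \<alpha> b"
proof
  note pos = parameters_pos
  let ?c = "n / 2" and ?\<mu> = "(1 + \<alpha>) / 2" and ?\<kappa> = "(1 - \<alpha>) / 2"
  define \<Lambda> where "\<Lambda> = Gamma ?c * Gamma ?\<mu> / (Gamma A * Gamma B)"
  have eq: "?c - A - B = ?\<kappa>" "?c - A = (n - 2 * \<alpha> - b + 3) / 4" "?c - B = (n + b - 1) / 4"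
    by (simp_all add: A_def B_def field_simps)
  have G: "Gamma ?c > 0" "Gamma ?\<mu> > 0" "Gamma A > 0" "Gamma B > 0" "Gamma ?\<kappa> > 0"
    "Gamma (?c - A) > 0" "Gamma (?c - B) > 0" "Gamma ((3 - \<alpha>) / 2) > 0"
    using pos \<alpha> by (auto intro!: Gamma_real_pos)
  have "((\<lambda>t. A * B / ?c * ((1 - t) powr ?\<mu> * hyp (A + 1) (B + 1) (?c + 1) t)) \<longlongrightarrow>
      A * B / ?c * (Gamma (?c + 1) * Gamma ?\<mu> / (Gamma (A + 1) * Gamma (B + 1)))) (at_left 1)"
  proof (intro tendsto_intros hyp_blowup)
    show "A + 1 + (B + 1) = ?c + 1 + ?\<mu>" by (simp add: A_def B_def field_simps)
  qed (use pos \<alpha> in auto)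
  moreover have "A * B / ?c * (Gamma (?c + 1) * Gamma ?\<mu> / (Gamma (A + 1) * Gamma (B + 1))) = \<Lambda>"
  proof -
    have g: "Gamma (?c + 1) = ?c * Gamma ?c" "Gamma (A + 1) = A * Gamma A" "Gamma (B + 1) = B * Gamma B"
      by (rule Gamma_plus1[OF pos_not_nonpos_Int], rule pos)+
    show ?thesis unfolding g \<Lambda>_def using pos G n by (simp add: field_simps)
  qed
  ultimately show "((\<lambda>t. (1 - t) powr ?\<mu> * profile1 t) \<longlongrightarrow> \<Lambda>) (at_left 1)"
    by (simp add: profile1_def mult_ac)
  have "profile 1 = Gamma ?c * Gamma (?c - A - B) / (Gamma (?c - A) * Gamma (?c - B))"
    using sums_unique[OF hyp_Gauss[of A B ?c]] pos by (simp add: profile_def hyp_def)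
  then have p1: "profile 1 = Gamma ?c * Gamma ?\<kappa> / (Gamma (?c - A) * Gamma (?c - B))"
    by (simp add: eq(1))
  then show "0 < profile 1" using G by simp
  have g3: "Gamma ((3 - \<alpha>) / 2) = ?\<kappa> * Gamma ?\<kappa>"
  proof -
    have "Gamma (?\<kappa> + 1) = ?\<kappa> * Gamma ?\<kappa>"
      using \<alpha> by (intro Gamma_plus1 pos_not_nonpos_Int) simp
    moreover have "(3 - \<alpha>) / 2 = ?\<kappa> + 1" by (simp add: field_simps)
    ultimately show ?thesis by metis
  qed
  have K: "K n \<alpha> b = (1 - \<alpha>) * (Gamma (?c - A) * Gamma (?c - B) * Gamma ?\<mu>) /
      (?\<kappa> * Gamma ?\<kappa> * Gamma B * Gamma A)"
    unfolding eq(2,3) g3[symmetric] unfolding A_def B_def K_def by (simp add: add.commute)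
  show "2 * \<Lambda> = K n \<alpha> b * profile 1"
  proof -
    have "2 * (gc * gm / (ga * gb)) = (1 - \<alpha>) * (x * y * gm) / (k * gk * gb * ga) * (gc * gk / (x * y))"
      if "0 < gk" "0 < x" "0 < y" "k = (1 - \<alpha>) / 2" "0 < ga" "0 < gb" for gc gm ga gb x y k gk :: real
      unfolding that(4) using that(1-3) that(5,6) \<alpha> by (simp add: field_simps)
    then show ?thesis unfolding K p1 \<Lambda>_def using G by blast
  qed
  show "0 < K n \<alpha> b"
    unfolding K using G \<alpha> by (intro divide_pos_pos mult_pos_pos) auto
qed

lemma profile_1_pos: "0 < profile 1" and K_pos: "0 < K n \<alpha> b"
  by (rule profile_flux_ratio; assumption)+

definition angular_weight where
  "angular_weight w = w powr \<alpha> * (1 + w\<^sup>2) powr ((3 - n - \<alpha>) / 2)"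
definition angular_mass where
  "angular_mass w = w powr \<alpha> * (1 + w\<^sup>2) powr (- (n + 1 + \<alpha>) / 2)"
text \<open>
  The positive solution that is regular at the pole; \<open>flux\<close> is the quantity whose derivative the
  equation prescribes.
\<close>

definition ground where "ground w = profile (1 / (1 + w\<^sup>2))"
definition ground' where "ground' w = profile1 (1 / (1 + w\<^sup>2)) * (- 2 * w / (1 + w\<^sup>2)\<^sup>2)"
definition flux where "flux w = angular_weight w * ground' w"

lemma slope_bounds:
  fixes w :: real
  assumes "0 < w"
  shows "0 < 1 / (1 + w\<^sup>2)" "1 / (1 + w\<^sup>2) < 1" "1 - 1 / (1 + w\<^sup>2) = w\<^sup>2 / (1 + w\<^sup>2)"
  using assms one_plus_sq_pos[of w] by (auto simp: field_simps)

lemma slope_deriv: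
  "((\<lambda>w. 1 / (1 + w\<^sup>2)) has_real_derivative (- 2 * w / (1 + w\<^sup>2)\<^sup>2)) (at w)" for w :: real
  using one_plus_sq_pos[of w]
  by (auto intro!: derivative_eq_intros simp: field_simps power2_eq_square)

lemma ground_deriv:
  assumes "0 < w"
  shows "(ground has_real_derivative ground' w) (at w)"
  unfolding ground_def[abs_def] ground'_def
  using slope_bounds[OF assms] by (intro DERIV_chain2[OF profile_deriv(1) slope_deriv]) auto

lemma ground_pos: "0 < w \<Longrightarrow> 1 \<le> ground w"
  unfolding ground_def using slope_bounds[of w] by (intro profile_ge_1) auto

lemma flux_eq:
  assumes "0 < w"
  shows "flux w = - 2 * (w powr (\<alpha> + 1) * (1 + w\<^sup>2) powr (- (n + 1 + \<alpha>) / 2) * profile1 (1 / (1 + w\<^sup>2)))"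
proof -
  have "(1 + w\<^sup>2) powr ((3 - n - \<alpha>) / 2) = (1 + w\<^sup>2) powr (- (n + 1 + \<alpha>) / 2 + 2)"
    by (simp add: field_simps)
  also have "\<dots> = (1 + w\<^sup>2) powr (- (n + 1 + \<alpha>) / 2) * (1 + w\<^sup>2)\<^sup>2"
    using one_plus_sq_pos[of w] by (simp only: powr_add powr_numeral)
  finally have e: "(1 + w\<^sup>2) powr ((3 - n - \<alpha>) / 2) = (1 + w\<^sup>2) powr (- (n + 1 + \<alpha>) / 2) * (1 + w\<^sup>2)\<^sup>2" .
  have "w powr (\<alpha> + 1) = w powr \<alpha> * w" using assms by (simp add: powr_add)
  then show ?thesis
    unfolding flux_def angular_weight_def ground'_def e using one_plus_sq_pos(2)[of w]
    by (simp add: field_simps)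
qed

text \<open>
  The hypergeometric equation in divergence form.
\<close>

lemma flux_deriv:
  assumes w: "0 < w"
  shows "(flux has_real_derivative 4 * (A * B) * angular_mass w * ground w) (at w)"
proof -
  define \<beta> where "\<beta> = (n + 1 + \<alpha>) / 2"
  define u where "u = 1 + w\<^sup>2"
  define t where "t = 1 / u"
  have u: "u > 0" unfolding u_def by (rule one_plus_sq_pos)
  have t: "0 < t" "t < 1" "1 - t = w\<^sup>2 / u" unfolding t_def u_def using slope_bounds[OF w] by auto
  have d1: "((\<lambda>w. w powr (\<alpha> + 1)) has_real_derivative (\<alpha> + 1) * w powr \<alpha>) (at w)"
    using has_real_derivative_powr[of w "\<alpha> + 1"] w by simp
  have d2: "((\<lambda>w. (1 + w\<^sup>2) powr (- \<beta>)) has_real_derivative (- \<beta> * u powr (- \<beta> - 1)) * (2 * w)) (at w)"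
    unfolding u_def by (rule DERIV_chain2[where f = "\<lambda>x. x powr (- \<beta>)", OF has_real_derivative_powr])
      (auto intro!: derivative_eq_intros simp: one_plus_sq_pos)
  have d3: "((\<lambda>w. profile1 (1 / (1 + w\<^sup>2))) has_real_derivative profile2 t * (- 2 * w / u\<^sup>2)) (at w)"
    unfolding t_def u_def using slope_bounds[OF w] by (intro DERIV_chain2[OF profile_deriv(2) slope_deriv]) auto
  have "((\<lambda>w. - 2 * (w powr (\<alpha> + 1) * (1 + w\<^sup>2) powr (- \<beta>) * profile1 (1 / (1 + w\<^sup>2)))) has_real_derivative
     - 2 * (((\<alpha> + 1) * w powr \<alpha> * (1 + w\<^sup>2) powr (- \<beta>) + ((- \<beta> * u powr (- \<beta> - 1)) * (2 * w)) * w powr (\<alpha> + 1))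
        * profile1 (1 / (1 + w\<^sup>2)) + (profile2 t * (- 2 * w / u\<^sup>2)) * (w powr (\<alpha> + 1) * (1 + w\<^sup>2) powr (- \<beta>)))) (at w)"
    by (intro DERIV_cmult DERIV_mult d1 d2 d3)
  moreover have "- 2 * (((\<alpha> + 1) * w powr \<alpha> * (1 + w\<^sup>2) powr (- \<beta>) + ((- \<beta> * u powr (- \<beta> - 1)) * (2 * w)) * w powr (\<alpha> + 1))
        * profile1 (1 / (1 + w\<^sup>2)) + (profile2 t * (- 2 * w / u\<^sup>2)) * (w powr (\<alpha> + 1) * (1 + w\<^sup>2) powr (- \<beta>)))
      = 4 * (A * B) * angular_mass w * ground w"
  proof -
    define W where "W = w powr \<alpha> * u powr (- \<beta>)"
    have wp: "w powr (\<alpha> + 1) = w powr \<alpha> * w" using w by (simp add: powr_add)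
    have up: "u powr (- \<beta> - 1) = u powr (- \<beta>) / u" using u by (simp add: powr_diff)
    have "- 2 * (((\<alpha> + 1) * w powr \<alpha> * u powr (- \<beta>) + ((- \<beta> * u powr (- \<beta> - 1)) * (2 * w)) * w powr (\<alpha> + 1))
        * profile1 t + (profile2 t * (- 2 * w / u\<^sup>2)) * (w powr (\<alpha> + 1) * u powr (- \<beta>)))
      = W * (4 * (t * (w\<^sup>2 / u)) * profile2 t + (4 * \<beta> * (w\<^sup>2 / u) - 2 * (\<alpha> + 1)) * profile1 t)"
      unfolding wp up W_def t_def using u by (simp add: field_simps power2_eq_square)
    also have "\<dots> = W * (4 * (t * (1 - t) * profile2 t + (n / 2 - (A + B + 1) * t) * profile1 t))"
    proof -
      have e: "4 * \<beta> * (1 - t) - 2 * (\<alpha> + 1) = 4 * (n / 2 - (A + B + 1) * t)"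
        by (simp add: \<beta>_def A_def B_def field_simps)
      show ?thesis unfolding t(3)[symmetric] e by (simp add: algebra_simps)
    qed
    also have "\<dots> = W * (4 * (A * B * profile t))"
      by (simp only: profile_ode[OF t(1,2)])
    also have "\<dots> = 4 * (A * B) * angular_mass w * ground w"
      by (simp add: W_def angular_mass_def ground_def t_def u_def \<beta>_def mult_ac minus_divide_left)
    finally show ?thesis by (simp add: t_def u_def)
  qed
  ultimately have "((\<lambda>w. - 2 * (w powr (\<alpha> + 1) * (1 + w\<^sup>2) powr (- \<beta>) * profile1 (1 / (1 + w\<^sup>2))))
      has_real_derivative 4 * (A * B) * angular_mass w * ground w) (at w)" by simp
  then show ?thesis
  proof (rule has_field_derivative_transform_within_open[where S = "{0<..}"])
    show "- 2 * (x powr (\<alpha> + 1) * (1 + x\<^sup>2) powr (- \<beta>) * profile1 (1 / (1 + x\<^sup>2))) = flux x" if "x \<in> {0<..}" for x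
      using that flux_eq[of x] by (simp add: \<beta>_def minus_divide_left)
  qed (use w in auto)
qed

text \<open>
  The derivative of the profile blows up like \<open>(1 - t)\<close> to the power \<open>- (1 + \<alpha>) / 2\<close> at the base; here the
  product that has a limit is split off.
\<close>

lemma flux_eq_singular:
  assumes w: "0 < w"
  shows "flux w = - 2 * ((1 - 1 / (1 + w\<^sup>2)) powr ((1 + \<alpha>) / 2) * profile1 (1 / (1 + w\<^sup>2))) * (1 + w\<^sup>2) powr (- n / 2)"
proof -
  have u: "0 < 1 + w\<^sup>2" by (rule one_plus_sq_pos)
  have "w\<^sup>2 = w powr 2" using w by simp
  then have "(w\<^sup>2) powr ((1 + \<alpha>) / 2) = w powr (2 * ((1 + \<alpha>) / 2))" by (simp only: powr_powr)
  also have "2 * ((1 + \<alpha>) / 2) = \<alpha> + 1" by simp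
  finally have "(w\<^sup>2) powr ((1 + \<alpha>) / 2) = w powr (\<alpha> + 1)" .
  moreover have "(w\<^sup>2 / (1 + w\<^sup>2)) powr ((1 + \<alpha>) / 2) = (w\<^sup>2) powr ((1 + \<alpha>) / 2) / (1 + w\<^sup>2) powr ((1 + \<alpha>) / 2)"
    using u w by (simp add: powr_divide)
  moreover have "(1 + w\<^sup>2) powr (- n / 2) = (1 + w\<^sup>2) powr (- (n + 1 + \<alpha>) / 2) * (1 + w\<^sup>2) powr ((1 + \<alpha>) / 2)"
    using u by (simp add: field_simps flip: powr_add)
  moreover have "(1 + w\<^sup>2) powr ((1 + \<alpha>) / 2) \<noteq> 0" using u by simp
  ultimately show ?thesis
    unfolding flux_eq[OF w] slope_bounds(3)[OF w] by (simp add: field_simps)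
qed

lemma slope_to_base: "filterlim (\<lambda>w::real. 1 / (1 + w\<^sup>2)) (at_left 1) (at_right 0)"
proof -
  have "((\<lambda>w::real. 1 / (1 + w\<^sup>2)) \<longlongrightarrow> 1 / (1 + 0\<^sup>2)) (at_right 0)"
    by (intro tendsto_intros) simp
  then show ?thesis
    by (auto simp: filterlim_at eventually_at_filter slope_bounds intro!: always_eventually)
qed

lemma one_plus_sq_at_top: "filterlim (\<lambda>w::real. 1 + w\<^sup>2) at_top at_top"
  by (intro filterlim_tendsto_add_at_top[OF tendsto_const] filterlim_pow_at_top filterlim_ident) simp

lemma slope_to_pole: "((\<lambda>w::real. 1 / (1 + w\<^sup>2)) \<longlongrightarrow> 0) at_top"
  by (rule tendsto_divide_0[OF tendsto_const filterlim_at_top_imp_at_infinity[OF one_plus_sq_at_top]])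

lemma ground_tendsto_base: "(ground \<longlongrightarrow> profile 1) (at_right 0)"
proof -
  have "(profile \<longlongrightarrow> profile 1) (at_left 1)"
  proof -
    have "(profile \<longlongrightarrow> profile 1) (at 1 within {0..1})"
      using profile_continuous by (simp add: continuous_on_def)
    then show ?thesis by (simp add: at_within_Icc_at_left)
  qed
  then show ?thesis
    unfolding ground_def[abs_def] by (rule filterlim_compose) (rule slope_to_base)
qed

lemma flux_tendsto_base: "(flux \<longlongrightarrow> - (K n \<alpha> b * profile 1)) (at_right 0)"
proof -
  obtain \<Lambda> where \<Lambda>: "((\<lambda>t. (1 - t) powr ((1 + \<alpha>) / 2) * profile1 t) \<longlongrightarrow> \<Lambda>) (at_left 1)"
    "2 * \<Lambda> = K n \<alpha> b * profile 1" "0 < profile 1" "0 < K n \<alpha> b"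
    by (rule profile_flux_ratio)
  have "((\<lambda>w::real. (1 + w\<^sup>2) powr (- n / 2)) \<longlongrightarrow> (1 + 0\<^sup>2) powr (- n / 2)) (at_right 0)"
    by (intro tendsto_intros) auto
  then have lim: "((\<lambda>w. - 2 * ((1 - 1 / (1 + w\<^sup>2)) powr ((1 + \<alpha>) / 2) * profile1 (1 / (1 + w\<^sup>2))) * (1 + w\<^sup>2) powr (- n / 2))
      \<longlongrightarrow> - 2 * \<Lambda> * 1) (at_right 0)"
    by (intro tendsto_mult tendsto_const filterlim_compose[OF \<Lambda>(1) slope_to_base]) simp
  have ev: "\<forall>\<^sub>F w in at_right 0. flux w = - 2 * ((1 - 1 / (1 + w\<^sup>2)) powr ((1 + \<alpha>) / 2) * profile1 (1 / (1 + w\<^sup>2))) * (1 + w\<^sup>2) powr (- n / 2)"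
    by (rule eventually_at_rightI[of 0 1], rule flux_eq_singular) simp_all
  have "(flux \<longlongrightarrow> - 2 * \<Lambda> * 1) (at_right 0)"
    using lim unfolding tendsto_cong[OF ev] .
  then show ?thesis using \<Lambda>(2) by simp
qed

lemma ground_tendsto_pole: "(ground \<longlongrightarrow> profile 0) at_top"
  unfolding ground_def[abs_def]
  by (rule isCont_tendsto_compose[OF DERIV_isCont[OF profile_deriv(1)] slope_to_pole]) simp

lemma flux_tendsto_pole: "(flux \<longlongrightarrow> 0) at_top"
proof -
  have 1: "((\<lambda>w. profile1 (1 / (1 + w\<^sup>2))) \<longlongrightarrow> profile1 0) at_top"
    by (rule isCont_tendsto_compose[OF DERIV_isCont[OF profile_deriv(2)] slope_to_pole]) simp
  have 2: "((\<lambda>w. (1 - 1 / (1 + w\<^sup>2)) powr ((1 + \<alpha>) / 2)) \<longlongrightarrow> (1 - 0) powr ((1 + \<alpha>) / 2)) at_top"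
    by (intro tendsto_intros slope_to_pole) simp
  have 3: "((\<lambda>w::real. (1 + w\<^sup>2) powr (- n / 2)) \<longlongrightarrow> 0) at_top"
    using n by (intro tendsto_neg_powr one_plus_sq_at_top) auto
  have lim: "((\<lambda>w. - 2 * ((1 - 1 / (1 + w\<^sup>2)) powr ((1 + \<alpha>) / 2) * profile1 (1 / (1 + w\<^sup>2))) * (1 + w\<^sup>2) powr (- n / 2))
      \<longlongrightarrow> - 2 * ((1 - 0) powr ((1 + \<alpha>) / 2) * profile1 0) * 0) at_top"
    by (intro tendsto_mult tendsto_const 1 2 3)
  have ev: "\<forall>\<^sub>F w in at_top. flux w = - 2 * ((1 - 1 / (1 + w\<^sup>2)) powr ((1 + \<alpha>) / 2) * profile1 (1 / (1 + w\<^sup>2))) * (1 + w\<^sup>2) powr (- n / 2)"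
    using eventually_gt_at_top[of 0] by eventually_elim (rule flux_eq_singular)
  have "(flux \<longlongrightarrow> - 2 * ((1 - 0) powr ((1 + \<alpha>) / 2) * profile1 0) * 0) at_top"
    using lim unfolding tendsto_cong[OF ev] .
  then show ?thesis by simp
qed

lemma angular_weights_continuous:
  "continuous_on {0<..} angular_weight" "continuous_on {0<..} angular_mass"
  unfolding angular_weight_def[abs_def] angular_mass_def[abs_def]
  using one_plus_sq_pos by (auto intro!: continuous_intros simp: less_imp_neq[THEN not_sym])

lemma angular_weights_nonneg: "0 \<le> angular_weight w" "0 \<le> angular_mass w"
  by (auto simp: angular_weight_def angular_mass_def)

text \<open>
  The square of \<open>v' - v g' / g\<close>, with \<open>g\<close> the ground state, is the difference of the two sides up to
  the derivative of \<open>v\<^sup>2\<close> times \<open>flux / g\<close>; the boundary value of the latter at the base is the trace term.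
\<close>

theorem angular_inequality:
  assumes v: "\<And>w. 0 < w \<Longrightarrow> (v has_real_derivative v' w) (at w)"
    and v': "continuous_on {0<..} v'"
    and v0: "(v \<longlongrightarrow> v0) (at_right 0)" and bd: "\<And>w. 0 < w \<Longrightarrow> \<bar>v w\<bar> \<le> M"
  shows "ennreal (K n \<alpha> b * v0\<^sup>2) \<le>
    (\<integral>\<^sup>+w. indicator {0<..} w * ennreal (angular_weight w * (v' w)\<^sup>2 + 4 * (A * B) * angular_mass w * (v w)\<^sup>2) \<partial>lborel)"
proof -
  let ?Q = "\<lambda>w. flux w / ground w * (v w)\<^sup>2"
  let ?D = "\<lambda>w. (4 * (A * B) * angular_mass w * ground w * ground w - flux w * ground' w) / (ground w * ground w) * (v w)\<^sup>2
      + 2 * v w * v' w * (flux w / ground w)"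
  let ?E = "\<lambda>w. angular_weight w * (v' w)\<^sup>2 + 4 * (A * B) * angular_mass w * (v w)\<^sup>2"
  have "ennreal (0 - (- (K n \<alpha> b * profile 1) / profile 1 * v0\<^sup>2)) \<le> (\<integral>\<^sup>+w. indicator {0<..} w * ennreal (?E w) \<partial>lborel)"
  proof (rule nn_integral_ge_FTC_Ioi[where Q = ?Q and D = ?D])
    fix w :: real assume w: "0 < w"
    have g: "ground w \<noteq> 0" "ground w > 0" using ground_pos[OF w] by auto
    have dv: "((\<lambda>w. (v w)\<^sup>2) has_real_derivative 2 * v w * v' w) (at w)"
      using DERIV_power[OF v[OF w], of 2] by (simp add: mult_ac)
    show "(?Q has_real_derivative ?D w) (at w)"
      by (intro DERIV_mult DERIV_divide flux_deriv ground_deriv w g dv)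
    define r where "r = ground' w / ground w"
    have "(4 * (A * B) * angular_mass w * ground w * ground w - flux w * ground' w) / (ground w * ground w)
        = 4 * (A * B) * angular_mass w - angular_weight w * r\<^sup>2"
      using g(1) by (simp add: flux_def r_def diff_divide_distrib power2_eq_square)
    moreover have "flux w / ground w = angular_weight w * r" by (simp add: flux_def r_def)
    ultimately have "?E w - ?D w = angular_weight w * (v' w - v w * r)\<^sup>2"
      by (simp only:) (simp add: power2_eq_square algebra_simps)
    then have "0 \<le> ?E w - ?D w"
      by (simp only: mult_nonneg_nonneg[OF angular_weights_nonneg(1) zero_le_power2])
    then show "?D w \<le> ?E w" by (simp only: diff_ge_0_iff_ge)
    show "0 \<le> ?E w"
      using parameters_pos by (simp add: angular_weights_nonneg)
  next
    have "continuous_on {0<..} v"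
      using v by (auto intro!: continuous_at_imp_continuous_on DERIV_isCont)
    then show "continuous_on {0<..} ?E"
      by (intro continuous_intros angular_weights_continuous v')
    show "(?Q \<longlongrightarrow> - (K n \<alpha> b * profile 1) / profile 1 * v0\<^sup>2) (at_right 0)"
      using profile_1_pos by (intro tendsto_intros flux_tendsto_base ground_tendsto_base v0) auto
    have "(flux \<longlongrightarrow> 0) at_top" by (rule flux_tendsto_pole)
    moreover have "\<forall>\<^sub>F w in at_top. norm (?Q w) \<le> norm (flux w) * M\<^sup>2"
      using eventually_gt_at_top[of 0]
    proof eventually_elim
      case (elim w)
      have "(v w)\<^sup>2 \<le> M\<^sup>2" using bd[OF elim] power_mono[of "\<bar>v w\<bar>" M 2] by simp
      moreover have "\<bar>flux w\<bar> / ground w \<le> \<bar>flux w\<bar>"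
        using ground_pos[OF elim] mult_left_mono[of 1 "ground w" "\<bar>flux w\<bar>"] by (simp add: divide_le_eq)
      ultimately have "\<bar>flux w\<bar> / ground w * (v w)\<^sup>2 \<le> \<bar>flux w\<bar> * M\<^sup>2"
        by (intro mult_mono) auto
      then show ?case
        using ground_pos[OF elim] by (simp add: abs_mult)
    qed
    ultimately show "(?Q \<longlongrightarrow> 0) at_top"
      by (rule tendsto_0_le[where f = flux and K = "M\<^sup>2"])
  qed
  then show ?thesis using profile_1_pos by simp
qed

text \<open>For the ground state itself the square vanishes.\<close>

lemma angular_equality_ground:
  "(\<integral>\<^sup>+w. indicator {0<..} w * ennreal (angular_weight w * (ground' w)\<^sup>2 + 4 * (A * B) * angular_mass w * (ground w)\<^sup>2) \<partial>lborel)
    = ennreal (K n \<alpha> b * (profile 1)\<^sup>2)"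
proof -
  let ?E = "\<lambda>w. angular_weight w * (ground' w)\<^sup>2 + 4 * (A * B) * angular_mass w * (ground w)\<^sup>2"
  have "(\<integral>\<^sup>+w. indicator {0<..} w * ennreal (?E w) \<partial>lborel) = ennreal (0 * profile 0 - (- (K n \<alpha> b * profile 1)) * profile 1)"
  proof (rule nn_integral_FTC_Ioi[where Q = "\<lambda>w. flux w * ground w"])
    fix w :: real assume w: "0 < w"
    have "((\<lambda>w. flux w * ground w) has_real_derivative
        4 * (A * B) * angular_mass w * ground w * ground w + ground' w * flux w) (at w)"
      by (intro DERIV_mult flux_deriv ground_deriv w)
    then show "((\<lambda>w. flux w * ground w) has_real_derivative ?E w) (at w)"
      by (simp only: flux_def power2_eq_square mult_ac add.commute)
    show "0 \<le> ?E w"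
      using parameters_pos by (simp add: angular_weights_nonneg)
  next
    have g: "continuous_on {0<..} ground"
      using ground_deriv by (auto intro!: continuous_at_imp_continuous_on DERIV_isCont)
    have p: "continuous_on {0<..<1} profile1"
      by (auto intro!: continuous_at_imp_continuous_on DERIV_isCont[OF profile_deriv(2)])
    have "continuous_on {0<..} (\<lambda>w. profile1 (1 / (1 + w\<^sup>2)))"
      by (rule continuous_on_compose2[OF p])
        (use one_plus_sq_pos slope_bounds in \<open>auto intro!: continuous_intros\<close>)
    then have "continuous_on {0<..} ground'"
      unfolding ground'_def[abs_def] using one_plus_sq_pos by (intro continuous_intros) auto
    then show "continuous_on {0<..} ?E"
      by (intro continuous_intros angular_weights_continuous g)
    show "((\<lambda>w. flux w * ground w) \<longlongrightarrow> - (K n \<alpha> b * profile 1) * profile 1) (at_right 0)"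
      by (intro tendsto_mult flux_tendsto_base ground_tendsto_base)
    show "((\<lambda>w. flux w * ground w) \<longlongrightarrow> 0 * profile 0) at_top"
      by (intro tendsto_mult flux_tendsto_pole ground_tendsto_pole)
  qed
  then show ?thesis by (simp add: power2_eq_square mult_ac)
qed

text \<open>
  The ground state is not smooth at the base. Its Taylor polynomials at the pole are polynomials in
  \<open>H\<^sub>0\<^sup>2 / \<Phi>\<^sub>0\<^sup>2\<close>, hence smooth away from the origin as soon as \<open>H\<^sub>0\<close> is replaced by a smooth function.
\<close>

definition taylor where "taylor m t = (\<Sum>i\<le>m. hyp_coeff A B (n / 2) i * t ^ i)"
definition taylor1 where "taylor1 m t = (\<Sum>i<m. diffs (hyp_coeff A B (n / 2)) i * t ^ i)"

lemma taylor_deriv: "(taylor m has_real_derivative taylor1 m t) (at t)"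
proof -
  have "taylor m = (\<lambda>t. hyp_coeff A B (n / 2) 0 + (\<Sum>i<m. hyp_coeff A B (n / 2) (Suc i) * t ^ Suc i))"
    unfolding taylor_def[abs_def] by (rule ext, subst sum.atMost_shift) simp
  moreover have "((\<lambda>t. hyp_coeff A B (n / 2) 0 + (\<Sum>i<m. hyp_coeff A B (n / 2) (Suc i) * t ^ Suc i))
      has_real_derivative 0 + (\<Sum>i<m. hyp_coeff A B (n / 2) (Suc i) * (real (Suc i) * t ^ i))) (at t)"
    by (intro DERIV_add DERIV_const DERIV_sum DERIV_cmult) (rule DERIV_cong[OF DERIV_pow], simp)
  ultimately show ?thesis by (simp add: taylor1_def diffs_def mult_ac)
qed

lemma taylor_ge_1: "0 \<le> t \<Longrightarrow> 1 \<le> taylor m t"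
proof -
  assume t: "0 \<le> t"
  have "(\<Sum>i\<in>{0}. hyp_coeff A B (n / 2) i * t ^ i) \<le> taylor m t"
    unfolding taylor_def using t parameters_pos hyp_coeff_pos[of A B "n / 2"]
    by (intro sum_mono2) (auto simp: less_imp_le)
  then show ?thesis by (simp add: hyp_coeff_0)
qed

lemma taylor_bounds:
  assumes t: "0 \<le> t" "t < 1"
  shows "taylor m t \<le> profile t" "0 \<le> taylor1 m t" "taylor1 m t \<le> profile1 t"
proof -
  note pos = parameters_pos
  show "taylor m t \<le> profile t"
    using partial_sum_le_hyp[of A B "n / 2" t "Suc m"] pos t
    by (simp add: taylor_def profile_def lessThan_Suc_atMost)
  have d: "0 \<le> diffs (hyp_coeff A B (n / 2)) i" for i
    using hyp_coeff_pos[of A B "n / 2" "Suc i"] pos by (simp add: diffs_def)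
  then show "0 \<le> taylor1 m t"
    unfolding taylor1_def using t by (intro sum_nonneg) auto
  have "taylor1 m t = A * B / (n / 2) * (\<Sum>i<m. hyp_coeff (A + 1) (B + 1) (n / 2 + 1) i * t ^ i)"
    unfolding taylor1_def diffs_hyp_coeff by (simp add: sum_distrib_left mult.assoc)
  also have "\<dots> \<le> profile1 t"
    unfolding profile1_def using pos t by (intro mult_left_mono partial_sum_le_hyp) auto
  finally show "taylor1 m t \<le> profile1 t" .
qed

text \<open>
  All coefficients are positive, so that the polynomials and their derivatives increase to the ground
  state: the integral is at most that of the ground state, and the value at the base is nearly attained.
\<close>

lemma angular_equality_taylor:
  assumes e: "0 < e"
  shows "\<exists>m. (\<integral>\<^sup>+w. indicator {0<..} w * ennreal (angular_weight w *
        (taylor1 m (1 / (1 + w\<^sup>2)) * (- 2 * w / (1 + w\<^sup>2)\<^sup>2))\<^sup>2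
        + 4 * (A * B) * angular_mass w * (taylor m (1 / (1 + w\<^sup>2)))\<^sup>2) \<partial>lborel)
      \<le> ennreal (K n \<alpha> b * (taylor m 1)\<^sup>2 + e)"
proof -
  note pos = parameters_pos
  have "hyp_coeff A B (n / 2) sums profile 1"
    using summable_sums[OF sums_summable[OF hyp_Gauss[of A B "n / 2"]]] pos
    by (simp add: profile_def hyp_def)
  then have "(\<lambda>m. taylor m 1) \<longlonglongrightarrow> profile 1"
    by (simp add: sums_def_le taylor_def)
  then have "(\<lambda>m. K n \<alpha> b * (taylor m 1)\<^sup>2 + e) \<longlonglongrightarrow> K n \<alpha> b * (profile 1)\<^sup>2 + e"
    by (intro tendsto_intros)
  then have "\<forall>\<^sub>F m in sequentially. K n \<alpha> b * (profile 1)\<^sup>2 < K n \<alpha> b * (taylor m 1)\<^sup>2 + e"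
    using e by (intro order_tendstoD) auto
  then obtain m where m: "K n \<alpha> b * (profile 1)\<^sup>2 < K n \<alpha> b * (taylor m 1)\<^sup>2 + e"
    by (auto simp: eventually_sequentially)
  have "(\<integral>\<^sup>+w. indicator {0<..} w * ennreal (angular_weight w *
        (taylor1 m (1 / (1 + w\<^sup>2)) * (- 2 * w / (1 + w\<^sup>2)\<^sup>2))\<^sup>2
        + 4 * (A * B) * angular_mass w * (taylor m (1 / (1 + w\<^sup>2)))\<^sup>2) \<partial>lborel)
      \<le> (\<integral>\<^sup>+w. indicator {0<..} w * ennreal (angular_weight w * (ground' w)\<^sup>2 + 4 * (A * B) * angular_mass w * (ground w)\<^sup>2) \<partial>lborel)"
  proof (rule nn_integral_mono)
    fix w :: real
    show "indicator {0<..} w * ennreal (angular_weight w *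
        (taylor1 m (1 / (1 + w\<^sup>2)) * (- 2 * w / (1 + w\<^sup>2)\<^sup>2))\<^sup>2
        + 4 * (A * B) * angular_mass w * (taylor m (1 / (1 + w\<^sup>2)))\<^sup>2)
      \<le> indicator {0<..} w * ennreal (angular_weight w * (ground' w)\<^sup>2 + 4 * (A * B) * angular_mass w * (ground w)\<^sup>2)"
    proof (cases "0 < w")
      case True
      define t where "t = 1 / (1 + w\<^sup>2)"
      have t: "0 \<le> t" "t < 1" using slope_bounds[OF True] by (auto simp: t_def)
      have "(taylor1 m t)\<^sup>2 \<le> (profile1 t)\<^sup>2" "(taylor m t)\<^sup>2 \<le> (profile t)\<^sup>2"
        using taylor_bounds[OF t, of m] taylor_ge_1[OF t(1), of m] by (auto intro!: power_mono)
      then have "(taylor1 m t * (- 2 * w / (1 + w\<^sup>2)\<^sup>2))\<^sup>2 \<le> (ground' w)\<^sup>2" "(taylor m t)\<^sup>2 \<le> (ground w)\<^sup>2"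
        unfolding ground'_def ground_def power_mult_distrib t_def[symmetric] by (auto intro!: mult_right_mono)
      then have "angular_weight w * (taylor1 m t * (- 2 * w / (1 + w\<^sup>2)\<^sup>2))\<^sup>2
            + 4 * (A * B) * angular_mass w * (taylor m t)\<^sup>2
          \<le> angular_weight w * (ground' w)\<^sup>2 + 4 * (A * B) * angular_mass w * (ground w)\<^sup>2"
        using pos by (intro add_mono mult_left_mono) (simp_all add: angular_weights_nonneg)
      then show ?thesis unfolding t_def by (intro mult_left_mono ennreal_leI) simp_all
    qed simp
  qed
  also have "\<dots> \<le> ennreal (K n \<alpha> b * (taylor m 1)\<^sup>2 + e)"
    unfolding angular_equality_ground using m by (intro ennreal_leI) simp
  finally show ?thesis by blast
qed

end

section \<open>The radial inequality with logarithmic weights\<close>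

lemma X_bounds:
  assumes "0 < \<rho>" "\<rho> < 1"
  shows "0 < X k \<rho>" "X k \<rho> < 1"
proof (induction k)
  case (Suc k)
  case 1
  have "ln (X k \<rho>) < 0" using Suc by simp
  then show ?case by simp
next
  case (Suc k)
  case 2
  have "ln (X k \<rho>) < 0" using Suc by simp
  then show ?case by simp
qed (use assms in auto)

lemma P_0: "P 0 \<rho> = 1" and P_Suc: "P (Suc k) \<rho> = P k \<rho> * X (Suc k) \<rho>"
  by (simp_all add: P_def)

lemma P_bounds:
  assumes "0 < \<rho>" "\<rho> < 1"
  shows "0 < P k \<rho>" "P k \<rho> \<le> 1"
proof -
  show "0 < P k \<rho>" unfolding P_def using X_bounds[OF assms] by (intro prod_pos) auto
  have "0 \<le> X i \<rho> \<and> X i \<rho> \<le> 1" for i using X_bounds[OF assms, of i] by linarith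
  then show "P k \<rho> \<le> 1" unfolding P_def by (intro prod_le_1) auto
qed

text \<open>
  The iteration is made for this: the derivative of \<open>ln X\<^sub>k\<close> with respect to \<open>ln \<rho>\<close> is \<open>P\<^sub>k\<close>.
\<close>

lemma X_deriv:
  assumes "0 < \<rho>" "\<rho> < 1"
  shows "(X k has_real_derivative P k \<rho> * X k \<rho> / \<rho>) (at \<rho>)"
proof (induction k)
  case 0
  have "X 0 = (\<lambda>\<rho>. \<rho>)" by (rule ext) simp
  then show ?case using assms by (simp add: P_0)
next
  case (Suc k)
  note b = X_bounds[OF assms, of k]
  have l: "1 - ln (X k \<rho>) > 0" using b by (smt (verit) ln_less_zero)
  have "((\<lambda>\<rho>. 1 / (1 - ln (X k \<rho>))) has_real_derivative
      (P k \<rho> * X k \<rho> / \<rho>) * (inverse (X k \<rho>)) * (1 / (1 - ln (X k \<rho>)))\<^sup>2) (at \<rho>)"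
    using b l by (auto intro!: derivative_eq_intros Suc simp: power2_eq_square field_simps)
  moreover have "X (Suc k) = (\<lambda>\<rho>. 1 / (1 - ln (X k \<rho>)))" by (rule ext) simp
  moreover have "(P k \<rho> * X k \<rho> / \<rho>) * (inverse (X k \<rho>)) * (1 / (1 - ln (X k \<rho>)))\<^sup>2 = P (Suc k) \<rho> * X (Suc k) \<rho> / \<rho>"
  proof -
    have "P k \<rho> * X k \<rho> / \<rho> * inverse (X k \<rho>) = P k \<rho> / \<rho>" using b by (simp del: X.simps)
    then show ?thesis by (simp only: P_Suc) (simp add: power2_eq_square)
  qed
  ultimately show ?case by simp
qed

definition log_sum where "log_sum k \<rho> = (\<Sum>i\<in>{1..k}. P i \<rho>)"
definition log_square_sum where "log_square_sum k \<rho> = (\<Sum>i\<in>{1..k}. (P i \<rho>)\<^sup>2)"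

lemma log_sum_Suc: "log_sum (Suc k) \<rho> = log_sum k \<rho> + P (Suc k) \<rho>"
  and log_square_sum_Suc: "log_square_sum (Suc k) \<rho> = log_square_sum k \<rho> + (P (Suc k) \<rho>)\<^sup>2"
  by (simp_all add: log_sum_def log_square_sum_def)

lemma log_sum_nonneg: "0 < \<rho> \<Longrightarrow> \<rho> < 1 \<Longrightarrow> 0 \<le> log_sum k \<rho>"
  unfolding log_sum_def by (intro sum_nonneg) (simp add: P_bounds less_imp_le)

lemma log_square_sum_nonneg: "0 \<le> log_square_sum k \<rho>"
  unfolding log_square_sum_def by (intro sum_nonneg) simp

lemma P_deriv:
  assumes "0 < \<rho>" "\<rho> < 1"
  shows "(P k has_real_derivative P k \<rho> * log_sum k \<rho> / \<rho>) (at \<rho>)"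
proof (induction k)
  case 0
  have "P 0 = (\<lambda>\<rho>. 1)" by (rule ext) (simp add: P_0)
  then show ?case by (simp add: log_sum_def)
next
  case (Suc k)
  have "((\<lambda>\<rho>. P k \<rho> * X (Suc k) \<rho>) has_real_derivative
      P k \<rho> * log_sum k \<rho> / \<rho> * X (Suc k) \<rho> + P (Suc k) \<rho> * X (Suc k) \<rho> / \<rho> * P k \<rho>) (at \<rho>)"
    by (intro DERIV_mult Suc X_deriv assms)
  moreover have "P (Suc k) = (\<lambda>\<rho>. P k \<rho> * X (Suc k) \<rho>)" by (rule ext) (rule P_Suc)
  moreover have "P k \<rho> * log_sum k \<rho> / \<rho> * X (Suc k) \<rho> + P (Suc k) \<rho> * X (Suc k) \<rho> / \<rho> * P k \<rho>
      = P (Suc k) \<rho> * log_sum (Suc k) \<rho> / \<rho>"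
    by (simp add: log_sum_Suc P_Suc add_divide_distrib algebra_simps del: X.simps)
  ultimately show ?case by simp
qed

text \<open>
  With respect to \<open>ln \<rho>\<close> the derivative of \<open>P\<^sub>i\<close> is \<open>P\<^sub>i (P\<^sub>1 + \<dots> + P\<^sub>i)\<close>; summing over \<open>i\<close> gives every product
  \<open>P\<^sub>i P\<^sub>j\<close> with \<open>j \<le> i\<close> once, which is half of the square of the sum and of the sum of the squares.
\<close>

lemma log_sum_deriv:
  assumes "0 < \<rho>" "\<rho> < 1"
  shows "(log_sum k has_real_derivative ((log_sum k \<rho>)\<^sup>2 + log_square_sum k \<rho>) / 2 / \<rho>) (at \<rho>)"
proof (induction k)
  case 0
  have "log_sum 0 = (\<lambda>\<rho>. 0)" by (rule ext) (simp add: log_sum_def)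
  then show ?case by (simp add: log_square_sum_def)
next
  case (Suc k)
  have "((\<lambda>\<rho>. log_sum k \<rho> + P (Suc k) \<rho>) has_real_derivative
      ((log_sum k \<rho>)\<^sup>2 + log_square_sum k \<rho>) / 2 / \<rho> + P (Suc k) \<rho> * log_sum (Suc k) \<rho> / \<rho>) (at \<rho>)"
    by (intro DERIV_add Suc P_deriv assms)
  moreover have "log_sum (Suc k) = (\<lambda>\<rho>. log_sum k \<rho> + P (Suc k) \<rho>)" by (rule ext) (rule log_sum_Suc)
  moreover have "((log_sum k \<rho>)\<^sup>2 + log_square_sum k \<rho>) / 2 / \<rho> + P (Suc k) \<rho> * log_sum (Suc k) \<rho> / \<rho>
      = ((log_sum (Suc k) \<rho>)\<^sup>2 + log_square_sum (Suc k) \<rho>) / 2 / \<rho>"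
    using assms by (simp add: log_sum_Suc log_square_sum_Suc field_simps power2_eq_square)
  ultimately show ?case by simp
qed

lemma X_tendsto_0: "(X k \<longlongrightarrow> 0) (at_right 0)"
proof (induction k)
  case 0
  have "X 0 = (\<lambda>\<rho>. \<rho>)" by (rule ext) simp
  then show ?case by simp
next
  case (Suc k)
  have "filterlim (X k) (at_right 0) (at_right 0)"
    unfolding filterlim_at
    by (intro conjI Suc eventually_at_rightI[of 0 1]) (auto dest: X_bounds(1)[of _ k])
  then have "filterlim (\<lambda>\<rho>. ln (X k \<rho>)) at_bot (at_right 0)"
    by (rule filterlim_compose[OF ln_at_0])
  then have "filterlim (\<lambda>\<rho>. - ln (X k \<rho>)) at_top (at_right 0)"
    by (simp add: filterlim_uminus_at_top)
  then have "filterlim (\<lambda>\<rho>. 1 + - ln (X k \<rho>)) at_top (at_right 0)"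
    by (intro filterlim_tendsto_add_at_top[OF tendsto_const])
  then have "((\<lambda>\<rho>. 1 / (1 + - ln (X k \<rho>))) \<longlongrightarrow> 0) (at_right 0)"
    by (intro tendsto_divide_0[OF tendsto_const] filterlim_at_top_imp_at_infinity)
  moreover have "X (Suc k) = (\<lambda>\<rho>. 1 / (1 + - ln (X k \<rho>)))" by (rule ext) simp
  ultimately show ?case by simp
qed

text \<open>
  Completing the square with the logarithmic derivative \<open>- (\<sigma> + log_sum / 2) / s\<close> of
  \<open>s\<^sup>-\<^sup>\<sigma> P\<^sub>k\<^sup>-\<^sup>1\<^sup>/\<^sup>2\<close>; the quadratic relation between \<open>log_sum\<close> and its derivative is what
  turns the square of the sum into the sum of the squares.
\<close>

lemma radial_identity:
  assumes D: "0 < s" "s < D" and v: "(v has_real_derivative v') (at s)"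
  shows "((\<lambda>s. - (s powr (2 * \<sigma>) * (\<sigma> + log_sum k (s / D) / 2) * (v s)\<^sup>2)) has_real_derivative
     s powr (2 * \<sigma> + 1) * v'\<^sup>2 - s powr (2 * \<sigma> - 1) * (\<sigma>\<^sup>2 + log_square_sum k (s / D) / 4) * (v s)\<^sup>2
     - s powr (2 * \<sigma> + 1) * (v' + (\<sigma> + log_sum k (s / D) / 2) / s * v s)\<^sup>2) (at s)"
proof -
  let ?L = "log_sum k (s / D)" and ?S = "log_square_sum k (s / D)"
  have r: "0 < s / D" "s / D < 1" using D by auto
  have d1: "((\<lambda>s. s powr (2 * \<sigma>)) has_real_derivative 2 * \<sigma> * s powr (2 * \<sigma> - 1)) (at s)"
    using has_real_derivative_powr[of s "2 * \<sigma>"] D by simp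
  have "((\<lambda>s. log_sum k (s / D)) has_real_derivative (?L\<^sup>2 + ?S) / 2 / (s / D) * (1 / D)) (at s)"
    by (rule DERIV_chain2[where f = "log_sum k" and g = "\<lambda>s. s / D", OF log_sum_deriv[OF r]]) (use D in \<open>auto intro!: derivative_eq_intros\<close>)
  then have d2: "((\<lambda>s. \<sigma> + log_sum k (s / D) / 2) has_real_derivative 0 + (?L\<^sup>2 + ?S) / 2 / (s / D) * (1 / D) / 2) (at s)"
    by (intro DERIV_add DERIV_const DERIV_cdivide)
  have d3: "((\<lambda>s. (v s)\<^sup>2) has_real_derivative 2 * v s * v') (at s)"
    using DERIV_power[OF v, of 2] by (simp add: mult_ac)
  have "((\<lambda>s. - (s powr (2 * \<sigma>) * (\<sigma> + log_sum k (s / D) / 2) * (v s)\<^sup>2)) has_real_derivative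
     - ((2 * \<sigma> * s powr (2 * \<sigma> - 1) * (\<sigma> + ?L / 2) + (0 + (?L\<^sup>2 + ?S) / 2 / (s / D) * (1 / D) / 2) * s powr (2 * \<sigma>))
         * (v s)\<^sup>2 + 2 * v s * v' * (s powr (2 * \<sigma>) * (\<sigma> + ?L / 2)))) (at s)"
    by (intro DERIV_minus DERIV_mult d1 d2 d3)
  moreover have "- ((2 * \<sigma> * s powr (2 * \<sigma> - 1) * (\<sigma> + ?L / 2) + (0 + (?L\<^sup>2 + ?S) / 2 / (s / D) * (1 / D) / 2) * s powr (2 * \<sigma>))
         * (v s)\<^sup>2 + 2 * v s * v' * (s powr (2 * \<sigma>) * (\<sigma> + ?L / 2)))
    = s powr (2 * \<sigma> + 1) * v'\<^sup>2 - s powr (2 * \<sigma> - 1) * (\<sigma>\<^sup>2 + ?S / 4) * (v s)\<^sup>2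
     - s powr (2 * \<sigma> + 1) * (v' + (\<sigma> + ?L / 2) / s * v s)\<^sup>2"
  proof -
    define q where "q = s powr (2 * \<sigma> - 1)"
    have e1: "s powr (2 * \<sigma>) = q * s" unfolding q_def using D by (simp add: powr_diff)
    have e2: "s powr (2 * \<sigma> + 1) = q * s * s" using e1 D by (simp add: powr_add)
    have e3: "(?L\<^sup>2 + ?S) / 2 / (s / D) * (1 / D) / 2 = (?L\<^sup>2 + ?S) / (4 * s)"
      using D by (simp add: field_simps)
    show ?thesis unfolding e1 e2 e3 q_def[symmetric] using D
      by (simp add: field_simps power2_eq_square)
  qed
  ultimately show ?thesis by simp
qed

lemma log_sums_continuous:
  assumes "0 < D"
  shows "continuous_on {0<..<D} (\<lambda>s. log_sum k (s / D))"
    "continuous_on {0<..<D} (\<lambda>s. P k (s / D))" "continuous_on {0<..<D} (\<lambda>s. X k (s / D))"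
    "continuous_on {0<..<D} (\<lambda>s. log_square_sum k (s / D))"
proof -
  have c: "continuous_on {0<..<D} (\<lambda>s. f (s / D))" if "\<And>\<rho>. 0 < \<rho> \<Longrightarrow> \<rho> < 1 \<Longrightarrow> \<exists>d. (f has_real_derivative d) (at \<rho>)" for f
  proof (rule continuous_on_compose2[where g = f and t = "{0<..<1}"])
    show "continuous_on {0<..<1} f"
      using that by (metis DERIV_isCont continuous_at_imp_continuous_on greaterThanLessThan_iff)
  qed (use assms in \<open>auto intro!: continuous_intros\<close>)
  show "continuous_on {0<..<D} (\<lambda>s. log_sum k (s / D))" by (rule c) (use log_sum_deriv in blast)
  show P: "continuous_on {0<..<D} (\<lambda>s. P k (s / D))" for k by (rule c) (use P_deriv in blast)
  show "continuous_on {0<..<D} (\<lambda>s. X k (s / D))" by (rule c) (use X_deriv in blast)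
  show "continuous_on {0<..<D} (\<lambda>s. log_square_sum k (s / D))"
    unfolding log_square_sum_def by (intro continuous_intros P)
qed

text \<open>
  Integrate the identity and drop the completed square. The boundary term vanishes at the upper end
  together with \<open>v\<close>, and at the lower end it has the favourable sign, so that nothing has to be known
  about \<open>v\<close> near the origin.
\<close>

theorem radial_inequality:
  assumes D: "0 < D" and \<sigma>: "0 < \<sigma>"
    and v: "\<And>s. 0 < s \<Longrightarrow> s < D \<Longrightarrow> (v has_real_derivative v' s) (at s)"
    and v': "continuous_on {0<..<D} v'" and d: "d < D" "\<And>s. d \<le> s \<Longrightarrow> s < D \<Longrightarrow> v s = 0"
  shows "(\<integral>\<^sup>+s. indicator {0<..<D} s *
        ennreal (s powr (2 * \<sigma> - 1) * (\<sigma>\<^sup>2 + log_square_sum k (s / D) / 4) * (v s)\<^sup>2) \<partial>lborel)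
     \<le> (\<integral>\<^sup>+s. indicator {0<..<D} s * ennreal (s powr (2 * \<sigma> + 1) * (v' s)\<^sup>2) \<partial>lborel)"
    (is "?L \<le> ?R")
proof -
  let ?V = "\<lambda>s. s powr (2 * \<sigma> - 1) * (\<sigma>\<^sup>2 + log_square_sum k (s / D) / 4) * (v s)\<^sup>2"
  let ?E = "\<lambda>s. s powr (2 * \<sigma> + 1) * (v' s)\<^sup>2"
  let ?Q = "\<lambda>s. - (s powr (2 * \<sigma>) * (\<sigma> + log_sum k (s / D) / 2) * (v s)\<^sup>2)"
  \<comment> \<open>the assumption does not exclude \<open>d \<le> 0\<close>\<close>
  define d' where "d' = max d (D / 2)"
  have d': "0 < d'" "d' < D" "\<And>s. d' \<le> s \<Longrightarrow> s < D \<Longrightarrow> v s = 0" using d D by (auto simp: d'_def)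
  have V0: "0 \<le> ?V s" for s using log_square_sum_nonneg[of k "s / D"] by simp
  have vc: "continuous_on {0<..<D} v"
    using v by (auto intro!: continuous_at_imp_continuous_on DERIV_isCont)
  have Vc: "continuous_on {0<..<D} ?V" and Ec: "continuous_on {0<..<D} ?E"
    using D by (intro continuous_intros log_sums_continuous vc v'; auto)+
  have step: "(\<integral>\<^sup>+s. indicator {e..d'} s * ennreal (?V s) \<partial>lborel) \<le> ?R" if e: "0 < e" "e \<le> d'" for e
  proof -
    have sub: "{e..d'} \<subseteq> {0<..<D}" using e d' by auto
    have Vi: "(?V has_integral integral {e..d'} ?V) {e..d'}" and Ei: "(?E has_integral integral {e..d'} ?E) {e..d'}"
      by (intro integrable_integral integrable_continuous_real continuous_on_subset[OF Vc sub]
          continuous_on_subset[OF Ec sub])+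
    have "((\<lambda>s. ?E s - ?V s - s powr (2 * \<sigma> + 1) * (v' s + (\<sigma> + log_sum k (s / D) / 2) / s * v s)\<^sup>2)
        has_integral (?Q d' - ?Q e)) {e..d'}"
    proof (rule fundamental_theorem_of_calculus[OF e(2)])
      fix s assume "s \<in> {e..d'}"
      then have "0 < s" "s < D" using sub by auto
      from has_field_derivative_at_within[OF radial_identity[OF this v[OF this]]]
      show "(?Q has_vector_derivative ?E s - ?V s - s powr (2 * \<sigma> + 1) * (v' s + (\<sigma> + log_sum k (s / D) / 2) / s * v s)\<^sup>2)
          (at s within {e..d'})"
        by (simp only: has_real_derivative_iff_has_vector_derivative)
    qed
    then have "?Q d' - ?Q e \<le> integral {e..d'} ?E - integral {e..d'} ?V"
      by (rule has_integral_le[OF _ has_integral_diff[OF Ei Vi]]) simp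
    moreover have "?Q d' = 0" using d' by simp
    moreover have "?Q e \<le> 0"
      using log_sum_nonneg[of "e / D" k] e d' \<sigma> by simp
    ultimately have "integral {e..d'} ?V \<le> integral {e..d'} ?E" by linarith
    then have "(\<integral>\<^sup>+s. indicator {e..d'} s * ennreal (?V s) \<partial>lborel) \<le> (\<integral>\<^sup>+s. indicator {e..d'} s * ennreal (?E s) \<partial>lborel)"
      using V0 continuous_on_subset[OF Vc sub] continuous_on_subset[OF Ec sub]
      by (subst (1 2) nn_integral_Icc_eq_integral) (auto intro: ennreal_leI)
    also have "\<dots> \<le> ?R"
      using sub by (intro nn_integral_mono) (auto simp: indicator_def)
    finally show ?thesis .
  qed
  define e where "e j = d' / real (Suc j)" for j
  have e: "0 < e j" "e j \<le> d'" for j using d' by (auto simp: e_def divide_le_eq mult_le_cancel_left1)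
  have em: "e (Suc j) \<le> e j" for j
    unfolding e_def using d' by (intro divide_left_mono) auto
  have "?L = (\<integral>\<^sup>+s. (SUP j. indicator {e j..d'} s * ennreal (?V s)) \<partial>lborel)"
  proof (rule nn_integral_cong)
    fix s
    show "indicator {0<..<D} s * ennreal (?V s) = (SUP j. indicator {e j..d'} s * ennreal (?V s))"
    proof (cases "0 < s \<and> s \<le> d'")
      case True
      have "(\<lambda>j. d' / real (Suc j)) \<longlonglongrightarrow> 0"
        using LIMSEQ_inverse_real_of_nat[THEN tendsto_mult_right_zero, of d'] by (simp add: divide_inverse mult.commute)
      then have "\<forall>\<^sub>F j in sequentially. e j < s"
        unfolding e_def using True by (intro order_tendstoD) auto
      then obtain j where j: "e j < s" by (auto simp: eventually_sequentially)
      have "(SUP j. indicator {e j..d'} s * ennreal (?V s)) = ennreal (?V s)"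
      proof (rule antisym)
        show "(SUP j. indicator {e j..d'} s * ennreal (?V s)) \<le> ennreal (?V s)"
          by (rule SUP_least) (simp add: indicator_def)
        show "ennreal (?V s) \<le> (SUP j. indicator {e j..d'} s * ennreal (?V s))"
          by (rule SUP_upper2[of j]) (use j True in auto)
      qed
      then show ?thesis using True d' by simp
    next
      case False
      then have "indicator {e j..d'} s = (0::ennreal)" for j using e(1)[of j] by (auto simp: indicator_def)
      moreover have "indicator {0<..<D} s * ennreal (?V s) = 0"
        using False d'(3)[of s] by (auto simp: indicator_def)
      ultimately show ?thesis by simp
    qed
  qed
  also have "\<dots> = (SUP j. (\<integral>\<^sup>+s. indicator {e j..d'} s * ennreal (?V s) \<partial>lborel))"
  proof (rule nn_integral_monotone_convergence_SUP)
    show "incseq (\<lambda>j s. indicator {e j..d'} s * ennreal (?V s))"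
    proof (rule incseq_SucI, rule le_funI)
      fix j s
      show "indicator {e j..d'} s * ennreal (?V s) \<le> indicator {e (Suc j)..d'} s * ennreal (?V s)"
        using em[of j] by (intro mult_right_mono) (auto simp: indicator_def)
    qed
    fix j
    have sub: "{e j..d'} \<subseteq> {0<..<D}" using e(1)[of j] d' by auto
    have "(\<lambda>s. indicator {e j..d'} s *\<^sub>R ?V s) \<in> borel_measurable borel"
      by (intro borel_measurable_continuous_on_indicator continuous_on_subset[OF Vc sub]) simp
    then have "(\<lambda>s. ennreal (indicator {e j..d'} s *\<^sub>R ?V s)) \<in> borel_measurable lborel" by simp
    moreover have "ennreal (indicator {e j..d'} s *\<^sub>R ?V s) = indicator {e j..d'} s * ennreal (?V s)" for s
      by (simp add: indicator_def)
    ultimately show "(\<lambda>s. indicator {e j..d'} s * ennreal (?V s)) \<in> borel_measurable lborel" by simp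
  qed
  also have "\<dots> \<le> ?R" by (rule SUP_least) (rule step[OF e])
  finally show ?thesis .
qed

section \<open>Smooth functions\<close>

lemma Ck_on_cong_imp:
  assumes "open S" "Ck_on k f S" "\<And>x. x \<in> S \<Longrightarrow> f x = g x"
  shows "Ck_on k g S"
  using assms(2,3)
proof (induction k arbitrary: f g)
  case 0
  then show ?case using continuous_on_cong[of S S f g] by simp
next
  case (Suc k)
  have d: "f differentiable (at x)" if "x \<in> S" for x using Suc.prems that by simp
  have fd: "frechet_derivative f (at x) = frechet_derivative g (at x)" if "x \<in> S" for x
    by (rule frechet_derivative_transform_within_open[OF d[OF that] assms(1) that Suc.prems(2)])
  have "g differentiable (at x)" if x: "x \<in> S" for x
  proof -
    have "(f has_derivative frechet_derivative f (at x)) (at x)"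
      using d[OF x] by (simp add: frechet_derivative_works)
    then have "(g has_derivative frechet_derivative f (at x)) (at x)"
      by (rule has_derivative_transform_within_open[OF _ assms(1) x Suc.prems(2)])
    then show ?thesis unfolding differentiable_def by blast
  qed
  moreover have "Ck_on k (\<lambda>x. frechet_derivative g (at x) v) S" for v
    using Suc.IH[of "\<lambda>x. frechet_derivative f (at x) v" "\<lambda>x. frechet_derivative g (at x) v"] fd Suc.prems(1)
    by simp
  ultimately show ?case by simp
qed

text \<open>
  The class is defined by Frechet derivatives; an explicit derivative whose values in every
  direction are of class \<open>C\<^sup>k\<close> is enough, which reduces the closure properties to inductions over \<open>k\<close>.
\<close>

lemma Ck_on_SucI:
  assumes "open S" "\<And>x. x \<in> S \<Longrightarrow> (f has_derivative f' x) (at x)" "\<And>v. Ck_on k (\<lambda>x. f' x v) S"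
  shows "Ck_on (Suc k) f S"
proof -
  have "Ck_on k (\<lambda>x. frechet_derivative f (at x) v) S" for v
    by (rule Ck_on_cong_imp[OF assms(1) assms(3)[of v]]) (simp add: frechet_derivative_at[OF assms(2), symmetric])
  moreover have "f differentiable (at x)" if "x \<in> S" for x
    using assms(2)[OF that] unfolding differentiable_def by blast
  ultimately show ?thesis by simp
qed

lemma Ck_on_SucE:
  assumes "Ck_on (Suc k) f S"
  shows "x \<in> S \<Longrightarrow> (f has_derivative frechet_derivative f (at x)) (at x)"
    and "Ck_on k (\<lambda>x. frechet_derivative f (at x) v) S"
  using assms by (simp_all add: frechet_derivative_works)

lemma Ck_on_subset:
  assumes "T \<subseteq> S" "Ck_on k f S"
  shows "Ck_on k f T"
  using assms(2)
proof (induction k arbitrary: f)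
  case 0
  then show ?case using assms(1) continuous_on_subset by auto
next
  case (Suc k)
  then show ?case using assms(1) by (simp add: subset_iff)
qed

lemma Ck_on_Un:
  assumes "open S" "open T" "Ck_on k f S" "Ck_on k f T"
  shows "Ck_on k f (S \<union> T)"
  using assms(3,4)
proof (induction k arbitrary: f)
  case 0
  then show ?case using assms(1,2) by (simp add: continuous_on_open_Un)
next
  case (Suc k)
  then show ?case by (simp add: ball_Un)
qed

lemma Ck_on_SucD: "Ck_on (Suc k) f S \<Longrightarrow> Ck_on k f S"
proof (induction k arbitrary: f)
  case 0
  then show ?case
    by (simp add: continuous_at_imp_continuous_on differentiable_imp_continuous_within)
next
  case (Suc k)
  have "Ck_on k (\<lambda>x. frechet_derivative f (at x) v) S" for v
    using Ck_on_SucE(2)[OF Suc.prems] by (rule Suc.IH)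
  then show ?case using Suc.prems by (simp add: Ck_on.simps(2)[of k] del: Ck_on.simps) (simp)
qed

lemma Ck_on_continuous: "Ck_on k f S \<Longrightarrow> continuous_on S f"
proof (induction k)
  case (Suc k)
  then show ?case using Ck_on_SucD by blast
qed simp

lemma Ck_on_const: "Ck_on k (\<lambda>x. c) S"
  by (induction k arbitrary: c) (simp_all)

lemma Ck_on_bounded_linear:
  assumes f: "bounded_linear f" and S: "open S"
  shows "Ck_on k f S"
proof (cases k)
  case 0
  then show ?thesis using f by (simp add: linear_continuous_on)
next
  case (Suc m)
  show ?thesis unfolding Suc
    by (rule Ck_on_SucI[OF S bounded_linear_imp_has_derivative[OF f] Ck_on_const])
qed

lemma Ck_on_add:
  assumes "open S" "Ck_on k f S" "Ck_on k g S"
  shows "Ck_on k (\<lambda>x. f x + g x) S"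
  using assms(2,3)
proof (induction k arbitrary: f g)
  case 0
  then show ?case by (simp add: continuous_on_add)
next
  case (Suc k)
  show ?case
    by (rule Ck_on_SucI[OF assms(1) has_derivative_add[OF Ck_on_SucE(1)[OF Suc.prems(1)] Ck_on_SucE(1)[OF Suc.prems(2)]]])
      (assumption | rule Suc.IH[OF Ck_on_SucE(2)[OF Suc.prems(1)] Ck_on_SucE(2)[OF Suc.prems(2)]])+
qed

lemma Ck_on_mult:
  assumes "open S" "Ck_on k f S" "Ck_on k g S"
  shows "Ck_on k (\<lambda>x. f x * g x) S"
  using assms(2,3)
proof (induction k arbitrary: f g)
  case 0
  then show ?case by (simp add: continuous_on_mult)
next
  case (Suc k)
  note f = Suc.prems(1) and g = Suc.prems(2)
  show ?case
  proof (rule Ck_on_SucI[OF assms(1)])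
    show "((\<lambda>x. f x * g x) has_derivative
        (\<lambda>h. f x * frechet_derivative g (at x) h + frechet_derivative f (at x) h * g x)) (at x)" if "x \<in> S" for x
      by (rule has_derivative_mult[OF Ck_on_SucE(1)[OF f that] Ck_on_SucE(1)[OF g that]])
    show "Ck_on k (\<lambda>x. f x * frechet_derivative g (at x) v + frechet_derivative f (at x) v * g x) S" for v
      by (rule Ck_on_add[OF assms(1) Suc.IH[OF Ck_on_SucD[OF f] Ck_on_SucE(2)[OF g]]
            Suc.IH[OF Ck_on_SucE(2)[OF f] Ck_on_SucD[OF g]]])
  qed
qed

lemma Ck_on_compose:
  fixes f :: "'a::euclidean_space \<Rightarrow> real" and g :: "real \<Rightarrow> real"
  assumes "open S" "open T" "Ck_on k g T" "Ck_on k f S" "\<And>x. x \<in> S \<Longrightarrow> f x \<in> T"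
  shows "Ck_on k (\<lambda>x. g (f x)) S"
  using assms(3,4)
proof (induction k arbitrary: g)
  case 0
  then show ?case using assms(5) continuous_on_compose2[of T g S f] by auto
next
  case (Suc k)
  note g = Suc.prems(1) and f = Suc.prems(2)
  have lin: "frechet_derivative g (at (f x)) h = h * frechet_derivative g (at (f x)) 1" if "x \<in> S" for x h
  proof -
    have "linear (frechet_derivative g (at (f x)))"
      using has_derivative_linear[OF Ck_on_SucE(1)[OF g assms(5)[OF that]]] .
    from linear_scale[OF this, of h 1] show ?thesis by simp
  qed
  show ?case
  proof (rule Ck_on_SucI[OF assms(1)])
    fix x assume x: "x \<in> S"
    have eq: "(\<lambda>h. frechet_derivative g (at (f x)) (frechet_derivative f (at x) h)) =
        (\<lambda>h. frechet_derivative f (at x) h * frechet_derivative g (at (f x)) 1)"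
      by (rule ext) (rule lin[OF x])
    show "((\<lambda>x. g (f x)) has_derivative
        (\<lambda>h. frechet_derivative f (at x) h * frechet_derivative g (at (f x)) 1)) (at x)"
      using has_derivative_compose[OF Ck_on_SucE(1)[OF f x] Ck_on_SucE(1)[OF g assms(5)[OF x]]]
      unfolding eq .
  next
    fix v
    show "Ck_on k (\<lambda>x. frechet_derivative f (at x) v * frechet_derivative g (at (f x)) 1) S"
      by (rule Ck_on_mult[OF assms(1) Ck_on_SucE(2)[OF f] Suc.IH[OF Ck_on_SucE(2)[OF g] Ck_on_SucD[OF f]]])
  qed
qed

lemma Ck_on_real_derivI:
  fixes g :: "real \<Rightarrow> real"
  assumes "open T" "\<And>t. t \<in> T \<Longrightarrow> (g has_real_derivative g' t) (at t)" "Ck_on k g' T"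
  shows "Ck_on (Suc k) g T"
proof (rule Ck_on_SucI[OF assms(1)])
  show "(g has_derivative (\<lambda>h. g' t * h)) (at t)" if "t \<in> T" for t
    using assms(2)[OF that] by (simp add: has_field_derivative_def)
  show "Ck_on k (\<lambda>t. g' t * h) T" for h
    by (rule Ck_on_mult[OF assms(1) assms(3) Ck_on_const])
qed

lemma Ck_on_powr: "Ck_on k (\<lambda>t::real. t powr a) {0<..}"
proof (induction k arbitrary: a)
  case 0
  then show ?case by (auto intro!: continuous_intros)
next
  case (Suc k)
  show ?case
    by (rule Ck_on_real_derivI[where g' = "\<lambda>t. a * t powr (a - 1)"])
      (auto intro!: has_real_derivative_powr Ck_on_mult Ck_on_const Suc)
qed

lemma Ck_on_exp: "Ck_on k (exp :: real \<Rightarrow> real) UNIV"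
proof (induction k)
  case 0
  then show ?case by (auto intro!: continuous_intros)
next
  case (Suc k)
  show ?case by (rule Ck_on_real_derivI[OF open_UNIV DERIV_exp Suc])
qed

lemma Ck_on_ln: "Ck_on k (ln :: real \<Rightarrow> real) {0<..}"
proof (cases k)
  case 0
  then show ?thesis by (auto intro!: continuous_intros)
next
  case (Suc m)
  show ?thesis unfolding Suc
  proof (rule Ck_on_real_derivI[where g' = "\<lambda>t. t powr (-1)"])
    show "(ln has_real_derivative t powr - 1) (at t)" if "t \<in> {0<..}" for t :: real
      using that by (auto intro!: derivative_eq_intros simp: powr_minus divide_inverse)
  qed (rule open_greaterThan Ck_on_powr)+
qed

lemma Ck_on_sum:
  assumes "open S" "\<And>i. i \<in> A \<Longrightarrow> Ck_on k (f i) S"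
  shows "Ck_on k (\<lambda>x. \<Sum>i\<in>A. f i x) S"
  using assms(2)
  by (induction A rule: infinite_finite_induct) (auto intro: Ck_on_const Ck_on_add[OF assms(1)])

lemma Ck_on_prod:
  assumes "open S" "\<And>i. i \<in> A \<Longrightarrow> Ck_on k (f i) S"
  shows "Ck_on k (\<lambda>x. \<Prod>i\<in>A. f i x) S"
  using assms(2)
  by (induction A rule: infinite_finite_induct) (auto intro: Ck_on_const Ck_on_mult[OF assms(1)])

lemma Ck_on_power:
  assumes "open S" "Ck_on k f S"
  shows "Ck_on k (\<lambda>x. f x ^ m) S"
  by (induction m) (auto intro: Ck_on_const Ck_on_mult[OF assms(1)] assms(2))

text \<open>
  Smooth functions with compact support come from \<open>exp (- 1 / x)\<close>. The extra factor \<open>x\<^sup>-\<^sup>m\<close> makes the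
  family closed under differentiation, so that smoothness at \<open>0\<close> is one induction.
\<close>

definition flat :: "nat \<Rightarrow> real \<Rightarrow> real" where
  "flat m x = (if 0 < x then inverse x ^ m * exp (- inverse x) else 0)"

lemma flat_deriv: "(flat m has_real_derivative flat (m + 2) x - real m * flat (m + 1) x) (at x)"
proof -
  consider "x < 0" | "x = 0" | "0 < x" by linarith
  then show ?thesis
  proof cases
    case 1
    have "((\<lambda>x. 0) has_real_derivative 0) (at x)" by simp
    then have "(flat m has_real_derivative 0) (at x)"
      by (rule has_field_derivative_transform_within_open[where S = "{..<0}"]) (use 1 in \<open>auto simp: flat_def\<close>)
    then show ?thesis using 1 by (simp add: flat_def)
  next
    case 3
    have i: "(inverse has_real_derivative - (inverse x)\<^sup>2) (at x)"
      using DERIV_inverse[of x] 3 by (simp add: power2_eq_square)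
    have "((\<lambda>x. inverse x ^ m) has_real_derivative real m * inverse x ^ (m - Suc 0) * (- (inverse x)\<^sup>2)) (at x)"
      by (rule DERIV_chain2[OF DERIV_pow i])
    moreover have "real m * inverse x ^ (m - Suc 0) * (- (inverse x)\<^sup>2) = - real m * inverse x ^ (m + 1)"
      by (cases m) (simp_all add: power2_eq_square algebra_simps)
    ultimately have "((\<lambda>x. inverse x ^ m) has_real_derivative - real m * inverse x ^ (m + 1)) (at x)"
      by (simp only:)
    moreover have "((\<lambda>x. exp (- inverse x)) has_real_derivative exp (- inverse x) * - (- (inverse x)\<^sup>2)) (at x)"
      by (rule DERIV_chain2[OF DERIV_exp DERIV_minus[OF i]])
    ultimately have "((\<lambda>x. inverse x ^ m * exp (- inverse x)) has_real_derivative
        - real m * inverse x ^ (m + 1) * exp (- inverse x) + exp (- inverse x) * - (- (inverse x)\<^sup>2) * inverse x ^ m) (at x)"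
      by (rule DERIV_mult)
    moreover have "- real m * inverse x ^ (m + 1) * exp (- inverse x) + exp (- inverse x) * - (- (inverse x)\<^sup>2) * inverse x ^ m
        = flat (m + 2) x - real m * flat (m + 1) x"
      using 3 by (simp add: flat_def power2_eq_square)
    ultimately have "((\<lambda>x. inverse x ^ m * exp (- inverse x)) has_real_derivative
        flat (m + 2) x - real m * flat (m + 1) x) (at x)" by simp
    then show ?thesis
      by (rule has_field_derivative_transform_within_open[where S = "{0<..}"]) (use 3 in \<open>auto simp: flat_def\<close>)
  next
    case 2
    have lim: "((\<lambda>x. flat m x / x) \<longlongrightarrow> 0) (at_right 0)"
    proof -
      have "((\<lambda>y::real. y ^ (m + 1) / exp y) \<longlongrightarrow> 0) at_top" by (rule tendsto_power_div_exp_0)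
      then have "((\<lambda>x::real. inverse x ^ (m + 1) / exp (inverse x)) \<longlongrightarrow> 0) (at_right 0)"
        by (rule filterlim_compose[OF _ filterlim_inverse_at_top_right])
      moreover have "\<forall>\<^sub>F x in at_right 0. inverse x ^ (m + 1) / exp (inverse x) = flat m x / x"
        by (rule eventually_at_rightI[of 0 1]) (auto simp: flat_def exp_minus divide_inverse mult_ac)
      ultimately show ?thesis by (rule Lim_transform_eventually)
    qed
    have "((\<lambda>x. flat m x / x) \<longlongrightarrow> 0) (at_left 0)"
    proof -
      have "\<forall>\<^sub>F x in at_left (0::real). 0 = flat m x / x"
        by (rule eventually_at_leftI[of "-1"]) (auto simp: flat_def)
      then show ?thesis by (rule Lim_transform_eventually[OF tendsto_const])
    qed
    with lim have "((\<lambda>x. flat m x / x) \<longlongrightarrow> 0) (at 0)" by (simp add: filterlim_split_at)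
    then have "(flat m has_real_derivative 0) (at 0)"
      by (simp add: has_field_derivative_iff flat_def)
    then show ?thesis using 2 by (simp add: flat_def)
  qed
qed

lemma Ck_on_flat: "Ck_on k (flat m) UNIV"
proof (induction k arbitrary: m)
  case 0
  show ?case by (auto intro!: continuous_at_imp_continuous_on DERIV_isCont[OF flat_deriv])
next
  case (Suc k)
  have "Ck_on k (\<lambda>x. flat (m + 2) x + (- real m) * flat (m + 1) x) UNIV"
    by (intro Ck_on_add Ck_on_mult Ck_on_const Suc open_UNIV)
  then show ?case
    by (intro Ck_on_real_derivI[OF open_UNIV flat_deriv]) simp
qed

definition bump :: "real \<Rightarrow> real" where "bump t = flat 0 t * flat 0 (1 - t)"

lemma Ck_on_bump: "Ck_on k bump UNIV"
proof -
  have "Ck_on k (\<lambda>t::real. 1 + (- 1) * t) UNIV"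
    by (intro Ck_on_add Ck_on_mult Ck_on_const Ck_on_bounded_linear[OF bounded_linear_ident] open_UNIV)
  then have "Ck_on k (\<lambda>t::real. 1 - t) UNIV" by simp
  from Ck_on_compose[OF open_UNIV open_UNIV Ck_on_flat this]
  have "Ck_on k (\<lambda>t. flat 0 (1 - t)) UNIV" by simp
  then show ?thesis unfolding bump_def[abs_def] by (intro Ck_on_mult Ck_on_flat open_UNIV)
qed

lemma bump_pos: "0 < t \<Longrightarrow> t < 1 \<Longrightarrow> 0 < bump t"
  and bump_eq_0: "t \<notin> {0<..<1} \<Longrightarrow> bump t = 0"
  by (auto simp: bump_def flat_def)

lemma Ck_on_real_deriv:
  fixes g :: "real \<Rightarrow> real"
  assumes "Ck_on (Suc k) g T" "open T"
  obtains g' where "\<And>t. t \<in> T \<Longrightarrow> (g has_real_derivative g' t) (at t)" "Ck_on k g' T"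
proof
  show "(g has_real_derivative frechet_derivative g (at t) 1) (at t)" if "t \<in> T" for t
  proof -
    have d: "(g has_derivative frechet_derivative g (at t)) (at t)" by (rule Ck_on_SucE(1)[OF assms(1) that])
    have "frechet_derivative g (at t) = (\<lambda>h. frechet_derivative g (at t) 1 * h)"
    proof
      show "frechet_derivative g (at t) h = frechet_derivative g (at t) 1 * h" for h
        using linear_scale[OF has_derivative_linear[OF d], of h 1] by (simp add: mult.commute)
    qed
    then show ?thesis using d unfolding has_field_derivative_def by metis
  qed
  show "Ck_on k (\<lambda>t. frechet_derivative g (at t) 1) T" by (rule Ck_on_SucE(2)[OF assms(1)])
qed

section \<open>Gradients\<close>

lemma grad_eq:
  assumes "GDERIV u z :> D"
  shows "grad u z = D"
proof -
  have "D' = D" if "GDERIV u z :> D'" for D'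
  proof -
    have "(\<lambda>h. inner h D') = (\<lambda>h. inner h D)"
      using assms that unfolding gderiv_def by (rule has_derivative_unique[rotated])
    then show ?thesis using vector_eq_ldot[of D' D] by metis
  qed
  then show ?thesis unfolding grad_def using assms by (rule the_equality[rotated])
qed

lemma GDERIV_grad:
  assumes "(u has_derivative u') (at z)"
  shows "GDERIV u z :> grad u z" "inner h (grad u z) = u' h" "grad u z = (\<Sum>b\<in>Basis. u' b *\<^sub>R b)"
proof -
  let ?D = "\<Sum>b\<in>Basis. u' b *\<^sub>R b"
  interpret linear u' using has_derivative_linear[OF assms] .
  have eq: "inner h ?D = u' h" for h
  proof -
    have "u' h = u' (\<Sum>b\<in>Basis. (h \<bullet> b) *\<^sub>R b)" by (simp add: euclidean_representation)
    also have "\<dots> = (\<Sum>b\<in>Basis. (h \<bullet> b) * u' b)" by (simp add: sum scale)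
    also have "\<dots> = inner h ?D" by (simp add: inner_sum_right mult.commute)
    finally show ?thesis by simp
  qed
  then have "GDERIV u z :> ?D" using assms by (simp add: gderiv_def)
  then have g: "grad u z = ?D" by (rule grad_eq)
  then show "GDERIV u z :> grad u z" "inner h (grad u z) = u' h" "grad u z = ?D"
    using \<open>GDERIV u z :> ?D\<close> eq by auto
qed

section \<open>The Hardy inequality\<close>

locale hardy_setting =
  fixes H :: "'a::euclidean_space \<Rightarrow> real" and U :: "('a \<times> real) set" and \<alpha> b :: real
  assumes parameters: "hardy_parameters (real DIM('a)) \<alpha> b"
    and norm_H: "is_norm H" and open_U: "open U" and bounded_U: "bounded U" and zero_U: "0 \<in> U"
begin

sublocale hardy_parameters "real DIM('a)" \<alpha> b
  by (rule parameters)

abbreviation "N0 \<equiv> dual_norm H"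
abbreviation "D \<equiv> sup_Phi0 H U"
abbreviation "directions \<equiv> cone_measure N0"
abbreviation "dir x \<equiv> x /\<^sub>R N0 x"

lemmas norm_N0 = is_norm_dual[OF norm_H] and norm_Phi0 = is_norm_Phi0[OF norm_H]

lemma N0_measurable [measurable]: "N0 \<in> borel_measurable borel"
  by (rule norm_borel[OF norm_N0])

lemma Phi0_measurable [measurable]: "Phi0 H \<in> borel_measurable borel"
  by (rule norm_borel[OF norm_Phi0])

lemma X_measurable [measurable]: "X k \<in> borel_measurable borel"
proof (induction k)
  case 0
  have "X 0 = (\<lambda>\<rho>. \<rho>)" by (rule ext) simp
  then show ?case by simp
next
  case (Suc k)
  note [measurable] = Suc
  have "X (Suc k) = (\<lambda>\<rho>. 1 / (1 - ln (X k \<rho>)))" by (rule ext) simp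
  then show ?case by simp
qed

lemma P_measurable [measurable]: "P k \<in> borel_measurable borel"
  unfolding P_def[abs_def] by measurable

text \<open>
  The supremum is not attained: \<open>U\<close> being open, every point can be moved outwards and upwards. Thus the
  arguments of the logarithmic weights lie strictly between \<open>0\<close> and \<open>1\<close>.
\<close>

lemma Phi0_less_D:
  assumes "z \<in> U" "0 \<le> snd z"
  shows "Phi0 H z < D"
proof -
  obtain C where C: "\<And>z. Phi0 H z \<le> C * norm z" "C > 0" using norm_upper[OF norm_Phi0] by blast
  obtain R where R: "\<And>z. z \<in> U \<Longrightarrow> norm z \<le> R" using bounded_U by (auto simp: bounded_iff)
  have bdd: "bdd_above (Phi0 H ` upper U)"
  proof (rule bdd_aboveI2)
    show "Phi0 H z \<le> C * R" if "z \<in> upper U" for z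
      using C(1)[of z] R[of z] that C(2) by (smt (verit) mem_Collect_eq mult_left_mono upper_def)
  qed
  have "((\<lambda>e. (1 + e) *\<^sub>R z + e *\<^sub>R (0, 1)) \<longlongrightarrow> (1 + 0) *\<^sub>R z + 0 *\<^sub>R (0, 1)) (at_right (0::real))"
    by (intro tendsto_intros)
  moreover have "(1 + 0) *\<^sub>R z + 0 *\<^sub>R (0, 1) = z" by (simp flip: zero_prod_def)
  ultimately have "((\<lambda>e. (1 + e) *\<^sub>R z + e *\<^sub>R (0, 1)) \<longlongrightarrow> z) (at_right (0::real))" by (simp only:)
  then have "\<forall>\<^sub>F e in at_right (0::real). (1 + e) *\<^sub>R z + e *\<^sub>R (0, 1) \<in> U"
    using open_U assms(1) by (rule topological_tendstoD)
  then obtain e where e: "0 < e" "(1 + e) *\<^sub>R z + e *\<^sub>R (0, 1) \<in> U"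
    by (metis (no_types, lifting) dense eventually_at_right_field)
  define z' where "z' = (1 + e) *\<^sub>R z + e *\<^sub>R (0::'a, 1::real)"
  have z': "fst z' = (1 + e) *\<^sub>R fst z" "snd z' = (1 + e) * snd z + e" by (simp_all add: z'_def)
  have s: "snd z < snd z'" unfolding z' using e assms(2) by (simp add: algebra_simps add_pos_nonneg)
  have n: "N0 (fst z) \<le> N0 (fst z')"
    unfolding z' norm_scale[OF norm_N0] using e norm_nonneg[OF norm_N0, of "fst z"]
    by (simp add: algebra_simps)
  have "(Phi0 H z)\<^sup>2 < (Phi0 H z')\<^sup>2"
    unfolding Phi0_sq[OF norm_H] using s n assms(2) norm_nonneg[OF norm_N0, of "fst z"]
    by (intro add_le_less_mono power_mono power_strict_mono) auto
  then have "Phi0 H z < Phi0 H z'" using Phi0_nonneg[OF norm_H] by (rule power_less_imp_less_base)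
  also have "\<dots> \<le> D" unfolding sup_Phi0_def
    using e s assms(2) by (intro cSUP_upper bdd) (auto simp: upper_def z'_def)
  finally show ?thesis .
qed

lemma D_pos: "0 < D"
  using Phi0_less_D[OF zero_U] norm_zero[OF norm_Phi0] by simp

lemma AE_directions: "AE x in directions. N0 (dir x) = 1"
proof -
  have "AE x in directions. 1 \<le> N0 x"
    unfolding cone_measure_def by (subst AE_density) (auto simp: indicator_def)
  then show ?thesis
  proof eventually_elim
    case (elim x)
    then show ?case by (simp add: norm_scale[OF norm_N0])
  qed
qed

lemma arc_norms:
  assumes \<omega>: "N0 \<omega> = 1" and "0 < \<rho>"
  shows "N0 (fst (\<rho> *\<^sub>R arc \<omega> w)) = \<rho> / sqrt (1 + w\<^sup>2)"
    and "snd (\<rho> *\<^sub>R arc \<omega> w) = \<rho> * w / sqrt (1 + w\<^sup>2)"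
    and "Phi0 H (\<rho> *\<^sub>R arc \<omega> w) = \<rho>"
proof -
  define r where "r = sqrt (1 + w\<^sup>2)"
  have r: "r > 0" "r\<^sup>2 = 1 + w\<^sup>2" unfolding r_def using one_plus_sq_pos(1)[of w] by simp_all
  have arc: "\<rho> *\<^sub>R arc \<omega> w = ((\<rho> / r) *\<^sub>R \<omega>, \<rho> / r * w)" by (simp add: arc_def r_def)
  have "\<bar>\<rho> / r\<bar> = \<rho> / r" using assms(2) r(1) by simp
  then have a: "N0 (fst (\<rho> *\<^sub>R arc \<omega> w)) = \<rho> / r"
    by (simp only: arc fst_conv norm_scale[OF norm_N0] \<omega> mult_1_right)
  have b: "snd (\<rho> *\<^sub>R arc \<omega> w) = \<rho> / r * w" by (simp only: arc snd_conv)
  show "N0 (fst (\<rho> *\<^sub>R arc \<omega> w)) = \<rho> / sqrt (1 + w\<^sup>2)" using a by (simp only: r_def)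
  show "snd (\<rho> *\<^sub>R arc \<omega> w) = \<rho> * w / sqrt (1 + w\<^sup>2)"
    using b by (simp only: r_def times_divide_eq_left)
  have "(Phi0 H (\<rho> *\<^sub>R arc \<omega> w))\<^sup>2 = (\<rho> / r)\<^sup>2 + (\<rho> / r * w)\<^sup>2"
    by (simp only: Phi0_sq[OF norm_H] a b)
  also have "\<dots> = (\<rho> / r)\<^sup>2 * r\<^sup>2" unfolding r(2) power_mult_distrib[of "\<rho> / r" w] by (simp add: distrib_left)
  also have "\<dots> = \<rho>\<^sup>2" using r(1) by (simp flip: power_mult_distrib)
  finally show "Phi0 H (\<rho> *\<^sub>R arc \<omega> w) = \<rho>"
    using \<open>0 < \<rho>\<close> Phi0_nonneg[OF norm_H] by (auto dest: power2_eq_imp_eq)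
qed

lemma two_sigma: "2 * \<sigma> + 1 = real DIM('a) + \<alpha>"
  by (simp add: \<sigma>_def field_simps)

text \<open>
  The weight \<open>y\<^sup>\<alpha>\<close> is \<open>\<rho>\<^sup>\<alpha>\<close> times a function of the slope, so that the density remains a product of a
  radial and an angular factor.
\<close>

lemma nn_integral_weighted_half_space:
  fixes F :: "'a \<times> real \<Rightarrow> real"
  assumes F [measurable]: "F \<in> borel_measurable borel" and nonneg: "\<And>z. 0 \<le> F z"
  shows "(\<integral>\<^sup>+z. indicator {z. 0 < snd z} z * ennreal (snd z powr \<alpha> * F z) \<partial>lborel) =
    (\<integral>\<^sup>+x. (\<integral>\<^sup>+w. (\<integral>\<^sup>+\<rho>. indicator {0<..} w * indicator {0<..} \<rho> *
        ennreal (\<rho> powr (2 * \<sigma> + 1) * angular_mass w * F (\<rho> *\<^sub>R arc (dir x) w)) \<partial>lborel) \<partial>lborel) \<partial>directions)"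
proof -
  have eq: "indicator {0<..} w * indicator {0<..} \<rho> *
        ennreal (\<rho> ^ DIM('a) * (1 + w\<^sup>2) powr (- (real DIM('a) + 1) / 2)) *
        ennreal (snd (\<rho> *\<^sub>R arc \<omega> w) powr \<alpha> * F (\<rho> *\<^sub>R arc \<omega> w))
      = indicator {0<..} w * indicator {0<..} \<rho> *
        ennreal (\<rho> powr (2 * \<sigma> + 1) * angular_mass w * F (\<rho> *\<^sub>R arc \<omega> w))" for w \<rho> :: real and \<omega>
  proof (cases "0 < w \<and> 0 < \<rho>")
    case True
    have u: "1 + w\<^sup>2 > 0" by (rule one_plus_sq_pos)
    have "snd (\<rho> *\<^sub>R arc \<omega> w) = \<rho> * w * (1 + w\<^sup>2) powr (- 1 / 2)"
      using u by (simp add: arc_def powr_minus_divide powr_half_sqrt)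
    then have s: "snd (\<rho> *\<^sub>R arc \<omega> w) powr \<alpha> = \<rho> powr \<alpha> * (w powr \<alpha> * (1 + w\<^sup>2) powr (- \<alpha> / 2))"
      using True u by (simp add: powr_mult powr_powr)
    have "\<rho> powr (2 * \<sigma> + 1) = \<rho> powr real DIM('a) * \<rho> powr \<alpha>"
      by (simp only: two_sigma powr_add)
    then have r: "\<rho> powr (2 * \<sigma> + 1) = \<rho> ^ DIM('a) * \<rho> powr \<alpha>" using True by (simp add: powr_realpow)
    have "- (real DIM('a) + 1 + \<alpha>) / 2 = - (real DIM('a) + 1) / 2 + - \<alpha> / 2" by (simp add: field_simps)
    then have m: "angular_mass w = (1 + w\<^sup>2) powr (- (real DIM('a) + 1) / 2) * (w powr \<alpha> * (1 + w\<^sup>2) powr (- \<alpha> / 2))"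
      unfolding angular_mass_def by (simp only: powr_add mult_ac)
    show ?thesis
      using True nonneg[of "\<rho> *\<^sub>R arc \<omega> w"] unfolding s r m by (simp add: ennreal_mult[symmetric] mult_ac)
  qed auto
  show ?thesis
  proof (subst nn_integral_half_space[OF norm_N0])
    have [measurable]: "(snd :: 'a \<times> real \<Rightarrow> real) \<in> borel_measurable borel"
      by (intro borel_measurable_continuous_onI continuous_intros)
    show "(\<lambda>z. ennreal (snd z powr \<alpha> * F z)) \<in> borel_measurable borel" by measurable
  qed (simp only: eq)
qed

text \<open>
  The ground state is at least 1 and has finite energy.
\<close>

lemma nn_integral_mass_finite: "(\<integral>\<^sup>+w. indicator {0<..} w * ennreal (angular_mass w) \<partial>lborel) < \<infinity>"
proof -
  have AB: "0 < 4 * (A * B)" using parameters_pos by simp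
  have [measurable]: "angular_mass \<in> borel_measurable borel" unfolding angular_mass_def[abs_def] by measurable
  have "ennreal (4 * (A * B)) * (\<integral>\<^sup>+w. indicator {0<..} w * ennreal (angular_mass w) \<partial>lborel)
      = (\<integral>\<^sup>+w. ennreal (4 * (A * B)) * (indicator {0<..} w * ennreal (angular_mass w)) \<partial>lborel)"
    by (rule nn_integral_cmult[symmetric]) measurable
  also have "\<dots> \<le> (\<integral>\<^sup>+w. indicator {0<..} w * ennreal (angular_weight w * (ground' w)\<^sup>2
      + 4 * (A * B) * angular_mass w * (ground w)\<^sup>2) \<partial>lborel)"
  proof (rule nn_integral_mono)
    fix w :: real
    show "ennreal (4 * (A * B)) * (indicator {0<..} w * ennreal (angular_mass w)) \<le> indicator {0<..} w *
        ennreal (angular_weight w * (ground' w)\<^sup>2 + 4 * (A * B) * angular_mass w * (ground w)\<^sup>2)"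
    proof (cases "0 < w")
      case True
      have "1 \<le> (ground w)\<^sup>2" using ground_pos[OF True] by simp
      then have "4 * (A * B) * angular_mass w * 1 \<le> 4 * (A * B) * angular_mass w * (ground w)\<^sup>2"
        using AB by (intro mult_left_mono) (simp_all add: angular_weights_nonneg)
      moreover have "0 \<le> angular_weight w * (ground' w)\<^sup>2" by (simp add: angular_weights_nonneg)
      ultimately have "4 * (A * B) * angular_mass w
          \<le> angular_weight w * (ground' w)\<^sup>2 + 4 * (A * B) * angular_mass w * (ground w)\<^sup>2" by linarith
      then show ?thesis using True AB
        by (simp add: ennreal_mult[symmetric] angular_weights_nonneg ennreal_leI del: ennreal_plus)
    qed simp
  qed
  also have "\<dots> < \<infinity>" unfolding angular_equality_ground by simp
  finally show ?thesis using AB by (auto simp: ennreal_mult_less_top)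
qed

lemma nn_integral_powr_finite:
  fixes a R :: real
  assumes "-1 < a"
  shows "(\<integral>\<^sup>+s. indicator {0<..R} s * ennreal (s powr a) \<partial>lborel) < \<infinity>"
proof (cases "0 \<le> R")
  case True
  have "(\<integral>\<^sup>+s. indicator {0<..R} s * ennreal (s powr a) \<partial>lborel) \<le>
      (\<integral>\<^sup>+s. ennreal (indicator {0..R} s * s powr a) \<partial>lborel)"
    by (intro nn_integral_mono) (auto simp: indicator_def)
  also have "\<dots> = ennreal (R powr (a + 1) / (a + 1))"
    using has_integral_powr_from_0[OF assms True] by (intro nn_integral_has_integral_lebesgue) auto
  finally show ?thesis by (rule le_less_trans) simp
next
  case False
  then have "{0<..R} = {}" by auto
  then show ?thesis by simp
qed

text \<open>
  The Hardy weight \<open>1 / \<Phi>\<^sub>0\<^sup>2\<close> is integrable at the origin because \<open>\<sigma>\<close> is positive.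
\<close>

lemma nn_integral_weighted_finite:
  fixes F :: "'a \<times> real \<Rightarrow> real"
  assumes F [measurable]: "F \<in> borel_measurable borel" and nonneg: "\<And>z. 0 \<le> F z"
    and bd: "\<And>z. 0 < snd z \<Longrightarrow> F z \<le> C / (Phi0 H z)\<^sup>2" and supp: "\<And>z. 0 < snd z \<Longrightarrow> R < Phi0 H z \<Longrightarrow> F z = 0"
  shows "(\<integral>\<^sup>+z. indicator {z. 0 < snd z} z * ennreal (snd z powr \<alpha> * F z) \<partial>lborel) < \<infinity>"
proof -
  have [measurable]: "angular_mass \<in> borel_measurable borel" unfolding angular_mass_def[abs_def] by measurable
  define J where "J = (\<integral>\<^sup>+\<rho>. indicator {0<..R} \<rho> * ennreal (\<rho> powr (2 * \<sigma> - 1)) \<partial>lborel)"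
  define M where "M = (\<integral>\<^sup>+w. indicator {0<..} w * ennreal (angular_mass w) \<partial>lborel)"
  define C' where "C' = max C 0"
  have fin: "J < \<infinity>" "M < \<infinity>" unfolding J_def M_def
    using parameters_pos by (intro nn_integral_powr_finite nn_integral_mass_finite; simp)+
  have "(\<integral>\<^sup>+z. indicator {z. 0 < snd z} z * ennreal (snd z powr \<alpha> * F z) \<partial>lborel)
      \<le> (\<integral>\<^sup>+x. (\<integral>\<^sup>+w. (\<integral>\<^sup>+\<rho>. ennreal C' * (indicator {0<..} w * ennreal (angular_mass w)) *
         (indicator {0<..R} \<rho> * ennreal (\<rho> powr (2 * \<sigma> - 1))) \<partial>lborel) \<partial>lborel) \<partial>directions)"
    unfolding nn_integral_weighted_half_space[OF F nonneg]
  proof (rule nn_integral_mono_AE)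
    show "AE x in directions. (\<integral>\<^sup>+w. (\<integral>\<^sup>+\<rho>. indicator {0<..} w * indicator {0<..} \<rho> *
        ennreal (\<rho> powr (2 * \<sigma> + 1) * angular_mass w * F (\<rho> *\<^sub>R arc (dir x) w)) \<partial>lborel) \<partial>lborel)
      \<le> (\<integral>\<^sup>+w. (\<integral>\<^sup>+\<rho>. ennreal C' * (indicator {0<..} w * ennreal (angular_mass w)) *
         (indicator {0<..R} \<rho> * ennreal (\<rho> powr (2 * \<sigma> - 1))) \<partial>lborel) \<partial>lborel)"
      using AE_directions
    proof eventually_elim
      case (elim x)
      show ?case
      proof (intro nn_integral_mono)
        fix w \<rho> :: real
        show "indicator {0<..} w * indicator {0<..} \<rho> *
            ennreal (\<rho> powr (2 * \<sigma> + 1) * angular_mass w * F (\<rho> *\<^sub>R arc (dir x) w))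
          \<le> ennreal C' * (indicator {0<..} w * ennreal (angular_mass w)) *
            (indicator {0<..R} \<rho> * ennreal (\<rho> powr (2 * \<sigma> - 1)))"
        proof (cases "0 < w \<and> 0 < \<rho>")
          case True
          define z where "z = \<rho> *\<^sub>R arc (dir x) w"
          have z: "0 < snd z" "Phi0 H z = \<rho>"
            unfolding z_def using arc_norms[OF elim, of \<rho> w] True one_plus_sq_pos[of w] by auto
          show ?thesis
          proof (cases "\<rho> \<le> R")
            case le: True
            have p: "\<rho> powr (2 * \<sigma> + 1) = \<rho> powr (2 * \<sigma> - 1) * \<rho>\<^sup>2"
            proof -
              have "2 * \<sigma> + 1 = 2 * \<sigma> - 1 + 2" by simp
              then have "\<rho> powr (2 * \<sigma> + 1) = \<rho> powr (2 * \<sigma> - 1) * \<rho> powr 2" by (simp only: powr_add)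
              then show ?thesis using True by simp
            qed
            have "F z * \<rho>\<^sup>2 \<le> C'"
              using bd[OF z(1)] True unfolding z(2) C'_def by (simp add: field_simps)
            then have "\<rho> powr (2 * \<sigma> - 1) * angular_mass w * (F z * \<rho>\<^sup>2) \<le> \<rho> powr (2 * \<sigma> - 1) * angular_mass w * C'"
              by (intro mult_left_mono) (simp_all add: angular_weights_nonneg)
            then have "\<rho> powr (2 * \<sigma> + 1) * angular_mass w * F z \<le> C' * angular_mass w * \<rho> powr (2 * \<sigma> - 1)"
              unfolding p by (simp add: mult_ac)
            then show ?thesis using True le
              by (simp add: z_def[symmetric] ennreal_mult[symmetric] angular_weights_nonneg C'_def ennreal_leI)
          next
            case False
            then show ?thesis using supp[OF z(1)] z(2) by (simp add: z_def[symmetric])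
          qed
        qed auto
      qed
    qed
  qed
  also have "\<dots> = (\<integral>\<^sup>+x. (\<integral>\<^sup>+w. ennreal C' * (indicator {0<..} w * ennreal (angular_mass w)) * J \<partial>lborel) \<partial>directions)"
    unfolding J_def by (intro nn_integral_cong nn_integral_cmult) measurable
  also have "\<dots> = ennreal C' * M * J * emeasure directions UNIV"
    unfolding M_def by (simp add: nn_integral_multc nn_integral_cmult cone_measure_def)
  also have "\<dots> < \<infinity>"
    using fin emeasure_cone_measure(1)[OF norm_N0] by (simp add: ennreal_mult_less_top)
  finally show ?thesis .
qed

text \<open>
  The gradient is tested in the plane spanned by the radius \<open>arc \<omega> w\<close> and by the tangent of the arc. On
  this plane \<open>\<Phi>\<^sub>0\<close> is a Euclidean norm for which the two vectors are orthonormal; testing with the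
  combination whose coefficients are the two derivatives themselves and using duality gives Bessel's
  inequality.
\<close>

lemma Phi_ge_radial_angular:
  assumes \<omega>: "N0 \<omega> = 1"
  shows "(inner \<zeta> (arc \<omega> w))\<^sup>2 + (inner \<zeta> ((1 / sqrt (1 + w\<^sup>2)) *\<^sub>R (- w *\<^sub>R \<omega>, 1)))\<^sup>2 \<le> (Phi H \<zeta>)\<^sup>2"
proof -
  define c where "c = 1 / sqrt (1 + w\<^sup>2)"
  have c2: "c\<^sup>2 * (1 + w\<^sup>2) = 1"
    unfolding c_def using one_plus_sq_pos[of w] by (simp add: power_divide)
  define t where "t = c *\<^sub>R (- w *\<^sub>R \<omega>, 1::real)"
  define p q where "p = inner \<zeta> (arc \<omega> w)" and "q = inner \<zeta> t"
  define z where "z = p *\<^sub>R arc \<omega> w + q *\<^sub>R t"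
  have arc: "arc \<omega> w = (c *\<^sub>R \<omega>, c * w)" by (simp add: arc_def c_def)
  have f: "fst z = (c * (p - q * w)) *\<^sub>R \<omega>" and s: "snd z = c * (p * w + q)"
    by (simp_all add: z_def arc t_def algebra_simps)
  have "(Phi0 H z)\<^sup>2 = (c * (p - q * w))\<^sup>2 + (c * (p * w + q))\<^sup>2"
    by (simp only: Phi0_sq[OF norm_H] f s norm_scale[OF norm_N0] \<omega> mult_1_right power2_abs)
  also have "\<dots> = (p\<^sup>2 + q\<^sup>2) * (c\<^sup>2 * (1 + w\<^sup>2))" by (simp add: power2_eq_square algebra_simps)
  finally have z2: "(Phi0 H z)\<^sup>2 = p\<^sup>2 + q\<^sup>2" by (simp add: c2)
  have "inner z \<zeta> = p\<^sup>2 + q\<^sup>2"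
    by (simp add: z_def inner_add_right p_def q_def power2_eq_square inner_commute[of _ \<zeta>])
  then have le: "(Phi0 H z)\<^sup>2 \<le> Phi0 H z * Phi H \<zeta>" using inner_le_Phi[OF norm_H, of z \<zeta>] by (simp add: z2)
  have "Phi0 H z \<le> Phi H \<zeta>"
  proof (cases "Phi0 H z = 0")
    case False
    then have "0 < Phi0 H z" using Phi0_nonneg[OF norm_H, of z] by linarith
    then show ?thesis using le by (simp add: power2_eq_square)
  qed (simp add: Phi_nonneg[OF norm_H])
  then have "(Phi0 H z)\<^sup>2 \<le> (Phi H \<zeta>)\<^sup>2" using Phi0_nonneg[OF norm_H] by (rule power_mono)
  then show ?thesis unfolding z2 p_def q_def t_def c_def .
qed

lemma arc_deriv:
  "((\<lambda>w. arc \<omega> w) has_vector_derivative (1 / (1 + w\<^sup>2)) *\<^sub>R ((1 / sqrt (1 + w\<^sup>2)) *\<^sub>R (- w *\<^sub>R \<omega>, 1))) (at w)"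
proof -
  have u: "0 < 1 + w\<^sup>2" by (rule one_plus_sq_pos)
  define r where "r = sqrt (1 + w\<^sup>2)"
  have r: "r > 0" "r\<^sup>2 = 1 + w\<^sup>2" using u by (auto simp: r_def)
  have "((\<lambda>w. 1 + w\<^sup>2) has_real_derivative 2 * w) (at w)"
    by (auto intro!: derivative_eq_intros)
  from DERIV_chain2[OF DERIV_real_sqrt[OF u] this]
  have "((\<lambda>w. sqrt (1 + w\<^sup>2)) has_real_derivative inverse r / 2 * (2 * w)) (at w)"
    unfolding r_def .
  from DERIV_inverse_fun[OF this]
  have "((\<lambda>w. inverse (sqrt (1 + w\<^sup>2))) has_real_derivative - (w / r ^ 3)) (at w)"
    using r(1) unfolding r_def[symmetric] by (simp add: field_simps power3_eq_cube)
  moreover have "((\<lambda>w. (\<omega>, w)) has_vector_derivative (0, 1)) (at w)"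
    by (intro has_vector_derivative_Pair has_vector_derivative_const has_vector_derivative_id)
  ultimately have d: "((\<lambda>w. inverse (sqrt (1 + w\<^sup>2)) *\<^sub>R (\<omega>, w)) has_vector_derivative
      inverse r *\<^sub>R (0, 1) + (- (w / r ^ 3)) *\<^sub>R (\<omega>, w)) (at w)"
    unfolding r_def by (rule has_vector_derivative_scaleR)
  have "1 / r - w / r ^ 3 * w = 1 / r ^ 2 * (1 / r)"
  proof -
    have "1 / r = r\<^sup>2 / r ^ 3" using r(1) by (simp add: power2_eq_square power3_eq_cube)
    then have "1 / r - w / r ^ 3 * w = (r\<^sup>2 - w * w) / r ^ 3" by (simp only: diff_divide_distrib times_divide_eq_left)
    also have "r\<^sup>2 - w * w = 1" unfolding r(2) by (simp add: power2_eq_square)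
    finally show ?thesis by (simp add: power2_eq_square power3_eq_cube)
  qed
  then have "inverse r *\<^sub>R (0, 1) + (- (w / r ^ 3)) *\<^sub>R (\<omega>, w) = (1 / r\<^sup>2) *\<^sub>R ((1 / r) *\<^sub>R (- w *\<^sub>R \<omega>, 1))"
    by (intro prod_eqI) (simp_all add: divide_inverse power2_eq_square power3_eq_cube mult_ac)
  moreover have "(\<lambda>w. inverse (sqrt (1 + w\<^sup>2)) *\<^sub>R (\<omega>, w)) = (\<lambda>w. arc \<omega> w)"
    by (simp add: arc_def divide_inverse)
  ultimately show ?thesis using d unfolding r_def[symmetric] unfolding r(2)[symmetric] by (simp only:)
qed

text \<open>
  A compact support in \<open>U\<close> keeps \<open>\<Phi>\<^sub>0 / D\<close> away from 1 in the closed half-space.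
\<close>

lemma test_function_facts:
  assumes u: "u \<in> test_functions U"
  obtains M d where "continuous_on UNIV u" "\<And>z. GDERIV u z :> grad u z" "continuous_on UNIV (grad u)"
    "\<And>z. \<bar>u z\<bar> \<le> M" "\<And>z. (Phi H (grad u z))\<^sup>2 \<le> M" "0 < d" "d < D"
    "\<And>z. 0 \<le> snd z \<Longrightarrow> d \<le> Phi0 H z \<Longrightarrow> u z = 0 \<and> grad u z = 0"
    "\<And>z. z \<notin> U \<Longrightarrow> u z = 0 \<and> grad u z = 0"
proof -
  define S where "S = closure {z. u z \<noteq> 0}"
  have S: "compact S" "S \<subseteq> U" and C1: "Ck_on (Suc 0) u UNIV"
    using u unfolding test_functions_def S_def by blast+
  have d: "(u has_derivative frechet_derivative u (at z)) (at z)" for z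
    by (rule Ck_on_SucE(1)[OF C1]) simp
  have fc: "continuous_on UNIV (\<lambda>z. frechet_derivative u (at z) v)" for v
    using Ck_on_SucE(2)[OF C1, of v] by simp
  have g: "GDERIV u z :> grad u z" for z by (rule GDERIV_grad(1)[OF d])
  have ge: "grad u = (\<lambda>z. \<Sum>b\<in>Basis. frechet_derivative u (at z) b *\<^sub>R b)"
    by (rule ext) (rule GDERIV_grad(3)[OF d])
  have gc: "continuous_on UNIV (grad u)" unfolding ge by (intro continuous_intros fc)
  have uc: "continuous_on UNIV u" by (rule Ck_on_continuous[OF C1])
  have out: "u z = 0 \<and> grad u z = 0" if "z \<notin> S" for z
  proof -
    have 0: "u x = 0" if "x \<in> - S" for x
      using that closure_subset[of "{z. u z \<noteq> 0}"] unfolding S_def by blast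
    have "open (- S)" using S(1) by (simp add: compact_imp_closed open_Compl)
    moreover have "((\<lambda>x. 0) has_derivative (\<lambda>h. 0)) (at z)" by simp
    ultimately have "(u has_derivative (\<lambda>h. 0)) (at z)"
      using that 0 by (intro has_derivative_transform_within_open[of "\<lambda>x. 0" _ z UNIV "- S" u]) auto
    then have "GDERIV u z :> 0" by (simp add: gderiv_def)
    then show ?thesis using grad_eq 0 that by blast
  qed
  have Pc: "continuous_on UNIV (\<lambda>z. (Phi H (grad u z))\<^sup>2)"
    unfolding Phi_sq[OF norm_H]
    by (intro continuous_intros continuous_on_compose2[OF norm_continuous[OF norm_H, of UNIV]] gc) auto
  have bdd: "\<exists>M. \<forall>z. \<bar>f z\<bar> \<le> M" if "continuous_on UNIV f" "\<And>z. z \<notin> S \<Longrightarrow> f z = 0" for f :: "'a \<times> real \<Rightarrow> real"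
  proof -
    have "bounded (f ` S)"
      using S(1) that(1) by (intro compact_imp_bounded compact_continuous_image) (auto intro: continuous_on_subset)
    then obtain M where "\<And>z. z \<in> S \<Longrightarrow> \<bar>f z\<bar> \<le> M" by (auto simp: bounded_iff)
    have "\<bar>f z\<bar> \<le> max M 0" for z
    proof (cases "z \<in> S")
      case True
      then show ?thesis using \<open>\<And>z. z \<in> S \<Longrightarrow> \<bar>f z\<bar> \<le> M\<close>[of z] by linarith
    next
      case False
      then show ?thesis using that(2)[of z] by simp
    qed
    then show ?thesis by blast
  qed
  obtain M1 where M1: "\<And>z. \<bar>u z\<bar> \<le> M1" using bdd[OF uc] out by blast
  have "(Phi H (grad u z))\<^sup>2 = 0" if "z \<notin> S" for z
    using out[OF that] by (simp add: Phi_sq[OF norm_H] norm_zero[OF norm_H])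
  then obtain M2 where M2: "\<And>z. \<bar>(Phi H (grad u z))\<^sup>2\<bar> \<le> M2" using bdd[OF Pc] by blast
  define T where "T = S \<inter> {z. 0 \<le> snd z}"
  have "closed {z::'a \<times> real. 0 \<le> snd z}" by (intro closed_Collect_le continuous_intros)
  then have T: "compact T" unfolding T_def using S(1) by (intro compact_Int_closed)
  have "\<exists>d. 0 < d \<and> d < D \<and> (\<forall>z\<in>T. Phi0 H z < d)"
  proof (cases "T = {}")
    case True
    then show ?thesis using D_pos dense by blast
  next
    case False
    obtain z0 where z0: "z0 \<in> T" "\<And>z. z \<in> T \<Longrightarrow> Phi0 H z \<le> Phi0 H z0"
      using continuous_attains_sup[OF T False norm_continuous[OF norm_Phi0]] by blast
    have "Phi0 H z0 < D" using z0(1) S(2) by (intro Phi0_less_D) (auto simp: T_def)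
    then obtain d where "Phi0 H z0 < d" "d < D" using dense by blast
    then show ?thesis using z0(2) Phi0_nonneg[OF norm_H, of z0] by (meson le_less_trans)
  qed
  then obtain d where d: "0 < d" "d < D" "\<And>z. z \<in> T \<Longrightarrow> Phi0 H z < d" by blast
  show ?thesis
  proof (rule that[of "max M1 M2" d])
    show "\<bar>u z\<bar> \<le> max M1 M2" for z using M1[of z] by simp
    show "(Phi H (grad u z))\<^sup>2 \<le> max M1 M2" for z using M2[of z] by simp
    show "u z = 0 \<and> grad u z = 0" if "0 \<le> snd z" "d \<le> Phi0 H z" for z
      using d(3)[of z] that out[of z] by (auto simp: T_def)
    show "u z = 0 \<and> grad u z = 0" if "z \<notin> U" for z using out[of z] S(2) that by blast
  qed (use uc g gc d in auto)
qed

text \<open>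
  Test functions vanish outside \<open>U\<close>, so that the integrals may be taken over the whole half-space. With
  values in \<open>[0, \<infinity>]\<close> they can be rearranged before they are known to be finite.
\<close>

definition nn_energy where
  "nn_energy u = (\<integral>\<^sup>+z. indicator {z. 0 < snd z} z * ennreal (snd z powr \<alpha> * (Phi H (grad u z))\<^sup>2) \<partial>lborel)"
definition nn_hardy where
  "nn_hardy f u = (\<integral>\<^sup>+z. indicator {z. 0 < snd z} z *
      ennreal (snd z powr \<alpha> * (f (Phi0 H z / D) / (Phi0 H z)\<^sup>2 * (u z)\<^sup>2)) \<partial>lborel)"
definition nn_trace where
  "nn_trace u = (\<integral>\<^sup>+x. ennreal ((u (x, 0::real))\<^sup>2 / N0 x powr (1 - \<alpha>)) \<partial>lborel)"

lemma nn_trace_polar: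
  assumes [measurable]: "u \<in> borel_measurable borel"
  shows "nn_trace u = (\<integral>\<^sup>+x. (\<integral>\<^sup>+\<rho>. indicator {0<..} \<rho> *
      ennreal (\<rho> powr (2 * \<sigma> - 1) * (u (\<rho> *\<^sub>R dir x, 0))\<^sup>2) \<partial>lborel) \<partial>directions)"
proof -
  have "(\<lambda>x. (x, 0::real)) \<in> borel_measurable (borel :: 'a measure)"
    by (intro borel_measurable_continuous_onI continuous_intros)
  from measurable_compose[OF this assms]
  have [measurable]: "(\<lambda>x. u (x, 0)) \<in> borel_measurable borel" .
  have "nn_trace u = (\<integral>\<^sup>+x. (\<integral>\<^sup>+\<rho>. indicator {0<..} \<rho> * ennreal (\<rho> ^ (DIM('a) - 1)) *
      ennreal ((u (\<rho> *\<^sub>R dir x, 0))\<^sup>2 / N0 (\<rho> *\<^sub>R dir x) powr (1 - \<alpha>)) \<partial>lborel) \<partial>directions)"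
    unfolding nn_trace_def by (rule nn_integral_polar[OF norm_N0]) measurable
  also have "\<dots> = (\<integral>\<^sup>+x. (\<integral>\<^sup>+\<rho>. indicator {0<..} \<rho> *
      ennreal (\<rho> powr (2 * \<sigma> - 1) * (u (\<rho> *\<^sub>R dir x, 0))\<^sup>2) \<partial>lborel) \<partial>directions)"
  proof (rule nn_integral_cong_AE)
    show "AE x in directions. (\<integral>\<^sup>+\<rho>. indicator {0<..} \<rho> * ennreal (\<rho> ^ (DIM('a) - 1)) *
        ennreal ((u (\<rho> *\<^sub>R dir x, 0))\<^sup>2 / N0 (\<rho> *\<^sub>R dir x) powr (1 - \<alpha>)) \<partial>lborel)
      = (\<integral>\<^sup>+\<rho>. indicator {0<..} \<rho> * ennreal (\<rho> powr (2 * \<sigma> - 1) * (u (\<rho> *\<^sub>R dir x, 0))\<^sup>2) \<partial>lborel)"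
      using AE_directions
    proof eventually_elim
      case (elim x)
      show ?case
      proof (rule nn_integral_cong)
        fix \<rho> :: real
        show "indicator {0<..} \<rho> * ennreal (\<rho> ^ (DIM('a) - 1)) *
            ennreal ((u (\<rho> *\<^sub>R dir x, 0))\<^sup>2 / N0 (\<rho> *\<^sub>R dir x) powr (1 - \<alpha>))
          = indicator {0<..} \<rho> * ennreal (\<rho> powr (2 * \<sigma> - 1) * (u (\<rho> *\<^sub>R dir x, 0))\<^sup>2)"
        proof (cases "0 < \<rho>")
          case True
          have "N0 (\<rho> *\<^sub>R dir x) = \<bar>\<rho>\<bar> * N0 (dir x)" by (rule norm_scale[OF norm_N0])
          then have N: "N0 (\<rho> *\<^sub>R dir x) = \<rho>" unfolding elim using True by (simp only: abs_of_pos mult_1_right)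
          have "2 * \<sigma> - 1 = (real DIM('a) - 1) - (1 - \<alpha>)" using two_sigma by linarith
          then have "\<rho> powr (2 * \<sigma> - 1) = \<rho> powr (real DIM('a) - 1) / \<rho> powr (1 - \<alpha>)"
            by (simp only: powr_diff)
          moreover have "real DIM('a) - 1 = real (DIM('a) - 1)"
            using DIM_positive[where 'a = 'a] by (simp add: of_nat_diff Suc_leI)
          ultimately have p: "\<rho> powr (2 * \<sigma> - 1) = \<rho> ^ (DIM('a) - 1) / \<rho> powr (1 - \<alpha>)"
            using True by (simp only: powr_realpow)
          have "ennreal (\<rho> ^ (DIM('a) - 1)) * ennreal ((u (\<rho> *\<^sub>R dir x, 0))\<^sup>2 / \<rho> powr (1 - \<alpha>))
              = ennreal (\<rho> ^ (DIM('a) - 1) * ((u (\<rho> *\<^sub>R dir x, 0))\<^sup>2 / \<rho> powr (1 - \<alpha>)))"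
            using True by (intro ennreal_mult[symmetric]) auto
          also have "\<rho> ^ (DIM('a) - 1) * ((u (\<rho> *\<^sub>R dir x, 0))\<^sup>2 / \<rho> powr (1 - \<alpha>))
              = \<rho> powr (2 * \<sigma> - 1) * (u (\<rho> *\<^sub>R dir x, 0))\<^sup>2"
            unfolding p by (simp only: times_divide_eq_left times_divide_eq_right)
          finally show ?thesis by (simp only: N mult.assoc)
        qed simp
      qed
    qed
  qed
  finally show ?thesis .
qed

lemma nn_hardy_polar:
  assumes [measurable]: "u \<in> borel_measurable borel" "f \<in> borel_measurable borel" and f: "\<And>\<rho>. 0 \<le> f \<rho>"
  shows "nn_hardy f u = (\<integral>\<^sup>+x. (\<integral>\<^sup>+w. (\<integral>\<^sup>+\<rho>. indicator {0<..} w * indicator {0<..} \<rho> *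
      ennreal (\<rho> powr (2 * \<sigma> - 1) * angular_mass w * (f (\<rho> / D) * (u (\<rho> *\<^sub>R arc (dir x) w))\<^sup>2)) \<partial>lborel) \<partial>lborel) \<partial>directions)"
proof -
  have "nn_hardy f u = (\<integral>\<^sup>+x. (\<integral>\<^sup>+w. (\<integral>\<^sup>+\<rho>. indicator {0<..} w * indicator {0<..} \<rho> *
      ennreal (\<rho> powr (2 * \<sigma> + 1) * angular_mass w * (f (Phi0 H (\<rho> *\<^sub>R arc (dir x) w) / D)
        / (Phi0 H (\<rho> *\<^sub>R arc (dir x) w))\<^sup>2 * (u (\<rho> *\<^sub>R arc (dir x) w))\<^sup>2)) \<partial>lborel) \<partial>lborel) \<partial>directions)"
    unfolding nn_hardy_def
  proof (rule nn_integral_weighted_half_space)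
    show "(\<lambda>z. f (Phi0 H z / D) / (Phi0 H z)\<^sup>2 * (u z)\<^sup>2) \<in> borel_measurable borel" by measurable
  qed (simp add: f)
  also have "\<dots> = (\<integral>\<^sup>+x. (\<integral>\<^sup>+w. (\<integral>\<^sup>+\<rho>. indicator {0<..} w * indicator {0<..} \<rho> *
      ennreal (\<rho> powr (2 * \<sigma> - 1) * angular_mass w * (f (\<rho> / D) * (u (\<rho> *\<^sub>R arc (dir x) w))\<^sup>2)) \<partial>lborel) \<partial>lborel) \<partial>directions)"
  proof (rule nn_integral_cong_AE)
    show "AE x in directions. (\<integral>\<^sup>+w. (\<integral>\<^sup>+\<rho>. indicator {0<..} w * indicator {0<..} \<rho> *
      ennreal (\<rho> powr (2 * \<sigma> + 1) * angular_mass w * (f (Phi0 H (\<rho> *\<^sub>R arc (dir x) w) / D)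
        / (Phi0 H (\<rho> *\<^sub>R arc (dir x) w))\<^sup>2 * (u (\<rho> *\<^sub>R arc (dir x) w))\<^sup>2)) \<partial>lborel) \<partial>lborel)
      = (\<integral>\<^sup>+w. (\<integral>\<^sup>+\<rho>. indicator {0<..} w * indicator {0<..} \<rho> *
      ennreal (\<rho> powr (2 * \<sigma> - 1) * angular_mass w * (f (\<rho> / D) * (u (\<rho> *\<^sub>R arc (dir x) w))\<^sup>2)) \<partial>lborel) \<partial>lborel)"
      using AE_directions
    proof eventually_elim
      case (elim x)
      show ?case
      proof (intro nn_integral_cong)
        fix w \<rho> :: real
        show "indicator {0<..} w * indicator {0<..} \<rho> *
          ennreal (\<rho> powr (2 * \<sigma> + 1) * angular_mass w * (f (Phi0 H (\<rho> *\<^sub>R arc (dir x) w) / D)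
            / (Phi0 H (\<rho> *\<^sub>R arc (dir x) w))\<^sup>2 * (u (\<rho> *\<^sub>R arc (dir x) w))\<^sup>2))
          = indicator {0<..} w * indicator {0<..} \<rho> *
          ennreal (\<rho> powr (2 * \<sigma> - 1) * angular_mass w * (f (\<rho> / D) * (u (\<rho> *\<^sub>R arc (dir x) w))\<^sup>2))"
        proof (cases "0 < \<rho>")
          case True
          have p: "\<rho> powr (2 * \<sigma> + 1) = \<rho> powr (2 * \<sigma> - 1) * \<rho>\<^sup>2"
          proof -
            have "2 * \<sigma> + 1 = 2 * \<sigma> - 1 + 2" by simp
            then have "\<rho> powr (2 * \<sigma> + 1) = \<rho> powr (2 * \<sigma> - 1) * \<rho> powr 2" by (simp only: powr_add)
            then show ?thesis using True by simp
          qed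
          have "\<rho>\<^sup>2 * m * (y / \<rho>\<^sup>2 * z) = m * (y * z)" for m y z using True by simp
          then have "\<rho> powr (2 * \<sigma> - 1) * \<rho>\<^sup>2 * m * (y / \<rho>\<^sup>2 * z) = \<rho> powr (2 * \<sigma> - 1) * m * (y * z)" for m y z
            by (simp only: mult.assoc)
          then show ?thesis unfolding arc_norms(3)[OF elim True] p by (simp only:)
        qed simp
      qed
    qed
  qed
  finally show ?thesis .
qed

lemma angular_weights_measurable [measurable]:
  "angular_mass \<in> borel_measurable borel" "angular_weight \<in> borel_measurable borel"
  unfolding angular_mass_def[abs_def] angular_weight_def[abs_def] by measurable

lemma log_square_sum_measurable [measurable]: "log_square_sum k \<in> borel_measurable borel"
  unfolding log_square_sum_def[abs_def] by measurable

definition unit_tangent where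
  "unit_tangent x w = (1 / sqrt (1 + w\<^sup>2)) *\<^sub>R (- w *\<^sub>R dir x, 1::real)"
definition on_arcs where "on_arcs u x w \<rho> = u (\<rho> *\<^sub>R arc (dir x) w)"
definition radial where
  "radial u x w \<rho> = inner (grad u (\<rho> *\<^sub>R arc (dir x) w)) (arc (dir x) w)"
definition angular where
  "angular u x w \<rho> = inner (grad u (\<rho> *\<^sub>R arc (dir x) w)) (\<rho> *\<^sub>R (1 / (1 + w\<^sup>2)) *\<^sub>R unit_tangent x w)"

lemma unit_tangent_measurable [measurable (raw)]:
  assumes [measurable]: "f \<in> borel_measurable M" "g \<in> borel_measurable M"
  shows "(\<lambda>y. unit_tangent (f y) (g y)) \<in> borel_measurable M"
  unfolding unit_tangent_def by measurable

lemma Phi_measurable [measurable]: "Phi H \<in> borel_measurable borel"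
proof -
  have "continuous_on UNIV (Phi H)"
    unfolding Phi_def case_prod_beta
    by (intro continuous_intros continuous_on_compose2[OF norm_continuous[OF norm_H, of UNIV]]) auto
  then show ?thesis by (rule borel_measurable_continuous_onI)
qed

lemma powr_two_sigma:
  assumes "0 < \<rho>"
  shows "\<rho> powr (2 * \<sigma> + 1) = \<rho> powr (2 * \<sigma> - 1) * \<rho>\<^sup>2"
proof -
  have "2 * \<sigma> + 1 = 2 * \<sigma> - 1 + 2" by simp
  then have "\<rho> powr (2 * \<sigma> + 1) = \<rho> powr (2 * \<sigma> - 1) * \<rho> powr 2" by (simp only: powr_add)
  then show ?thesis using assms by simp
qed

lemma angular_weight_eq_mass: "angular_weight w = angular_mass w * (1 + w\<^sup>2)\<^sup>2"
proof -
  have "(3 - real DIM('a) - \<alpha>) / 2 = - (real DIM('a) + 1 + \<alpha>) / 2 + 2" by (simp add: field_simps)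
  then have "(1 + w\<^sup>2) powr ((3 - real DIM('a) - \<alpha>) / 2) = (1 + w\<^sup>2) powr (- (real DIM('a) + 1 + \<alpha>) / 2) * (1 + w\<^sup>2) powr 2"
    by (simp only: powr_add)
  moreover have "(1 + w\<^sup>2) powr 2 = (1 + w\<^sup>2)\<^sup>2" using one_plus_sq_pos(1)[of w] by simp
  ultimately show ?thesis unfolding angular_weight_def angular_mass_def by (simp only: mult.assoc)
qed

lemma nn_integral3_add:
  assumes "\<And>x w. (\<lambda>\<rho>. a x w \<rho>) \<in> borel_measurable lborel"
    "\<And>x. (\<lambda>w. \<integral>\<^sup>+\<rho>. a x w \<rho> \<partial>lborel) \<in> borel_measurable lborel"
    "(\<lambda>x. \<integral>\<^sup>+w. \<integral>\<^sup>+\<rho>. a x w \<rho> \<partial>lborel \<partial>lborel) \<in> borel_measurable directions"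
    "\<And>x w. (\<lambda>\<rho>. c x w \<rho>) \<in> borel_measurable lborel"
    "\<And>x. (\<lambda>w. \<integral>\<^sup>+\<rho>. c x w \<rho> \<partial>lborel) \<in> borel_measurable lborel"
    "(\<lambda>x. \<integral>\<^sup>+w. \<integral>\<^sup>+\<rho>. c x w \<rho> \<partial>lborel \<partial>lborel) \<in> borel_measurable directions"
  shows "(\<integral>\<^sup>+x. (\<integral>\<^sup>+w. (\<integral>\<^sup>+\<rho>. a x w \<rho> + c x w \<rho> \<partial>lborel) \<partial>lborel) \<partial>directions) =
    (\<integral>\<^sup>+x. (\<integral>\<^sup>+w. (\<integral>\<^sup>+\<rho>. a x w \<rho> \<partial>lborel) \<partial>lborel) \<partial>directions) +
    (\<integral>\<^sup>+x. (\<integral>\<^sup>+w. (\<integral>\<^sup>+\<rho>. c x w \<rho> \<partial>lborel) \<partial>lborel) \<partial>directions)"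
  using assms by (simp add: nn_integral_add)

lemma nn_integral3_cmult:
  assumes "\<And>x w. (\<lambda>\<rho>. a x w \<rho>) \<in> borel_measurable lborel"
    "\<And>x. (\<lambda>w. \<integral>\<^sup>+\<rho>. a x w \<rho> \<partial>lborel) \<in> borel_measurable lborel"
    "(\<lambda>x. \<integral>\<^sup>+w. \<integral>\<^sup>+\<rho>. a x w \<rho> \<partial>lborel \<partial>lborel) \<in> borel_measurable directions"
  shows "(\<integral>\<^sup>+x. (\<integral>\<^sup>+w. (\<integral>\<^sup>+\<rho>. r * a x w \<rho> \<partial>lborel) \<partial>lborel) \<partial>directions) =
    r * (\<integral>\<^sup>+x. (\<integral>\<^sup>+w. (\<integral>\<^sup>+\<rho>. a x w \<rho> \<partial>lborel) \<partial>lborel) \<partial>directions)"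
  using assms by (simp add: nn_integral_cmult)

context
  fixes u :: "'a \<times> real \<Rightarrow> real"
  assumes u_cont: "continuous_on UNIV u" and u_grad: "\<And>z. GDERIV u z :> grad u z"
    and grad_cont: "continuous_on UNIV (grad u)"
begin

lemma u_measurable [measurable]: "u \<in> borel_measurable borel"
  by (rule borel_measurable_continuous_onI[OF u_cont])

lemma grad_measurable [measurable]: "grad u \<in> borel_measurable borel"
  by (rule borel_measurable_continuous_onI[OF grad_cont])

lemma radial_deriv: "((\<lambda>\<rho>. on_arcs u x w \<rho>) has_real_derivative radial u x w \<rho>) (at \<rho>)"
proof -
  have "((\<lambda>\<rho>. \<rho> *\<^sub>R arc (dir x) w) has_derivative (\<lambda>h. h *\<^sub>R arc (dir x) w)) (at \<rho>)"
    by (rule bounded_linear_imp_has_derivative[OF bounded_linear_scaleR_left])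
  from has_derivative_compose[OF this u_grad[of "\<rho> *\<^sub>R arc (dir x) w", unfolded gderiv_def]]
  have "((\<lambda>\<rho>. on_arcs u x w \<rho>) has_derivative (\<lambda>h. h * inner (arc (dir x) w) (grad u (\<rho> *\<^sub>R arc (dir x) w)))) (at \<rho>)"
    unfolding on_arcs_def by (simp only: inner_scaleR_left)
  then show ?thesis unfolding radial_def has_field_derivative_def inner_commute[of "grad u _"]
    by (simp only: mult_commute_abs)
qed

lemma angular_deriv: "((\<lambda>w. on_arcs u x w \<rho>) has_real_derivative angular u x w \<rho>) (at w)"
proof -
  have "((\<lambda>w. \<rho> *\<^sub>R arc (dir x) w) has_vector_derivative \<rho> *\<^sub>R (1 / (1 + w\<^sup>2)) *\<^sub>R unit_tangent x w) (at w)"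
    unfolding unit_tangent_def by (rule bounded_linear.has_vector_derivative[OF bounded_linear_scaleR_right arc_deriv])
  then have "((\<lambda>w. \<rho> *\<^sub>R arc (dir x) w) has_derivative (\<lambda>h. h *\<^sub>R (\<rho> *\<^sub>R (1 / (1 + w\<^sup>2)) *\<^sub>R unit_tangent x w))) (at w)"
    by (simp only: has_vector_derivative_def)
  from has_derivative_compose[OF this u_grad[of "\<rho> *\<^sub>R arc (dir x) w", unfolded gderiv_def]]
  have "((\<lambda>w. on_arcs u x w \<rho>) has_derivative (\<lambda>h. h * inner (\<rho> *\<^sub>R (1 / (1 + w\<^sup>2)) *\<^sub>R unit_tangent x w) (grad u (\<rho> *\<^sub>R arc (dir x) w)))) (at w)"
    unfolding on_arcs_def inner_scaleR_left[of "_::real" "\<rho> *\<^sub>R (1 / (1 + w\<^sup>2)) *\<^sub>R unit_tangent x w"] .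
  then show ?thesis unfolding angular_def has_field_derivative_def inner_commute[of "grad u _"]
    by (simp only: mult_commute_abs)
qed

lemma radial_continuous: "continuous_on S (radial u x w)"
  unfolding radial_def[abs_def]
  by (intro continuous_intros continuous_on_compose2[OF grad_cont]) auto

lemma angular_continuous: "continuous_on S (\<lambda>w. angular u x w \<rho>)"
proof -
  have arc_c: "continuous_on S (\<lambda>w. arc \<omega> w)" for S and \<omega> :: 'a
    by (auto intro!: continuous_at_imp_continuous_on has_vector_derivative_continuous[OF arc_deriv])
  have nz: "1 + w\<^sup>2 \<noteq> 0" "sqrt (1 + w\<^sup>2) \<noteq> 0" for w :: real using one_plus_sq_pos[of w] by simp_all
  show ?thesis
    unfolding angular_def unit_tangent_def
    by (intro continuous_intros continuous_on_compose2[OF grad_cont] arc_c) (use nz in auto)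
qed

definition radial_energy where
  "radial_energy = (\<integral>\<^sup>+x. (\<integral>\<^sup>+w. (\<integral>\<^sup>+\<rho>. indicator {0<..} w * indicator {0<..} \<rho> *
      ennreal (\<rho> powr (2 * \<sigma> + 1) * angular_mass w * (radial u x w \<rho>)\<^sup>2) \<partial>lborel) \<partial>lborel) \<partial>directions)"
definition angular_energy where
  "angular_energy = (\<integral>\<^sup>+x. (\<integral>\<^sup>+w. (\<integral>\<^sup>+\<rho>. indicator {0<..} w * indicator {0<..} \<rho> *
      ennreal (\<rho> powr (2 * \<sigma> - 1) * angular_weight w * (angular u x w \<rho>)\<^sup>2) \<partial>lborel) \<partial>lborel) \<partial>directions)"

text \<open>
  Bessel's inequality on every arc, integrated.
\<close>

lemma radial_plus_angular_energy: "radial_energy + angular_energy \<le> nn_energy u"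
proof -
  have "radial_energy + angular_energy = (\<integral>\<^sup>+x. (\<integral>\<^sup>+w. (\<integral>\<^sup>+\<rho>. indicator {0<..} w * indicator {0<..} \<rho> *
      ennreal (\<rho> powr (2 * \<sigma> + 1) * angular_mass w * (radial u x w \<rho>)\<^sup>2) +
      indicator {0<..} w * indicator {0<..} \<rho> *
      ennreal (\<rho> powr (2 * \<sigma> - 1) * angular_weight w * (angular u x w \<rho>)\<^sup>2) \<partial>lborel) \<partial>lborel) \<partial>directions)"
    unfolding radial_energy_def angular_energy_def radial_def angular_def
    by (subst nn_integral_add[symmetric], measurable)+
  also have "\<dots> \<le> (\<integral>\<^sup>+x. (\<integral>\<^sup>+w. (\<integral>\<^sup>+\<rho>. indicator {0<..} w * indicator {0<..} \<rho> *
      ennreal (\<rho> powr (2 * \<sigma> + 1) * angular_mass w * (Phi H (grad u (\<rho> *\<^sub>R arc (dir x) w)))\<^sup>2) \<partial>lborel) \<partial>lborel) \<partial>directions)"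
  proof (rule nn_integral_mono_AE)
    show "AE x in directions. (\<integral>\<^sup>+w. (\<integral>\<^sup>+\<rho>. indicator {0<..} w * indicator {0<..} \<rho> *
      ennreal (\<rho> powr (2 * \<sigma> + 1) * angular_mass w * (radial u x w \<rho>)\<^sup>2) +
      indicator {0<..} w * indicator {0<..} \<rho> *
      ennreal (\<rho> powr (2 * \<sigma> - 1) * angular_weight w * (angular u x w \<rho>)\<^sup>2) \<partial>lborel) \<partial>lborel)
     \<le> (\<integral>\<^sup>+w. (\<integral>\<^sup>+\<rho>. indicator {0<..} w * indicator {0<..} \<rho> *
      ennreal (\<rho> powr (2 * \<sigma> + 1) * angular_mass w * (Phi H (grad u (\<rho> *\<^sub>R arc (dir x) w)))\<^sup>2) \<partial>lborel) \<partial>lborel)"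
      using AE_directions
    proof eventually_elim
      case (elim x)
      show ?case
      proof (intro nn_integral_mono)
        fix w \<rho> :: real
        show "indicator {0<..} w * indicator {0<..} \<rho> *
            ennreal (\<rho> powr (2 * \<sigma> + 1) * angular_mass w * (radial u x w \<rho>)\<^sup>2) +
            indicator {0<..} w * indicator {0<..} \<rho> *
            ennreal (\<rho> powr (2 * \<sigma> - 1) * angular_weight w * (angular u x w \<rho>)\<^sup>2)
          \<le> indicator {0<..} w * indicator {0<..} \<rho> *
            ennreal (\<rho> powr (2 * \<sigma> + 1) * angular_mass w * (Phi H (grad u (\<rho> *\<^sub>R arc (dir x) w)))\<^sup>2)"
        proof (cases "0 < w \<and> 0 < \<rho>")
          case True
          define e where "e = inner (grad u (\<rho> *\<^sub>R arc (dir x) w)) (unit_tangent x w)"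
          define y where "y = 1 + w\<^sup>2"
          have y: "0 < y" unfolding y_def by (rule one_plus_sq_pos)
          have "angular_weight w = angular_mass w * y\<^sup>2"
          proof -
            have "(3 - real DIM('a) - \<alpha>) / 2 = - (real DIM('a) + 1 + \<alpha>) / 2 + 2" by (simp add: field_simps)
            then have "y powr ((3 - real DIM('a) - \<alpha>) / 2) = y powr (- (real DIM('a) + 1 + \<alpha>) / 2) * y powr 2"
              by (simp only: powr_add)
            then show ?thesis using y unfolding angular_weight_def angular_mass_def y_def[symmetric] by simp
          qed
          moreover have "angular u x w \<rho> = \<rho> / y * e"
            unfolding angular_def e_def y_def by simp
          moreover have "\<rho> powr (2 * \<sigma> + 1) = \<rho> powr (2 * \<sigma> - 1) * \<rho>\<^sup>2"
          proof -
            have "2 * \<sigma> + 1 = 2 * \<sigma> - 1 + 2" by simp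
            then have "\<rho> powr (2 * \<sigma> + 1) = \<rho> powr (2 * \<sigma> - 1) * \<rho> powr 2" by (simp only: powr_add)
            then show ?thesis using True by simp
          qed
          ultimately have a: "\<rho> powr (2 * \<sigma> - 1) * angular_weight w * (angular u x w \<rho>)\<^sup>2
              = \<rho> powr (2 * \<sigma> + 1) * angular_mass w * e\<^sup>2"
            using y by (simp add: power_mult_distrib power_divide)
          have "\<rho> powr (2 * \<sigma> + 1) * angular_mass w * ((radial u x w \<rho>)\<^sup>2 + e\<^sup>2)
              \<le> \<rho> powr (2 * \<sigma> + 1) * angular_mass w * (Phi H (grad u (\<rho> *\<^sub>R arc (dir x) w)))\<^sup>2"
            using Phi_ge_radial_angular[OF elim] unfolding radial_def e_def unit_tangent_def
            by (intro mult_left_mono) (simp_all add: angular_weights_nonneg)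
          then have "ennreal (\<rho> powr (2 * \<sigma> + 1) * angular_mass w * (radial u x w \<rho>)\<^sup>2) +
              ennreal (\<rho> powr (2 * \<sigma> + 1) * angular_mass w * e\<^sup>2)
              \<le> ennreal (\<rho> powr (2 * \<sigma> + 1) * angular_mass w * (Phi H (grad u (\<rho> *\<^sub>R arc (dir x) w)))\<^sup>2)"
            by (subst ennreal_plus[symmetric]) (auto intro!: ennreal_leI simp: angular_weights_nonneg distrib_left simp del: ennreal_plus)
          then show ?thesis using True unfolding a by simp
        qed auto
      qed
    qed
  qed
  also have "\<dots> = nn_energy u"
    unfolding nn_energy_def
  proof (rule nn_integral_weighted_half_space[symmetric])
    from measurable_compose[OF grad_measurable Phi_measurable]
    show "(\<lambda>z. (Phi H (grad u z))\<^sup>2) \<in> borel_measurable borel" by measurable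
  qed simp
  finally show ?thesis .
qed

text \<open>
  The logarithmic inequality on every ray.
\<close>

lemma radial_energy_ge:
  assumes d: "0 < d" "d < D" and ud: "\<And>z. 0 \<le> snd z \<Longrightarrow> d \<le> Phi0 H z \<Longrightarrow> u z = 0 \<and> grad u z = 0"
  shows "nn_hardy (\<lambda>\<rho>. \<sigma>\<^sup>2 + log_square_sum k \<rho> / 4) u \<le> radial_energy"
proof -
  have "nn_hardy (\<lambda>\<rho>. \<sigma>\<^sup>2 + log_square_sum k \<rho> / 4) u = (\<integral>\<^sup>+x. (\<integral>\<^sup>+w. (\<integral>\<^sup>+\<rho>. indicator {0<..} w * indicator {0<..} \<rho> *
    ennreal (\<rho> powr (2 * \<sigma> - 1) * angular_mass w * ((\<sigma>\<^sup>2 + log_square_sum k (\<rho> / D) / 4) * (on_arcs u x w \<rho>)\<^sup>2)) \<partial>lborel) \<partial>lborel) \<partial>directions)"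
    unfolding on_arcs_def using log_square_sum_nonneg[of k] by (subst nn_hardy_polar) (auto intro!: add_nonneg_nonneg)
  also have "\<dots> \<le> radial_energy"
    unfolding radial_energy_def
  proof (rule nn_integral_mono_AE)
    show "AE x in directions. (\<integral>\<^sup>+w. (\<integral>\<^sup>+\<rho>. indicator {0<..} w * indicator {0<..} \<rho> *
        ennreal (\<rho> powr (2 * \<sigma> - 1) * angular_mass w * ((\<sigma>\<^sup>2 + log_square_sum k (\<rho> / D) / 4) * (on_arcs u x w \<rho>)\<^sup>2)) \<partial>lborel) \<partial>lborel)
      \<le> (\<integral>\<^sup>+w. (\<integral>\<^sup>+\<rho>. indicator {0<..} w * indicator {0<..} \<rho> *
        ennreal (\<rho> powr (2 * \<sigma> + 1) * angular_mass w * (radial u x w \<rho>)\<^sup>2) \<partial>lborel) \<partial>lborel)"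
      using AE_directions
    proof eventually_elim
      case (elim x)
      show ?case
      proof (rule nn_integral_mono)
        fix w :: real
        show "(\<integral>\<^sup>+\<rho>. indicator {0<..} w * indicator {0<..} \<rho> *
            ennreal (\<rho> powr (2 * \<sigma> - 1) * angular_mass w * ((\<sigma>\<^sup>2 + log_square_sum k (\<rho> / D) / 4) * (on_arcs u x w \<rho>)\<^sup>2)) \<partial>lborel)
          \<le> (\<integral>\<^sup>+\<rho>. indicator {0<..} w * indicator {0<..} \<rho> *
            ennreal (\<rho> powr (2 * \<sigma> + 1) * angular_mass w * (radial u x w \<rho>)\<^sup>2) \<partial>lborel)"
        proof (cases "0 < w")
          case True
          have vz: "on_arcs u x w \<rho> = 0" if "d \<le> \<rho>" "0 < \<rho>" for \<rho>
            unfolding on_arcs_def using ud[of "\<rho> *\<^sub>R arc (dir x) w"] arc_norms[OF elim that(2), of w] that True by simp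
          have v_m: "(\<lambda>\<rho>. on_arcs u x w \<rho>) \<in> borel_measurable borel" and r_m: "(\<lambda>\<rho>. radial u x w \<rho>) \<in> borel_measurable borel"
            unfolding on_arcs_def radial_def by measurable
          note [measurable] = v_m r_m
          have "(\<integral>\<^sup>+\<rho>. indicator {0<..} w * indicator {0<..} \<rho> *
            ennreal (\<rho> powr (2 * \<sigma> - 1) * angular_mass w * ((\<sigma>\<^sup>2 + log_square_sum k (\<rho> / D) / 4) * (on_arcs u x w \<rho>)\<^sup>2)) \<partial>lborel)
            = (\<integral>\<^sup>+\<rho>. ennreal (angular_mass w) * (indicator {0<..<D} \<rho> *
            ennreal (\<rho> powr (2 * \<sigma> - 1) * (\<sigma>\<^sup>2 + log_square_sum k (\<rho> / D) / 4) * (on_arcs u x w \<rho>)\<^sup>2)) \<partial>lborel)"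
          proof (rule nn_integral_cong)
            fix \<rho> :: real
            show "indicator {0<..} w * indicator {0<..} \<rho> *
                ennreal (\<rho> powr (2 * \<sigma> - 1) * angular_mass w * ((\<sigma>\<^sup>2 + log_square_sum k (\<rho> / D) / 4) * (on_arcs u x w \<rho>)\<^sup>2))
              = ennreal (angular_mass w) * (indicator {0<..<D} \<rho> *
                ennreal (\<rho> powr (2 * \<sigma> - 1) * (\<sigma>\<^sup>2 + log_square_sum k (\<rho> / D) / 4) * (on_arcs u x w \<rho>)\<^sup>2))"
            proof (cases "0 < \<rho> \<and> \<rho> < D")
              case le: True
              have "ennreal (angular_mass w) * ennreal (\<rho> powr (2 * \<sigma> - 1) * (\<sigma>\<^sup>2 + log_square_sum k (\<rho> / D) / 4) * (on_arcs u x w \<rho>)\<^sup>2)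
                  = ennreal (angular_mass w * (\<rho> powr (2 * \<sigma> - 1) * (\<sigma>\<^sup>2 + log_square_sum k (\<rho> / D) / 4) * (on_arcs u x w \<rho>)\<^sup>2))"
                using log_square_sum_nonneg[of k "\<rho> / D"] by (intro ennreal_mult[symmetric]) (auto simp: angular_weights_nonneg)
              then show ?thesis using True le by (simp add: mult_ac)
            next
              case False
              then show ?thesis using vz[of \<rho>] d by (cases "0 < \<rho>") auto
            qed
          qed
          also have "\<dots> = ennreal (angular_mass w) * (\<integral>\<^sup>+\<rho>. indicator {0<..<D} \<rho> *
            ennreal (\<rho> powr (2 * \<sigma> - 1) * (\<sigma>\<^sup>2 + log_square_sum k (\<rho> / D) / 4) * (on_arcs u x w \<rho>)\<^sup>2) \<partial>lborel)"
            by (rule nn_integral_cmult) measurable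
          also have "\<dots> \<le> ennreal (angular_mass w) * (\<integral>\<^sup>+\<rho>. indicator {0<..<D} \<rho> *
            ennreal (\<rho> powr (2 * \<sigma> + 1) * (radial u x w \<rho>)\<^sup>2) \<partial>lborel)"
            using D_pos parameters_pos d vz
            by (intro mult_left_mono radial_inequality[where d = d] radial_deriv radial_continuous) auto
          also have "\<dots> = (\<integral>\<^sup>+\<rho>. ennreal (angular_mass w) * (indicator {0<..<D} \<rho> *
            ennreal (\<rho> powr (2 * \<sigma> + 1) * (radial u x w \<rho>)\<^sup>2)) \<partial>lborel)"
            by (rule nn_integral_cmult[symmetric]) measurable
          also have "\<dots> \<le> (\<integral>\<^sup>+\<rho>. indicator {0<..} w * indicator {0<..} \<rho> *
            ennreal (\<rho> powr (2 * \<sigma> + 1) * angular_mass w * (radial u x w \<rho>)\<^sup>2) \<partial>lborel)"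
            using True by (intro nn_integral_mono)
              (auto simp: indicator_def ennreal_mult[symmetric] angular_weights_nonneg mult_ac)
          finally show ?thesis .
        qed simp
      qed
    qed
  qed
  finally show ?thesis .
qed

text \<open>
  The trace inequality on every arc: the arc of radius \<open>\<rho>\<close> starts at the point \<open>\<rho> \<omega>\<close> of the base, so
  that the integral over all arcs of the value at the start is the trace term.
\<close>

lemma angular_energy_ge:
  assumes M: "\<And>z. \<bar>u z\<bar> \<le> M"
  shows "ennreal (K (real DIM('a)) \<alpha> b) * nn_trace u \<le> angular_energy + ennreal (4 * (A * B)) * nn_hardy (\<lambda>\<rho>. 1) u"
proof -
  have AB: "0 \<le> 4 * (A * B)" using parameters_pos by simp
  have Z: "nn_hardy (\<lambda>\<rho>. 1) u = (\<integral>\<^sup>+x. (\<integral>\<^sup>+w. (\<integral>\<^sup>+\<rho>. indicator {0<..} w * indicator {0<..} \<rho> *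
      ennreal (\<rho> powr (2 * \<sigma> - 1) * angular_mass w * (on_arcs u x w \<rho>)\<^sup>2) \<partial>lborel) \<partial>lborel) \<partial>directions)"
    unfolding on_arcs_def by (subst nn_hardy_polar) simp_all
  have Kp: "0 \<le> K (real DIM('a)) \<alpha> b" using K_pos by simp
  have "(\<lambda>x. (x, 0::real)) \<in> borel_measurable (borel :: 'a measure)"
    by (intro borel_measurable_continuous_onI continuous_intros)
  from measurable_compose[OF this u_measurable]
  have [measurable]: "(\<lambda>x. u (x, 0)) \<in> borel_measurable borel" .
  have "ennreal (K (real DIM('a)) \<alpha> b) * nn_trace u = (\<integral>\<^sup>+x. ennreal (K (real DIM('a)) \<alpha> b) * (\<integral>\<^sup>+\<rho>. indicator {0<..} \<rho> *
      ennreal (\<rho> powr (2 * \<sigma> - 1) * (u (\<rho> *\<^sub>R dir x, 0))\<^sup>2) \<partial>lborel) \<partial>directions)"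
    unfolding nn_trace_polar[OF u_measurable] by (rule nn_integral_cmult[symmetric]) measurable
  also have "\<dots> = (\<integral>\<^sup>+x. (\<integral>\<^sup>+\<rho>. ennreal (K (real DIM('a)) \<alpha> b) * (indicator {0<..} \<rho> *
      ennreal (\<rho> powr (2 * \<sigma> - 1) * (u (\<rho> *\<^sub>R dir x, 0))\<^sup>2)) \<partial>lborel) \<partial>directions)"
    by (intro nn_integral_cong nn_integral_cmult[symmetric]) measurable
  also have "\<dots> \<le> (\<integral>\<^sup>+x. (\<integral>\<^sup>+\<rho>. (\<integral>\<^sup>+w. indicator {0<..} w * indicator {0<..} \<rho> *
      ennreal (\<rho> powr (2 * \<sigma> - 1) * (angular_weight w * (angular u x w \<rho>)\<^sup>2 + 4 * (A * B) * angular_mass w * (on_arcs u x w \<rho>)\<^sup>2))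
      \<partial>lborel) \<partial>lborel) \<partial>directions)"
  proof (intro nn_integral_mono)
    fix x :: 'a and \<rho> :: real
    have v_m: "(\<lambda>w. on_arcs u x w \<rho>) \<in> borel_measurable borel" and r_m: "(\<lambda>w. angular u x w \<rho>) \<in> borel_measurable borel"
      unfolding on_arcs_def angular_def by measurable
    note [measurable] = v_m r_m
    show "ennreal (K (real DIM('a)) \<alpha> b) * (indicator {0<..} \<rho> *
        ennreal (\<rho> powr (2 * \<sigma> - 1) * (u (\<rho> *\<^sub>R dir x, 0))\<^sup>2))
      \<le> (\<integral>\<^sup>+w. indicator {0<..} w * indicator {0<..} \<rho> *
      ennreal (\<rho> powr (2 * \<sigma> - 1) * (angular_weight w * (angular u x w \<rho>)\<^sup>2 + 4 * (A * B) * angular_mass w * (on_arcs u x w \<rho>)\<^sup>2)) \<partial>lborel)"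
    proof (cases "0 < \<rho>")
      case True
      have "((\<lambda>w. on_arcs u x w \<rho>) \<longlongrightarrow> on_arcs u x 0 \<rho>) (at_right 0)"
        using DERIV_isCont[OF angular_deriv[of x \<rho> 0]] by (auto simp: isCont_def intro: filterlim_at_split[THEN iffD1, THEN conjunct2])
      moreover have "on_arcs u x 0 \<rho> = u (\<rho> *\<^sub>R dir x, 0)" by (simp add: on_arcs_def arc_def)
      ultimately have lim: "((\<lambda>w. on_arcs u x w \<rho>) \<longlongrightarrow> u (\<rho> *\<^sub>R dir x, 0)) (at_right 0)" by simp
      have "ennreal (K (real DIM('a)) \<alpha> b) * (indicator {0<..} \<rho> * ennreal (\<rho> powr (2 * \<sigma> - 1) * (u (\<rho> *\<^sub>R dir x, 0))\<^sup>2))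
          = ennreal (\<rho> powr (2 * \<sigma> - 1)) * ennreal (K (real DIM('a)) \<alpha> b * (u (\<rho> *\<^sub>R dir x, 0))\<^sup>2)"
        using True Kp by (simp add: ennreal_mult[symmetric] mult_ac)
      also have "\<dots> \<le> ennreal (\<rho> powr (2 * \<sigma> - 1)) * (\<integral>\<^sup>+w. indicator {0<..} w *
          ennreal (angular_weight w * (angular u x w \<rho>)\<^sup>2 + 4 * (A * B) * angular_mass w * (on_arcs u x w \<rho>)\<^sup>2) \<partial>lborel)"
        by (intro mult_left_mono angular_inequality[OF angular_deriv angular_continuous lim, of M]) (auto simp: on_arcs_def M)
      also have "\<dots> = (\<integral>\<^sup>+w. ennreal (\<rho> powr (2 * \<sigma> - 1)) * (indicator {0<..} w *
          ennreal (angular_weight w * (angular u x w \<rho>)\<^sup>2 + 4 * (A * B) * angular_mass w * (on_arcs u x w \<rho>)\<^sup>2)) \<partial>lborel)"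
        by (rule nn_integral_cmult[symmetric]) measurable
      also have "\<dots> = (\<integral>\<^sup>+w. indicator {0<..} w * indicator {0<..} \<rho> *
          ennreal (\<rho> powr (2 * \<sigma> - 1) * (angular_weight w * (angular u x w \<rho>)\<^sup>2 + 4 * (A * B) * angular_mass w * (on_arcs u x w \<rho>)\<^sup>2)) \<partial>lborel)"
      proof (rule nn_integral_cong)
        fix w
        have "0 \<le> angular_weight w * (angular u x w \<rho>)\<^sup>2 + 4 * (A * B) * angular_mass w * (on_arcs u x w \<rho>)\<^sup>2"
          using parameters_pos by (simp add: angular_weights_nonneg)
        then show "ennreal (\<rho> powr (2 * \<sigma> - 1)) * (indicator {0<..} w *
            ennreal (angular_weight w * (angular u x w \<rho>)\<^sup>2 + 4 * (A * B) * angular_mass w * (on_arcs u x w \<rho>)\<^sup>2))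
          = indicator {0<..} w * indicator {0<..} \<rho> *
            ennreal (\<rho> powr (2 * \<sigma> - 1) * (angular_weight w * (angular u x w \<rho>)\<^sup>2 + 4 * (A * B) * angular_mass w * (on_arcs u x w \<rho>)\<^sup>2))"
          using True by (subst ennreal_mult) (simp_all add: mult_ac)
      qed
      finally show ?thesis .
    qed simp
  qed
  also have "\<dots> = (\<integral>\<^sup>+x. (\<integral>\<^sup>+w. (\<integral>\<^sup>+\<rho>. indicator {0<..} w * indicator {0<..} \<rho> *
      ennreal (\<rho> powr (2 * \<sigma> - 1) * (angular_weight w * (angular u x w \<rho>)\<^sup>2 + 4 * (A * B) * angular_mass w * (on_arcs u x w \<rho>)\<^sup>2))
      \<partial>lborel) \<partial>lborel) \<partial>directions)"
    unfolding on_arcs_def angular_def by (rule nn_integral_cong, rule lborel_pair.Fubini') measurable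
  also have "\<dots> = (\<integral>\<^sup>+x. (\<integral>\<^sup>+w. (\<integral>\<^sup>+\<rho>. indicator {0<..} w * indicator {0<..} \<rho> *
      ennreal (\<rho> powr (2 * \<sigma> - 1) * angular_weight w * (angular u x w \<rho>)\<^sup>2) +
      ennreal (4 * (A * B)) * (indicator {0<..} w * indicator {0<..} \<rho> *
      ennreal (\<rho> powr (2 * \<sigma> - 1) * angular_mass w * (on_arcs u x w \<rho>)\<^sup>2)) \<partial>lborel) \<partial>lborel) \<partial>directions)"
  proof (intro nn_integral_cong)
    fix x and w \<rho> :: real
    have "ennreal (\<rho> powr (2 * \<sigma> - 1) * (angular_weight w * (angular u x w \<rho>)\<^sup>2 + 4 * (A * B) * angular_mass w * (on_arcs u x w \<rho>)\<^sup>2))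
        = ennreal (\<rho> powr (2 * \<sigma> - 1) * angular_weight w * (angular u x w \<rho>)\<^sup>2) +
          ennreal (4 * (A * B) * (\<rho> powr (2 * \<sigma> - 1) * angular_mass w * (on_arcs u x w \<rho>)\<^sup>2))"
      using parameters_pos
      by (subst ennreal_plus[symmetric]) (simp_all add: angular_weights_nonneg algebra_simps del: ennreal_plus)
    also have "ennreal (4 * (A * B) * (\<rho> powr (2 * \<sigma> - 1) * angular_mass w * (on_arcs u x w \<rho>)\<^sup>2))
        = ennreal (4 * (A * B)) * ennreal (\<rho> powr (2 * \<sigma> - 1) * angular_mass w * (on_arcs u x w \<rho>)\<^sup>2)"
      using AB by (intro ennreal_mult) (simp_all add: angular_weights_nonneg)
    finally show "indicator {0<..} w * indicator {0<..} \<rho> *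
      ennreal (\<rho> powr (2 * \<sigma> - 1) * (angular_weight w * (angular u x w \<rho>)\<^sup>2 + 4 * (A * B) * angular_mass w * (on_arcs u x w \<rho>)\<^sup>2))
      = indicator {0<..} w * indicator {0<..} \<rho> *
      ennreal (\<rho> powr (2 * \<sigma> - 1) * angular_weight w * (angular u x w \<rho>)\<^sup>2) +
      ennreal (4 * (A * B)) * (indicator {0<..} w * indicator {0<..} \<rho> *
      ennreal (\<rho> powr (2 * \<sigma> - 1) * angular_mass w * (on_arcs u x w \<rho>)\<^sup>2))"
      by (simp add: indicator_def)
  qed
  also have "\<dots> = angular_energy + ennreal (4 * (A * B)) * nn_hardy (\<lambda>\<rho>. 1) u"
    unfolding angular_energy_def Z on_arcs_def angular_def
    by (subst nn_integral3_add; (measurable)?) (subst nn_integral3_cmult; (measurable)?; rule refl)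
  finally show ?thesis .
qed

end

text \<open>
  The gradient controls the radial and the angular derivative together. On every ray the former obeys
  the logarithmic inequality with constant \<open>\<sigma>\<^sup>2\<close>, on every arc the latter the trace inequality with
  the loss \<open>4 A B\<close>; the difference \<open>\<sigma>\<^sup>2 - 4 A B\<close> is the Hardy constant.
\<close>

theorem nn_hardy_inequality:
  assumes u: "u \<in> test_functions U"
  shows "nn_hardy (\<lambda>\<rho>. \<sigma>\<^sup>2 + log_square_sum k \<rho> / 4) u + ennreal (K (real DIM('a)) \<alpha> b) * nn_trace u
    \<le> nn_energy u + ennreal (4 * (A * B)) * nn_hardy (\<lambda>\<rho>. 1) u"
proof -
  obtain M d where uc: "continuous_on UNIV u" and gd: "\<And>z. GDERIV u z :> grad u z"
    and gc: "continuous_on UNIV (grad u)" and M: "\<And>z. \<bar>u z\<bar> \<le> M" and gM: "\<And>z. (Phi H (grad u z))\<^sup>2 \<le> M"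
    and d: "0 < d" "d < D" and ud: "\<And>z. 0 \<le> snd z \<Longrightarrow> d \<le> Phi0 H z \<Longrightarrow> u z = 0 \<and> grad u z = 0"
    and out: "\<And>z. z \<notin> U \<Longrightarrow> u z = 0 \<and> grad u z = 0"
    by (fact test_function_facts[OF u])
  note c = uc gd gc
  have "nn_hardy (\<lambda>\<rho>. \<sigma>\<^sup>2 + log_square_sum k \<rho> / 4) u + ennreal (K (real DIM('a)) \<alpha> b) * nn_trace u
      \<le> radial_energy u + (angular_energy u + ennreal (4 * (A * B)) * nn_hardy (\<lambda>\<rho>. 1) u)"
    by (intro add_mono radial_energy_ge[OF c d ud] angular_energy_ge[OF c M])
  also have "\<dots> \<le> nn_energy u + ennreal (4 * (A * B)) * nn_hardy (\<lambda>\<rho>. 1) u"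
    using radial_plus_angular_energy[OF c] by (simp add: add.assoc[symmetric] add_right_mono)
  finally show ?thesis .
qed

end

lemma set_integrable_sum:
    fixes f :: "'i \<Rightarrow> 'b \<Rightarrow> real"
    assumes "\<And>i. i \<in> J \<Longrightarrow> set_integrable M A (f i)"
    shows "set_integrable M A (\<lambda>x. \<Sum>i\<in>J. f i x)"
  and set_integral_sum: "(LINT x:A|M. \<Sum>i\<in>J. f i x) = (\<Sum>i\<in>J. LINT x:A|M. f i x)"
  using assms unfolding set_integrable_def set_lebesgue_integral_def
  by (simp_all add: sum_distrib_left)

context hardy_setting
begin

text \<open>
  The passage from the integrals over the half-space with values in \<open>[0, \<infinity>]\<close> to the real ones.
\<close>

lemma set_integral_upper:
  fixes f :: "'a \<times> real \<Rightarrow> real"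
  assumes f [measurable]: "f \<in> borel_measurable borel" and nonneg: "\<And>z. 0 \<le> f z"
    and out: "\<And>z. z \<notin> U \<Longrightarrow> f z = 0"
    and fin: "(\<integral>\<^sup>+z. indicator {z. 0 < snd z} z * ennreal (f z) \<partial>lborel) < \<infinity>"
  shows "set_integrable lborel (upper U) f"
    and "ennreal (LINT z:upper U|lborel. f z) = (\<integral>\<^sup>+z. indicator {z. 0 < snd z} z * ennreal (f z) \<partial>lborel)"
proof -
  have [measurable]: "(snd :: 'a \<times> real \<Rightarrow> real) \<in> borel_measurable borel"
    by (intro borel_measurable_continuous_onI continuous_intros)
  have eq: "indicator (upper U) z *\<^sub>R f z = indicator {z. 0 < snd z} z * f z" for z
    using out[of z] by (auto simp: indicator_def upper_def)
  have nn: "(\<integral>\<^sup>+z. ennreal (indicator {z. 0 < snd z} z * f z) \<partial>lborel) =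
      (\<integral>\<^sup>+z. indicator {z. 0 < snd z} z * ennreal (f z) \<partial>lborel)"
    by (intro nn_integral_cong) (simp add: indicator_def)
  have i: "integrable lborel (\<lambda>z. indicator {z. 0 < snd z} z * f z)"
    using fin nonneg by (intro integrableI_nonneg) (auto simp: nn)
  then show "set_integrable lborel (upper U) f" unfolding set_integrable_def eq .
  show "ennreal (LINT z:upper U|lborel. f z) = (\<integral>\<^sup>+z. indicator {z. 0 < snd z} z * ennreal (f z) \<partial>lborel)"
    unfolding set_lebesgue_integral_def eq nn[symmetric]
    using i nonneg by (intro nn_integral_eq_integral[symmetric]) auto
qed

lemma hardy_density_eq:
  "hardy_density H \<alpha> U f u z = snd z powr \<alpha> * (f (Phi0 H z / D) / (Phi0 H z)\<^sup>2 * (u z)\<^sup>2)"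
  by (simp add: hardy_density_def)

lemma hardy_term_nonneg:
  assumes "\<And>\<rho>. 0 \<le> f \<rho>"
  shows "0 \<le> hardy_term H \<alpha> U f u"
  unfolding hardy_term_def set_lebesgue_integral_def
  using assms by (intro integral_nonneg_AE) (auto simp: hardy_density_eq)

lemma energy_trace_nonneg: "0 \<le> energy H \<alpha> U u" "0 \<le> trace_term H \<alpha> U u"
  unfolding energy_def trace_term_def set_lebesgue_integral_def
  by (intro integral_nonneg_AE; auto simp: energy_density_def trace_density_def)+

lemma hardy_term_nn:
  assumes u: "u \<in> test_functions U" and f [measurable]: "f \<in> borel_measurable borel"
    and nonneg: "\<And>\<rho>. 0 \<le> f \<rho>" and bd: "\<And>\<rho>. 0 < \<rho> \<Longrightarrow> \<rho> < 1 \<Longrightarrow> f \<rho> \<le> C"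
  shows "set_integrable lborel (upper U) (hardy_density H \<alpha> U f u)"
    and "ennreal (hardy_term H \<alpha> U f u) = nn_hardy f u"
proof -
  obtain M d where uc: "continuous_on UNIV u" and gd: "\<And>z. GDERIV u z :> grad u z"
    and gc: "continuous_on UNIV (grad u)" and M: "\<And>z. \<bar>u z\<bar> \<le> M" and gM: "\<And>z. (Phi H (grad u z))\<^sup>2 \<le> M"
    and d: "0 < d" "d < D" and ud: "\<And>z. 0 \<le> snd z \<Longrightarrow> d \<le> Phi0 H z \<Longrightarrow> u z = 0 \<and> grad u z = 0"
    and out: "\<And>z. z \<notin> U \<Longrightarrow> u z = 0 \<and> grad u z = 0"
    by (fact test_function_facts[OF u])
  have [measurable]: "u \<in> borel_measurable borel" by (rule borel_measurable_continuous_onI[OF uc])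
  have [measurable]: "(snd :: 'a \<times> real \<Rightarrow> real) \<in> borel_measurable borel"
    by (intro borel_measurable_continuous_onI continuous_intros)
  have eq: "hardy_density H \<alpha> U f u = (\<lambda>z. snd z powr \<alpha> * (f (Phi0 H z / D) / (Phi0 H z)\<^sup>2 * (u z)\<^sup>2))"
    by (rule ext) (rule hardy_density_eq)
  have fin: "(\<integral>\<^sup>+z. indicator {z. 0 < snd z} z *
      ennreal (snd z powr \<alpha> * (f (Phi0 H z / D) / (Phi0 H z)\<^sup>2 * (u z)\<^sup>2)) \<partial>lborel) < \<infinity>"
  proof (rule nn_integral_weighted_finite[where C = "C * M\<^sup>2" and R = d])
    fix z :: "'a \<times> real" assume z: "0 < snd z"
    show "f (Phi0 H z / D) / (Phi0 H z)\<^sup>2 * (u z)\<^sup>2 \<le> C * M\<^sup>2 / (Phi0 H z)\<^sup>2"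
    proof (cases "Phi0 H z < d")
      case True
      have p: "0 < Phi0 H z" using z by (intro norm_pos[OF norm_Phi0]) auto
      have "f (Phi0 H z / D) \<le> C" using p True d by (intro bd) auto
      moreover have "(u z)\<^sup>2 \<le> M\<^sup>2" using power_mono[OF M[of z], of 2] by simp
      ultimately have "f (Phi0 H z / D) * (u z)\<^sup>2 \<le> C * M\<^sup>2"
        using nonneg[of "Phi0 H z / D"] by (intro mult_mono) auto
      then have "f (Phi0 H z / D) * (u z)\<^sup>2 / (Phi0 H z)\<^sup>2 \<le> C * M\<^sup>2 / (Phi0 H z)\<^sup>2"
        by (rule divide_right_mono) simp
      then show ?thesis by simp
    next
      case False
      have "0 \<le> C" using bd[of "1/2"] nonneg[of "1/2"] by simp
      then show ?thesis using ud[of z] z False by simp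
    qed
    show "f (Phi0 H z / D) / (Phi0 H z)\<^sup>2 * (u z)\<^sup>2 = 0" if "d < Phi0 H z"
      using ud[of z] z that by simp
  qed (use nonneg in simp_all)
  have finD: "(\<integral>\<^sup>+z. indicator {z. 0 < snd z} z * ennreal (hardy_density H \<alpha> U f u z) \<partial>lborel) < \<infinity>"
    using fin by (simp only: hardy_density_eq)
  have m: "hardy_density H \<alpha> U f u \<in> borel_measurable borel" unfolding eq by measurable
  have 0: "0 \<le> hardy_density H \<alpha> U f u z" for z unfolding hardy_density_eq using nonneg by simp
  have o: "hardy_density H \<alpha> U f u z = 0" if "z \<notin> U" for z
    using out[OF that] by (simp add: hardy_density_def)
  show "set_integrable lborel (upper U) (hardy_density H \<alpha> U f u)"
    by (rule set_integral_upper(1)[OF m 0 _ finD], erule o)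
  show "ennreal (hardy_term H \<alpha> U f u) = nn_hardy f u"
    unfolding hardy_term_def nn_hardy_def hardy_density_eq[symmetric]
    by (rule set_integral_upper(2)[OF m 0 _ finD], erule o)
qed

lemma energy_nn:
  assumes u: "u \<in> test_functions U"
  shows "set_integrable lborel (upper U) (energy_density H \<alpha> u)"
    and "ennreal (energy H \<alpha> U u) = nn_energy u"
proof -
  obtain M d where uc: "continuous_on UNIV u" and gd: "\<And>z. GDERIV u z :> grad u z"
    and gc: "continuous_on UNIV (grad u)" and M: "\<And>z. \<bar>u z\<bar> \<le> M" and gM: "\<And>z. (Phi H (grad u z))\<^sup>2 \<le> M"
    and d: "0 < d" "d < D" and ud: "\<And>z. 0 \<le> snd z \<Longrightarrow> d \<le> Phi0 H z \<Longrightarrow> u z = 0 \<and> grad u z = 0"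
    and out: "\<And>z. z \<notin> U \<Longrightarrow> u z = 0 \<and> grad u z = 0"
    by (fact test_function_facts[OF u])
  have "grad u \<in> borel_measurable borel" by (rule borel_measurable_continuous_onI[OF gc])
  from measurable_compose[OF this Phi_measurable]
  have [measurable]: "(\<lambda>z. Phi H (grad u z)) \<in> borel_measurable borel" .
  have [measurable]: "(snd :: 'a \<times> real \<Rightarrow> real) \<in> borel_measurable borel"
    by (intro borel_measurable_continuous_onI continuous_intros)
  have P0: "Phi H 0 = 0" by (simp add: Phi_def norm_zero[OF norm_H] zero_prod_def)
  have fin: "(\<integral>\<^sup>+z. indicator {z. 0 < snd z} z * ennreal (snd z powr \<alpha> * (Phi H (grad u z))\<^sup>2) \<partial>lborel) < \<infinity>"
  proof (rule nn_integral_weighted_finite[where C = "M * d\<^sup>2" and R = d])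
    fix z :: "'a \<times> real" assume z: "0 < snd z"
    have M0: "0 \<le> M" using gM[of z] by (meson order_trans zero_le_power2)
    show "(Phi H (grad u z))\<^sup>2 \<le> M * d\<^sup>2 / (Phi0 H z)\<^sup>2"
    proof (cases "Phi0 H z < d")
      case True
      have p: "0 < Phi0 H z" using z by (intro norm_pos[OF norm_Phi0]) auto
      then have "(Phi0 H z)\<^sup>2 \<le> d\<^sup>2" using True by (intro power_mono) auto
      then have "(Phi H (grad u z))\<^sup>2 * (Phi0 H z)\<^sup>2 \<le> M * d\<^sup>2" using gM[of z] M0 by (intro mult_mono) auto
      then show ?thesis using p by (simp add: pos_le_divide_eq)
    qed (use ud[of z] z P0 M0 in simp)
    show "(Phi H (grad u z))\<^sup>2 = 0" if "d < Phi0 H z"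
      using ud[of z] z that P0 by simp
  qed simp_all
  have finD: "(\<integral>\<^sup>+z. indicator {z. 0 < snd z} z * ennreal (energy_density H \<alpha> u z) \<partial>lborel) < \<infinity>"
    using fin by (simp only: energy_density_def)
  have m: "energy_density H \<alpha> u \<in> borel_measurable borel" unfolding energy_density_def[abs_def] by measurable
  have 0: "0 \<le> energy_density H \<alpha> u z" for z unfolding energy_density_def by simp
  have o: "energy_density H \<alpha> u z = 0" if "z \<notin> U" for z
    using out[OF that] by (simp add: energy_density_def P0)
  show "set_integrable lborel (upper U) (energy_density H \<alpha> u)"
    by (rule set_integral_upper(1)[OF m 0 _ finD], erule o)
  show "ennreal (energy H \<alpha> U u) = nn_energy u"
    unfolding energy_def nn_energy_def energy_density_def[symmetric]
    by (rule set_integral_upper(2)[OF m 0 _ finD], erule o)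
qed

text \<open>
  In polar coordinates the singular weight becomes \<open>\<rho>\<^sup>2\<^sup>\<sigma>\<^sup>-\<^sup>1\<close>, which is integrable at the origin.
\<close>

lemma trace_nn:
  assumes u: "u \<in> test_functions U"
  shows "set_integrable lborel (base U) (trace_density H \<alpha> u)"
    and "ennreal (trace_term H \<alpha> U u) = nn_trace u"
proof -
  obtain M d where uc: "continuous_on UNIV u" and gd: "\<And>z. GDERIV u z :> grad u z"
    and gc: "continuous_on UNIV (grad u)" and M: "\<And>z. \<bar>u z\<bar> \<le> M" and gM: "\<And>z. (Phi H (grad u z))\<^sup>2 \<le> M"
    and d: "0 < d" "d < D" and ud: "\<And>z. 0 \<le> snd z \<Longrightarrow> d \<le> Phi0 H z \<Longrightarrow> u z = 0 \<and> grad u z = 0"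
    and out: "\<And>z. z \<notin> U \<Longrightarrow> u z = 0 \<and> grad u z = 0"
    by (fact test_function_facts[OF u])
  have u_m [measurable]: "u \<in> borel_measurable borel" by (rule borel_measurable_continuous_onI[OF uc])
  have "continuous_on UNIV (\<lambda>x. u (x, 0))"
    by (intro continuous_on_compose2[OF uc] continuous_intros) auto
  then have [measurable]: "(\<lambda>x. u (x, 0)) \<in> borel_measurable borel" by (rule borel_measurable_continuous_onI)
  have "nn_trace u \<le> (\<integral>\<^sup>+x. (\<integral>\<^sup>+\<rho>. ennreal (M\<^sup>2) * (indicator {0<..d} \<rho> *
      ennreal (\<rho> powr (2 * \<sigma> - 1))) \<partial>lborel) \<partial>directions)"
    unfolding nn_trace_polar[OF u_m]
  proof (rule nn_integral_mono_AE)
    show "AE x in directions. (\<integral>\<^sup>+\<rho>. indicator {0<..} \<rho> *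
        ennreal (\<rho> powr (2 * \<sigma> - 1) * (u (\<rho> *\<^sub>R dir x, 0))\<^sup>2) \<partial>lborel)
      \<le> (\<integral>\<^sup>+\<rho>. ennreal (M\<^sup>2) * (indicator {0<..d} \<rho> * ennreal (\<rho> powr (2 * \<sigma> - 1))) \<partial>lborel)"
      using AE_directions
    proof eventually_elim
      case (elim x)
      show ?case
      proof (rule nn_integral_mono)
        fix \<rho> :: real
        show "indicator {0<..} \<rho> * ennreal (\<rho> powr (2 * \<sigma> - 1) * (u (\<rho> *\<^sub>R dir x, 0))\<^sup>2)
          \<le> ennreal (M\<^sup>2) * (indicator {0<..d} \<rho> * ennreal (\<rho> powr (2 * \<sigma> - 1)))"
        proof (cases "0 < \<rho>")
          case True
          have a: "\<rho> *\<^sub>R arc (dir x) 0 = (\<rho> *\<^sub>R dir x, 0)" by (simp add: arc_def)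
          have p: "Phi0 H (\<rho> *\<^sub>R dir x, 0) = \<rho>" using arc_norms(3)[OF elim True, of 0] unfolding a .
          show ?thesis
          proof (cases "\<rho> \<le> d")
            case le: True
            have "(u (\<rho> *\<^sub>R dir x, 0))\<^sup>2 \<le> M\<^sup>2" using power_mono[OF M[of "(\<rho> *\<^sub>R dir x, 0)"], of 2] by simp
            then have "\<rho> powr (2 * \<sigma> - 1) * (u (\<rho> *\<^sub>R dir x, 0))\<^sup>2 \<le> M\<^sup>2 * \<rho> powr (2 * \<sigma> - 1)"
              by (subst mult.commute) (rule mult_right_mono, simp_all)
            then have "ennreal (\<rho> powr (2 * \<sigma> - 1) * (u (\<rho> *\<^sub>R dir x, 0))\<^sup>2) \<le> ennreal (M\<^sup>2) * ennreal (\<rho> powr (2 * \<sigma> - 1))"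
              by (subst ennreal_mult[symmetric]) (auto intro: ennreal_leI)
            then show ?thesis using True le by simp
          next
            case False
            have "u (\<rho> *\<^sub>R dir x, 0) = 0" using ud[of "(\<rho> *\<^sub>R dir x, 0)"] p False by simp
            then show ?thesis by simp
          qed
        qed simp
      qed
    qed
  qed
  also have "\<dots> = ennreal (M\<^sup>2) * (\<integral>\<^sup>+\<rho>. indicator {0<..d} \<rho> * ennreal (\<rho> powr (2 * \<sigma> - 1)) \<partial>lborel) * emeasure directions UNIV"
    by (subst nn_integral_cmult) (simp_all add: cone_measure_def)
  also have "\<dots> < \<infinity>"
    using emeasure_cone_measure(1)[OF norm_N0] nn_integral_powr_finite[of "2 * \<sigma> - 1" d] parameters_pos
    by (simp add: ennreal_mult_less_top)
  finally have fin: "nn_trace u < \<infinity>" .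
  have eq: "indicator (base U) x *\<^sub>R trace_density H \<alpha> u x = (u (x, 0))\<^sup>2 / N0 x powr (1 - \<alpha>)" for x
    using out[of "(x, 0)"] by (auto simp: indicator_def base_def trace_density_def)
  have i: "integrable lborel (\<lambda>x. (u (x, 0))\<^sup>2 / N0 x powr (1 - \<alpha>))"
    using fin unfolding nn_trace_def by (intro integrableI_nonneg) auto
  then show "set_integrable lborel (base U) (trace_density H \<alpha> u)" unfolding set_integrable_def eq .
  show "ennreal (trace_term H \<alpha> U u) = nn_trace u"
    unfolding trace_term_def set_lebesgue_integral_def eq nn_trace_def
    using i by (intro nn_integral_eq_integral[symmetric]) auto
qed

lemma P_square_bounds: "0 < \<rho> \<Longrightarrow> \<rho> < 1 \<Longrightarrow> (P i \<rho>)\<^sup>2 \<le> 1"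
  using P_bounds[of \<rho> i] by (simp add: power_le_one)

lemma hardy_term_combination:
  assumes u: "u \<in> test_functions U"
  shows "hardy_term H \<alpha> U (\<lambda>\<rho>. c0 + (\<Sum>i\<in>J. c i * (P i \<rho>)\<^sup>2)) u
    = c0 * hardy_term H \<alpha> U (\<lambda>\<rho>. 1) u + (\<Sum>i\<in>J. c i * hardy_term H \<alpha> U (\<lambda>\<rho>. (P i \<rho>)\<^sup>2) u)"
proof -
  have i0: "set_integrable lborel (upper U) (hardy_density H \<alpha> U (\<lambda>\<rho>. 1) u)"
    by (rule hardy_term_nn(1)[OF u, where C = 1]) auto
  have i: "set_integrable lborel (upper U) (hardy_density H \<alpha> U (\<lambda>\<rho>. (P i \<rho>)\<^sup>2) u)" for i
    by (rule hardy_term_nn(1)[OF u, where C = 1]) (auto simp: P_square_bounds)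
  have "hardy_term H \<alpha> U (\<lambda>\<rho>. c0 + (\<Sum>i\<in>J. c i * (P i \<rho>)\<^sup>2)) u
      = (LINT z:upper U|lborel. c0 * hardy_density H \<alpha> U (\<lambda>\<rho>. 1) u z
         + (\<Sum>i\<in>J. c i * hardy_density H \<alpha> U (\<lambda>\<rho>. (P i \<rho>)\<^sup>2) u z))"
    unfolding hardy_term_def
    by (rule arg_cong[where f = "set_lebesgue_integral lborel (upper U)"], rule ext)
      (simp add: hardy_density_def add_divide_distrib sum_divide_distrib sum_distrib_left
        sum_distrib_right algebra_simps)
  also have "\<dots> = c0 * hardy_term H \<alpha> U (\<lambda>\<rho>. 1) u + (\<Sum>i\<in>J. c i * hardy_term H \<alpha> U (\<lambda>\<rho>. (P i \<rho>)\<^sup>2) u)"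
    unfolding hardy_term_def using i0 i
    by (subst set_integral_add(2)) (simp_all add: set_integral_sum set_integrable_sum del: One_nat_def)
  finally show ?thesis .
qed

theorem hardy_inequality_partial:
  assumes u: "u \<in> test_functions U"
  shows "K (real DIM('a)) \<alpha> b * trace_term H \<alpha> U u + (\<alpha> + b - 2)\<^sup>2 / 4 * hardy_term H \<alpha> U (\<lambda>\<rho>. 1) u
     + 1 / 4 * (\<Sum>i\<in>{1..k}. hardy_term H \<alpha> U (\<lambda>\<rho>. (P i \<rho>)\<^sup>2) u) \<le> energy H \<alpha> U u"
proof -
  let ?h = "\<lambda>i. hardy_term H \<alpha> U (\<lambda>\<rho>. (P i \<rho>)\<^sup>2) u" and ?one = "hardy_term H \<alpha> U (\<lambda>\<rho>. 1) u"
  have S: "hardy_term H \<alpha> U (\<lambda>\<rho>. \<sigma>\<^sup>2 + log_square_sum k \<rho> / 4) u = \<sigma>\<^sup>2 * ?one + 1 / 4 * (\<Sum>i\<in>{1..k}. ?h i)"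
    using hardy_term_combination[OF u, of "\<sigma>\<^sup>2" "\<lambda>i. 1 / 4" "{1..k}"]
    by (simp add: log_square_sum_def sum_divide_distrib del: One_nat_def)
  have lb: "log_square_sum k \<rho> \<le> real k" if "0 < \<rho>" "\<rho> < 1" for \<rho>
    unfolding log_square_sum_def using sum_bounded_above[of "{1..k}" "\<lambda>i. (P i \<rho>)\<^sup>2" 1] P_square_bounds[OF that] by simp
  have nS: "ennreal (hardy_term H \<alpha> U (\<lambda>\<rho>. \<sigma>\<^sup>2 + log_square_sum k \<rho> / 4) u) = nn_hardy (\<lambda>\<rho>. \<sigma>\<^sup>2 + log_square_sum k \<rho> / 4) u"
    by (rule hardy_term_nn(2)[OF u, where C = "\<sigma>\<^sup>2 + real k / 4"]) (auto simp: lb log_square_sum_nonneg add_nonneg_nonneg)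
  have n0: "ennreal ?one = nn_hardy (\<lambda>\<rho>. 1) u"
    by (rule hardy_term_nn(2)[OF u, where C = 1]) auto
  have h0: "0 \<le> ?one" by (rule hardy_term_nonneg) simp
  have hS: "0 \<le> hardy_term H \<alpha> U (\<lambda>\<rho>. \<sigma>\<^sup>2 + log_square_sum k \<rho> / 4) u"
    by (rule hardy_term_nonneg) (simp add: log_square_sum_nonneg)
  have AB: "0 \<le> 4 * (A * B)" using parameters_pos by simp
  have "ennreal (hardy_term H \<alpha> U (\<lambda>\<rho>. \<sigma>\<^sup>2 + log_square_sum k \<rho> / 4) u) + ennreal (K (real DIM('a)) \<alpha> b) * ennreal (trace_term H \<alpha> U u)
      \<le> ennreal (energy H \<alpha> U u) + ennreal (4 * (A * B)) * ennreal ?one"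
    unfolding nS n0 energy_nn(2)[OF u] trace_nn(2)[OF u] by (rule nn_hardy_inequality[OF u])
  then have "hardy_term H \<alpha> U (\<lambda>\<rho>. \<sigma>\<^sup>2 + log_square_sum k \<rho> / 4) u + K (real DIM('a)) \<alpha> b * trace_term H \<alpha> U u
      \<le> energy H \<alpha> U u + 4 * (A * B) * ?one"
    using hS h0 AB K_pos energy_trace_nonneg[of u]
    by (simp add: ennreal_mult[symmetric] ennreal_plus[symmetric] ennreal_le_iff del: ennreal_plus)
  then show ?thesis unfolding S four_AB by (simp add: algebra_simps)
qed

end

section \<open>Smooth approximation of the dual norm\<close>

lemma Ck_on_log_sum_exp:
  fixes F :: "'a::euclidean_space set"
  shows "Ck_on k (\<lambda>x. ln (1 + (\<Sum>\<xi>\<in>F. exp (\<beta> * inner x \<xi>))) / \<beta>) UNIV"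
proof -
  have lin: "Ck_on k (\<lambda>x. \<beta> * inner x \<xi>) UNIV" for \<xi> :: 'a
    by (intro Ck_on_bounded_linear bounded_linear_mult_right[THEN bounded_linear_compose]
        bounded_linear_inner_left open_UNIV)
  have ex: "Ck_on k (\<lambda>x. exp (\<beta> * inner x \<xi>)) UNIV" for \<xi> :: 'a
    by (rule Ck_on_compose[OF open_UNIV open_UNIV Ck_on_exp lin]) simp
  have s: "Ck_on k (\<lambda>x. 1 + (\<Sum>\<xi>\<in>F. exp (\<beta> * inner x \<xi>))) UNIV"
    by (intro Ck_on_add Ck_on_const Ck_on_sum ex open_UNIV)
  have "Ck_on k (\<lambda>x. ln (1 + (\<Sum>\<xi>\<in>F. exp (\<beta> * inner x \<xi>)))) UNIV"
    by (rule Ck_on_compose[OF open_UNIV open_greaterThan Ck_on_ln s]) (simp add: add_pos_nonneg sum_nonneg)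
  then have "Ck_on k (\<lambda>x. ln (1 + (\<Sum>\<xi>\<in>F. exp (\<beta> * inner x \<xi>))) * (1 / \<beta>)) UNIV"
    by (intro Ck_on_mult Ck_on_const open_UNIV)
  then show ?thesis by simp
qed

text \<open>
  The dual norm is the supremum of the linear functions \<open>\<langle>\<cdot>, \<xi>\<rangle>\<close> with \<open>H \<xi> \<le> 1\<close>. The logarithm of a
  sum of exponentials smooths the maximum over a finite net; its gradient is a subconvex combination
  of the points of the net, so that it stays in the unit ball of \<open>H\<close>. A finer net and a larger
  exponent for smaller \<open>e\<close> give the two-sided bound.
\<close>

lemma smooth_dual_norm:
  fixes H :: "'a::euclidean_space \<Rightarrow> real"
  assumes H: "is_norm H" and e: "0 < e"
  obtains N G where "\<And>k. Ck_on k N UNIV" "\<And>x. 0 < N x"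
    "\<And>x. (1 - e) * dual_norm H x \<le> N x" "\<And>x. N x \<le> dual_norm H x + e"
    "\<And>x. GDERIV N x :> G x" "\<And>x. H (G x) \<le> 1"
proof -
  obtain c where c: "0 < c" "\<And>x. c * norm x \<le> dual_norm H x" using norm_lower[OF is_norm_dual[OF H]] by blast
  obtain c' where c': "0 < c'" "\<And>x. c' * norm x \<le> H x" using norm_lower[OF H] by blast
  define S where "S = {\<xi>. H \<xi> \<le> 1}"
  have "closed S" unfolding S_def by (intro closed_Collect_le norm_continuous[OF H] continuous_on_const)
  moreover have "bounded S"
    unfolding bounded_iff
  proof (intro exI ballI)
    fix \<xi> assume "\<xi> \<in> S"
    then have "c' * norm \<xi> \<le> 1" using c'(2)[of \<xi>] by (simp add: S_def)
    then show "norm \<xi> \<le> 1 / c'" using c'(1) by (simp add: field_simps)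
  qed
  ultimately have "compact S" by (simp add: compact_eq_bounded_closed)
  then obtain F where F: "finite F" "F \<subseteq> S" "S \<subseteq> (\<Union>\<xi>\<in>F. ball \<xi> (e * c))"
  proof (rule compactE_image)
    show "S \<subseteq> (\<Union>\<xi>\<in>S. ball \<xi> (e * c))" using e c(1) by force
  qed auto
  have "0 \<in> S" by (simp add: S_def norm_zero[OF H])
  then have Fne: "F \<noteq> {}" using F(3) by auto
  \<comment> \<open>the logarithm of the sum exceeds the maximum by at most \<open>ln (1 + card F) / \<beta>\<close>\<close>
  define \<beta> where "\<beta> = (ln (1 + real (card F)) + 1) / e"
  have lc: "0 \<le> ln (1 + real (card F))" by simp
  have \<beta>: "0 < \<beta>" "ln (1 + real (card F)) / \<beta> \<le> e"
  proof -
    show b: "0 < \<beta>" unfolding \<beta>_def using e lc by (intro divide_pos_pos) linarith+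
    have "e * \<beta> = ln (1 + real (card F)) + 1" unfolding \<beta>_def using e by simp
    then have "ln (1 + real (card F)) \<le> e * \<beta>" by linarith
    then show "ln (1 + real (card F)) / \<beta> \<le> e" using b by (simp add: pos_divide_le_eq)
  qed
  define s where "s x = (\<Sum>\<xi>\<in>F. exp (\<beta> * inner x \<xi>))" for x
  define N where "N x = ln (1 + s x) / \<beta>" for x
  define G where "G x = (\<Sum>\<xi>\<in>F. (exp (\<beta> * inner x \<xi>) / (1 + s x)) *\<^sub>R \<xi>)" for x
  have s: "0 < s x" for x unfolding s_def using F(1) Fne by (intro sum_pos) auto
  show ?thesis
  proof (rule that[of N G])
    show "Ck_on k N UNIV" for k unfolding N_def[abs_def] s_def by (rule Ck_on_log_sum_exp)
    show "0 < N x" for x unfolding N_def using s[of x] \<beta>(1) by simp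
    have le: "inner x \<xi> \<le> N x" if "\<xi> \<in> F" for x \<xi>
    proof -
      have "exp (\<beta> * inner x \<xi>) \<le> s x" unfolding s_def using F(1) that by (intro member_le_sum) auto
      then have "exp (\<beta> * inner x \<xi>) \<le> 1 + s x" by simp
      then have "\<beta> * inner x \<xi> \<le> ln (1 + s x)" using s[of x] by (subst ln_ge_iff) auto
      then show ?thesis unfolding N_def using \<beta>(1) by (simp add: pos_le_divide_eq mult.commute)
    qed
    show "(1 - e) * dual_norm H x \<le> N x" for x
    proof -
      have "dual_norm H x \<le> N x + e * dual_norm H x"
      proof (rule dense_le)
        fix a assume "a < dual_norm H x"
        then obtain \<xi> where xi: "H \<xi> \<le> 1" "a < inner x \<xi>" using dual_norm_approx[OF H] by blast
        then obtain \<xi>' where xi': "\<xi>' \<in> F" "dist \<xi>' \<xi> < e * c" using F(3) by (auto simp: S_def)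
        have "inner x (\<xi> - \<xi>') \<le> norm x * norm (\<xi> - \<xi>')" by (rule norm_cauchy_schwarz)
        also have "\<dots> \<le> norm x * (e * c)" using xi'(2) by (intro mult_left_mono) (auto simp: dist_norm norm_minus_commute)
        also have "\<dots> = e * (c * norm x)" by simp
        also have "\<dots> \<le> e * dual_norm H x" using c(2)[of x] e by (intro mult_left_mono) auto
        finally have "inner x \<xi> \<le> inner x \<xi>' + e * dual_norm H x" by (simp add: inner_diff_right)
        then show "a \<le> N x + e * dual_norm H x" using le[OF xi'(1), of x] xi(2) by linarith
      qed
      then show ?thesis by (simp add: algebra_simps)
    qed
    show "N x \<le> dual_norm H x + e" for x
    proof -
      let ?E = "exp (\<beta> * dual_norm H x)"
      have "exp (\<beta> * inner x \<xi>) \<le> ?E" if "\<xi> \<in> F" for \<xi>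
      proof -
        have "H \<xi> \<le> 1" using that F(2) by (auto simp: S_def)
        then have "dual_norm H x * H \<xi> \<le> dual_norm H x * 1" by (intro mult_left_mono dual_norm_nonneg[OF H])
        then have "inner x \<xi> \<le> dual_norm H x" using inner_le_dual[OF H, of x \<xi>] by linarith
        then show ?thesis using \<beta>(1) by simp
      qed
      then have "s x \<le> real (card F) * ?E" unfolding s_def by (rule sum_bounded_above)
      moreover have "1 \<le> ?E" using \<beta>(1) dual_norm_nonneg[OF H, of x] by simp
      ultimately have "1 + s x \<le> (1 + real (card F)) * ?E"
        unfolding distrib_right mult_1_left by linarith
      then have "ln (1 + s x) \<le> ln ((1 + real (card F)) * ?E)" using s[of x] by (subst ln_le_cancel_iff) (auto intro: add_pos_nonneg mult_pos_pos)
      also have "\<dots> = ln (1 + real (card F)) + \<beta> * dual_norm H x" by (simp add: ln_mult)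
      finally have "N x \<le> (ln (1 + real (card F)) + \<beta> * dual_norm H x) / \<beta>"
        unfolding N_def using \<beta>(1) by (intro divide_right_mono) auto
      also have "\<dots> = ln (1 + real (card F)) / \<beta> + dual_norm H x" using \<beta>(1) by (simp add: add_divide_distrib)
      finally show ?thesis using \<beta>(2) by linarith
    qed
    show "GDERIV N x :> G x" for x
    proof -
      have ds: "(s has_derivative (\<lambda>h. \<Sum>\<xi>\<in>F. exp (\<beta> * inner x \<xi>) * (\<beta> * inner h \<xi>))) (at x)"
        unfolding s_def[abs_def] by (intro has_derivative_sum) (auto intro!: derivative_eq_intros simp: mult_ac)
      have "((\<lambda>x. ln (1 + s x) / \<beta>) has_derivative
          (\<lambda>h. (\<Sum>\<xi>\<in>F. exp (\<beta> * inner x \<xi>) * (\<beta> * inner h \<xi>)) / (1 + s x) / \<beta>)) (at x)"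
        using s[of x] \<beta>(1) by (auto intro!: derivative_eq_intros ds simp: divide_inverse mult_ac)
      moreover have "(\<Sum>\<xi>\<in>F. exp (\<beta> * inner x \<xi>) * (\<beta> * inner h \<xi>)) / (1 + s x) / \<beta> = inner h (G x)" for h
        using \<beta>(1) unfolding G_def inner_sum_right inner_scaleR_right sum_divide_distrib
        by (intro sum.cong) auto
      ultimately show ?thesis unfolding gderiv_def N_def[abs_def] by simp
    qed
    show "H (G x) \<le> 1" for x
    proof -
      have "H (G x) \<le> (\<Sum>\<xi>\<in>F. H ((exp (\<beta> * inner x \<xi>) / (1 + s x)) *\<^sub>R \<xi>))"
        unfolding G_def by (rule norm_sum_le[OF H])
      also have "\<dots> \<le> (\<Sum>\<xi>\<in>F. exp (\<beta> * inner x \<xi>) / (1 + s x))"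
      proof (rule sum_mono)
        fix \<xi> assume "\<xi> \<in> F"
        then have "H \<xi> \<le> 1" using F(2) by (auto simp: S_def)
        then show "H ((exp (\<beta> * inner x \<xi>) / (1 + s x)) *\<^sub>R \<xi>) \<le> exp (\<beta> * inner x \<xi>) / (1 + s x)"
          using s[of x] mult_left_mono[of "H \<xi>" 1 "exp (\<beta> * inner x \<xi>) / (1 + s x)"]
          by (simp add: norm_scale[OF H])
      qed
      also have "\<dots> = s x / (1 + s x)" by (simp add: s_def sum_divide_distrib)
      also have "\<dots> \<le> 1" using s[of x] by simp
      finally show ?thesis .
    qed
  qed
qed

section \<open>Radial trial functions\<close>

text \<open>
  Monotonicity makes the logarithmic variable below decreasing, so that the cut-off has compact support.
\<close>

lemma X_mono:
  assumes "0 < \<rho>" "\<rho> \<le> \<rho>'" "\<rho>' < 1"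
  shows "X k \<rho> \<le> X k \<rho>'"
proof (rule DERIV_nonneg_imp_nondecreasing[OF assms(2)])
  fix x assume "\<rho> \<le> x" "x \<le> \<rho>'"
  then have x: "0 < x" "x < 1" using assms by auto
  show "\<exists>y. (X k has_real_derivative y) (at x) \<and> 0 \<le> y"
    using X_deriv[OF x, of k] P_bounds[OF x, of k] X_bounds[OF x, of k] x
    by (intro exI conjI) (auto intro!: divide_nonneg_pos mult_nonneg_nonneg simp del: X.simps)
qed

lemma Ck_on_X:
  assumes D: "0 < D"
  shows "Ck_on j (\<lambda>s. X i (s / D)) {0<..<D}"
proof (induction i)
  case 0
  have "Ck_on j (\<lambda>s. s * (1 / D)) {0<..<D}"
    by (intro Ck_on_bounded_linear bounded_linear_mult_left open_greaterThanLessThan)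
  then show ?case by simp
next
  case (Suc i)
  let ?S = "{0<..<D}"
  have r: "0 < s / D" "s / D < 1" if "s \<in> ?S" for s using that D by auto
  have l: "Ck_on j (\<lambda>s. ln (X i (s / D))) ?S"
    by (rule Ck_on_compose[OF open_greaterThanLessThan open_greaterThan Ck_on_ln Suc]) (use X_bounds(1)[OF r] in auto)
  have "Ck_on j (\<lambda>s. 1 + (- 1) * ln (X i (s / D))) ?S"
    by (intro Ck_on_add Ck_on_mult Ck_on_const l open_greaterThanLessThan)
  then have a: "Ck_on j (\<lambda>s. 1 - ln (X i (s / D))) ?S" by simp
  have pos: "0 < 1 - ln (X i (s / D))" if "s \<in> ?S" for s
    using X_bounds[OF r[OF that], of i] by (smt (verit) ln_less_zero)
  have b: "Ck_on j (\<lambda>s. (1 - ln (X i (s / D))) powr (- 1)) ?S"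
    by (rule Ck_on_compose[OF open_greaterThanLessThan open_greaterThan Ck_on_powr a]) (use pos in auto)
  show ?case
  proof (rule Ck_on_cong_imp[OF open_greaterThanLessThan b])
    show "(1 - ln (X i (s / D))) powr (- 1) = X (Suc i) (s / D)" if "s \<in> ?S" for s
      using pos[OF that] by (simp add: powr_minus_divide abs_if)
  qed
qed

text \<open>
  The two integrals determine how far the bump has to be stretched.
\<close>

lemma bump_integrals:
  obtains bump' c0 c1 where "\<And>t. (bump has_real_derivative bump' t) (at t)" "continuous_on UNIV bump'"
    "integral {0..1} (\<lambda>t. (bump t)\<^sup>2) = c0" "integral {0..1} (\<lambda>t. (bump' t)\<^sup>2) = c1" "0 < c0" "0 \<le> c1"
    "\<And>t. t \<notin> {0..1} \<Longrightarrow> bump' t = 0"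
proof -
  obtain bump' where d: "\<And>t. (bump has_real_derivative bump' t) (at t)" "continuous_on UNIV bump'"
  proof (rule Ck_on_real_deriv[OF Ck_on_bump[of "Suc 0"] open_UNIV])
    fix g' assume "\<And>t. t \<in> UNIV \<Longrightarrow> (bump has_real_derivative g' t) (at t)" "Ck_on 0 g' UNIV"
    then show thesis using that[of g'] by simp
  qed
  have c: "continuous_on {0..1} (\<lambda>t. (bump t)\<^sup>2)"
    by (intro continuous_intros continuous_on_subset[OF Ck_on_continuous[OF Ck_on_bump[of 0]]]) auto
  have c': "continuous_on {1/4..3/4} (\<lambda>t. (bump t)\<^sup>2)" by (rule continuous_on_subset[OF c]) auto
  obtain t0 :: real where t0: "t0 \<in> {1/4..3/4}" "\<And>t. t \<in> {1/4..3/4} \<Longrightarrow> (bump t0)\<^sup>2 \<le> (bump t)\<^sup>2"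
    using continuous_attains_inf[OF _ _ c'] by auto
  have "0 < (bump t0)\<^sup>2 * (3/4 - 1/4)" using bump_pos[of t0] t0(1) by auto
  also have "\<dots> = integral {1/4..3/4} (\<lambda>t::real. (bump t0)\<^sup>2)"
    using integral_const_real[of "1/4" "3/4" "(bump t0)\<^sup>2"] by simp
  also have "\<dots> \<le> integral {1/4..3/4} (\<lambda>t. (bump t)\<^sup>2)"
    using t0(2) by (intro integral_le integrable_continuous_real c') auto
  also have "\<dots> \<le> integral {0..1} (\<lambda>t. (bump t)\<^sup>2)"
    by (rule integral_subset_le) (auto intro!: integrable_continuous_real c c')
  finally have c0: "0 < integral {0..1} (\<lambda>t. (bump t)\<^sup>2)" .
  have c1: "0 \<le> integral {0..1} (\<lambda>t. (bump' t)\<^sup>2)"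
    by (intro integral_nonneg integrable_continuous_real continuous_intros continuous_on_subset[OF d(2)]) auto
  have out: "bump' t = 0" if t: "t \<notin> {0..1}" for t
  proof -
    have "((\<lambda>t. 0) has_real_derivative 0) (at t)" by simp
    then have "(bump has_real_derivative 0) (at t)"
      by (rule has_field_derivative_transform_within_open[where S = "- {0..1}"])
        (use t in \<open>auto simp: bump_eq_0 open_Compl\<close>)
    then show ?thesis using DERIV_unique[OF d(1)] by blast
  qed
  show ?thesis by (rule that[OF d refl refl c0 c1 out])
qed

text \<open>
  In the variable \<open>- ln X\<^sub>k\<close> the completed square becomes the Dirichlet integral of the cut-off
  and the \<open>k\<close>-th remainder term its \<open>L\<^sup>2\<close> norm, both with respect to Lebesgue measure. A bump
  stretched by a factor \<open>T\<close> makes the quotient of the two of order \<open>1 / T\<^sup>2\<close>, and as the variable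
  tends to infinity at the origin there is room for it in every neighbourhood of the origin.
\<close>

lemma radial_trial:
  assumes D: "0 < D" and \<sigma>: "0 < \<sigma>" and R: "0 < R" "R < D" and \<eta>: "0 < \<eta>" and k: "k = Suc k'"
  obtains v v' r1 where "0 < r1" "r1 < R" "\<And>j. Ck_on j v UNIV"
    "\<And>s. (v has_real_derivative v' s) (at s)" "continuous_on UNIV v'"
    "\<And>s. s \<notin> {r1..R} \<Longrightarrow> v s = 0 \<and> v' s = 0"
    "0 < integral {r1..R} (\<lambda>s. s powr (2 * \<sigma> - 1) * (P k (s / D))\<^sup>2 * (v s)\<^sup>2)"
    "integral {r1..R} (\<lambda>s. s powr (2 * \<sigma> + 1) * (v' s)\<^sup>2)
      - integral {r1..R} (\<lambda>s. s powr (2 * \<sigma> - 1) * (\<sigma>\<^sup>2 + log_square_sum k' (s / D) / 4) * (v s)\<^sup>2)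
      \<le> (1 / 4 + \<eta>) * integral {r1..R} (\<lambda>s. s powr (2 * \<sigma> - 1) * (P k (s / D))\<^sup>2 * (v s)\<^sup>2)"
proof -
  obtain bump' c0 c1 where db: "\<And>t. (bump has_real_derivative bump' t) (at t)" and cb: "continuous_on UNIV bump'"
    and ci: "integral {0..1} (\<lambda>t. (bump t)\<^sup>2) = c0" "integral {0..1} (\<lambda>t. (bump' t)\<^sup>2) = c1" "0 < c0" "0 \<le> c1"
    and out': "\<And>t. t \<notin> {0..1} \<Longrightarrow> bump' t = 0"
    by (fact bump_integrals)
  define T where "T = 1 + c1 / (\<eta> * c0)"
  have T: "1 \<le> T" "c1 / T \<le> \<eta> * (T * c0)"
  proof -
    show T1: "1 \<le> T" unfolding T_def using ci \<eta> by simp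
    have "c1 \<le> \<eta> * c0 * T" unfolding T_def using ci \<eta> by (simp add: distrib_left)
    also have "\<dots> \<le> \<eta> * c0 * T * T" using T1 ci \<eta> mult_left_mono[of 1 T "\<eta> * c0 * T"] by simp
    finally show "c1 / T \<le> \<eta> * (T * c0)" using T1 by (simp add: divide_le_eq mult_ac)
  qed
  have q: "0 < s / D" "s / D < 1" if "0 < s" "s < D" for s using that D by auto
  define l where "l s = - ln (X k (s / D))" for s
  have dl: "(l has_real_derivative - (P k (s / D) / s)) (at s)" if "0 < s" "s < D" for s
  proof -
    have "((\<lambda>s. X k (s / D)) has_real_derivative P k (s / D) * X k (s / D) / (s / D) * (1 / D)) (at s)"
      by (rule DERIV_chain2[where f = "X k" and g = "\<lambda>s. s / D", OF X_deriv[OF q[OF that]]])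
        (use D in \<open>auto intro!: derivative_eq_intros\<close>)
    moreover have "P k (s / D) * X k (s / D) / (s / D) * (1 / D) = P k (s / D) * X k (s / D) / s"
      using D by simp
    ultimately have "((\<lambda>s. X k (s / D)) has_real_derivative P k (s / D) * X k (s / D) / s) (at s)"
      by (simp only:)
    from DERIV_minus[OF DERIV_chain2[OF DERIV_ln[OF X_bounds(1)[OF q[OF that], of k]] this]]
    moreover have "- (inverse (X k (s / D)) * (P k (s / D) * X k (s / D) / s)) = - (P k (s / D) / s)"
      using X_bounds(1)[OF q[OF that], of k] by (simp add: field_simps del: X.simps)
    ultimately show ?thesis unfolding l_def[abs_def] by (simp only:)
  qed
  have lc: "continuous_on {s..R} l" if "0 < s" for s
    using R that by (auto intro!: continuous_at_imp_continuous_on DERIV_isCont[OF dl])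
  have l_anti: "l s' \<le> l s" if "0 < s" "s \<le> s'" "s' < D" for s s'
  proof -
    have "X k (s / D) \<le> X k (s' / D)" using that D by (intro X_mono) (auto simp: divide_right_mono)
    then show ?thesis unfolding l_def using X_bounds(1)[OF q, of s k] X_bounds(1)[OF q, of s' k] that by (simp del: X.simps)
  qed
  define a where "a = l R"
  obtain s0 where s0: "0 < s0" "s0 < R" "a + T < l s0"
  proof -
    have "\<forall>\<^sub>F \<rho> in at_right 0. X k \<rho> < exp (- (a + T))"
      by (rule order_tendstoD(2)[OF X_tendsto_0]) simp
    moreover have "\<forall>\<^sub>F \<rho> in at_right 0. \<rho> \<in> {0<..<R / D}"
      by (rule eventually_at_rightI[of 0 "R / D"]) (use R D in auto)
    ultimately have "\<forall>\<^sub>F \<rho> in at_right 0. X k \<rho> < exp (- (a + T)) \<and> \<rho> \<in> {0<..<R / D}"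
      by eventually_elim blast
    then obtain \<rho> where \<rho>: "X k \<rho> < exp (- (a + T))" "0 < \<rho>" "\<rho> < R / D"
      using eventually_happens[of _ "at_right (0::real)"] trivial_limit_at_right_real[of "0::real"] by auto
    have \<rho>1: "\<rho> < 1" using \<rho>(3) R D by (smt (verit) divide_less_eq_1_pos)
    have "ln (X k \<rho>) < ln (exp (- (a + T)))"
      using \<rho>(1) X_bounds(1)[OF \<rho>(2) \<rho>1, of k] by (subst ln_less_cancel_iff) auto
    then have "a + T < l (\<rho> * D)" unfolding l_def using D by (simp del: X.simps)
    then show thesis using that[of "\<rho> * D"] \<rho> D by (simp add: less_divide_eq)
  qed
  obtain r1 where r1: "s0 \<le> r1" "r1 \<le> R" "l r1 = a + T"
    using IVT2'[of l R "a + T" s0] s0 lc[OF s0(1)] T(1) by (auto simp: a_def)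
  have r: "0 < r1" "r1 < R"
    using r1 s0 T(1) by (auto simp: a_def order.order_iff_strict)
  define g where "g s = (l s - a) / T" for s
  have dg: "(g has_real_derivative - (P k (s / D) / s) / T) (at s)" if "0 < s" "s < D" for s
    unfolding g_def[abs_def] using DERIV_cdivide[OF DERIV_diff[OF dl[OF that] DERIV_const[of a]], of T] by simp
  have g_ends: "g r1 = 1" "g R = 0" using T(1) by (auto simp: g_def r1(3) a_def)
  define v where "v s = (if 0 < s \<and> s < D then s powr (- \<sigma>) * P k (s / D) powr (- 1 / 2) * bump (g s) else 0)" for s
  have v0: "v s = 0" if out: "s \<notin> {r1<..<R}" for s
  proof (cases "0 < s \<and> s < D")
    case True
    note that = conjunct1[OF True] out
    have "g s \<notin> {0<..<1}"
    proof (cases "s \<le> r1")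
      case le: True
      have "a + T \<le> l s" using l_anti[OF that(1) le] r R r1(3) by simp
      then have "1 \<le> g s" unfolding g_def using T(1) by (simp add: le_divide_eq)
      then show ?thesis by simp
    next
      case False
      then have "l s \<le> a" unfolding a_def using l_anti[of R s] that r R True by auto
      then have "g s \<le> 0" unfolding g_def using T(1) by (simp add: divide_le_0_iff)
      then show ?thesis by simp
    qed
    then show ?thesis by (simp add: v_def bump_eq_0)
  next
    case False
    then show ?thesis by (auto simp: v_def)
  qed
  have Ck: "Ck_on j v UNIV" for j
  proof -
    let ?S = "{0<..<D}"
    note o = open_greaterThanLessThan
    have 1: "Ck_on j (\<lambda>s. s powr (- \<sigma>)) ?S" by (rule Ck_on_subset[OF _ Ck_on_powr]) auto
    have "Ck_on j (\<lambda>s. P k (s / D)) ?S"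
      unfolding P_def by (intro Ck_on_prod o Ck_on_X D)
    then have 2: "Ck_on j (\<lambda>s. P k (s / D) powr (- 1 / 2)) ?S"
      by (rule Ck_on_compose[OF o open_greaterThan Ck_on_powr]) (use P_bounds(1)[OF q] in auto)
    have "Ck_on j (\<lambda>s. ln (X k (s / D))) ?S"
      by (rule Ck_on_compose[OF o open_greaterThan Ck_on_ln Ck_on_X[OF D]]) (use X_bounds(1)[OF q] in auto)
    then have "Ck_on j (\<lambda>s. (- 1 / T) * ln (X k (s / D)) + (- a / T)) ?S"
      by (intro Ck_on_add Ck_on_mult Ck_on_const o)
    moreover have "(- 1 / T) * ln (X k (s / D)) + (- a / T) = g s" for s
      unfolding g_def l_def using T(1) by (simp add: field_simps)
    ultimately have "Ck_on j g ?S" by (simp only:)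
    then have 3: "Ck_on j (\<lambda>s. bump (g s)) ?S"
      by (rule Ck_on_compose[OF o open_UNIV Ck_on_bump]) simp
    have "Ck_on j (\<lambda>s. s powr (- \<sigma>) * P k (s / D) powr (- 1 / 2) * bump (g s)) ?S"
      by (intro Ck_on_mult 1 2 3 o)
    then have "Ck_on j v ?S" by (rule Ck_on_cong_imp[OF o]) (simp add: v_def)
    moreover have "Ck_on j v {..<r1}"
      by (rule Ck_on_cong_imp[OF open_lessThan Ck_on_const[of j 0]]) (use v0 in auto)
    moreover have "Ck_on j v {R<..}"
      by (rule Ck_on_cong_imp[OF open_greaterThan Ck_on_const[of j 0]]) (use v0 in auto)
    ultimately have "Ck_on j v ({..<r1} \<union> (?S \<union> {R<..}))"
      by (intro Ck_on_Un o open_greaterThan open_lessThan open_Un)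
    moreover have "{..<r1} \<union> (?S \<union> {R<..}) = UNIV" using r R by auto
    ultimately show ?thesis by (simp only:)
  qed
  obtain v' where dv: "\<And>s. (v has_real_derivative v' s) (at s)" and v'c: "Ck_on 0 v' UNIV"
    by (rule Ck_on_real_deriv[OF Ck[of "Suc 0"] open_UNIV]) blast
  have v'0: "v' s = 0" if s: "s \<notin> {r1..R}" for s
  proof -
    have "((\<lambda>t. 0) has_real_derivative 0) (at s)" by simp
    then have "(v has_real_derivative 0) (at s)"
    proof (rule has_field_derivative_transform_within_open[where S = "{..<r1} \<union> {R<..}"])
      show "0 = v x" if "x \<in> {..<r1} \<union> {R<..}" for x using that v0[of x] r by auto
    qed (use s in auto)
    then show ?thesis using DERIV_unique[OF dv] s by auto
  qed
  define L where "L s = (\<sigma> + log_sum k (s / D) / 2) / s" for s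
  have v'_eq: "v' s + L s * v s = - (s powr (- \<sigma>) * P k (s / D) powr (1 / 2) / (s * T) * bump' (g s))"
    if s: "0 < s" "s < D" for s
  proof -
    define p where "p = P k (s / D)"
    have p: "0 < p" unfolding p_def by (rule P_bounds(1)[OF q[OF s]])
    have d1: "((\<lambda>s. s powr (- \<sigma>)) has_real_derivative - \<sigma> * s powr (- \<sigma> - 1)) (at s)"
      using has_real_derivative_powr[of s "- \<sigma>"] s by simp
    have "((\<lambda>s. P k (s / D)) has_real_derivative p * log_sum k (s / D) / (s / D) * (1 / D)) (at s)"
      unfolding p_def
      by (rule DERIV_chain2[where f = "P k" and g = "\<lambda>s. s / D", OF P_deriv[OF q[OF s]]])
        (use D in \<open>auto intro!: derivative_eq_intros\<close>)
    from DERIV_chain2[where f = "\<lambda>x. x powr (- 1 / 2)", OF has_real_derivative_powr this]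
    have d2: "((\<lambda>s. P k (s / D) powr (- 1 / 2)) has_real_derivative
        (- 1 / 2 * p powr (- 1 / 2 - 1)) * (p * log_sum k (s / D) / (s / D) * (1 / D))) (at s)"
      using p unfolding p_def by simp
    have d3: "((\<lambda>s. bump (g s)) has_real_derivative bump' (g s) * (- (P k (s / D) / s) / T)) (at s)"
      by (rule DERIV_chain2[OF db dg[OF s]])
    have "((\<lambda>s. s powr (- \<sigma>) * P k (s / D) powr (- 1 / 2) * bump (g s)) has_real_derivative
       ((- \<sigma> * s powr (- \<sigma> - 1)) * P k (s / D) powr (- 1 / 2) +
        ((- 1 / 2 * p powr (- 1 / 2 - 1)) * (p * log_sum k (s / D) / (s / D) * (1 / D))) * s powr (- \<sigma>)) * bump (g s) +
       (bump' (g s) * (- (P k (s / D) / s) / T)) * (s powr (- \<sigma>) * P k (s / D) powr (- 1 / 2))) (at s)"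
      by (intro DERIV_mult d1 d2 d3)
    then have "(v has_real_derivative
       ((- \<sigma> * s powr (- \<sigma> - 1)) * P k (s / D) powr (- 1 / 2) +
        ((- 1 / 2 * p powr (- 1 / 2 - 1)) * (p * log_sum k (s / D) / (s / D) * (1 / D))) * s powr (- \<sigma>)) * bump (g s) +
       (bump' (g s) * (- (P k (s / D) / s) / T)) * (s powr (- \<sigma>) * P k (s / D) powr (- 1 / 2))) (at s)"
      by (rule has_field_derivative_transform_within_open[where S = "{0<..<D}"]) (use s in \<open>auto simp: v_def\<close>)
    from DERIV_unique[OF dv this]
    have e: "v' s = ((- \<sigma> * s powr (- \<sigma> - 1)) * p powr (- 1 / 2) +
        ((- 1 / 2 * p powr (- 1 / 2 - 1)) * (p * log_sum k (s / D) / (s / D) * (1 / D))) * s powr (- \<sigma>)) * bump (g s) +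
       (bump' (g s) * (- (p / s) / T)) * (s powr (- \<sigma>) * p powr (- 1 / 2))"
      using s unfolding p_def by simp
    have "s powr (- \<sigma> - 1) = s powr (- \<sigma>) / s" "p powr (- 1 / 2 - 1) = p powr (- 1 / 2) / p"
      using s p by (simp_all only: powr_diff powr_one less_imp_le)
    moreover have "p powr (1 / 2) = p powr (- 1 / 2) * p"
    proof -
      have "p powr (1 / 2) = p powr (- 1 / 2 + 1)" by simp
      then show ?thesis using p by (simp only: powr_add) simp
    qed
    moreover have "v s = s powr (- \<sigma>) * p powr (- 1 / 2) * bump (g s)" using s by (simp add: v_def p_def)
    moreover have "((- \<sigma> * (y / s)) * z + ((- 1 / 2 * (z / p)) * (p * m / (s / D) * (1 / D))) * y) * t + (t' * (- (p / s) / T)) * (y * z)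
       + (\<sigma> + m / 2) / s * (y * z * t) = - (y * (z * p) / (s * T) * t')" for y z m t t'
      using s p D T(1) by (simp add: field_simps)
    ultimately show ?thesis unfolding L_def e p_def[symmetric] by (simp only:)
  qed
  let ?E = "\<lambda>s. s powr (2 * \<sigma> + 1) * (v' s)\<^sup>2"
  let ?V = "\<lambda>s. s powr (2 * \<sigma> - 1) * (\<sigma>\<^sup>2 + log_square_sum k (s / D) / 4) * (v s)\<^sup>2"
  let ?V' = "\<lambda>s. s powr (2 * \<sigma> - 1) * (\<sigma>\<^sup>2 + log_square_sum k' (s / D) / 4) * (v s)\<^sup>2"
  let ?W = "\<lambda>s. s powr (2 * \<sigma> - 1) * (P k (s / D))\<^sup>2 * (v s)\<^sup>2"
  let ?F = "\<lambda>s. s powr (2 * \<sigma> + 1) * (v' s + L s * v s)\<^sup>2"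
  have sub: "{r1..R} \<subseteq> {0<..<D}" using r R by auto
  have vc: "continuous_on {r1..R} v" by (rule continuous_on_subset[OF Ck_on_continuous[OF Ck[of 0]] subset_UNIV])
  have v'c': "continuous_on {r1..R} v'" by (rule continuous_on_subset[OF Ck_on_continuous[OF v'c] subset_UNIV])
  note logc = continuous_on_subset[OF log_sums_continuous(1)[OF D] sub] continuous_on_subset[OF log_sums_continuous(2)[OF D] sub]
    continuous_on_subset[OF log_sums_continuous(4)[OF D] sub]
  have pw: "continuous_on {r1..R} (\<lambda>s. s powr x)" for x
    by (intro continuous_intros) (use r in auto)
  have id: "continuous_on {r1..R} (\<lambda>s. s)" by (rule continuous_on_id)
  have Ei: "?E integrable_on {r1..R}" and Vi: "?V integrable_on {r1..R}" and V'i: "?V' integrable_on {r1..R}"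
    and Wi: "?W integrable_on {r1..R}"
    by (intro integrable_continuous_real continuous_on_mult continuous_on_power continuous_on_add
        continuous_on_const continuous_on_divide pw vc v'c' logc; simp)+
  have dQ: "((\<lambda>s. ?E s - ?V s - ?F s) has_integral 0) {r1..R}"
  proof -
    have "((\<lambda>s. ?E s - ?V s - ?F s) has_integral
        (- (R powr (2 * \<sigma>) * (\<sigma> + log_sum k (R / D) / 2) * (v R)\<^sup>2) - - (r1 powr (2 * \<sigma>) * (\<sigma> + log_sum k (r1 / D) / 2) * (v r1)\<^sup>2))) {r1..R}"
    proof (rule fundamental_theorem_of_calculus)
      fix s assume s: "s \<in> {r1..R}"
      then have "0 < s" "s < D" using sub by auto
      from has_field_derivative_at_within[OF radial_identity[OF this dv, of \<sigma> k]]
      show "((\<lambda>s. - (s powr (2 * \<sigma>) * (\<sigma> + log_sum k (s / D) / 2) * (v s)\<^sup>2)) has_vector_derivative ?E s - ?V s - ?F s) (at s within {r1..R})"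
        using \<open>0 < s\<close> unfolding L_def by (simp add: has_real_derivative_iff_has_vector_derivative)
    qed (use r in simp)
    moreover have "v R = 0" "v r1 = 0" using v0 r by auto
    ultimately show ?thesis by simp
  qed
  \<comment> \<open>substitution of the logarithmic variable\<close>
  have subst: "((\<lambda>s. P k (s / D) / s * f (g s)) has_integral T * integral {0..1} f) {r1..R}"
    if f: "continuous_on UNIV f" for f :: "real \<Rightarrow> real"
  proof -
    have "((\<lambda>s. (- (P k (s / D) / s) / T) *\<^sub>R f (g s)) has_integral (integral {g r1..g R} f - integral {g R..g r1} f)) {r1..R}"
    proof (rule has_integral_substitution_general[of "{}" _ _ _ "Inf (g ` {r1..R})" "Sup (g ` {r1..R})"])
      have gc: "continuous_on {r1..R} g"
        using sub by (auto intro!: continuous_at_imp_continuous_on DERIV_isCont[OF dg])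
      then show "continuous_on {r1..R} g" .
      have "compact (g ` {r1..R})" by (intro compact_continuous_image gc) auto
      then have "bdd_above (g ` {r1..R})" "bdd_below (g ` {r1..R})"
        by (auto dest: compact_imp_bounded intro: bounded_imp_bdd_above bounded_imp_bdd_below)
      then show "g ` {r1..R} \<subseteq> {Inf (g ` {r1..R})..Sup (g ` {r1..R})}"
        by (auto intro!: cInf_lower cSup_upper)
      show "(g has_field_derivative - (P k (s / D) / s) / T) (at s within {r1..R})" if "s \<in> {r1..R} - {}" for s
        using that sub by (intro has_field_derivative_at_within[OF dg]) auto
    qed (use r f in \<open>auto intro: continuous_on_subset\<close>)
    from has_integral_mult_right[OF this, of "- T"] T(1) show ?thesis
      by (simp add: g_ends field_simps)
  qed
  have bc: "continuous_on UNIV bump" by (rule Ck_on_continuous[OF Ck_on_bump[of 0]])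
  have W_int: "(?W has_integral T * c0) {r1..R}"
  proof (rule has_integral_eq[OF _ subst[of "\<lambda>t. (bump t)\<^sup>2", unfolded ci(1)]])
    show "P k (s / D) / s * (bump (g s))\<^sup>2 = ?W s" if "s \<in> {r1..R}" for s
    proof -
      have s: "0 < s" "s < D" using that sub by auto
      define p where "p = P k (s / D)"
      have p: "0 < p" unfolding p_def by (rule P_bounds(1)[OF q[OF s]])
      have "v s = s powr (- \<sigma>) * p powr (- 1 / 2) * bump (g s)" using s by (simp add: v_def p_def)
      moreover have inv: "x powr (- 1) = 1 / x" if "0 < x" for x :: real
        using that by (simp add: powr_minus_divide)
      moreover have "(s powr (- \<sigma>))\<^sup>2 = s powr (- 2 * \<sigma>)"
        by (simp add: power2_eq_square flip: powr_add)
      moreover have "(p powr (- 1 / 2))\<^sup>2 = 1 / p"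
        unfolding inv[OF p, symmetric] by (simp add: power2_eq_square flip: powr_add)
      moreover have "s powr (2 * \<sigma> - 1) * s powr (- 2 * \<sigma>) = 1 / s"
        unfolding inv[OF s(1), symmetric] by (simp flip: powr_add)
      ultimately have "?W s = 1 / s * p\<^sup>2 * (1 / p) * (bump (g s))\<^sup>2"
        unfolding p_def[symmetric] by (simp add: power_mult_distrib mult_ac)
      then show ?thesis using p by (simp add: p_def[symmetric] power2_eq_square)
    qed
  qed (intro continuous_intros bc)
  have F_int: "(?F has_integral c1 / T) {r1..R}"
  proof -
    have "((\<lambda>s. P k (s / D) / s * (bump' (g s))\<^sup>2 * (1 / T\<^sup>2)) has_integral T * c1 * (1 / T\<^sup>2)) {r1..R}"
      by (rule has_integral_mult_left[OF subst[of "\<lambda>t. (bump' t)\<^sup>2", unfolded ci(2)]]) (intro continuous_intros cb)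
    moreover have "T * c1 * (1 / T\<^sup>2) = c1 / T" using T(1) by (simp add: power2_eq_square)
    ultimately have "((\<lambda>s. P k (s / D) / s * (bump' (g s))\<^sup>2 * (1 / T\<^sup>2)) has_integral c1 / T) {r1..R}" by simp
    then show ?thesis
    proof (rule has_integral_eq[rotated])
      show "P k (s / D) / s * (bump' (g s))\<^sup>2 * (1 / T\<^sup>2) = ?F s" if "s \<in> {r1..R}" for s
      proof -
        have s: "0 < s" "s < D" using that sub by auto
        define p where "p = P k (s / D)"
        have p: "0 < p" unfolding p_def by (rule P_bounds(1)[OF q[OF s]])
        have "(s powr (- \<sigma>))\<^sup>2 = s powr (- 2 * \<sigma>)" "(p powr (1 / 2))\<^sup>2 = p"
          using s p by (simp_all add: powr_power)
        moreover have "s powr (2 * \<sigma> + 1) * s powr (- 2 * \<sigma>) = s"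
          using s by (simp flip: powr_add)
        ultimately have "?F s = s * p / (s * T)\<^sup>2 * (bump' (g s))\<^sup>2"
          unfolding v'_eq[OF s] p_def[symmetric] by (simp add: power_mult_distrib power_divide mult_ac)
        then show ?thesis using s T(1) by (simp add: p_def[symmetric] power2_eq_square)
      qed
    qed
  qed
  have W: "integral {r1..R} ?W = T * c0" by (rule integral_unique[OF W_int])
  have "integral {r1..R} (\<lambda>s. ?E s - ?V s - ?F s) = integral {r1..R} ?E - integral {r1..R} ?V - integral {r1..R} ?F"
    using Ei Vi has_integral_integrable[OF F_int] by (simp add: integral_diff integrable_diff)
  then have "integral {r1..R} ?E - integral {r1..R} ?V = c1 / T"
    using integral_unique[OF dQ] integral_unique[OF F_int] by simp
  moreover have "integral {r1..R} ?V = integral {r1..R} ?V' + 1 / 4 * integral {r1..R} ?W"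
  proof -
    have "?V = (\<lambda>s. ?V' s + 1 / 4 * ?W s)"
      by (rule ext) (simp add: k log_square_sum_Suc algebra_simps del: X.simps)
    then show ?thesis using V'i Wi by (simp only: integral_add integrable_on_mult_right integral_mult_right)
  qed
  ultimately have main: "integral {r1..R} ?E - integral {r1..R} ?V' \<le> (1 / 4 + \<eta>) * integral {r1..R} ?W"
    using T(2) unfolding W by (simp add: distrib_right)
  have Wpos: "0 < integral {r1..R} ?W" unfolding W using T(1) ci by simp
  show ?thesis
  proof (rule that[OF r Ck _ _ _ Wpos main])
    show "(v has_real_derivative v' s) (at s)" for s by (rule dv)
    show "continuous_on UNIV v'" by (rule Ck_on_continuous[OF v'c])
    show "v s = 0 \<and> v' s = 0" if "s \<notin> {r1..R}" for s
      using v0[of s] v'0[of s] that by auto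
  qed
qed

section \<open>Trial functions in the half-space\<close>

lemma Ck_on_fst:
  fixes f :: "'a::euclidean_space \<Rightarrow> real"
  assumes "Ck_on k f UNIV"
  shows "Ck_on k (\<lambda>z::'a \<times> 'b::euclidean_space. f (fst z)) UNIV"
  using assms
proof (induction k arbitrary: f)
  case 0
  then show ?case by (auto intro!: continuous_on_compose2[of UNIV f] continuous_intros)
next
  case (Suc k)
  show ?case
  proof (rule Ck_on_SucI[OF open_UNIV])
    show "((\<lambda>z. f (fst z)) has_derivative (\<lambda>h. frechet_derivative f (at (fst z)) (fst h))) (at z)" for z :: "'a \<times> 'b"
      by (rule has_derivative_compose[OF has_derivative_fst[OF has_derivative_ident] Ck_on_SucE(1)[OF Suc.prems]]) simp
    show "Ck_on k (\<lambda>z::'a \<times> 'b. frechet_derivative f (at (fst z)) (fst h)) UNIV" for h :: "'a \<times> 'b"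
      by (rule Suc.IH[OF Ck_on_SucE(2)[OF Suc.prems]])
  qed
qed

context hardy_setting
begin

text \<open>
  The product of a radial function and of the truncated ground state, in terms of \<open>r\<close>, in place of the
  dual norm, and \<open>y\<close>; \<open>r\<^sup>2 / (r\<^sup>2 + y\<^sup>2)\<close> is the variable \<open>t\<close> of the hypergeometric function.
\<close>

definition trial where
  "trial v m r y = v (sqrt (r\<^sup>2 + y\<^sup>2)) * taylor m (r\<^sup>2 / (r\<^sup>2 + y\<^sup>2))"
definition trial_energy where
  "trial_energy v v' m r y = (v' (sqrt (r\<^sup>2 + y\<^sup>2)) * taylor m (r\<^sup>2 / (r\<^sup>2 + y\<^sup>2)))\<^sup>2
     + 4 * (r\<^sup>2 / (r\<^sup>2 + y\<^sup>2)) * (y\<^sup>2 / (r\<^sup>2 + y\<^sup>2)) * (taylor1 m (r\<^sup>2 / (r\<^sup>2 + y\<^sup>2)) * v (sqrt (r\<^sup>2 + y\<^sup>2)))\<^sup>2 / (r\<^sup>2 + y\<^sup>2)"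

lemma Ck_on_trial:
  fixes N :: "'a \<Rightarrow> real"
  assumes N: "Ck_on k N UNIV" "\<And>x. 0 < N x" and v: "Ck_on k v UNIV"
  shows "Ck_on k (\<lambda>z. trial v m (N (fst z)) (snd z)) UNIV"
proof -
  let ?s = "\<lambda>z::'a \<times> real. (N (fst z))\<^sup>2 + (snd z)\<^sup>2"
  have n: "Ck_on k (\<lambda>z::'a \<times> real. (N (fst z))\<^sup>2) UNIV" by (intro Ck_on_power Ck_on_fst N open_UNIV)
  have s: "Ck_on k ?s UNIV"
    by (intro Ck_on_add n Ck_on_power Ck_on_bounded_linear bounded_linear_snd open_UNIV)
  have pos: "0 < ?s z" for z using N(2)[of "fst z"] by (intro add_pos_nonneg) auto
  have p: "Ck_on k (\<lambda>z. ?s z powr a) UNIV" for a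
    by (rule Ck_on_compose[OF open_UNIV open_greaterThan Ck_on_powr s]) (use pos in auto)
  have a: "Ck_on k (\<lambda>z. v (?s z powr (1 / 2))) UNIV"
    by (rule Ck_on_compose[OF open_UNIV open_UNIV v p]) simp
  have T: "Ck_on k (taylor m) UNIV"
    unfolding taylor_def[abs_def]
    by (intro Ck_on_sum Ck_on_mult Ck_on_const Ck_on_power Ck_on_bounded_linear bounded_linear_ident open_UNIV)
  have b: "Ck_on k (\<lambda>z. taylor m ((N (fst z))\<^sup>2 * ?s z powr (- 1))) UNIV"
    by (rule Ck_on_compose[OF open_UNIV open_UNIV T]) (intro Ck_on_mult n p open_UNIV, simp)
  have "trial v m (N (fst z)) (snd z) = v (?s z powr (1 / 2)) * taylor m ((N (fst z))\<^sup>2 * ?s z powr (- 1))" for z :: "'a \<times> real"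
    unfolding trial_def using pos[of z] by (simp add: powr_half_sqrt powr_minus_divide)
  then show ?thesis by (simp only:) (intro Ck_on_mult a b open_UNIV)
qed

text \<open>
  In the plane of \<open>(r, y)\<close> the gradients of radius and angle are orthogonal, which leaves the sum of two
  squares; the substitution of a function \<open>N\<close> with \<open>H (\<nabla>N) \<le> 1\<close> for \<open>r\<close> does not increase it.
\<close>

lemma trial_grad:
  fixes N :: "'a \<Rightarrow> real"
  assumes N: "GDERIV N (fst z) :> G" "0 < N (fst z)" "H G \<le> 1"
    and v: "\<And>s. (v has_real_derivative v' s) (at s)"
  shows "(Phi H (grad (\<lambda>z. trial v m (N (fst z)) (snd z)) z))\<^sup>2 \<le> trial_energy v v' m (N (fst z)) (snd z)"
proof -
  define n y where "n = N (fst z)" and "y = snd z"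
  define s where "s = n\<^sup>2 + y\<^sup>2"
  define T T' V V' where "T = taylor m (n\<^sup>2 / s)" and "T' = taylor1 m (n\<^sup>2 / s)"
    and "V = v (sqrt s)" and "V' = v' (sqrt s)"
  have n: "0 < n" unfolding n_def by (rule N(2))
  then have s: "0 < s" unfolding s_def by (intro add_pos_nonneg) auto
  have "(N has_derivative (\<lambda>h. inner h G)) (at (fst z))" using N(1) by (simp add: gderiv_def)
  from has_derivative_compose[OF has_derivative_fst[OF has_derivative_ident] this]
  have dn: "GDERIV (\<lambda>z. N (fst z)) z :> (G, 0)" by (simp add: gderiv_def inner_prod_def)
  have dy: "GDERIV snd z :> (0::'a, 1::real)"
    unfolding gderiv_def by (rule has_derivative_eq_rhs[OF has_derivative_snd[OF has_derivative_ident]]) (simp add: inner_prod_def)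
  note n2 = GDERIV_mult[OF dn dn]
  note ds = GDERIV_add[OF n2 GDERIV_mult[OF dy dy]]
  have sq: "N (fst z) * N (fst z) + snd z * snd z = s" by (simp add: s_def n_def y_def power2_eq_square)
  have dr: "(sqrt has_real_derivative inverse (sqrt s) / 2) (at (N (fst z) * N (fst z) + snd z * snd z))"
    unfolding sq by (rule DERIV_real_sqrt[OF s])
  have dv: "GDERIV (\<lambda>z. v (sqrt (N (fst z) * N (fst z) + snd z * snd z))) z :>
      V' *\<^sub>R (inverse (sqrt s) / 2) *\<^sub>R ((n *\<^sub>R (G, 0) + n *\<^sub>R (G, 0)) + (y *\<^sub>R (0, 1) + y *\<^sub>R (0, 1)))"
    by (rule GDERIV_DERIV_compose[OF GDERIV_DERIV_compose[OF ds dr, folded n_def y_def]])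
      (use v in \<open>simp add: V'_def sq\<close>)
  have di: "GDERIV (\<lambda>z. inverse (N (fst z) * N (fst z) + snd z * snd z)) z :>
      - (inverse s)\<^sup>2 *\<^sub>R ((n *\<^sub>R (G, 0) + n *\<^sub>R (G, 0)) + (y *\<^sub>R (0, 1) + y *\<^sub>R (0, 1)))"
    using GDERIV_inverse[OF ds] s unfolding sq by (simp add: n_def y_def)
  have dt: "GDERIV (\<lambda>z. (N (fst z) * N (fst z)) * inverse (N (fst z) * N (fst z) + snd z * snd z)) z :>
      (n * n) *\<^sub>R (- (inverse s)\<^sup>2 *\<^sub>R ((n *\<^sub>R (G, 0) + n *\<^sub>R (G, 0)) + (y *\<^sub>R (0, 1) + y *\<^sub>R (0, 1))))
      + inverse s *\<^sub>R (n *\<^sub>R (G, 0) + n *\<^sub>R (G, 0))"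
    using GDERIV_mult[OF n2 di] unfolding sq by (simp only: n_def)
  have te: "N (fst z) * N (fst z) * inverse s = n\<^sup>2 / s"
    by (simp add: n_def power2_eq_square divide_inverse)
  have dT: "GDERIV (\<lambda>z. taylor m ((N (fst z) * N (fst z)) * inverse (N (fst z) * N (fst z) + snd z * snd z))) z :>
      T' *\<^sub>R ((n * n) *\<^sub>R (- (inverse s)\<^sup>2 *\<^sub>R ((n *\<^sub>R (G, 0) + n *\<^sub>R (G, 0)) + (y *\<^sub>R (0, 1) + y *\<^sub>R (0, 1))))
      + inverse s *\<^sub>R (n *\<^sub>R (G, 0) + n *\<^sub>R (G, 0)))"
    by (rule GDERIV_DERIV_compose[OF dt]) (simp only: sq te T'_def taylor_deriv)
  define Z where "Z = V *\<^sub>R (T' *\<^sub>R ((n * n) *\<^sub>R (- (inverse s)\<^sup>2 *\<^sub>R ((n *\<^sub>R (G, 0) + n *\<^sub>R (G, 0)) + (y *\<^sub>R (0::'a, 1::real) + y *\<^sub>R (0, 1))))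
      + inverse s *\<^sub>R (n *\<^sub>R (G, 0) + n *\<^sub>R (G, 0))))
      + T *\<^sub>R (V' *\<^sub>R (inverse (sqrt s) / 2) *\<^sub>R ((n *\<^sub>R (G, 0) + n *\<^sub>R (G, 0)) + (y *\<^sub>R (0, 1) + y *\<^sub>R (0, 1))))"
  have "GDERIV (\<lambda>z. v (sqrt (N (fst z) * N (fst z) + snd z * snd z))
      * taylor m ((N (fst z) * N (fst z)) * inverse (N (fst z) * N (fst z) + snd z * snd z))) z :> Z"
    using GDERIV_mult[OF dv dT] unfolding sq te Z_def V_def T_def .
  then have "GDERIV (\<lambda>z. trial v m (N (fst z)) (snd z)) z :> Z"
    by (simp only: trial_def power2_eq_square divide_inverse)
  then have g: "grad (\<lambda>z. trial v m (N (fst z)) (snd z)) z = Z" by (rule grad_eq)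
  define i j where "i = inverse s" and "j = inverse (sqrt s) / 2"
  define p q where "p = T * V' * (2 * j)" and "q = V * T' * (2 * n * y * (i * i))"
  have ii: "i = (n * n + y * y) * (i * i)" 
  proof -
    have "n * n + y * y = s" by (simp add: s_def power2_eq_square)
    then show ?thesis using s by (simp add: i_def)
  qed
  have Z: "Z = V *\<^sub>R (T' *\<^sub>R ((n * n) *\<^sub>R (- (i * i) *\<^sub>R ((n *\<^sub>R (G, 0) + n *\<^sub>R (G, 0)) + (y *\<^sub>R (0::'a, 1::real) + y *\<^sub>R (0, 1))))
      + i *\<^sub>R (n *\<^sub>R (G, 0) + n *\<^sub>R (G, 0))))
      + T *\<^sub>R (V' *\<^sub>R j *\<^sub>R ((n *\<^sub>R (G, 0) + n *\<^sub>R (G, 0)) + (y *\<^sub>R (0, 1) + y *\<^sub>R (0, 1))))"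
    unfolding Z_def i_def j_def power2_eq_square ..
  have snd: "snd Z = p * y - q * n" by (simp add: Z p_def q_def algebra_simps)
  have fst: "fst Z = (p * n + q * y) *\<^sub>R G"
  proof -
    have "fst Z = (V * (T' * (n * (n * (- (i * i) * (n + n))) + i * (n + n))) + T * (V' * (j * (n + n)))) *\<^sub>R G"
      unfolding Z by (simp only: fst_add fst_scaleR fst_conv scaleR_zero_right add_0_right scaleR_left_distrib[symmetric] scaleR_scaleR mult.assoc)
    also have "n * (n * (- (i * i) * (n + n))) + i * (n + n)
        = n * n * (- (i * i) * (n + n)) + (n * n + y * y) * (i * i) * (n + n)"
      using ii by (simp only: mult.assoc)
    also have "V * (T' * \<dots>) + T * (V' * (j * (n + n))) = p * n + q * y"
      unfolding p_def q_def by (simp add: algebra_simps)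
    finally show ?thesis .
  qed
  have "(Phi H Z)\<^sup>2 = (\<bar>p * n + q * y\<bar> * H G)\<^sup>2 + (p * y - q * n)\<^sup>2"
    by (simp add: Phi_sq[OF norm_H] fst snd norm_scale[OF norm_H])
  also have "\<dots> \<le> (\<bar>p * n + q * y\<bar> * 1)\<^sup>2 + (p * y - q * n)\<^sup>2"
    using N(3) by (intro add_right_mono power_mono mult_left_mono) (auto intro!: mult_nonneg_nonneg norm_nonneg[OF norm_H])
  also have "\<dots> = (p * n + q * y)\<^sup>2 + (p * y - q * n)\<^sup>2" by simp
  also have "\<dots> = p\<^sup>2 * s + q\<^sup>2 * s"
    by (simp add: s_def power2_eq_square algebra_simps)
  also have "p\<^sup>2 * s = (V' * T)\<^sup>2"
  proof -
    have "p = T * V' / sqrt s" by (simp add: p_def j_def inverse_eq_divide)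
    then show ?thesis using s by (simp add: power_divide power_mult_distrib)
  qed
  also have "q\<^sup>2 * s = 4 * (n\<^sup>2 / s) * (y\<^sup>2 / s) * (T' * V)\<^sup>2 / s"
    using s by (simp add: q_def i_def power2_eq_square field_simps)
  also have "(V' * T)\<^sup>2 + 4 * (n\<^sup>2 / s) * (y\<^sup>2 / s) * (T' * V)\<^sup>2 / s = trial_energy v v' m n y"
    unfolding trial_energy_def s_def[symmetric] V_def V'_def T_def T'_def ..
  finally show ?thesis unfolding g n_def y_def .
qed

text \<open>
  A lower bound of \<open>r\<close> by half of the dual norm costs at most a factor 2 in the radius of the support.
\<close>

lemma trial_eq_0:
  assumes "\<And>s. s \<notin> {r1..R} \<Longrightarrow> v s = 0 \<and> v' s = 0" "0 \<le> r" "x \<le> 2 * r" "0 \<le> x" "2 * R < sqrt (x\<^sup>2 + y\<^sup>2)"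
  shows "trial v m r y = 0" "trial_energy v v' m r y = 0"
proof -
  have "x\<^sup>2 \<le> 4 * r\<^sup>2" using power_mono[OF assms(3,4), of 2] by (simp add: power_mult_distrib)
  then have "x\<^sup>2 + y\<^sup>2 \<le> 4 * (r\<^sup>2 + y\<^sup>2)" using zero_le_power2[of y] unfolding distrib_left by linarith
  then have "sqrt (x\<^sup>2 + y\<^sup>2) \<le> sqrt (4 * (r\<^sup>2 + y\<^sup>2))" by (rule real_sqrt_le_mono)
  also have "\<dots> = 2 * sqrt (r\<^sup>2 + y\<^sup>2)" unfolding real_sqrt_mult by simp
  finally have "sqrt (r\<^sup>2 + y\<^sup>2) \<notin> {r1..R}" using assms(5) by auto
  from assms(1)[OF this] show "trial v m r y = 0" "trial_energy v v' m r y = 0"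
    by (simp_all add: trial_def trial_energy_def)
qed

lemma trial_test_function:
  fixes N :: "'a \<Rightarrow> real"
  assumes N: "\<And>k. Ck_on k N UNIV" "\<And>x. 0 < N x" "\<And>x. N0 x \<le> 2 * N x"
    and v: "\<And>k. Ck_on k v UNIV" "\<And>s. s \<notin> {r1..R} \<Longrightarrow> v s = 0"
    and U: "{z. Phi0 H z \<le> 2 * R} \<subseteq> U"
  shows "(\<lambda>z. trial v m (N (fst z)) (snd z)) \<in> test_functions U"
proof -
  let ?u = "\<lambda>z. trial v m (N (fst z)) (snd z)" and ?S = "{z. Phi0 H z \<le> 2 * R}"
  have "closed ?S" by (intro closed_Collect_le norm_continuous[OF norm_Phi0] continuous_on_const)
  moreover have "bounded ?S"
  proof -
    obtain c where c: "0 < c" "\<And>z. c * norm z \<le> Phi0 H z" using norm_lower[OF norm_Phi0] by blast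
    have "norm z \<le> 2 * R / c" if "z \<in> ?S" for z
      using c(2)[of z] that c(1) by (simp add: pos_le_divide_eq mult.commute[of _ c])
    then show ?thesis unfolding bounded_iff by blast
  qed
  ultimately have S: "compact ?S" "closed ?S" by (simp_all add: compact_eq_bounded_closed)
  have "?u z = 0" if "z \<notin> ?S" for z
  proof (rule trial_eq_0(1)[where v' = v and x = "N0 (fst z)"])
    show "2 * R < sqrt ((N0 (fst z))\<^sup>2 + (snd z)\<^sup>2)" using that by (simp add: Phi0_def case_prod_beta)
  qed (use N(2)[of "fst z"] N(3)[of "fst z"] norm_nonneg[OF norm_N0] v(2) in \<open>auto simp: less_imp_le\<close>)
  then have sub: "closure {z. ?u z \<noteq> 0} \<subseteq> ?S" by (intro closure_minimal S(2)) auto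
  have "compact (?S \<inter> closure {z. ?u z \<noteq> 0})" by (rule compact_Int_closed[OF S(1) closed_closure])
  then have "compact (closure {z. ?u z \<noteq> 0})" unfolding Int_absorb1[OF sub] .
  then show ?thesis
    unfolding test_functions_def using sub U Ck_on_trial[OF N(1,2) v(1)] by auto
qed

end

section \<open>Passage to the dual norm\<close>

lemma ennreal_liminf_add:
  fixes f g :: "nat \<Rightarrow> ennreal"
  shows "liminf f + liminf g \<le> liminf (\<lambda>n. f n + g n)"
proof -
  have i: "incseq (\<lambda>n. INF m\<in>{n..}. h m)" for h :: "nat \<Rightarrow> ennreal"
    by (intro incseq_SucI INF_superset_mono) auto
  have "liminf f + liminf g = (SUP n. (INF m\<in>{n..}. f m) + (INF m\<in>{n..}. g m))"
    unfolding liminf_SUP_INF by (rule ennreal_SUP_add[OF i i, symmetric])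
  also have "\<dots> \<le> (SUP n. (INF m\<in>{n..}. f m + g m))"
    by (intro SUP_mono' INF_greatest add_mono INF_lower) auto
  finally show ?thesis unfolding liminf_SUP_INF .
qed

context hardy_setting
begin

text \<open>
  Dominated convergence: the bound by \<open>C / \<Phi>\<^sub>0\<^sup>2\<close> on a bounded set is integrable.
\<close>

lemma nn_integral_weighted_tendsto:
  fixes F :: "nat \<Rightarrow> 'a \<times> real \<Rightarrow> real"
  assumes F [measurable]: "\<And>j. F j \<in> borel_measurable borel" "F' \<in> borel_measurable borel"
    and bd: "\<And>j z. 0 < snd z \<Longrightarrow> F j z \<le> C / (Phi0 H z)\<^sup>2"
    and supp: "\<And>j z. 0 < snd z \<Longrightarrow> R < Phi0 H z \<Longrightarrow> F j z = 0"
    and lim: "\<And>z. 0 < snd z \<Longrightarrow> (\<lambda>j. F j z) \<longlonglongrightarrow> F' z"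
  shows "(\<lambda>j. \<integral>\<^sup>+z. indicator {z. 0 < snd z} z * ennreal (snd z powr \<alpha> * F j z) \<partial>lborel)
    \<longlonglongrightarrow> (\<integral>\<^sup>+z. indicator {z. 0 < snd z} z * ennreal (snd z powr \<alpha> * F' z) \<partial>lborel)"
proof -
  have [measurable]: "(snd :: 'a \<times> real \<Rightarrow> real) \<in> borel_measurable borel"
    by (intro borel_measurable_continuous_onI continuous_intros)
  define G where "G z = (if Phi0 H z \<le> R then \<bar>C\<bar> / (Phi0 H z)\<^sup>2 else 0)" for z
  have [measurable]: "G \<in> borel_measurable borel" unfolding G_def[abs_def] by measurable
  show ?thesis
  proof (rule nn_integral_dominated_convergence[where w = "\<lambda>z. indicator {z. 0 < snd z} z * ennreal (snd z powr \<alpha> * G z)"])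
    show "(\<integral>\<^sup>+z. indicator {z. 0 < snd z} z * ennreal (snd z powr \<alpha> * G z) \<partial>lborel) < \<infinity>"
      by (rule nn_integral_weighted_finite[where C = "\<bar>C\<bar>" and R = R]) (auto simp: G_def)
    show "AE z in lborel. indicator {z. 0 < snd z} z * ennreal (snd z powr \<alpha> * F j z)
        \<le> indicator {z. 0 < snd z} z * ennreal (snd z powr \<alpha> * G z)" for j
    proof (rule AE_I2)
      fix z :: "'a \<times> real"
      show "indicator {z. 0 < snd z} z * ennreal (snd z powr \<alpha> * F j z)
        \<le> indicator {z. 0 < snd z} z * ennreal (snd z powr \<alpha> * G z)"
      proof (cases "0 < snd z")
        case True
        have "F j z \<le> G z"
        proof (cases "Phi0 H z \<le> R")
          case le: True
          have "C / (Phi0 H z)\<^sup>2 \<le> \<bar>C\<bar> / (Phi0 H z)\<^sup>2" by (rule divide_right_mono) auto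
          then show ?thesis using bd[OF True, of j] le by (simp add: G_def)
        next
          case False
          then show ?thesis using supp[OF True, of j] by (simp add: G_def)
        qed
        then show ?thesis using True by (simp add: ennreal_leI mult_left_mono)
      qed simp
    qed
    show "AE z in lborel. (\<lambda>j. indicator {z. 0 < snd z} z * ennreal (snd z powr \<alpha> * F j z))
        \<longlonglongrightarrow> indicator {z. 0 < snd z} z * ennreal (snd z powr \<alpha> * F' z)"
    proof (rule AE_I2)
      fix z :: "'a \<times> real"
      show "(\<lambda>j. indicator {z. 0 < snd z} z * ennreal (snd z powr \<alpha> * F j z))
        \<longlonglongrightarrow> indicator {z. 0 < snd z} z * ennreal (snd z powr \<alpha> * F' z)"
      proof (cases "0 < snd z")
        case True
        then show ?thesis by (auto intro!: tendsto_ennrealI tendsto_mult_left lim)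
      qed simp
    qed
  qed measurable
qed

lemma taylor_continuous: "isCont (taylor m) t" "isCont (taylor1 m) t"
proof -
  show "isCont (taylor m) t" by (rule DERIV_isCont[OF taylor_deriv])
  show "isCont (taylor1 m) t" unfolding taylor1_def[abs_def] by (intro continuous_intros)
qed

lemma taylor_measurable [measurable]: "taylor m \<in> borel_measurable borel" "taylor1 m \<in> borel_measurable borel"
  by (intro borel_measurable_continuous_onI continuous_at_imp_continuous_on ballI taylor_continuous)+

lemma trial_measurable [measurable (raw)]:
  assumes [measurable]: "v \<in> borel_measurable borel" "f \<in> borel_measurable M" "g \<in> borel_measurable M"
  shows "(\<lambda>x. trial v m (f x) (g x)) \<in> borel_measurable M"
  unfolding trial_def by measurable

lemma trial_energy_measurable [measurable (raw)]:
  assumes [measurable]: "v \<in> borel_measurable borel" "v' \<in> borel_measurable borel"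
    "f \<in> borel_measurable M" "g \<in> borel_measurable M"
  shows "(\<lambda>x. trial_energy v v' m (f x) (g x)) \<in> borel_measurable M"
  unfolding trial_energy_def by measurable

lemma trial_tendsto:
  assumes c: "continuous_on UNIV v" "continuous_on UNIV v'" and r: "(\<lambda>j. r j) \<longlonglongrightarrow> r0" and nz: "r0\<^sup>2 + y\<^sup>2 \<noteq> 0"
  shows "(\<lambda>j. trial v m (r j) y) \<longlonglongrightarrow> trial v m r0 y"
    "(\<lambda>j. trial_energy v v' m (r j) y) \<longlonglongrightarrow> trial_energy v v' m r0 y"
proof -
  have s: "(\<lambda>j. sqrt ((r j)\<^sup>2 + y\<^sup>2)) \<longlonglongrightarrow> sqrt (r0\<^sup>2 + y\<^sup>2)" by (intro tendsto_intros r)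
  have t: "(\<lambda>j. (r j)\<^sup>2 / ((r j)\<^sup>2 + y\<^sup>2)) \<longlonglongrightarrow> r0\<^sup>2 / (r0\<^sup>2 + y\<^sup>2)" by (intro tendsto_intros r nz)
  have ic: "isCont v x" "isCont v' x" for x using c by (auto simp: continuous_on_eq_continuous_at)
  note cv = isCont_tendsto_compose[OF ic(1) s] isCont_tendsto_compose[OF ic(2) s]
    isCont_tendsto_compose[OF taylor_continuous(1) t] isCont_tendsto_compose[OF taylor_continuous(2) t]
  show "(\<lambda>j. trial v m (r j) y) \<longlonglongrightarrow> trial v m r0 y"
    unfolding trial_def by (intro tendsto_mult cv)
  show "(\<lambda>j. trial_energy v v' m (r j) y) \<longlonglongrightarrow> trial_energy v v' m r0 y"
    unfolding trial_energy_def by (intro tendsto_intros cv t r nz)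
qed

lemma trial_energy_bounded:
  assumes c: "continuous_on UNIV v" "continuous_on UNIV v'" and r1: "0 < r1"
    and out: "\<And>s. s \<notin> {r1..R} \<Longrightarrow> v s = 0 \<and> v' s = 0"
  shows "\<exists>C\<ge>0. \<forall>r y. trial_energy v v' m r y \<le> C"
proof -
  have b: "\<exists>M. \<forall>t\<in>{a..b}. \<bar>f t\<bar> \<le> M" if "continuous_on {a..b} f" for f :: "real \<Rightarrow> real" and a b
    using compact_imp_bounded[OF compact_continuous_image[OF that compact_Icc]] by (auto simp: bounded_iff)
  obtain M1 where M1: "\<And>t. t \<in> {0..1} \<Longrightarrow> \<bar>taylor m t\<bar> \<le> M1"
    using b[OF continuous_at_imp_continuous_on[OF ballI[OF taylor_continuous(1)]]] by blast
  obtain M2 where M2: "\<And>t. t \<in> {0..1} \<Longrightarrow> \<bar>taylor1 m t\<bar> \<le> M2"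
    using b[OF continuous_at_imp_continuous_on[OF ballI[OF taylor_continuous(2)]]] by blast
  obtain M3 where M3: "\<And>t. t \<in> {r1..R} \<Longrightarrow> \<bar>v t\<bar> \<le> M3"
    using b[OF continuous_on_subset[OF c(1) subset_UNIV]] by blast
  obtain M4 where M4: "\<And>t. t \<in> {r1..R} \<Longrightarrow> \<bar>v' t\<bar> \<le> M4"
    using b[OF continuous_on_subset[OF c(2) subset_UNIV]] by blast
  have bd: "trial_energy v v' m r y \<le> (M4 * M1)\<^sup>2 + 4 * (M2 * M3)\<^sup>2 / r1\<^sup>2" if s: "sqrt (r\<^sup>2 + y\<^sup>2) \<in> {r1..R}" for r y
  proof -
    define \<rho> where "\<rho> = sqrt (r\<^sup>2 + y\<^sup>2)"
    have \<rho>: "\<rho> \<in> {r1..R}" "r\<^sup>2 + y\<^sup>2 = \<rho>\<^sup>2" using s by (auto simp: \<rho>_def sum_power2_ge_zero)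
    then have \<rho>0: "0 < \<rho>" using r1 by auto
    have le: "r\<^sup>2 \<le> \<rho>\<^sup>2" "y\<^sup>2 \<le> \<rho>\<^sup>2" unfolding \<rho>(2)[symmetric] by simp_all
    have t: "r\<^sup>2 / \<rho>\<^sup>2 \<in> {0..1}" "y\<^sup>2 / \<rho>\<^sup>2 \<in> {0..1}"
      using le \<rho>0 by (simp_all add: divide_le_eq_1_pos)
    have "(v' \<rho> * taylor m (r\<^sup>2 / \<rho>\<^sup>2))\<^sup>2 \<le> (M4 * M1)\<^sup>2"
      unfolding abs_le_square_iff[symmetric] abs_mult
      using M4[OF \<rho>(1)] M1[OF t(1)] by (intro order_trans[OF mult_mono abs_ge_self[of "M4 * M1", unfolded abs_mult]]) auto
    moreover have "4 * (r\<^sup>2 / \<rho>\<^sup>2) * (y\<^sup>2 / \<rho>\<^sup>2) * (taylor1 m (r\<^sup>2 / \<rho>\<^sup>2) * v \<rho>)\<^sup>2 / \<rho>\<^sup>2 \<le> 4 * 1 * 1 * (M2 * M3)\<^sup>2 / r1\<^sup>2"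
    proof (intro frac_le mult_mono)
      show "(taylor1 m (r\<^sup>2 / \<rho>\<^sup>2) * v \<rho>)\<^sup>2 \<le> (M2 * M3)\<^sup>2"
        unfolding abs_le_square_iff[symmetric] abs_mult
        using M2[OF t(1)] M3[OF \<rho>(1)] by (intro order_trans[OF mult_mono abs_ge_self[of "M2 * M3", unfolded abs_mult]]) auto
      show "r1\<^sup>2 \<le> \<rho>\<^sup>2" using \<rho>(1) r1 by (intro power_mono) auto
    qed (use t r1 in auto)
    ultimately show ?thesis unfolding trial_energy_def \<rho>_def[symmetric] unfolding \<rho>(2) by linarith
  qed
  have "0 \<le> (M4 * M1)\<^sup>2 + 4 * (M2 * M3)\<^sup>2 / r1\<^sup>2" by simp
  moreover have "trial_energy v v' m r y = 0" if "sqrt (r\<^sup>2 + y\<^sup>2) \<notin> {r1..R}" for r y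
    using out[OF that] by (simp add: trial_energy_def)
  ultimately show ?thesis using bd by (metis (no_types))
qed

text \<open>
  For \<open>N\<^sub>j\<close> tending to the dual norm, the energies of the smooth trial functions are dominated, so
  that their limit is controlled; for the two terms which they have to exceed Fatou's lemma is enough.
\<close>

lemma trial_test_function_exists:
  assumes v: "\<And>k. Ck_on k v UNIV" "\<And>s. (v has_real_derivative v' s) (at s)" "continuous_on UNIV v'"
    and r1: "0 < r1" and out: "\<And>s. s \<notin> {r1..R} \<Longrightarrow> v s = 0 \<and> v' s = 0"
    and U: "{z. Phi0 H z \<le> 2 * R} \<subseteq> U"
    and f [measurable]: "f \<in> borel_measurable borel" and f0: "\<And>\<rho>. 0 \<le> f \<rho>" and c: "0 \<le> c"
    and less: "(\<integral>\<^sup>+z. indicator {z. 0 < snd z} z * ennreal (snd z powr \<alpha> * trial_energy v v' m (N0 (fst z)) (snd z)) \<partial>lborel)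
      < ennreal c * nn_trace (\<lambda>z. trial v m (N0 (fst z)) (snd z)) + nn_hardy f (\<lambda>z. trial v m (N0 (fst z)) (snd z))"
  shows "\<exists>u\<in>test_functions U. (\<forall>z. 2 * R < Phi0 H z \<longrightarrow> u z = 0) \<and> nn_energy u < ennreal c * nn_trace u + nn_hardy f u"
proof -
  have vc: "continuous_on UNIV v" by (rule Ck_on_continuous[OF v(1)[of 0]])
  have [measurable]: "v \<in> borel_measurable borel" "v' \<in> borel_measurable borel"
    by (intro borel_measurable_continuous_onI vc v(3))+
  have fst_snd [measurable]: "(snd :: 'a \<times> real \<Rightarrow> real) \<in> borel_measurable borel" "(fst :: 'a \<times> real \<Rightarrow> 'a) \<in> borel_measurable borel"
    by (intro borel_measurable_continuous_onI continuous_intros)+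
  have pair [measurable]: "(\<lambda>x. (x, 0::real)) \<in> borel_measurable (borel :: 'a measure)"
    by (intro borel_measurable_continuous_onI continuous_intros)
  \<comment> \<open>starting at \<open>1 / 2\<close> ensures the bound of the dual norm by \<open>2 N\<^sub>j\<close>\<close>
  define e where "e j = 1 / real (Suc (Suc j))" for j
  have e: "0 < e j" "e j \<le> 1 / 2" for j by (simp_all add: e_def field_simps)
  have e_lim: "e \<longlonglongrightarrow> 0"
    unfolding e_def[abs_def] using LIMSEQ_Suc[OF LIMSEQ_inverse_real_of_nat] by (simp add: inverse_eq_divide)
  have "\<exists>N G. (\<forall>k. Ck_on k N UNIV) \<and> (\<forall>x. 0 < N x) \<and> (\<forall>x. (1 - e j) * N0 x \<le> N x) \<and> (\<forall>x. N x \<le> N0 x + e j)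
      \<and> (\<forall>x. GDERIV N x :> G x) \<and> (\<forall>x. H (G x) \<le> 1)" for j
    by (rule smooth_dual_norm[OF norm_H e(1)[of j]]) blast
  then obtain N G where N: "\<And>j k. Ck_on k (N j) UNIV" "\<And>j x. 0 < N j x" "\<And>j x. (1 - e j) * N0 x \<le> N j x"
      "\<And>j x. N j x \<le> N0 x + e j" "\<And>j x. GDERIV (N j) x :> G j x" "\<And>j x. H (G j x) \<le> 1"
    by metis
  have N2: "N0 x \<le> 2 * N j x" for j x
  proof -
    have "1 / 2 * N0 x \<le> (1 - e j) * N0 x" using e(2)[of j] by (intro mult_right_mono norm_nonneg[OF norm_N0]) simp
    then show ?thesis using N(3)[of j x] by linarith
  qed
  have N_lim: "(\<lambda>j. N j x) \<longlonglongrightarrow> N0 x" for x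
  proof (rule tendsto_sandwich[OF always_eventually always_eventually])
    show "(\<lambda>j. (1 - e j) * N0 x) \<longlonglongrightarrow> N0 x" "(\<lambda>j. N0 x + e j) \<longlonglongrightarrow> N0 x"
      by (auto intro!: tendsto_eq_intros e_lim)
  qed (use N in auto)
  define u where "u j z = trial v m (N j (fst z)) (snd z)" for j z
  let ?u = "\<lambda>z. trial v m (N0 (fst z)) (snd z)"
  have test: "u j \<in> test_functions U" for j
    unfolding u_def[abs_def] by (rule trial_test_function[OF N(1,2) N2 v(1) _ U]) (use out in blast)
  have um [measurable]: "u j \<in> borel_measurable borel" for j
  proof -
    have "Ck_on 0 (u j) UNIV" using test[of j] unfolding test_functions_def by blast
    then show ?thesis by (intro borel_measurable_continuous_onI) simp
  qed
  have Nm [measurable]: "N j \<in> borel_measurable borel" for j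
    by (rule borel_measurable_continuous_onI[OF Ck_on_continuous[OF N(1)[of 0 j]]])
  have supp: "u j z = 0" "trial_energy v v' m (N j (fst z)) (snd z) = 0" if "2 * R < Phi0 H z" for j z
  proof -
    have "2 * R < sqrt ((N0 (fst z))\<^sup>2 + (snd z)\<^sup>2)" using that by (simp add: Phi0_def case_prod_beta)
    note * = trial_eq_0[OF out less_imp_le[OF N(2)] N2 norm_nonneg[OF norm_N0] this]
    show "u j z = 0" unfolding u_def by (rule *(1))
    show "trial_energy v v' m (N j (fst z)) (snd z) = 0" by (rule *(2))
  qed
  define E where "E j = (\<integral>\<^sup>+z. indicator {z. 0 < snd z} z *
      ennreal (snd z powr \<alpha> * trial_energy v v' m (N j (fst z)) (snd z)) \<partial>lborel)" for j
  define L where "L = (\<integral>\<^sup>+z. indicator {z. 0 < snd z} z * ennreal (snd z powr \<alpha> * trial_energy v v' m (N0 (fst z)) (snd z)) \<partial>lborel)"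
  have le_E: "nn_energy (u j) \<le> E j" for j
    unfolding nn_energy_def E_def u_def[abs_def]
    by (intro nn_integral_mono mult_left_mono ennreal_leI trial_grad[OF N(5,2,6) v(2)]) auto
  have nz: "(N0 (fst z))\<^sup>2 + (snd z)\<^sup>2 \<noteq> 0" if "0 < snd z" for z
    using that by (simp add: sum_power2_eq_zero_iff)
  have E_lim: "E \<longlonglongrightarrow> L"
  proof -
    obtain C where C: "0 \<le> C" "\<And>r y. trial_energy v v' m r y \<le> C" using trial_energy_bounded[OF vc v(3) r1 out] by blast
    show ?thesis
      unfolding E_def[abs_def] L_def
    proof (rule nn_integral_weighted_tendsto[where C = "C * (2 * R)\<^sup>2" and R = "2 * R"])
      show "trial_energy v v' m (N j (fst z)) (snd z) \<le> C * (2 * R)\<^sup>2 / (Phi0 H z)\<^sup>2" if z: "0 < snd z" for j z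
      proof (cases "2 * R < Phi0 H z")
        case False
        have p: "0 < Phi0 H z" using z by (intro norm_pos[OF norm_Phi0]) auto
        then have "(Phi0 H z)\<^sup>2 \<le> (2 * R)\<^sup>2" using False by (intro power_mono) auto
        then have "trial_energy v v' m (N j (fst z)) (snd z) * (Phi0 H z)\<^sup>2 \<le> C * (2 * R)\<^sup>2"
          using C by (intro mult_mono) auto
        then show ?thesis using p by (simp add: pos_le_divide_eq)
      qed (use supp C in simp)
    qed (use supp nz in \<open>auto intro!: trial_tendsto vc v(3) N_lim\<close>)
  qed
  have h_lim: "nn_hardy f ?u \<le> liminf (\<lambda>j. nn_hardy f (u j))"
  proof -
    let ?h = "\<lambda>w z. indicator {z. 0 < snd z} z * ennreal (snd z powr \<alpha> * (f (Phi0 H z / D) / (Phi0 H z)\<^sup>2 * (w z)\<^sup>2))"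
    have "nn_hardy f ?u \<le> (\<integral>\<^sup>+z. liminf (\<lambda>j. ?h (u j) z) \<partial>lborel)"
      unfolding nn_hardy_def
    proof (rule nn_integral_mono)
      fix z :: "'a \<times> real"
      show "?h ?u z \<le> liminf (\<lambda>j. ?h (u j) z)"
      proof (cases "0 < snd z")
        case True
        have "(\<lambda>j. u j z) \<longlonglongrightarrow> ?u z" unfolding u_def by (rule trial_tendsto(1)[OF vc v(3) N_lim nz[OF True]])
        then have "(\<lambda>j. ?h (u j) z) \<longlonglongrightarrow> ?h ?u z"
          using True by (simp only: indicator_simps mem_Collect_eq simp_thms mult_1_left) (intro tendsto_ennrealI tendsto_mult_left tendsto_power)
        then show ?thesis by (simp only: lim_imp_Liminf trivial_limit_sequentially order_refl simp_thms)
      qed simp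
    qed
    also have "\<dots> \<le> liminf (\<lambda>j. nn_hardy f (u j))"
      unfolding nn_hardy_def by (rule nn_integral_liminf) measurable
    finally show ?thesis .
  qed
  have t_lim: "nn_trace ?u \<le> liminf (\<lambda>j. nn_trace (u j))"
  proof -
    let ?h = "\<lambda>w x. ennreal ((w (x, 0::real))\<^sup>2 / N0 x powr (1 - \<alpha>))"
    have "nn_trace ?u \<le> (\<integral>\<^sup>+x. liminf (\<lambda>j. ?h (u j) x) \<partial>lborel)"
      unfolding nn_trace_def
    proof (rule nn_integral_mono)
      fix x :: 'a
      show "?h ?u x \<le> liminf (\<lambda>j. ?h (u j) x)"
      proof (cases "x = 0")
        case False
        have p: "0 < N0 x" by (rule norm_pos[OF norm_N0 False])
        then have "(\<lambda>j. u j (x, 0)) \<longlonglongrightarrow> ?u (x, 0)" unfolding u_def fst_conv snd_conv by (intro trial_tendsto(1)[OF vc v(3) N_lim]) simp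
        then have "(\<lambda>j. ?h (u j) x) \<longlonglongrightarrow> ?h ?u x" using p by (intro tendsto_ennrealI tendsto_intros) auto
        then show ?thesis by (simp only: lim_imp_Liminf trivial_limit_sequentially order_refl simp_thms)
      qed (simp add: norm_zero[OF norm_N0])
    qed
    also have "\<dots> \<le> liminf (\<lambda>j. nn_trace (u j))"
      unfolding nn_trace_def
    proof (rule nn_integral_liminf)
      show "?h (u j) \<in> borel_measurable lborel" for j
        using measurable_compose[OF pair um[of j]] by measurable
    qed
    finally show ?thesis .
  qed
  have "L < ennreal c * liminf (\<lambda>j. nn_trace (u j)) + liminf (\<lambda>j. nn_hardy f (u j))"
    using less unfolding L_def[symmetric]
    by (rule less_le_trans) (intro add_mono mult_left_mono t_lim h_lim, simp)
  also have "ennreal c * liminf (\<lambda>j. nn_trace (u j)) \<le> liminf (\<lambda>j. ennreal c * nn_trace (u j))"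
    unfolding liminf_SUP_INF SUP_mult_left_ennreal
    by (intro SUP_mono' INF_greatest mult_left_mono INF_lower) auto
  finally have "L < liminf (\<lambda>j. ennreal c * nn_trace (u j)) + liminf (\<lambda>j. nn_hardy f (u j))"
    by (simp add: add_right_mono)
  also have "\<dots> \<le> liminf (\<lambda>j. ennreal c * nn_trace (u j) + nn_hardy f (u j))" by (rule ennreal_liminf_add)
  finally have "L < liminf (\<lambda>j. ennreal c * nn_trace (u j) + nn_hardy f (u j))" .
  then obtain q where q: "L < q" "q < liminf (\<lambda>j. ennreal c * nn_trace (u j) + nn_hardy f (u j))" using dense by blast
  have "\<forall>\<^sub>F j in sequentially. E j < q \<and> q < ennreal c * nn_trace (u j) + nn_hardy f (u j)"
    using order_tendstoD(2)[OF E_lim q(1)] less_LiminfD[OF q(2)] by (rule eventually_conj)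
  then obtain j where "E j < q" "q < ennreal c * nn_trace (u j) + nn_hardy f (u j)"
    using eventually_happens trivial_limit_sequentially by blast
  then have "nn_energy (u j) < ennreal c * nn_trace (u j) + nn_hardy f (u j)" using le_E[of j] by order
  then show ?thesis using test[of j] supp(1)[of _ j] by blast
qed

text \<open>
  With the dual norm itself in place of \<open>r\<close>, radius and angle are the polar coordinates of the point, and
  all functionals become products of radial and angular integrals.
\<close>

lemma trial_on_arc:
  fixes w :: real
  assumes \<omega>: "N0 \<omega> = 1" and \<rho>: "0 < \<rho>"
  defines "z \<equiv> \<rho> *\<^sub>R arc \<omega> w"
  shows "trial v m (N0 (fst z)) (snd z) = v \<rho> * taylor m (1 / (1 + w\<^sup>2))"
    and "angular_mass w * trial_energy v v' m (N0 (fst z)) (snd z)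
      = (v' \<rho>)\<^sup>2 * (angular_mass w * (taylor m (1 / (1 + w\<^sup>2)))\<^sup>2)
        + (v \<rho>)\<^sup>2 / \<rho>\<^sup>2 * (angular_weight w * (taylor1 m (1 / (1 + w\<^sup>2)) * (- 2 * w / (1 + w\<^sup>2)\<^sup>2))\<^sup>2)"
proof -
  define q where "q = 1 + w\<^sup>2"
  have q: "0 < q" unfolding q_def by (rule one_plus_sq_pos)
  have r: "(N0 (fst z))\<^sup>2 = \<rho>\<^sup>2 * (1 / q)" "(snd z)\<^sup>2 = \<rho>\<^sup>2 * (w\<^sup>2 / q)"
    unfolding z_def arc_norms[OF \<omega> \<rho>] q_def[symmetric] using q by (simp_all add: power_divide power_mult_distrib)
  have sum: "(N0 (fst z))\<^sup>2 + (snd z)\<^sup>2 = \<rho>\<^sup>2"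
    using Phi0_sq[OF norm_H, of z] unfolding z_def arc_norms(3)[OF \<omega> \<rho>] by simp
  have t: "(N0 (fst z))\<^sup>2 / \<rho>\<^sup>2 = 1 / q" "(snd z)\<^sup>2 / \<rho>\<^sup>2 = w\<^sup>2 / q" unfolding r using \<rho> by simp_all
  have s: "sqrt (\<rho>\<^sup>2) = \<rho>" using \<rho> by simp
  show "trial v m (N0 (fst z)) (snd z) = v \<rho> * taylor m (1 / (1 + w\<^sup>2))"
    unfolding trial_def sum s t q_def ..
  have a: "angular_weight w * (x * (- 2 * w / q\<^sup>2))\<^sup>2 = angular_mass w * (4 * (1 / q) * (w\<^sup>2 / q) * x\<^sup>2)" for x
    unfolding angular_weight_eq_mass q_def[symmetric] using q
    by (simp add: power_mult_distrib power_divide power2_eq_square)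
  show "angular_mass w * trial_energy v v' m (N0 (fst z)) (snd z)
      = (v' \<rho>)\<^sup>2 * (angular_mass w * (taylor m (1 / (1 + w\<^sup>2)))\<^sup>2)
        + (v \<rho>)\<^sup>2 / \<rho>\<^sup>2 * (angular_weight w * (taylor1 m (1 / (1 + w\<^sup>2)) * (- 2 * w / (1 + w\<^sup>2)\<^sup>2))\<^sup>2)"
    unfolding trial_energy_def sum s t q_def[symmetric] a by (simp add: power_mult_distrib distrib_left mult_ac)
qed

lemma nn_integral_arcs_product:
  fixes f g :: "real \<Rightarrow> real"
  assumes [measurable]: "f \<in> borel_measurable borel" "g \<in> borel_measurable borel"
    and "\<And>\<rho>. 0 \<le> f \<rho>" "\<And>w. 0 \<le> g w"
  shows "(\<integral>\<^sup>+x. (\<integral>\<^sup>+w. (\<integral>\<^sup>+\<rho>. indicator {0<..} w * indicator {0<..} \<rho> * ennreal (f \<rho> * g w) \<partial>lborel) \<partial>lborel) \<partial>directions)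
    = (\<integral>\<^sup>+\<rho>. indicator {0<..} \<rho> * ennreal (f \<rho>) \<partial>lborel) * (\<integral>\<^sup>+w. indicator {0<..} w * ennreal (g w) \<partial>lborel) * emeasure directions UNIV"
proof -
  define F where "F = (\<integral>\<^sup>+\<rho>. indicator {0<..} \<rho> * ennreal (f \<rho>) \<partial>lborel)"
  have "indicator {0<..} w * indicator {0<..} \<rho> * ennreal (f \<rho> * g w)
      = (indicator {0<..} w * ennreal (g w)) * (indicator {0<..} \<rho> * ennreal (f \<rho>))" for w \<rho> :: real
    using assms(3)[of \<rho>] assms(4)[of w] by (simp add: ennreal_mult mult_ac)
  then have "(\<integral>\<^sup>+w. (\<integral>\<^sup>+\<rho>. indicator {0<..} w * indicator {0<..} \<rho> * ennreal (f \<rho> * g w) \<partial>lborel) \<partial>lborel)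
      = (\<integral>\<^sup>+w. indicator {0<..} w * ennreal (g w) * F \<partial>lborel)"
    unfolding F_def by (simp only:) (intro nn_integral_cong nn_integral_cmult; measurable)
  also have "\<dots> = F * (\<integral>\<^sup>+w. indicator {0<..} w * ennreal (g w) \<partial>lborel)"
    by (subst nn_integral_multc) (simp_all add: mult.commute)
  finally show ?thesis unfolding F_def by (simp add: cone_measure_def)
qed

definition trial_mass where
  "trial_mass m = (\<integral>\<^sup>+w. indicator {0<..} w * ennreal (angular_mass w * (taylor m (1 / (1 + w\<^sup>2)))\<^sup>2) \<partial>lborel)"
definition trial_slope where
  "trial_slope m = (\<integral>\<^sup>+w. indicator {0<..} w * ennreal (angular_weight w *
     (taylor1 m (1 / (1 + w\<^sup>2)) * (- 2 * w / (1 + w\<^sup>2)\<^sup>2))\<^sup>2) \<partial>lborel)"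
definition radial_mass where
  "radial_mass v f = (\<integral>\<^sup>+\<rho>. indicator {0<..} \<rho> * ennreal (\<rho> powr (2 * \<sigma> - 1) * f \<rho> * (v \<rho>)\<^sup>2) \<partial>lborel)"

lemma nn_energy_trial:
  assumes [measurable]: "v \<in> borel_measurable borel" "v' \<in> borel_measurable borel"
  shows "(\<integral>\<^sup>+z. indicator {z. 0 < snd z} z * ennreal (snd z powr \<alpha> * trial_energy v v' m (N0 (fst z)) (snd z)) \<partial>lborel)
    = ((\<integral>\<^sup>+\<rho>. indicator {0<..} \<rho> * ennreal (\<rho> powr (2 * \<sigma> + 1) * (v' \<rho>)\<^sup>2) \<partial>lborel) * trial_mass m
       + radial_mass v (\<lambda>\<rho>. 1) * trial_slope m) * emeasure directions UNIV"
proof -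
  let ?u = "\<lambda>z::'a \<times> real. trial v m (N0 (fst z)) (snd z)"
  have [measurable]: "(snd :: 'a \<times> real \<Rightarrow> real) \<in> borel_measurable borel" "(fst :: 'a \<times> real \<Rightarrow> 'a) \<in> borel_measurable borel"
    by (intro borel_measurable_continuous_onI continuous_intros)+
  let ?a = "\<lambda>w. angular_mass w * (taylor m (1 / (1 + w\<^sup>2)))\<^sup>2"
  let ?c = "\<lambda>w. angular_weight w * (taylor1 m (1 / (1 + w\<^sup>2)) * (- 2 * w / (1 + w\<^sup>2)\<^sup>2))\<^sup>2"
  have nn: "0 \<le> ?a w" "0 \<le> ?c w" for w by (simp_all add: angular_weights_nonneg)
  have meas: "(\<lambda>\<rho>. \<rho> powr (2 * \<sigma> + 1) * (v' \<rho>)\<^sup>2) \<in> borel_measurable borel"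
    "(\<lambda>\<rho>. \<rho> powr (2 * \<sigma> - 1) * 1 * (v \<rho>)\<^sup>2) \<in> borel_measurable borel"
    "?a \<in> borel_measurable borel" "?c \<in> borel_measurable borel"
    by measurable
  have nn': "0 \<le> \<rho> powr (2 * \<sigma> + 1) * (v' \<rho>)\<^sup>2" "0 \<le> \<rho> powr (2 * \<sigma> - 1) * 1 * (v \<rho>)\<^sup>2" for \<rho> by simp_all
  note P1 = nn_integral_arcs_product[OF meas(1,3) nn'(1) nn(1)] and P2 = nn_integral_arcs_product[OF meas(2,4) nn'(2) nn(2)]
  have "(\<integral>\<^sup>+z. indicator {z. 0 < snd z} z * ennreal (snd z powr \<alpha> * trial_energy v v' m (N0 (fst z)) (snd z)) \<partial>lborel)
    = (\<integral>\<^sup>+x. (\<integral>\<^sup>+w. (\<integral>\<^sup>+\<rho>. indicator {0<..} w * indicator {0<..} \<rho> *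
        ennreal (\<rho> powr (2 * \<sigma> + 1) * angular_mass w
          * trial_energy v v' m (N0 (fst (\<rho> *\<^sub>R arc (dir x) w))) (snd (\<rho> *\<^sub>R arc (dir x) w))) \<partial>lborel) \<partial>lborel) \<partial>directions)"
    by (rule nn_integral_weighted_half_space) (measurable, simp add: trial_energy_def)
  also have "\<dots> = (\<integral>\<^sup>+x. (\<integral>\<^sup>+w. (\<integral>\<^sup>+\<rho>.
      indicator {0<..} w * indicator {0<..} \<rho> * ennreal (\<rho> powr (2 * \<sigma> + 1) * (v' \<rho>)\<^sup>2 * ?a w)
    + indicator {0<..} w * indicator {0<..} \<rho> * ennreal (\<rho> powr (2 * \<sigma> - 1) * 1 * (v \<rho>)\<^sup>2 * ?c w) \<partial>lborel) \<partial>lborel) \<partial>directions)"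
  proof (rule nn_integral_cong_AE)
    show "AE x in directions. (\<integral>\<^sup>+w. (\<integral>\<^sup>+\<rho>. indicator {0<..} w * indicator {0<..} \<rho> *
        ennreal (\<rho> powr (2 * \<sigma> + 1) * angular_mass w
          * trial_energy v v' m (N0 (fst (\<rho> *\<^sub>R arc (dir x) w))) (snd (\<rho> *\<^sub>R arc (dir x) w))) \<partial>lborel) \<partial>lborel)
      = (\<integral>\<^sup>+w. (\<integral>\<^sup>+\<rho>.
      indicator {0<..} w * indicator {0<..} \<rho> * ennreal (\<rho> powr (2 * \<sigma> + 1) * (v' \<rho>)\<^sup>2 * ?a w)
    + indicator {0<..} w * indicator {0<..} \<rho> * ennreal (\<rho> powr (2 * \<sigma> - 1) * 1 * (v \<rho>)\<^sup>2 * ?c w) \<partial>lborel) \<partial>lborel)"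
      using AE_directions
    proof eventually_elim
      case (elim x)
      show ?case
      proof (intro nn_integral_cong)
        fix w \<rho> :: real
        show "indicator {0<..} w * indicator {0<..} \<rho> *
            ennreal (\<rho> powr (2 * \<sigma> + 1) * angular_mass w
              * trial_energy v v' m (N0 (fst (\<rho> *\<^sub>R arc (dir x) w))) (snd (\<rho> *\<^sub>R arc (dir x) w)))
          = indicator {0<..} w * indicator {0<..} \<rho> * ennreal (\<rho> powr (2 * \<sigma> + 1) * (v' \<rho>)\<^sup>2 * ?a w)
          + indicator {0<..} w * indicator {0<..} \<rho> * ennreal (\<rho> powr (2 * \<sigma> - 1) * 1 * (v \<rho>)\<^sup>2 * ?c w)"
        proof (cases "0 < w \<and> 0 < \<rho>")
          case True
          have "\<rho> powr (2 * \<sigma> + 1) * ((v' \<rho>)\<^sup>2 * x + (v \<rho>)\<^sup>2 / \<rho>\<^sup>2 * y)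
              = \<rho> powr (2 * \<sigma> + 1) * (v' \<rho>)\<^sup>2 * x + \<rho> powr (2 * \<sigma> - 1) * 1 * (v \<rho>)\<^sup>2 * y" for x y
            using True unfolding powr_two_sigma[OF conjunct2[OF True]] by (simp add: distrib_left)
          then have "\<rho> powr (2 * \<sigma> + 1) * angular_mass w
              * trial_energy v v' m (N0 (fst (\<rho> *\<^sub>R arc (dir x) w))) (snd (\<rho> *\<^sub>R arc (dir x) w))
            = \<rho> powr (2 * \<sigma> + 1) * (v' \<rho>)\<^sup>2 * ?a w + \<rho> powr (2 * \<sigma> - 1) * 1 * (v \<rho>)\<^sup>2 * ?c w"
            unfolding mult.assoc[of "\<rho> powr (2 * \<sigma> + 1)" "angular_mass w"] trial_on_arc(2)[OF elim conjunct2[OF True]]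
            by (simp only:)
          then show ?thesis using True nn[of w] by simp
        qed auto
      qed
    qed
  qed
  also have "\<dots> = ((\<integral>\<^sup>+\<rho>. indicator {0<..} \<rho> * ennreal (\<rho> powr (2 * \<sigma> + 1) * (v' \<rho>)\<^sup>2) \<partial>lborel) * trial_mass m
       + radial_mass v (\<lambda>\<rho>. 1) * trial_slope m) * emeasure directions UNIV"
    unfolding trial_mass_def trial_slope_def radial_mass_def distrib_right
    by (rule trans[OF nn_integral3_add]; (rule arg_cong2[where f = "(+)", OF P1 P2])?; measurable)
  finally show ?thesis .
qed

lemma nn_trace_trial:
  assumes [measurable]: "v \<in> borel_measurable borel"
  shows "nn_trace (\<lambda>z::'a \<times> real. trial v m (N0 (fst z)) (snd z))
    = ennreal ((taylor m 1)\<^sup>2) * radial_mass v (\<lambda>\<rho>. 1) * emeasure directions UNIV"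
proof -
  let ?u = "\<lambda>z::'a \<times> real. trial v m (N0 (fst z)) (snd z)"
  have [measurable]: "(snd :: 'a \<times> real \<Rightarrow> real) \<in> borel_measurable borel" "(fst :: 'a \<times> real \<Rightarrow> 'a) \<in> borel_measurable borel"
    by (intro borel_measurable_continuous_onI continuous_intros)+
  let ?a = "\<lambda>w. angular_mass w * (taylor m (1 / (1 + w\<^sup>2)))\<^sup>2"
  let ?c = "\<lambda>w. angular_weight w * (taylor1 m (1 / (1 + w\<^sup>2)) * (- 2 * w / (1 + w\<^sup>2)\<^sup>2))\<^sup>2"
  have nn: "0 \<le> ?a w" "0 \<le> ?c w" for w by (simp_all add: angular_weights_nonneg)
  have um: "?u \<in> borel_measurable borel" by measurable
  have "nn_trace ?u = (\<integral>\<^sup>+x. ennreal ((taylor m 1)\<^sup>2) * radial_mass v (\<lambda>\<rho>. 1) \<partial>directions)"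
    unfolding nn_trace_polar[OF um]
  proof (rule nn_integral_cong_AE)
    show "AE x in directions. (\<integral>\<^sup>+\<rho>. indicator {0<..} \<rho> * ennreal (\<rho> powr (2 * \<sigma> - 1) * (?u (\<rho> *\<^sub>R dir x, 0))\<^sup>2) \<partial>lborel)
        = ennreal ((taylor m 1)\<^sup>2) * radial_mass v (\<lambda>\<rho>. 1)"
      using AE_directions
    proof eventually_elim
      case (elim x)
      have "indicator {0<..} \<rho> * ennreal (\<rho> powr (2 * \<sigma> - 1) * (?u (\<rho> *\<^sub>R dir x, 0))\<^sup>2)
          = ennreal ((taylor m 1)\<^sup>2) * (indicator {0<..} \<rho> * ennreal (\<rho> powr (2 * \<sigma> - 1) * 1 * (v \<rho>)\<^sup>2))" for \<rho> :: real
      proof (cases "0 < \<rho>")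
        case True
        have arc0: "\<rho> *\<^sub>R arc (dir x) 0 = (\<rho> *\<^sub>R dir x, 0)" by (simp add: arc_def)
        have "?u (\<rho> *\<^sub>R dir x, 0) = v \<rho> * taylor m 1"
          using trial_on_arc(1)[OF elim True, of v m 0] unfolding arc0 by simp
        then show ?thesis using True by (simp add: ennreal_mult[symmetric] power_mult_distrib mult_ac)
      qed simp
      then show ?case unfolding radial_mass_def by (simp only:) (intro nn_integral_cmult; measurable)
    qed
  qed
  then show ?thesis by (simp add: cone_measure_def)
qed

lemma nn_hardy_trial:
  assumes [measurable]: "v \<in> borel_measurable borel"
    and f [measurable]: "f \<in> borel_measurable borel" and f0: "\<And>\<rho>. 0 \<le> f \<rho>"
  shows "nn_hardy f (\<lambda>z::'a \<times> real. trial v m (N0 (fst z)) (snd z))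
    = radial_mass v (\<lambda>\<rho>. f (\<rho> / D)) * trial_mass m * emeasure directions UNIV"
proof -
  let ?u = "\<lambda>z::'a \<times> real. trial v m (N0 (fst z)) (snd z)"
  have [measurable]: "(snd :: 'a \<times> real \<Rightarrow> real) \<in> borel_measurable borel" "(fst :: 'a \<times> real \<Rightarrow> 'a) \<in> borel_measurable borel"
    by (intro borel_measurable_continuous_onI continuous_intros)+
  let ?a = "\<lambda>w. angular_mass w * (taylor m (1 / (1 + w\<^sup>2)))\<^sup>2"
  let ?c = "\<lambda>w. angular_weight w * (taylor1 m (1 / (1 + w\<^sup>2)) * (- 2 * w / (1 + w\<^sup>2)\<^sup>2))\<^sup>2"
  have nn: "0 \<le> ?a w" "0 \<le> ?c w" for w by (simp_all add: angular_weights_nonneg)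
  have um: "?u \<in> borel_measurable borel" by measurable
  have "nn_hardy f ?u = (\<integral>\<^sup>+x. (\<integral>\<^sup>+w. (\<integral>\<^sup>+\<rho>. indicator {0<..} w * indicator {0<..} \<rho> *
      ennreal (\<rho> powr (2 * \<sigma> - 1) * f (\<rho> / D) * (v \<rho>)\<^sup>2 * ?a w) \<partial>lborel) \<partial>lborel) \<partial>directions)"
    unfolding nn_hardy_polar[OF um f f0]
  proof (rule nn_integral_cong_AE)
    show "AE x in directions. (\<integral>\<^sup>+w. (\<integral>\<^sup>+\<rho>. indicator {0<..} w * indicator {0<..} \<rho> *
        ennreal (\<rho> powr (2 * \<sigma> - 1) * angular_mass w * (f (\<rho> / D) * (?u (\<rho> *\<^sub>R arc (dir x) w))\<^sup>2)) \<partial>lborel) \<partial>lborel)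
      = (\<integral>\<^sup>+w. (\<integral>\<^sup>+\<rho>. indicator {0<..} w * indicator {0<..} \<rho> *
        ennreal (\<rho> powr (2 * \<sigma> - 1) * f (\<rho> / D) * (v \<rho>)\<^sup>2 * ?a w) \<partial>lborel) \<partial>lborel)"
      using AE_directions
    proof eventually_elim
      case (elim x)
      show ?case
      proof (intro nn_integral_cong)
        fix w \<rho> :: real
        show "indicator {0<..} w * indicator {0<..} \<rho> *
            ennreal (\<rho> powr (2 * \<sigma> - 1) * angular_mass w * (f (\<rho> / D) * (?u (\<rho> *\<^sub>R arc (dir x) w))\<^sup>2))
          = indicator {0<..} w * indicator {0<..} \<rho> * ennreal (\<rho> powr (2 * \<sigma> - 1) * f (\<rho> / D) * (v \<rho>)\<^sup>2 * ?a w)"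
        proof (cases "0 < \<rho>")
          case True
          have "?u (\<rho> *\<^sub>R arc (dir x) w) = v \<rho> * taylor m (1 / (1 + w\<^sup>2))"
            by (rule trial_on_arc(1)[OF elim True])
          then show ?thesis by (simp only: power_mult_distrib mult_ac)
        qed simp
      qed
    qed
  qed
  also have "\<dots> = radial_mass v (\<lambda>\<rho>. f (\<rho> / D)) * trial_mass m * emeasure directions UNIV"
    unfolding trial_mass_def radial_mass_def by (rule nn_integral_arcs_product) (measurable, simp_all add: f0 nn)
  finally show ?thesis .
qed

lemma radial_mass_eq:
  assumes r1: "0 < r1" and v: "continuous_on UNIV v" "\<And>s. s \<notin> {r1..R} \<Longrightarrow> v s = 0"
    and f: "continuous_on {r1..R} f" "\<And>s. s \<in> {r1..R} \<Longrightarrow> 0 \<le> f s"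
  shows "radial_mass v f = ennreal (integral {r1..R} (\<lambda>s. s powr (2 * \<sigma> - 1) * f s * (v s)\<^sup>2))"
proof -
  have "radial_mass v f = (\<integral>\<^sup>+s. indicator {r1..R} s * ennreal (s powr (2 * \<sigma> - 1) * f s * (v s)\<^sup>2) \<partial>lborel)"
    unfolding radial_mass_def
  proof (rule nn_integral_cong)
    fix s :: real
    show "indicator {0<..} s * ennreal (s powr (2 * \<sigma> - 1) * f s * (v s)\<^sup>2)
        = indicator {r1..R} s * ennreal (s powr (2 * \<sigma> - 1) * f s * (v s)\<^sup>2)"
      using r1 v(2)[of s] by (cases "s \<in> {r1..R}") auto
  qed
  also have "\<dots> = ennreal (integral {r1..R} (\<lambda>s. s powr (2 * \<sigma> - 1) * f s * (v s)\<^sup>2))"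
  proof (rule nn_integral_Icc_eq_integral)
    show "continuous_on {r1..R} (\<lambda>s. s powr (2 * \<sigma> - 1) * f s * (v s)\<^sup>2)"
      using r1 by (intro continuous_intros f(1) continuous_on_subset[OF v(1)]) auto
  qed (use f(2) in simp)
  finally show ?thesis .
qed

text \<open>
  The angular identity, nearly attained, trades the angular energy for the trace term and lowers \<open>\<sigma>\<^sup>2\<close>
  to the Hardy constant \<open>\<sigma>\<^sup>2 - 4 A B\<close>. Half of \<open>\<eta>\<close> is spent on the radial factor; the angular error is
  chosen after the radial factor, small enough to be absorbed by the other half.
\<close>

theorem near_optimal:
  assumes k: "1 \<le> k" and \<eta>: "0 < \<eta>" and r0: "0 < r0"
  obtains u where "u \<in> test_functions U" "\<And>z. r0 \<le> Phi0 H z \<Longrightarrow> u z = 0"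
    "energy H \<alpha> U u < K (real DIM('a)) \<alpha> b * trace_term H \<alpha> U u + (\<alpha> + b - 2)\<^sup>2 / 4 * hardy_term H \<alpha> U (\<lambda>\<rho>. 1) u
      + 1 / 4 * (\<Sum>i\<in>{1..<k}. hardy_term H \<alpha> U (\<lambda>\<rho>. (P i \<rho>)\<^sup>2) u)
      + (1 / 4 + \<eta>) * hardy_term H \<alpha> U (\<lambda>\<rho>. (P k \<rho>)\<^sup>2) u"
proof -
  obtain k' where k': "k = Suc k'" using k by (cases k) auto
  define l where "l = (\<alpha> + b - 2)\<^sup>2 / 4"
  have l_eq: "l = \<sigma>\<^sup>2 - 4 * (A * B)" by (simp add: l_def four_AB)
  have l: "0 \<le> l" by (simp add: l_def)
  obtain c where c: "0 < c" "\<And>z. c * norm z \<le> Phi0 H z" using norm_lower[OF norm_Phi0] by blast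
  obtain r where r: "0 < r" "ball 0 r \<subseteq> U" using open_U zero_U by (auto simp: open_contains_ball)
  \<comment> \<open>the trial functions are supported in \<open>\<Phi>\<^sub>0 \<le> 2 R\<close>, which has to lie in \<open>U\<close> and inside radius \<open>r0\<close>\<close>
  define R where "R = min (min (D / 2) (r0 / 4)) (c * r / 4)"
  have R: "0 < R" "R < D" "2 * R < r0" "2 * R < c * r"
    unfolding R_def using D_pos r0 c r by (auto simp: min_def)
  have RU: "{z. Phi0 H z \<le> 2 * R} \<subseteq> U"
  proof
    fix z assume "z \<in> {z. Phi0 H z \<le> 2 * R}"
    then have "c * norm z < c * r" using c(2)[of z] R(4) by simp
    then show "z \<in> U" using c(1) r(2) by auto
  qed
  have \<eta>2: "0 < \<eta> / 2" using \<eta> by simp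
  obtain v v' r1 where r1: "0 < r1" "r1 < R" and v: "\<And>j. Ck_on j v UNIV" "\<And>s. (v has_real_derivative v' s) (at s)"
      "continuous_on UNIV v'" and out: "\<And>s. s \<notin> {r1..R} \<Longrightarrow> v s = 0 \<and> v' s = 0"
    and Wpos: "0 < integral {r1..R} (\<lambda>s. s powr (2 * \<sigma> - 1) * (P k (s / D))\<^sup>2 * (v s)\<^sup>2)"
    and rad: "integral {r1..R} (\<lambda>s. s powr (2 * \<sigma> + 1) * (v' s)\<^sup>2)
      - integral {r1..R} (\<lambda>s. s powr (2 * \<sigma> - 1) * (\<sigma>\<^sup>2 + log_square_sum k' (s / D) / 4) * (v s)\<^sup>2)
      \<le> (1 / 4 + \<eta> / 2) * integral {r1..R} (\<lambda>s. s powr (2 * \<sigma> - 1) * (P k (s / D))\<^sup>2 * (v s)\<^sup>2)"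
    by (rule radial_trial[OF D_pos parameters_pos(4) R(1,2) \<eta>2 k']) (rule that; assumption)
  have vc: "continuous_on UNIV v" by (rule Ck_on_continuous[OF v(1)[of 0]])
  have vm [measurable]: "v \<in> borel_measurable borel" "v' \<in> borel_measurable borel"
    by (intro borel_measurable_continuous_onI vc v(3))+
  have v0: "\<And>s. s \<notin> {r1..R} \<Longrightarrow> v s = 0" using out by blast
  define f where "f \<rho> = l + log_square_sum k' \<rho> / 4 + (1 / 4 + \<eta>) * (P k \<rho>)\<^sup>2" for \<rho>
  have f0: "0 \<le> f \<rho>" for \<rho> unfolding f_def using l \<eta> log_square_sum_nonneg[of k' \<rho>] by simp
  have fm: "f \<in> borel_measurable borel" unfolding f_def[abs_def] by measurable
  let ?J = "\<lambda>g. integral {r1..R} (\<lambda>s. s powr (2 * \<sigma> - 1) * g s * (v s)\<^sup>2)"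
  define E V W J where "E = integral {r1..R} (\<lambda>s. s powr (2 * \<sigma> + 1) * (v' s)\<^sup>2)"
    and "V = ?J (\<lambda>s. \<sigma>\<^sup>2 + log_square_sum k' (s / D) / 4)" and "W = ?J (\<lambda>s. (P k (s / D))\<^sup>2)" and "J = ?J (\<lambda>s. 1)"
  have sub: "{r1..R} \<subseteq> {0<..<D}" using r1 R by auto
  note logc = continuous_on_subset[OF log_sums_continuous(4)[OF D_pos, of k'] sub]
    continuous_on_subset[OF log_sums_continuous(2)[OF D_pos, of k] sub]
  have gc: "continuous_on {r1..R} (\<lambda>s. s powr (2 * \<sigma> - 1) * g s * (v s)\<^sup>2)" if "continuous_on {r1..R} g" for g
    using r1 by (intro continuous_on_mult continuous_on_power continuous_on_powr continuous_on_id continuous_on_const that continuous_on_subset[OF vc]) auto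
  have cV: "continuous_on {r1..R} (\<lambda>s. \<sigma>\<^sup>2 + log_square_sum k' (s / D) / 4)"
    by (intro continuous_on_add continuous_on_divide continuous_on_const logc) simp
  have cW: "continuous_on {r1..R} (\<lambda>s. (P k (s / D))\<^sup>2)"
    by (intro continuous_on_power logc)
  have cf: "continuous_on {r1..R} (\<lambda>s. f (s / D))"
    unfolding f_def by (intro continuous_on_add continuous_on_divide continuous_on_mult continuous_on_const cW logc) simp
  have Jf: "?J (\<lambda>s. f (s / D)) = V - 4 * (A * B) * J + (1 / 4 + \<eta>) * W"
  proof -
    have "(\<lambda>s. s powr (2 * \<sigma> - 1) * f (s / D) * (v s)\<^sup>2)
      = (\<lambda>s. (s powr (2 * \<sigma> - 1) * (\<sigma>\<^sup>2 + log_square_sum k' (s / D) / 4) * (v s)\<^sup>2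
          - 4 * (A * B) * (s powr (2 * \<sigma> - 1) * 1 * (v s)\<^sup>2))
          + (1 / 4 + \<eta>) * (s powr (2 * \<sigma> - 1) * (P k (s / D))\<^sup>2 * (v s)\<^sup>2))"
      by (rule ext) (simp add: f_def l_eq algebra_simps)
    then show ?thesis unfolding V_def W_def J_def
      by (simp only: integral_add integral_diff integrable_diff integrable_on_mult_right integral_mult_right
          integrable_continuous_real[OF gc[OF cV]] integrable_continuous_real[OF gc[OF cW]]
          integrable_continuous_real[OF gc[OF continuous_on_const]])
  qed
  have J0: "0 \<le> J" unfolding J_def
    by (intro integral_nonneg integrable_continuous_real gc continuous_on_const) simp
  have Ec: "continuous_on {r1..R} (\<lambda>\<rho>. \<rho> powr (2 * \<sigma> + 1) * (v' \<rho>)\<^sup>2)"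
    using r1 by (intro continuous_on_mult continuous_on_power continuous_on_powr continuous_on_id continuous_on_const continuous_on_subset[OF v(3)]) auto
  have E0: "0 \<le> E" unfolding E_def by (intro integral_nonneg integrable_continuous_real Ec) simp
  have Jf0: "0 \<le> ?J (\<lambda>s. f (s / D))" by (intro integral_nonneg integrable_continuous_real gc cf) (simp add: f0)
  have W0: "0 < W" using Wpos by (simp add: W_def)
  define M where "M = (\<integral>\<^sup>+w. indicator {0<..} w * ennreal (angular_mass w) \<partial>lborel)"
  have "M < \<infinity>" unfolding M_def by (rule nn_integral_mass_finite)
  then obtain a1 where a1: "M = ennreal a1" "0 \<le> a1" by (cases M) auto
  have "M \<noteq> 0"
  proof
    assume "M = 0"
    then have "AE w in lborel. indicator {0<..} w * ennreal (angular_mass w) = 0"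
      unfolding M_def by (subst (asm) nn_integral_0_iff_AE) auto
    then have "AE w in lborel. w \<notin> {0<..<1::real}"
    proof eventually_elim
      case (elim w)
      have "0 < angular_mass w" if "0 < w" using that one_plus_sq_pos[of w] by (simp add: angular_mass_def)
      then show ?case using elim by (auto simp: indicator_def)
    qed
    then have "emeasure lborel {0<..<1::real} = 0" by (subst (asm) AE_iff_measurable[of "{0<..<1}"]) auto
    then show False by simp
  qed
  then have a1_pos: "0 < a1" using a1 by (cases "a1 = 0") auto
  \<comment> \<open>\<open>a1\<close> bounds the angular mass of every Taylor polynomial from below, as these are at least 1.\<close>
  define e where "e = \<eta> / 2 * W * a1 / (J + 1)"
  have e: "0 < e" unfolding e_def using \<eta> a1_pos W0 J0 by (intro divide_pos_pos mult_pos_pos) auto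
  obtain m where m: "(\<integral>\<^sup>+w. indicator {0<..} w * ennreal (angular_weight w *
        (taylor1 m (1 / (1 + w\<^sup>2)) * (- 2 * w / (1 + w\<^sup>2)\<^sup>2))\<^sup>2
        + 4 * (A * B) * angular_mass w * (taylor m (1 / (1 + w\<^sup>2)))\<^sup>2) \<partial>lborel)
      \<le> ennreal (K (real DIM('a)) \<alpha> b * (taylor m 1)\<^sup>2 + e)"
    using angular_equality_taylor[OF e] by blast
  have AB: "0 < 4 * (A * B)" using parameters_pos by simp
  have Ke: "0 \<le> K (real DIM('a)) \<alpha> b * (taylor m 1)\<^sup>2" using K_pos by simp
  have split: "trial_slope m + ennreal (4 * (A * B)) * trial_mass m \<le> ennreal (K (real DIM('a)) \<alpha> b * (taylor m 1)\<^sup>2 + e)"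
  proof -
    have "trial_slope m + ennreal (4 * (A * B)) * trial_mass m
        = (\<integral>\<^sup>+w. indicator {0<..} w * ennreal (angular_weight w * (taylor1 m (1 / (1 + w\<^sup>2)) * (- 2 * w / (1 + w\<^sup>2)\<^sup>2))\<^sup>2)
          + ennreal (4 * (A * B)) * (indicator {0<..} w * ennreal (angular_mass w * (taylor m (1 / (1 + w\<^sup>2)))\<^sup>2)) \<partial>lborel)"
      unfolding trial_slope_def trial_mass_def by (subst nn_integral_add) (auto simp: nn_integral_cmult)
    also have "\<dots> = (\<integral>\<^sup>+w. indicator {0<..} w * ennreal (angular_weight w *
        (taylor1 m (1 / (1 + w\<^sup>2)) * (- 2 * w / (1 + w\<^sup>2)\<^sup>2))\<^sup>2
        + 4 * (A * B) * angular_mass w * (taylor m (1 / (1 + w\<^sup>2)))\<^sup>2) \<partial>lborel)"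
    proof (rule nn_integral_cong)
      fix w :: real
      define x y where "x = angular_weight w * (taylor1 m (1 / (1 + w\<^sup>2)) * (- 2 * w / (1 + w\<^sup>2)\<^sup>2))\<^sup>2"
        and "y = angular_mass w * (taylor m (1 / (1 + w\<^sup>2)))\<^sup>2"
      have "0 \<le> x" "0 \<le> y" by (simp_all add: x_def y_def angular_weights_nonneg)
      then have "ennreal (x + 4 * (A * B) * y) = ennreal x + ennreal (4 * (A * B)) * ennreal y"
        using AB by (simp add: ennreal_mult)
      then have "indicator {0<..} w * ennreal x + ennreal (4 * (A * B)) * (indicator {0<..} w * ennreal y)
          = indicator {0<..} w * ennreal (x + 4 * (A * B) * y)"
        by (cases "0 < w") (simp_all only: indicator_simps greaterThan_iff mult_1_left, simp)
      then show "indicator {0<..} w * ennreal (angular_weight w * (taylor1 m (1 / (1 + w\<^sup>2)) * (- 2 * w / (1 + w\<^sup>2)\<^sup>2))\<^sup>2)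
          + ennreal (4 * (A * B)) * (indicator {0<..} w * ennreal (angular_mass w * (taylor m (1 / (1 + w\<^sup>2)))\<^sup>2))
        = indicator {0<..} w * ennreal (angular_weight w * (taylor1 m (1 / (1 + w\<^sup>2)) * (- 2 * w / (1 + w\<^sup>2)\<^sup>2))\<^sup>2
          + 4 * (A * B) * angular_mass w * (taylor m (1 / (1 + w\<^sup>2)))\<^sup>2)"
        unfolding x_def y_def by (simp only: mult.assoc)
    qed
    finally show ?thesis using m by simp
  qed
  have fin: "trial_slope m < \<infinity>" "trial_mass m < \<infinity>"
  proof -
    have s: "trial_slope m + ennreal (4 * (A * B)) * trial_mass m < \<infinity>" using split by (rule le_less_trans) simp
    have "trial_slope m \<le> trial_slope m + ennreal (4 * (A * B)) * trial_mass m"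
      "ennreal (4 * (A * B)) * trial_mass m \<le> trial_slope m + ennreal (4 * (A * B)) * trial_mass m"
      by (rule add_increasing2 add_increasing; simp)+
    from le_less_trans[OF this(1) s] le_less_trans[OF this(2) s]
    show "trial_slope m < \<infinity>" "trial_mass m < \<infinity>" using AB by (auto simp: ennreal_mult_less_top)
  qed
  then obtain a s where as: "trial_mass m = ennreal a" "0 \<le> a" "trial_slope m = ennreal s" "0 \<le> s"
    by (cases "trial_mass m"; cases "trial_slope m") auto
  have s_le: "s \<le> K (real DIM('a)) \<alpha> b * (taylor m 1)\<^sup>2 + e - 4 * (A * B) * a"
  proof -
    have "ennreal (s + 4 * (A * B) * a) \<le> ennreal (K (real DIM('a)) \<alpha> b * (taylor m 1)\<^sup>2 + e)"
    proof -
      have "ennreal (s + 4 * (A * B) * a) = ennreal s + ennreal (4 * (A * B)) * ennreal a"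
        using as AB by (simp add: ennreal_mult)
      then show ?thesis using split unfolding as(1,3) by (simp only:)
    qed
    then have "s + 4 * (A * B) * a \<le> K (real DIM('a)) \<alpha> b * (taylor m 1)\<^sup>2 + e"
      using Ke e by (subst (asm) ennreal_le_iff) auto
    then show ?thesis by linarith
  qed
  have "M \<le> trial_mass m"
    unfolding M_def trial_mass_def
  proof (rule nn_integral_mono)
    fix w :: real
    have "1 \<le> (taylor m (1 / (1 + w\<^sup>2)))\<^sup>2" using taylor_ge_1[of "1 / (1 + w\<^sup>2)" m] one_plus_sq_pos[of w] by simp
    then have "angular_mass w * 1 \<le> angular_mass w * (taylor m (1 / (1 + w\<^sup>2)))\<^sup>2"
      by (intro mult_left_mono angular_weights_nonneg)
    then show "indicator {0<..} w * ennreal (angular_mass w)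
        \<le> indicator {0<..} w * ennreal (angular_mass w * (taylor m (1 / (1 + w\<^sup>2)))\<^sup>2)"
      by (intro mult_left_mono ennreal_leI) auto
  qed
  then have a1_le: "a1 \<le> a" using a1 as by (simp add: ennreal_le_iff)
  have main: "E * a + J * s < K (real DIM('a)) \<alpha> b * ((taylor m 1)\<^sup>2 * J) + ?J (\<lambda>s. f (s / D)) * a"
  proof -
    have "E \<le> V + (1 / 4 + \<eta> / 2) * W" using rad by (simp add: E_def V_def W_def)
    then have "E * a + J * s \<le> (V + (1 / 4 + \<eta> / 2) * W) * a + J * (K (real DIM('a)) \<alpha> b * (taylor m 1)\<^sup>2 + e - 4 * (A * B) * a)"
      using as J0 s_le by (intro add_mono mult_right_mono mult_left_mono)
    also have "\<dots> = K (real DIM('a)) \<alpha> b * ((taylor m 1)\<^sup>2 * J) + ?J (\<lambda>s. f (s / D)) * a + (J * e - \<eta> / 2 * W * a)"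
      unfolding Jf by (simp add: algebra_simps)
    also have "J * e - \<eta> / 2 * W * a < 0"
    proof -
      have "J * e < (J + 1) * e" using e by (simp add: distrib_right)
      also have "\<dots> = \<eta> / 2 * W * a1" unfolding e_def times_divide_eq_right using J0 by (intro nonzero_mult_div_cancel_left) simp
      also have "\<dots> \<le> \<eta> / 2 * W * a" using a1_le \<eta> W0 by (intro mult_left_mono) auto
      finally show ?thesis by simp
    qed
    finally show ?thesis by simp
  qed
  obtain \<nu> where \<nu>: "emeasure directions UNIV = ennreal \<nu>" "0 < \<nu>"
    using emeasure_cone_measure[OF norm_N0] by (cases "emeasure directions UNIV") (auto simp: ennreal_less_zero_iff)
  have nE: "(\<integral>\<^sup>+\<rho>. indicator {0<..} \<rho> * ennreal (\<rho> powr (2 * \<sigma> + 1) * (v' \<rho>)\<^sup>2) \<partial>lborel) = ennreal E"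
  proof -
    have "(\<integral>\<^sup>+\<rho>. indicator {0<..} \<rho> * ennreal (\<rho> powr (2 * \<sigma> + 1) * (v' \<rho>)\<^sup>2) \<partial>lborel)
        = (\<integral>\<^sup>+\<rho>. indicator {r1..R} \<rho> * ennreal (\<rho> powr (2 * \<sigma> + 1) * (v' \<rho>)\<^sup>2) \<partial>lborel)"
    proof (rule nn_integral_cong)
      fix \<rho> :: real
      show "indicator {0<..} \<rho> * ennreal (\<rho> powr (2 * \<sigma> + 1) * (v' \<rho>)\<^sup>2)
          = indicator {r1..R} \<rho> * ennreal (\<rho> powr (2 * \<sigma> + 1) * (v' \<rho>)\<^sup>2)"
        using r1 out[of \<rho>] by (cases "\<rho> \<in> {r1..R}") auto
    qed
    also have "\<dots> = ennreal E" unfolding E_def by (rule nn_integral_Icc_eq_integral[OF Ec]) simp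
    finally show ?thesis .
  qed
  have nJ: "radial_mass v (\<lambda>\<rho>. 1) = ennreal J"
    unfolding J_def by (rule radial_mass_eq[OF r1(1) vc v0]) auto
  have nf: "radial_mass v (\<lambda>\<rho>. f (\<rho> / D)) = ennreal (?J (\<lambda>s. f (s / D)))"
    by (rule radial_mass_eq[OF r1(1) vc v0 cf]) (simp_all add: f0)
  let ?u = "\<lambda>z. trial v m (N0 (fst z)) (snd z)"
  have "(\<integral>\<^sup>+z. indicator {z. 0 < snd z} z * ennreal (snd z powr \<alpha> * trial_energy v v' m (N0 (fst z)) (snd z)) \<partial>lborel)
      = ennreal ((E * a + J * s) * \<nu>)"
    unfolding nn_energy_trial[OF vm] nE nJ as(1,3) \<nu>(1) using J0 E0 as \<nu>(2) by (simp add: ennreal_mult)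
  also have "\<dots> < ennreal ((K (real DIM('a)) \<alpha> b * ((taylor m 1)\<^sup>2 * J) + ?J (\<lambda>s. f (s / D)) * a) * \<nu>)"
  proof (intro ennreal_lessI mult_strict_right_mono main \<nu>(2) mult_pos_pos)
    have "0 \<le> E * a + J * s" using E0 J0 as by simp
    then show "0 < K (real DIM('a)) \<alpha> b * ((taylor m 1)\<^sup>2 * J) + ?J (\<lambda>s. f (s / D)) * a" using main by linarith
  qed
  also have "\<dots> = ennreal (K (real DIM('a)) \<alpha> b) * nn_trace ?u + nn_hardy f ?u"
    unfolding nn_trace_trial[OF vm(1)] nn_hardy_trial[OF vm(1) fm f0] nJ nf as(1) \<nu>(1) distrib_right
    using J0 Jf0 as \<nu>(2) K_pos by (simp add: ennreal_mult mult.assoc)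
  finally obtain u where u: "u \<in> test_functions U" "\<And>z. 2 * R < Phi0 H z \<Longrightarrow> u z = 0"
      "nn_energy u < ennreal (K (real DIM('a)) \<alpha> b) * nn_trace u + nn_hardy f u"
    using trial_test_function_exists[OF v r1(1) out RU fm f0 less_imp_le[OF K_pos]] by blast
  have fbd: "f \<rho> \<le> l + real k' / 4 + (1 / 4 + \<eta>)" if "0 < \<rho>" "\<rho> < 1" for \<rho>
  proof -
    have "log_square_sum k' \<rho> \<le> real k'"
      unfolding log_square_sum_def using sum_bounded_above[of "{1..k'}" "\<lambda>i. (P i \<rho>)\<^sup>2" 1] P_square_bounds[OF that] by simp
    moreover have "(1 / 4 + \<eta>) * (P k \<rho>)\<^sup>2 \<le> (1 / 4 + \<eta>) * 1"
      using P_square_bounds[OF that] \<eta> by (intro mult_left_mono) auto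
    ultimately show ?thesis unfolding f_def by (intro add_mono order_refl divide_right_mono) simp_all
  qed
  have hf: "ennreal (hardy_term H \<alpha> U f u) = nn_hardy f u"
    by (rule hardy_term_nn(2)[OF u(1) fm f0 fbd])
  have "ennreal (energy H \<alpha> U u) < ennreal (K (real DIM('a)) \<alpha> b) * ennreal (trace_term H \<alpha> U u) + ennreal (hardy_term H \<alpha> U f u)"
    using u(3) unfolding energy_nn(2)[OF u(1)] trace_nn(2)[OF u(1)] hf .
  then have lt: "energy H \<alpha> U u < K (real DIM('a)) \<alpha> b * trace_term H \<alpha> U u + hardy_term H \<alpha> U f u"
    using K_pos energy_trace_nonneg[of u] hardy_term_nonneg[of f u] f0
    by (simp add: ennreal_mult[symmetric] ennreal_plus[symmetric] ennreal_less_iff del: ennreal_plus)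
  have f_eq: "f = (\<lambda>\<rho>. l + (\<Sum>i\<in>{1..k}. (if i = k then 1 / 4 + \<eta> else 1 / 4) * (P i \<rho>)\<^sup>2))"
    by (rule ext) (simp add: f_def k' log_square_sum_def sum_divide_distrib del: One_nat_def)
  have fu: "hardy_term H \<alpha> U f u = l * hardy_term H \<alpha> U (\<lambda>\<rho>. 1) u
      + 1 / 4 * (\<Sum>i\<in>{1..<k}. hardy_term H \<alpha> U (\<lambda>\<rho>. (P i \<rho>)\<^sup>2) u)
      + (1 / 4 + \<eta>) * hardy_term H \<alpha> U (\<lambda>\<rho>. (P k \<rho>)\<^sup>2) u"
    unfolding f_eq hardy_term_combination[OF u(1)]
    by (simp add: k' sum_divide_distrib atLeastLessThanSuc_atLeastAtMost del: One_nat_def)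
  show ?thesis
  proof (rule that[OF u(1)])
    show "u z = 0" if "r0 \<le> Phi0 H z" for z using u(2)[of z] that R(3) by simp
    show "energy H \<alpha> U u < K (real DIM('a)) \<alpha> b * trace_term H \<alpha> U u + (\<alpha> + b - 2)\<^sup>2 / 4 * hardy_term H \<alpha> U (\<lambda>\<rho>. 1) u
      + 1 / 4 * (\<Sum>i\<in>{1..<k}. hardy_term H \<alpha> U (\<lambda>\<rho>. (P i \<rho>)\<^sup>2) u)
      + (1 / 4 + \<eta>) * hardy_term H \<alpha> U (\<lambda>\<rho>. (P k \<rho>)\<^sup>2) u"
      using lt unfolding fu l_def by (simp only: add.assoc)
  qed
qed

end

section \<open>The inequality and its optimality\<close>

context hardy_setting
begin

lemma hardy_term_mono:
  assumes u: "u \<in> test_functions U" and g: "set_integrable lborel (upper U) (hardy_density H \<alpha> U g u)"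
    and f: "set_integrable lborel (upper U) (hardy_density H \<alpha> U f u)"
    and le: "\<And>z. z \<in> upper U \<Longrightarrow> u z \<noteq> 0 \<Longrightarrow> f (Phi0 H z / D) \<le> g (Phi0 H z / D)"
  shows "hardy_term H \<alpha> U f u \<le> hardy_term H \<alpha> U g u"
  unfolding hardy_term_def
proof (rule set_integral_mono[OF f g])
  show "hardy_density H \<alpha> U f u z \<le> hardy_density H \<alpha> U g u z" if "z \<in> upper U" for z
    unfolding hardy_density_eq using le[OF that]
    by (cases "u z = 0") (auto intro!: mult_left_mono mult_right_mono divide_right_mono)
qed

end

theorem theorem2:
  fixes H :: "real ^ 'n \<Rightarrow> real"
    and U :: "((real ^ 'n) \<times> real) set"
    and \<alpha> b :: real
  assumes "is_norm H"
    and "Ck_on 2 H (UNIV - {0})"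
    and "strictly_convex (\<lambda>\<xi>. (H \<xi>)\<^sup>2)"
    and "-1 < \<alpha>" and "\<alpha> < 1"
    and "2 - \<alpha> \<le> b" and "b < real CARD('n) + 1"
    and "open U" and "connected U" and "bounded U" and "0 \<in> U"
  shows
    "(\<forall>u\<in>test_functions U.
        set_integrable lborel (upper U) (energy_density H \<alpha> u) \<and>
        set_integrable lborel (base U) (trace_density H \<alpha> u) \<and>
        set_integrable lborel (upper U) (hardy_density H \<alpha> U (\<lambda>\<rho>. 1) u) \<and>
        (\<forall>i\<ge>1. set_integrable lborel (upper U) (hardy_density H \<alpha> U (\<lambda>\<rho>. (P i \<rho>)\<^sup>2) u)) \<and>
        summable (\<lambda>i. hardy_term H \<alpha> U (\<lambda>\<rho>. (P (Suc i) \<rho>)\<^sup>2) u) \<and>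
        K (real CARD('n)) \<alpha> b * trace_term H \<alpha> U u
        + (\<alpha> + b - 2)\<^sup>2 / 4 * hardy_term H \<alpha> U (\<lambda>\<rho>. 1) u
        + 1 / 4 * (\<Sum>i. hardy_term H \<alpha> U (\<lambda>\<rho>. (P (Suc i) \<rho>)\<^sup>2) u)
        \<le> energy H \<alpha> U u)
     \<and>
     (\<forall>k\<ge>1.
        ereal (1 / 4) =
          (INF u\<in>{u\<in>test_functions U. hardy_term H \<alpha> U (\<lambda>\<rho>. (P k \<rho>)\<^sup>2) u \<noteq> 0}.
             ereal (I H \<alpha> b U k u / hardy_term H \<alpha> U (\<lambda>\<rho>. (P k \<rho>)\<^sup>2) u)))
     \<and>
     (\<forall>k\<ge>1. \<forall>\<epsilon> C. 0 < \<epsilon> \<longrightarrow> \<epsilon> < 2 \<longrightarrow> 0 < C \<longrightarrow>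
        (\<exists>u\<in>test_functions U.
           \<not> C * hardy_term H \<alpha> U (\<lambda>\<rho>. (P (k - 1) \<rho>)\<^sup>2 * X k \<rho> powr (2 - \<epsilon>)) u \<le> I H \<alpha> b U k u))"
proof -
  interpret hardy_setting H U \<alpha> b
  proof (unfold_locales)
    show "1 \<le> real DIM(real ^ 'n)" by (simp add: Suc_leI)
    show "b < real DIM(real ^ 'n) + 1" using assms(7) by simp
  qed (use assms in auto)
  have dim: "real DIM(real ^ 'n) = real CARD('n)" by simp
  let ?h = "\<lambda>i u. hardy_term H \<alpha> U (\<lambda>\<rho>. (P i \<rho>)\<^sup>2) u"
  have h0: "0 \<le> ?h i u" for i u by (rule hardy_term_nonneg) simp
  have h_int: "set_integrable lborel (upper U) (hardy_density H \<alpha> U (\<lambda>\<rho>. (P i \<rho>)\<^sup>2) u)" if "u \<in> test_functions U" for i u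
    by (rule hardy_term_nn(1)[OF that, where C = 1]) (auto simp: P_square_bounds)
  define G where "G u = energy H \<alpha> U u - K (real CARD('n)) \<alpha> b * trace_term H \<alpha> U u
    - (\<alpha> + b - 2)\<^sup>2 / 4 * hardy_term H \<alpha> U (\<lambda>\<rho>. 1) u" for u
  have I_eq: "I H \<alpha> b U k u = G u - 1 / 4 * (\<Sum>i\<in>{1..<k}. ?h i u)" for k u
    unfolding I_def G_def ..
  have partial: "1 / 4 * (\<Sum>i\<in>{1..k}. ?h i u) \<le> G u" if "u \<in> test_functions U" for u k
    using hardy_inequality_partial[OF that, of k] unfolding dim G_def le_diff_eq by (simp only: add_ac)
  have lower: "1 / 4 * ?h k u \<le> I H \<alpha> b U k u" if u: "u \<in> test_functions U" and k: "1 \<le> k" for u k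
  proof -
    have "{1..k} = insert k {1..<k}" using k by auto
    then have "(\<Sum>i\<in>{1..k}. ?h i u) = ?h k u + (\<Sum>i\<in>{1..<k}. ?h i u)" by simp
    then show ?thesis using partial[OF u, of k] unfolding I_eq by linarith
  qed
  have upper: "\<exists>u\<in>test_functions U. (\<forall>z. r0 \<le> Phi0 H z \<longrightarrow> u z = 0) \<and> 0 < ?h k u \<and> I H \<alpha> b U k u < (1 / 4 + \<eta>) * ?h k u"
    if k: "1 \<le> k" and \<eta>: "0 < \<eta>" and r0: "0 < r0" for k \<eta> r0
  proof -
    obtain u where u: "u \<in> test_functions U" "\<And>z. r0 \<le> Phi0 H z \<Longrightarrow> u z = 0"
      and lt: "energy H \<alpha> U u < K (real DIM(real ^ 'n)) \<alpha> b * trace_term H \<alpha> U u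
        + (\<alpha> + b - 2)\<^sup>2 / 4 * hardy_term H \<alpha> U (\<lambda>\<rho>. 1) u
        + 1 / 4 * (\<Sum>i\<in>{1..<k}. ?h i u) + (1 / 4 + \<eta>) * ?h k u"
      using near_optimal[OF k \<eta> r0] by blast
    have "G u < 1 / 4 * (\<Sum>i\<in>{1..<k}. ?h i u) + (1 / 4 + \<eta>) * ?h k u"
      using lt unfolding dim G_def diff_less_eq by (simp only: add_ac)
    then have I: "I H \<alpha> b U k u < (1 / 4 + \<eta>) * ?h k u" unfolding I_eq by linarith
    then have "?h k u \<noteq> 0" using lower[OF u(1) k] by auto
    then have "0 < ?h k u" using h0[of k u] by linarith
    then show ?thesis using u I by blast
  qed
  show ?thesis
  proof (intro conjI ballI allI impI)
    fix u assume u: "u \<in> test_functions U"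
    show "set_integrable lborel (upper U) (energy_density H \<alpha> u)" by (rule energy_nn(1)[OF u])
    show "set_integrable lborel (base U) (trace_density H \<alpha> u)" by (rule trace_nn(1)[OF u])
    show "set_integrable lborel (upper U) (hardy_density H \<alpha> U (\<lambda>\<rho>. 1) u)"
      by (rule hardy_term_nn(1)[OF u, where C = 1]) auto
    show "set_integrable lborel (upper U) (hardy_density H \<alpha> U (\<lambda>\<rho>. (P i \<rho>)\<^sup>2) u)" for i by (rule h_int[OF u])
    have sums: "(\<Sum>i<k. ?h (Suc i) u) \<le> 4 * G u" for k
    proof -
      have "(\<Sum>i<k. ?h (Suc i) u) = (\<Sum>i\<in>{1..k}. ?h i u)"
        by (rule sum.reindex_bij_witness[of _ "\<lambda>i. i - 1" Suc]) auto
      then show ?thesis using partial[OF u, of k] by linarith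
    qed
    show s: "summable (\<lambda>i. ?h (Suc i) u)" by (rule summableI_nonneg_bounded[OF h0 sums])
    have "(\<Sum>i. ?h (Suc i) u) \<le> 4 * G u" by (rule suminf_le_const[OF s sums])
    then have "1 / 4 * (\<Sum>i. ?h (Suc i) u) \<le> G u" by linarith
    then show "K (real CARD('n)) \<alpha> b * trace_term H \<alpha> U u + (\<alpha> + b - 2)\<^sup>2 / 4 * hardy_term H \<alpha> U (\<lambda>\<rho>. 1) u
        + 1 / 4 * (\<Sum>i. ?h (Suc i) u) \<le> energy H \<alpha> U u"
      unfolding G_def le_diff_eq by (simp only: add_ac)
  next
    fix k :: nat assume k: "1 \<le> k"
    let ?S = "{u\<in>test_functions U. ?h k u \<noteq> 0}"
    show "ereal (1 / 4) = (INF u\<in>?S. ereal (I H \<alpha> b U k u / ?h k u))"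
    proof (rule antisym)
      show "ereal (1 / 4) \<le> (INF u\<in>?S. ereal (I H \<alpha> b U k u / ?h k u))"
      proof (rule INF_greatest)
        fix u assume "u \<in> ?S"
        then have "u \<in> test_functions U" "0 < ?h k u" using h0[of k u] by auto
        then show "ereal (1 / 4) \<le> ereal (I H \<alpha> b U k u / ?h k u)"
          using lower[of u k] k by (simp add: pos_le_divide_eq)
      qed
      show "(INF u\<in>?S. ereal (I H \<alpha> b U k u / ?h k u)) \<le> ereal (1 / 4)"
      proof (rule ereal_le_epsilon2)
        fix \<eta> :: real assume "0 < \<eta>"
        obtain u where u: "u \<in> test_functions U" "0 < ?h k u" "I H \<alpha> b U k u < (1 / 4 + \<eta>) * ?h k u"
          using upper[OF k \<open>0 < \<eta>\<close> zero_less_one] by blast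
        have "I H \<alpha> b U k u / ?h k u \<le> 1 / 4 + \<eta>" using u by (simp add: pos_divide_le_eq)
        then show "(INF u\<in>?S. ereal (I H \<alpha> b U k u / ?h k u)) \<le> ereal (1 / 4) + ereal \<eta>"
          using u by (intro INF_lower2[of u]) auto
      qed
    qed
  next
    fix k :: nat and \<epsilon> C :: real assume k: "1 \<le> k" and \<epsilon>: "0 < \<epsilon>" "\<epsilon> < 2" and C: "0 < C"
    \<comment> \<open>On the set \<open>X\<^sub>k < \<tau>\<close> the weight \<open>P\<^sub>k\<^sup>2\<close> is at most \<open>\<tau>\<^sup>\<epsilon>\<close> times the one with the smaller power.\<close>
    define \<tau> where "\<tau> = (C / 2) powr (1 / \<epsilon>)"
    have \<tau>: "0 < \<tau>" "\<tau> powr \<epsilon> = C / 2" unfolding \<tau>_def using C \<epsilon> by (simp_all add: powr_powr)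
    have "\<forall>\<^sub>F \<rho> in at_right 0. X k \<rho> < \<tau>" by (rule order_tendstoD(2)[OF X_tendsto_0 \<tau>(1)])
    then obtain r where r: "0 < r" "\<And>\<rho>. 0 < \<rho> \<Longrightarrow> \<rho> < r \<Longrightarrow> X k \<rho> < \<tau>"
      unfolding eventually_at_right_field by blast
    have rD: "0 < r * D" using r D_pos by simp
    obtain u where u: "u \<in> test_functions U" "\<And>z. r * D \<le> Phi0 H z \<Longrightarrow> u z = 0"
      "0 < ?h k u" "I H \<alpha> b U k u < (1 / 4 + 1 / 4) * ?h k u"
      using upper[OF k _ rD, of "1 / 4"] by auto
    let ?g = "\<lambda>\<rho>. (P (k - 1) \<rho>)\<^sup>2 * X k \<rho> powr (2 - \<epsilon>)"
    have g: "set_integrable lborel (upper U) (hardy_density H \<alpha> U ?g u)"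
    proof (rule hardy_term_nn(1)[OF u(1), where C = 1])
      fix \<rho> :: real assume \<rho>: "0 < \<rho>" "\<rho> < 1"
      have "X k \<rho> powr (2 - \<epsilon>) \<le> 1 powr (2 - \<epsilon>)"
        using X_bounds[OF \<rho>, of k] \<epsilon> by (intro powr_mono2) auto
      then show "?g \<rho> \<le> 1" using P_square_bounds[OF \<rho>, of "k - 1"] by (simp add: mult_le_one)
    qed auto
    have cg: "set_integrable lborel (upper U) (hardy_density H \<alpha> U (\<lambda>\<rho>. C / 2 * ?g \<rho>) u)"
      and cg_eq: "hardy_term H \<alpha> U (\<lambda>\<rho>. C / 2 * ?g \<rho>) u = C / 2 * hardy_term H \<alpha> U ?g u"
    proof -
      have eq: "hardy_density H \<alpha> U (\<lambda>\<rho>. C / 2 * ?g \<rho>) u = (\<lambda>z. C / 2 * hardy_density H \<alpha> U ?g u z)"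
        by (rule ext) (simp add: hardy_density_def)
      show "set_integrable lborel (upper U) (hardy_density H \<alpha> U (\<lambda>\<rho>. C / 2 * ?g \<rho>) u)"
        unfolding eq using g by simp
      show "hardy_term H \<alpha> U (\<lambda>\<rho>. C / 2 * ?g \<rho>) u = C / 2 * hardy_term H \<alpha> U ?g u"
        unfolding hardy_term_def eq by simp
    qed
    have "?h k u \<le> hardy_term H \<alpha> U (\<lambda>\<rho>. C / 2 * ?g \<rho>) u"
    proof (rule hardy_term_mono[OF u(1) cg h_int[OF u(1)]])
      fix z assume z: "z \<in> upper U" "u z \<noteq> 0"
      define \<rho> where "\<rho> = Phi0 H z / D"
      have "0 < Phi0 H z" using z(1) by (intro norm_pos[OF norm_Phi0]) (auto simp: upper_def)
      moreover have "Phi0 H z < D" using z(1) by (intro Phi0_less_D) (auto simp: upper_def)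
      moreover have "Phi0 H z < r * D" using u(2)[of z] z(2) by (meson not_le)
      ultimately have \<rho>: "0 < \<rho>" "\<rho> < 1" "\<rho> < r" unfolding \<rho>_def using D_pos by (simp_all add: pos_divide_less_eq)
      have x: "0 < X k \<rho>" "X k \<rho> < \<tau>" using X_bounds(1)[OF \<rho>(1,2)] r(2)[OF \<rho>(1,3)] by auto
      have "P k \<rho> = P (k - 1) \<rho> * X k \<rho>" using k by (cases k) (simp_all add: P_def del: X.simps)
      moreover have "(X k \<rho>)\<^sup>2 = X k \<rho> powr \<epsilon> * X k \<rho> powr (2 - \<epsilon>)"
        using x(1) by (simp flip: powr_add)
      moreover have "X k \<rho> powr \<epsilon> \<le> C / 2" unfolding \<tau>(2)[symmetric] using x \<epsilon> by (intro powr_mono2) auto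
      then have "(P (k - 1) \<rho>)\<^sup>2 * (X k \<rho> powr \<epsilon> * X k \<rho> powr (2 - \<epsilon>)) \<le> (P (k - 1) \<rho>)\<^sup>2 * (C / 2 * X k \<rho> powr (2 - \<epsilon>))"
        by (intro mult_left_mono mult_right_mono) auto
      ultimately show "(P k (Phi0 H z / D))\<^sup>2 \<le> C / 2 * ?g (Phi0 H z / D)"
        unfolding \<rho>_def[symmetric] by (simp add: power_mult_distrib mult_ac)
    qed
    then have "(1 / 4 + 1 / 4) * ?h k u \<le> C * hardy_term H \<alpha> U ?g u" unfolding cg_eq using h0[of k u] by simp
    then have "I H \<alpha> b U k u < C * hardy_term H \<alpha> U ?g u" using u(4) by (rule less_le_trans[rotated])
    then show "\<exists>u\<in>test_functions U. \<not> C * hardy_term H \<alpha> U ?g u \<le> I H \<alpha> b U k u" using u(1) by (intro bexI[of _ u]) auto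
  qed
qed

end
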